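(* Assume the following statement (a conjecture): for all positive integers $d,f$ and every $n\geq1$, with $W_{n}^{g}:=\bigoplus_{\lambda\vdash n}\bigoplus_{M\in\operatorname{SSYT}_d(\lambda),\ f_M=g}V_M\subseteq\mathbb{Q}[\mathbf{x}_n]_d$ for $g\geq0$, (a) if $\lambda\vdash n$, $M\in\operatorname{SSYT}_d(\lambda)$, $f_M=f$, and $0\neq F\in V_M$, then every $N\in\operatorname{supp}_{n+1}F$ satisfies $f_N\in\{f,f-1\}$; (b) the map $p_n^f:W_n^f\to W_{n+1}^f$ taking $F$ to $\sum_{N\in\operatorname{supp}_{n+1}F,\ f_N=f}F_N$ is injective; (c) for $q_n^f:W_n^f\to W_{n+1}^{f-1}$, $q_n^fF:=F-p_n^fF$, the map $W_n^f\oplus W_n^{f-1}\to W_{n+1}^{f-1}$ given by $(F,G)\mapsto q_n^fF+p_n^{f-1}G$ is injective. Let $d\geq0$. Then the representation $\mathbb{Q}[\mathbf{x}_\infty]_d$ of $S_\infty$ and of $S_{\mathbb{N}}$, as well as its sub-representation $\mathbb{Q}[\mathbf{x}_\infty]_\mu$ for every content $\mu$ of sum $d$, admits a finite composition series. The semi-simplifications of these representations are isomorphic to the direct sums $\bigoplus_{\hat{\lambda}\vdash\infty}\bigoplus_{\hat{M}\in\operatorname{SSYT}_d(\hat{\lambda})}V_{\hat{M}^0}$ and $\bigoplus_{\hat{\lambda}\vdash\infty}\bigoplus_{\hat{M}\in\operatorname{SSYT}_\mu(\hat{\lambda})}V_{\hat{M}^0}$ respectively.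
   Context: Finite objects. $\mathbb{Q}[\mathbf{x}_n]_d$: homogeneous polynomials of degree $d$ in $x_1,\ldots,x_n$; $\mathbb{Q}[\mathbf{x}_\infty]_d$: the same in $x_1,x_2,\ldots$. A content of sum $d$ is a finite multi-set of positive integers summing to $d$; $\mathbb{Q}[\mathbf{x}_\infty]_\mu$ is the span of the monomials whose multi-set of positive exponents is $\mu$. For $\lambda\vdash n$, $\operatorname{SSYT}_d(\lambda)$ is the set of semi-standard Young tableaux of shape $\lambda$ with non-negative integer entries (rows weakly, columns strictly increasing) of entry sum $d$. For $M\in\operatorname{SSYT}_d(\lambda)$ and a bijective filling $T$ of $\lambda$ by $\{1,\ldots,n\}$, $R(T),C(T)\subseteq S_n$ are the row and column stabilizers, $p_{M,T}=\prod_{i=1}^nx_i^{h_i}$ with $h_i$ the entry of $M$ in the box of $T$ containing $i$, and $F_{M,T}=\sum_{\sigma\in C(T)}\operatorname{sgn}(\sigma)\sigma(\sum_pp)$, $p$ running over the $R(T)$-orbit of $p_{M,T}$. $V_M$ is the span of all $F_{M,T}$; it is an irreducible representation of $S_n$ isomorphic to the Specht module of $\lambda$, and it is known that $\mathbb{Q}[\mathbf{x}_n]_d=\bigoplus_{\lambda\vdash n}\bigoplus_{M\in\operatorname{SSYT}_d(\lambda)}V_M$. $f_M$ is the number of non-zero entries in the first row of $M$. For $F\in\mathbb{Q}[\mathbf{x}_n]_d$ write $F=\sum_MF_M$ with $F_M\in V_M$; $\operatorname{supp}_nF$ is the set of $M$ with $F_M\neq0$. A polynomial $F\in\mathbb{Q}[\mathbf{x}_n]_d$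 is also an element of $\mathbb{Q}[\mathbf{x}_{n+1}]_d$, and in $\operatorname{supp}_{n+1}F$ and the components $F_N$ above, the decomposition of $\mathbb{Q}[\mathbf{x}_{n+1}]_d$ is used. Infinite objects. $S_{\mathbb{N}}$: all permutations of $\mathbb{N}=\{1,2,\ldots\}$, acting by permuting variables; $S_\infty$ is the union of the $S_n$ (fixing all $m>n$). $\hat{\lambda}\vdash\infty$ is a Ferrers diagram with infinite first row, the remaining rows forming a finite partition diagram (the finite part). $\operatorname{SYT}(\hat{\lambda})$: standard fillings by $\mathbb{N}$. $\hat{M}\in\operatorname{SSYT}(\hat{\lambda})$: a semi-standard filling of the finite part by positive integers, plus a multiplicity $m_h\geq0$ for each $h>0$, finitely many non-zero. Its content is the multi-set in which each $h>0$ appears $m_h$ plus its number of occurrences in the finite part; $\operatorname{SSYT}_d(\hat{\lambda})$, $\operatorname{SSYT}_\mu(\hat{\lambda})$: those with content of sum $d$, resp. content $\mu$. $\hat{M}^0$ is $\hat{M}$ with all multiplicities replaced by $0$. For $\hat{T}\in\operatorname{SYT}(\hat{\lambda})$, $F_{\hat{M}^0,\hat{T}}=\sum_{\sigma\in C(\hat{T})}\operatorname{sgn}(\sigma)\sigma(\sum_pp)$, where $R(\hat{T}),C(\hat{T})\subseteq S_{\mathbb{N}}$ are the row and column stabilizers of $\hat{T}$ and $p$ runs over the $R(\hat{T})$-orbit of the monomial $\prod_ix_i^{h_i}$, with $h_i$ the entry of $\hat{M}$ in the box where $\hat{T}$ has $i$ if that box is in the finite part and $h_i=0$ otherwise (a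 polynomial). $V_{\hat{M}^0}$ is the $\mathbb{Q}$-span of $F_{\hat{M}^0,\hat{T}}$, $\hat{T}\in\operatorname{SYT}(\hat{\lambda})$, a representation of $S_{\mathbb{N}}$ and $S_\infty$. The semi-simplification of a representation with a finite composition series is the direct sum of its composition factors. *)

theory Defs
  imports
    Complex_Main
    "HOL-Library.Poly_Mapping"
    "HOL-Library.Multiset"
    "HOL-Library.FuncSet"
    "HOL-Combinatorics.Permutations"
begin

section \<open>Polynomials over the rationals\<close>

text \<open>
  A monomial is its finitely supported exponent function and a polynomial is its finitely
  supported coefficient function. Variables are indexed by the positive integers; the index 0
  is never used. Polynomials in \<open>x\<^sub>1, \<dots>, x\<^sub>n\<close> and in infinitely many variables share
  one type, so that the inclusion of the former into polynomials in more variables is the identity.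
\<close>

type_synonym monomial = "nat \<Rightarrow>\<^sub>0 nat"
type_synonym qpoly = "monomial \<Rightarrow>\<^sub>0 rat"

definition qscale :: "rat \<Rightarrow> qpoly \<Rightarrow> qpoly" where
  "qscale c F = Poly_Mapping.map ((*) c) F"

lemma lookup_qscale [simp]:
  "Poly_Mapping.lookup (qscale c F) m = c * Poly_Mapping.lookup F m"
  unfolding qscale_def by (simp add: Poly_Mapping.map.rep_eq when_def)

global_interpretation qvs: vector_space qscale
  by unfold_locales (auto intro!: poly_mapping_eqI simp: lookup_add algebra_simps)

definition mono_deg :: "monomial \<Rightarrow> nat" where
  "mono_deg m = (\<Sum>i\<in>Poly_Mapping.keys m. Poly_Mapping.lookup m i)"

definition mono_content :: "monomial \<Rightarrow> nat multiset" where
  "mono_content m = image_mset (Poly_Mapping.lookup m) (mset_set (Poly_Mapping.keys m))"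

definition hom_polys :: "nat set \<Rightarrow> nat \<Rightarrow> qpoly set" where
  "hom_polys X d =
     {F. \<forall>m\<in>Poly_Mapping.keys F. Poly_Mapping.keys m \<subseteq> X \<and> mono_deg m = d}"

definition is_content :: "nat multiset \<Rightarrow> nat \<Rightarrow> bool" where
  "is_content \<mu> d \<longleftrightarrow> 0 \<notin># \<mu> \<and> sum_mset \<mu> = d"

definition content_polys :: "nat multiset \<Rightarrow> qpoly set" where
  "content_polys \<mu> =
     qvs.span {Poly_Mapping.single m 1 | m. Poly_Mapping.keys m \<subseteq> {1..} \<and> mono_content m = \<mu>}"

text \<open>The action sends \<open>x\<^sub>i\<close> to \<open>x\<^bsub>\<sigma> i\<^esub>\<close>, hence the inverse on exponent functions.\<close>

definition mono_act :: "(nat \<Rightarrow> nat) \<Rightarrow> monomial \<Rightarrow> monomial" where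
  "mono_act \<sigma> m = Poly_Mapping.map_key (inv \<sigma>) m"

definition poly_act :: "(nat \<Rightarrow> nat) \<Rightarrow> qpoly \<Rightarrow> qpoly" where
  "poly_act \<sigma> F =
     (\<Sum>m\<in>Poly_Mapping.keys F. Poly_Mapping.single (mono_act \<sigma> m) (Poly_Mapping.lookup F m))"

definition S_N :: "(nat \<Rightarrow> nat) set" where
  "S_N = {\<sigma>. \<sigma> permutes {1..}}"

definition S_infty :: "(nat \<Rightarrow> nat) set" where
  "S_infty = (\<Union>n. {\<sigma>. \<sigma> permutes {1..n}})"


section \<open>Diagrams, tableaux and higher Specht polynomials\<close>

text \<open>
  Diagrams are sets of boxes \<open>(row, column)\<close>, both coordinates counted from 0. A filling by
  numbers is a function on all pairs which vanishes outside of the diagram; since it does not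
  determine its shape, semi-standard tableaux are always paired with their shape.
\<close>

type_synonym box = "nat \<times> nat"
type_synonym diagram = "box set"

definition ferrers :: "diagram \<Rightarrow> bool" where
  "ferrers D \<longleftrightarrow> (\<forall>i j i' j'. (i, j) \<in> D \<longrightarrow> i' \<le> i \<longrightarrow> j' \<le> j \<longrightarrow> (i', j') \<in> D)"

definition partition_of :: "diagram \<Rightarrow> nat \<Rightarrow> bool" where
  "partition_of D n \<longleftrightarrow> ferrers D \<and> finite D \<and> card D = n"

definition fin_part :: "diagram \<Rightarrow> diagram" where
  "fin_part D = {c \<in> D. 0 < fst c}"

definition partition_infty :: "diagram \<Rightarrow> bool" where
  "partition_infty D \<longleftrightarrow> ferrers D \<and> (\<forall>j. (0, j) \<in> D) \<and> finite (fin_part D)"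

definition semistandard :: "diagram \<Rightarrow> (box \<Rightarrow> nat) \<Rightarrow> bool" where
  "semistandard D M \<longleftrightarrow>
     (\<forall>c. c \<notin> D \<longrightarrow> M c = 0) \<and>
     (\<forall>i j j'. (i, j) \<in> D \<longrightarrow> (i, j') \<in> D \<longrightarrow> j < j' \<longrightarrow> M (i, j) \<le> M (i, j')) \<and>
     (\<forall>i i' j. (i, j) \<in> D \<longrightarrow> (i', j) \<in> D \<longrightarrow> i < i' \<longrightarrow> M (i, j) < M (i', j))"

definition standard_infty :: "diagram \<Rightarrow> (box \<Rightarrow> nat) set" where
  "standard_infty D = {T. bij_betw T D {1..} \<and>
     (\<forall>i j j'. (i, j) \<in> D \<longrightarrow> (i, j') \<in> D \<longrightarrow> j < j' \<longrightarrow> T (i, j) < T (i, j')) \<and>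
     (\<forall>i i' j. (i, j) \<in> D \<longrightarrow> (i', j) \<in> D \<longrightarrow> i < i' \<longrightarrow> T (i, j) < T (i', j))}"

definition row_stab :: "diagram \<Rightarrow> (box \<Rightarrow> nat) \<Rightarrow> (nat \<Rightarrow> nat) set" where
  "row_stab D T = {\<sigma>. \<sigma> permutes (T ` D) \<and>
     (\<forall>i. \<sigma> ` T ` {c \<in> D. fst c = i} = T ` {c \<in> D. fst c = i})}"

definition col_stab :: "diagram \<Rightarrow> (box \<Rightarrow> nat) \<Rightarrow> (nat \<Rightarrow> nat) set" where
  "col_stab D T = {\<sigma>. \<sigma> permutes (T ` D) \<and>
     (\<forall>j. \<sigma> ` T ` {c \<in> D. snd c = j} = T ` {c \<in> D. snd c = j})}"

text \<open>
  The definitions of \<open>p\<^bsub>M,T\<^esub>\<close> and \<open>F\<^bsub>M,T\<^esub>\<close> serve finite and infinite diagrams alike.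
  For an infinite diagram the filling is \<open>M\<^sup>0\<close>, zero on the first row. Then \<open>M\<close> has finitely
  many non-zero entries, the orbit under the row stabilizer is finite, and the column stabilizer
  is a finite group of finitely supported permutations, so that sums and signs are meaningful.
\<close>

definition tab_mono :: "diagram \<Rightarrow> (box \<Rightarrow> nat) \<Rightarrow> (box \<Rightarrow> nat) \<Rightarrow> monomial" where
  "tab_mono D M T = (\<Sum>c\<in>{c \<in> D. M c \<noteq> 0}. Poly_Mapping.single (T c) (M c))"

definition specht_poly :: "diagram \<Rightarrow> (box \<Rightarrow> nat) \<Rightarrow> (box \<Rightarrow> nat) \<Rightarrow> qpoly" where
  "specht_poly D M T =
     (\<Sum>\<sigma>\<in>col_stab D T. qscale (of_int (sign \<sigma>))
        (poly_act \<sigma> (\<Sum>p\<in>(\<lambda>\<tau>. mono_act \<tau> (tab_mono D M T)) ` row_stab D T.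
                        Poly_Mapping.single p 1)))"


subsection \<open>Finite diagrams\<close>

definition SSYT :: "nat \<Rightarrow> diagram \<Rightarrow> (box \<Rightarrow> nat) set" where
  "SSYT d D = {M. semistandard D M \<and> (\<Sum>c\<in>D. M c) = d}"

definition V_fin :: "nat \<Rightarrow> diagram \<Rightarrow> (box \<Rightarrow> nat) \<Rightarrow> qpoly set" where
  "V_fin n D M = qvs.span {specht_poly D M T | T. bij_betw T D {1..n}}"

definition first_row_nonzeros :: "diagram \<Rightarrow> (box \<Rightarrow> nat) \<Rightarrow> nat" where
  "first_row_nonzeros D M = card {j. (0, j) \<in> D \<and> M (0, j) \<noteq> 0}"

definition tableaux :: "nat \<Rightarrow> nat \<Rightarrow> (diagram \<times> (box \<Rightarrow> nat)) set" where
  "tableaux d n = {(D, M). partition_of D n \<and> M \<in> SSYT d D}"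

text \<open>
  The family of components \<open>F\<^sub>M \<in> V\<^sub>M\<close> of \<open>F\<close> in the decomposition of the homogeneous
  polynomials of degree \<open>d\<close> in \<open>n\<close> variables; it is well-defined because that decomposition
  is a direct sum.
\<close>

definition components ::
    "nat \<Rightarrow> nat \<Rightarrow> qpoly \<Rightarrow> (diagram \<times> (box \<Rightarrow> nat)) \<Rightarrow> qpoly" where
  "components d n F = (THE H.
     (\<forall>(D, M)\<in>tableaux d n. H (D, M) \<in> V_fin n D M) \<and>
     (\<forall>N. N \<notin> tableaux d n \<longrightarrow> H N = 0) \<and>
     F = (\<Sum>N\<in>tableaux d n. H N))"

definition specht_supp :: "nat \<Rightarrow> nat \<Rightarrow> qpoly \<Rightarrow> (diagram \<times> (box \<Rightarrow> nat)) set" where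
  "specht_supp d n F = {N \<in> tableaux d n. components d n F N \<noteq> 0}"

definition W_space :: "nat \<Rightarrow> nat \<Rightarrow> nat \<Rightarrow> qpoly set" where
  "W_space d n g = qvs.span
     (\<Union>(D, M)\<in>{(D, M) \<in> tableaux d n. first_row_nonzeros D M = g}. V_fin n D M)"

definition p_map :: "nat \<Rightarrow> nat \<Rightarrow> nat \<Rightarrow> qpoly \<Rightarrow> qpoly" where
  "p_map d n f F =
     (\<Sum>(D, N)\<in>{(D, N) \<in> specht_supp d (n + 1) F. first_row_nonzeros D N = f}.
        components d (n + 1) F (D, N))"

definition q_map :: "nat \<Rightarrow> nat \<Rightarrow> nat \<Rightarrow> qpoly \<Rightarrow> qpoly" where
  "q_map d n f F = F - p_map d n f F"


subsection \<open>Infinite diagrams\<close>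

text \<open>
  A semi-standard tableau of infinite shape is a pair of a filling of the finite part and the
  finite multiset in which each \<open>h > 0\<close> occurs \<open>m\<^sub>h\<close> times. Its version with all
  multiplicities replaced by 0 is given by the filling alone.
\<close>

type_synonym inf_tableau = "(box \<Rightarrow> nat) \<times> nat multiset"

definition SSYT_infty :: "diagram \<Rightarrow> inf_tableau set" where
  "SSYT_infty D = {(M, m).
     semistandard (fin_part D) M \<and> (\<forall>c\<in>fin_part D. 0 < M c) \<and> 0 \<notin># m}"

definition tab_content :: "diagram \<Rightarrow> inf_tableau \<Rightarrow> nat multiset" where
  "tab_content D = (\<lambda>(M, m). m + image_mset M (mset_set (fin_part D)))"

definition inf_tableaux_deg :: "nat \<Rightarrow> (diagram \<times> inf_tableau) set" where
  "inf_tableaux_deg d =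
     {(D, M). partition_infty D \<and> M \<in> SSYT_infty D \<and> sum_mset (tab_content D M) = d}"

definition inf_tableaux_content :: "nat multiset \<Rightarrow> (diagram \<times> inf_tableau) set" where
  "inf_tableaux_content \<mu> =
     {(D, M). partition_infty D \<and> M \<in> SSYT_infty D \<and> tab_content D M = \<mu>}"

definition V_infty :: "diagram \<Rightarrow> (box \<Rightarrow> nat) \<Rightarrow> qpoly set" where
  "V_infty D M0 = qvs.span {specht_poly D M0 T | T. T \<in> standard_infty D}"


section \<open>Representations over the rationals\<close>

text \<open>
  Representations with explicit carriers, since sub-representations, quotients and external
  direct sums have to be representations again. The acting group is a set \<open>G\<close>, given
  separately.
\<close>

record ('g, 'v) rep =
  vecs :: "'v set"
  vzero :: 'v
  vadd :: "'v \<Rightarrow> 'v \<Rightarrow> 'v"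
  vscale :: "rat \<Rightarrow> 'v \<Rightarrow> 'v"
  vact :: "'g \<Rightarrow> 'v \<Rightarrow> 'v"

definition poly_rep :: "qpoly set \<Rightarrow> (nat \<Rightarrow> nat, qpoly) rep" where
  "poly_rep U = \<lparr>vecs = U, vzero = 0, vadd = (+), vscale = qscale, vact = poly_act\<rparr>"

definition subrep :: "'g set \<Rightarrow> ('g, 'v) rep \<Rightarrow> 'v set \<Rightarrow> bool" where
  "subrep G R U \<longleftrightarrow> U \<subseteq> vecs R \<and> vzero R \<in> U \<and>
     (\<forall>u\<in>U. \<forall>v\<in>U. vadd R u v \<in> U) \<and>
     (\<forall>c. \<forall>u\<in>U. vscale R c u \<in> U) \<and>
     (\<forall>g\<in>G. \<forall>u\<in>U. vact R g u \<in> U)"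

definition irreducible_rep :: "'g set \<Rightarrow> ('g, 'v) rep \<Rightarrow> bool" where
  "irreducible_rep G R \<longleftrightarrow> vecs R \<noteq> {vzero R} \<and>
     (\<forall>U. subrep G R U \<longrightarrow> U = {vzero R} \<or> U = vecs R)"

text \<open>
  The quotient of \<open>R\<close> by \<open>W\<close>, on cosets. The summand from \<open>W\<close> in the scalar
  multiplication is needed for the scalar 0.
\<close>

definition quot_rep :: "('g, 'v) rep \<Rightarrow> 'v set \<Rightarrow> ('g, 'v set) rep" where
  "quot_rep R W =
     \<lparr>vecs = {{vadd R v w | w. w \<in> W} | v. v \<in> vecs R},
      vzero = W,
      vadd = (\<lambda>A B. {vadd R a b | a b. a \<in> A \<and> b \<in> B}),
      vscale = (\<lambda>c A. {vadd R (vscale R c a) w | a w. a \<in> A \<and> w \<in> W}),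
      vact = (\<lambda>g A. vact R g ` A)\<rparr>"

definition dsum_rep :: "'i set \<Rightarrow> ('i \<Rightarrow> ('g, 'v) rep) \<Rightarrow> ('g, 'i \<Rightarrow> 'v) rep" where
  "dsum_rep I R =
     \<lparr>vecs = {f \<in> (\<Pi>\<^sub>E i\<in>I. vecs (R i)). finite {i \<in> I. f i \<noteq> vzero (R i)}},
      vzero = (\<lambda>i\<in>I. vzero (R i)),
      vadd = (\<lambda>f g. \<lambda>i\<in>I. vadd (R i) (f i) (g i)),
      vscale = (\<lambda>c f. \<lambda>i\<in>I. vscale (R i) c (f i)),
      vact = (\<lambda>a f. \<lambda>i\<in>I. vact (R i) a (f i))\<rparr>"

definition rep_iso :: "'g set \<Rightarrow> ('g, 'v) rep \<Rightarrow> ('g, 'w) rep \<Rightarrow> bool" where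
  "rep_iso G R S \<longleftrightarrow> (\<exists>\<phi>. bij_betw \<phi> (vecs R) (vecs S) \<and>
     (\<forall>u\<in>vecs R. \<forall>v\<in>vecs R. \<phi> (vadd R u v) = vadd S (\<phi> u) (\<phi> v)) \<and>
     (\<forall>c. \<forall>u\<in>vecs R. \<phi> (vscale R c u) = vscale S c (\<phi> u)) \<and>
     (\<forall>g\<in>G. \<forall>u\<in>vecs R. \<phi> (vact R g u) = vact S g (\<phi> u)))"

definition comp_factor :: "('g, 'v) rep \<Rightarrow> 'v set list \<Rightarrow> nat \<Rightarrow> ('g, 'v set) rep" where
  "comp_factor R Us i = quot_rep (R\<lparr>vecs := Us ! Suc i\<rparr>) (Us ! i)"

definition composition_series :: "'g set \<Rightarrow> ('g, 'v) rep \<Rightarrow> 'v set list \<Rightarrow> bool" where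
  "composition_series G R Us \<longleftrightarrow>
     Us \<noteq> [] \<and> hd Us = {vzero R} \<and> last Us = vecs R \<and>
     (\<forall>U\<in>set Us. subrep G R U) \<and>
     (\<forall>i. Suc i < length Us \<longrightarrow>
        Us ! i \<subseteq> Us ! Suc i \<and> irreducible_rep G (comp_factor R Us i))"

definition semisimplification ::
    "('g, 'v) rep \<Rightarrow> 'v set list \<Rightarrow> ('g, nat \<Rightarrow> 'v set) rep" where
  "semisimplification R Us = dsum_rep {i. Suc i < length Us} (comp_factor R Us)"

text \<open>
  \<open>R\<close> has a finite composition series and its semi-simplification, which up to isomorphism
  does not depend on the series, is isomorphic to \<open>S\<close>.
\<close>

definition has_semisimplification :: "'g set \<Rightarrow> ('g, 'v) rep \<Rightarrow> ('g, 'w) rep \<Rightarrow> bool" where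
  "has_semisimplification G R S \<longleftrightarrow>
     (\<exists>Us. composition_series G R Us) \<and>
     (\<forall>Us. composition_series G R Us \<longrightarrow> rep_iso G (semisimplification R Us) S)"

definition V_sum :: "(diagram \<times> inf_tableau) set \<Rightarrow>
    (nat \<Rightarrow> nat, diagram \<times> inf_tableau \<Rightarrow> qpoly) rep" where
  "V_sum I = dsum_rep I (\<lambda>(D, (M, m)). poly_rep (V_infty D M))"

end

theory Submission
  imports Defs
begin

text \<open>
  Call a monomial \<open>q\<close> a submonomial of \<open>p\<close> if it arises from \<open>p\<close> by deleting some of the
  variables. The linear map \<open>ext_part j\<close> that sends \<open>p\<close> to the sum of its submonomials in
  exactly \<open>j\<close> variables commutes with all permutations of the variables. Let \<open>layer \<mu> j\<close>
  consist of the polynomials of content \<open>\<mu>\<close> that are killed by \<open>ext_part i\<close> for all \<open>i < j\<close>.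
  These sub-representations decrease from all polynomials of content \<open>\<mu>\<close>, for \<open>j = 0\<close>, to \<open>0\<close>,
  for \<open>j = \<bar>\<mu>\<bar> + 1\<close>. On \<open>layer \<mu> j\<close> the map \<open>ext_part j\<close> has the kernel \<open>layer \<mu> (j + 1)\<close>, and
  its image is the direct sum, over the sub-multisets \<open>b\<close> of \<open>\<mu>\<close> of size \<open>j\<close>, of the spaces
  \<open>K\<^sub>b = layer b j\<close>: it lies there by a double count (\<open>content_part_ext_part\<close>), and \<open>H\<close> in \<open>K\<^sub>b\<close>
  is the image of \<open>H\<close> times a monomial of content \<open>\<mu> - b\<close> in fresh variables
  (\<open>ext_part_surj\<close>). Since \<open>b\<close> and \<open>\<mu> - b\<close> are the content of the finite part and the multiset
  of multiplicities of a tableau of content \<open>\<mu>\<close>, it remains to show that \<open>K\<^sub>b\<close> is the direct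
  sum of the \<open>V\<^bsub>M\<^esub>\<close> over the fillings \<open>M\<close> of finite parts with content \<open>b\<close>, and that these are
  irreducible.

  The \<open>V\<^bsub>M\<^esub>\<close> span \<open>K\<^sub>b\<close> (\<open>finite_spanning\<close>). One may work in finitely many variables, with the
  Specht polynomials \<open>F\<^bsub>M,T\<^esub>\<close> of finite shape for which \<open>M\<close> vanishes on the first row. Suppose
  that their orthogonal complement \<open>X\<close> in \<open>K\<^sub>b\<close> is not \<open>0\<close>. Among the partitions of the set of
  variables into blocks for which \<open>X\<close> contains some \<open>y \<noteq> 0\<close> that is antisymmetric in each
  block, take one with the largest blocks. The blocks are the columns of a filling \<open>T\<close>, and
  maximality makes \<open>y\<close> satisfy the Garnir relations (\<open>garnir_closed_ex\<close>). By straightening,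
  \<open>y\<close> is determined by its coefficients at the monomials of semi-standard tableaux, and since
  those of the \<open>F\<^bsub>M,T\<^esub>\<close> form a triangular matrix, \<open>y\<close> is a linear combination of the \<open>F\<^bsub>M,T\<^esub>\<close> with
  this \<open>T\<close> (\<open>garnir_closed_span\<close>). It is orthogonal to those with \<open>M\<close> zero on the first row by
  the choice of \<open>X\<close>, and to the others because its product with \<open>F\<^bsub>M,T\<^esub>\<close> is a multiple of the
  sum of its coefficients over a row orbit, which splits into coefficients of \<open>ext_part i y\<close>
  for a single \<open>i < \<bar>b\<bar>\<close> (\<open>row_sum_zero\<close>). Hence \<open>y\<close> is orthogonal to itself, a contradiction.

  The column antisymmetriser of \<open>T\<close> maps \<open>V\<^bsub>M'\<^esub>\<close> into the multiples of \<open>F\<^bsub>M',T\<^esub>\<close> if \<open>M'\<close> has the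
  shape \<open>D\<close> of \<open>T\<close>, and to \<open>0\<close> if its shape \<open>D'\<close> is another one with \<open>n(D') \<le> n(D)\<close>
  (\<open>kappa_span\<close>). Together with the invariant form this gives irreducibility
  (\<open>V_all_irreducible\<close>). Followed by a coefficient it gives linear functionals that show that
  the \<open>V\<^bsub>M\<^esub>\<close>, suitably ordered, are independent (\<open>V_label_independent\<close>).

  This yields one chain of invariant subspaces with the required factors (\<open>filt_content\<close>,
  \<open>filt_degree\<close>). The Jordan--Hoelder theorem transfers them to every composition series.
  Isomorphisms between subquotients are represented by relations between representatives
  (\<open>subq_iso\<close>), so that quotient spaces appear only in the last step.
\<close>

abbreviation lookup :: "('a \<Rightarrow>\<^sub>0 'b::zero) \<Rightarrow> 'a \<Rightarrow> 'b" where
  "lookup \<equiv> Poly_Mapping.lookup"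

abbreviation keys :: "('a \<Rightarrow>\<^sub>0 'b::zero) \<Rightarrow> 'a set" where
  "keys \<equiv> Poly_Mapping.keys"

abbreviation single :: "'a \<Rightarrow> 'b::zero \<Rightarrow> 'a \<Rightarrow>\<^sub>0 'b" where
  "single \<equiv> Poly_Mapping.single"

section \<open>The action on monomials and polynomials\<close>

lemma lookup_mono_act: "bij \<sigma> \<Longrightarrow> lookup (mono_act \<sigma> m) i = lookup m (inv \<sigma> i)"
  by (simp add: mono_act_def Poly_Mapping.map_key.rep_eq bij_imp_bij_inv bij_is_inj)

lemma lookup_mono_act_image: "bij \<sigma> \<Longrightarrow> lookup (mono_act \<sigma> m) (\<sigma> i) = lookup m i"
  by (simp add: lookup_mono_act bij_is_inj)

lemma keys_mono_act: "bij \<sigma> \<Longrightarrow> keys (mono_act \<sigma> m) = \<sigma> ` keys m"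
  by (auto simp: in_keys_iff lookup_mono_act bij_is_surj surj_f_inv_f bij_is_inj
      intro!: image_eqI[of _ \<sigma> "inv \<sigma> _"])

lemma mono_act_id [simp]: "mono_act id m = m"
  by (rule poly_mapping_eqI) (simp add: lookup_mono_act)

lemma mono_act_comp: "bij \<sigma> \<Longrightarrow> bij \<tau> \<Longrightarrow> mono_act (\<sigma> \<circ> \<tau>) m = mono_act \<sigma> (mono_act \<tau> m)"
  by (rule poly_mapping_eqI) (simp add: lookup_mono_act bij_comp o_inv_distrib)

lemma mono_act_inv [simp]:
  "bij \<sigma> \<Longrightarrow> mono_act \<sigma> (mono_act (inv \<sigma>) m) = m"
  "bij \<sigma> \<Longrightarrow> mono_act (inv \<sigma>) (mono_act \<sigma> m) = m"
  by (rule poly_mapping_eqI, simp add: lookup_mono_act bij_imp_bij_inv inv_inv_eq bij_is_inj bij_is_surj surj_f_inv_f)+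

lemma mono_act_inj: "bij \<sigma> \<Longrightarrow> inj (mono_act \<sigma>)"
  by (metis injI mono_act_inv(2))

lemma mono_act_cong:
  assumes "bij \<sigma>" "bij \<tau>" "\<And>x. x \<in> keys m \<Longrightarrow> \<sigma> x = \<tau> x"
  shows "mono_act \<sigma> m = mono_act \<tau> m"
proof (rule poly_mapping_eqI)
  fix i
  show "lookup (mono_act \<sigma> m) i = lookup (mono_act \<tau> m) i"
  proof (cases "\<exists>x\<in>keys m. \<sigma> x = i")
    case True
    then obtain x where "x \<in> keys m" "\<sigma> x = i" by auto
    thus ?thesis using assms lookup_mono_act_image by metis
  next
    case False
    hence "i \<notin> keys (mono_act \<sigma> m)" "i \<notin> keys (mono_act \<tau> m)"
      using assms by (auto simp: keys_mono_act)
    thus ?thesis by (simp add: in_keys_iff)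
  qed
qed

lemma mono_content_act: "bij \<sigma> \<Longrightarrow> mono_content (mono_act \<sigma> m) = mono_content m"
proof -
  assume b: "bij \<sigma>"
  hence i: "inj_on \<sigma> (keys m)" by (meson bij_is_inj inj_on_subset subset_UNIV)
  have "mono_content (mono_act \<sigma> m) = image_mset (lookup (mono_act \<sigma> m)) (image_mset \<sigma> (mset_set (keys m)))"
    unfolding mono_content_def keys_mono_act[OF b] using i by (simp add: image_mset_mset_set)
  also have "\<dots> = image_mset (lookup (mono_act \<sigma> m) \<circ> \<sigma>) (mset_set (keys m))"
    by (simp add: multiset.map_comp)
  also have "lookup (mono_act \<sigma> m) \<circ> \<sigma> = lookup m" using b by (auto simp: lookup_mono_act_image)
  finally show ?thesis by (simp add: mono_content_def)
qed

lemma size_mono_content: "size (mono_content m) = card (keys m)"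
  by (simp add: mono_content_def)

lemma sum_mono_content: "sum_mset (mono_content m) = mono_deg m"
  by (simp add: mono_content_def mono_deg_def sum_unfold_sum_mset)

lemma zero_notin_mono_content: "0 \<notin># mono_content m"
  by (auto simp: mono_content_def in_keys_iff)

lemma lookup_poly_act:
  assumes "bij \<sigma>"
  shows "lookup (poly_act \<sigma> F) m = lookup F (mono_act (inv \<sigma>) m)"
proof -
  have "lookup (poly_act \<sigma> F) m
    = (\<Sum>m'\<in>keys F. lookup F m' when mono_act \<sigma> m' = m)"
    by (simp add: poly_act_def lookup_sum lookup_single)
  also have "\<dots> = (\<Sum>m'\<in>keys F. if m' = mono_act (inv \<sigma>) m then lookup F m' else 0)"
    using assms by (intro sum.cong) (auto simp: when_def)
  also have "\<dots> = lookup F (mono_act (inv \<sigma>) m)"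
    by (auto simp: sum.delta in_keys_iff)
  finally show ?thesis .
qed

lemma keys_poly_act: "bij \<sigma> \<Longrightarrow> keys (poly_act \<sigma> F) = mono_act \<sigma> ` keys F"
  by (auto simp: in_keys_iff lookup_poly_act intro!: image_eqI[of _ "mono_act \<sigma>" "mono_act (inv \<sigma>) _"])

lemma poly_act_hom: "bij \<sigma> \<Longrightarrow> module_hom qscale qscale (poly_act \<sigma>)"
  by unfold_locales (auto intro!: poly_mapping_eqI simp: lookup_add lookup_poly_act)

lemma poly_act_add: "bij \<sigma> \<Longrightarrow> poly_act \<sigma> (F + H) = poly_act \<sigma> F + poly_act \<sigma> H"
  by (rule module_hom.add[OF poly_act_hom])
lemma poly_act_scale: "bij \<sigma> \<Longrightarrow> poly_act \<sigma> (qscale c F) = qscale c (poly_act \<sigma> F)"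
  by (rule module_hom.scale[OF poly_act_hom])
lemma poly_act_sum: "bij \<sigma> \<Longrightarrow> poly_act \<sigma> (sum f A) = (\<Sum>a\<in>A. poly_act \<sigma> (f a))"
  by (rule module_hom.sum[OF poly_act_hom])
lemma poly_act_0: "bij \<sigma> \<Longrightarrow> poly_act \<sigma> 0 = 0"
  by (rule module_hom.zero[OF poly_act_hom])

lemma poly_act_id [simp]: "poly_act id F = F"
  by (rule poly_mapping_eqI) (simp add: lookup_poly_act)

lemma poly_act_comp: "bij \<sigma> \<Longrightarrow> bij \<tau> \<Longrightarrow> poly_act (\<sigma> \<circ> \<tau>) F = poly_act \<sigma> (poly_act \<tau> F)"
  by (rule poly_mapping_eqI) (simp add: lookup_poly_act bij_comp o_inv_distrib mono_act_comp bij_imp_bij_inv)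

lemma poly_act_inv [simp]:
  "bij \<sigma> \<Longrightarrow> poly_act \<sigma> (poly_act (inv \<sigma>) m) = m"
  "bij \<sigma> \<Longrightarrow> poly_act (inv \<sigma>) (poly_act \<sigma> m) = m"
  by (rule poly_mapping_eqI, simp add: lookup_poly_act bij_imp_bij_inv inv_inv_eq)+

lemma poly_act_single: "bij \<sigma> \<Longrightarrow> poly_act \<sigma> (single m c) = single (mono_act \<sigma> m) c"
  by (cases "c = 0") (simp_all add: poly_act_def)

text \<open>
  The sum of the monomials in a finite set.
\<close>

definition ind_poly :: "monomial set \<Rightarrow> qpoly" where
  "ind_poly A = (\<Sum>p\<in>A. single p 1)"

lemma lookup_ind_poly: "finite A \<Longrightarrow> lookup (ind_poly A) m = (if m \<in> A then 1 else 0)"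
  by (simp add: ind_poly_def lookup_sum lookup_single when_def)

lemma poly_act_ind_poly: "bij \<sigma> \<Longrightarrow> poly_act \<sigma> (ind_poly A) = ind_poly (mono_act \<sigma> ` A)"
  unfolding ind_poly_def
  by (subst sum.reindex) (auto simp: poly_act_sum poly_act_single intro: inj_on_subset[OF mono_act_inj])

text \<open>
  The polynomials all of whose monomials lie in a given set.
\<close>

definition polys_in :: "monomial set \<Rightarrow> qpoly set" where
  "polys_in A = {F. keys F \<subseteq> A}"

lemma polys_in_subspace: "qvs.subspace (polys_in A)"
proof (rule qvs.subspaceI)
  show "0 \<in> polys_in A" by (simp add: polys_in_def)
  show "F + H \<in> polys_in A" if "F \<in> polys_in A" "H \<in> polys_in A" for F H
    using that Poly_Mapping.keys_add[of F H] by (auto simp: polys_in_def)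
  show "qscale c F \<in> polys_in A" if "F \<in> polys_in A" for c F
    using that by (auto simp: polys_in_def in_keys_iff)
qed

lemma poly_expand: "F = (\<Sum>m\<in>keys F. qscale (lookup F m) (single m 1))"
proof (rule poly_mapping_eqI)
  fix k
  have "lookup (\<Sum>m\<in>keys F. qscale (lookup F m) (single m 1)) k
      = (\<Sum>m\<in>keys F. if m = k then lookup F m else 0)"
    unfolding lookup_sum by (intro sum.cong) (auto simp: lookup_single)
  also have "\<dots> = lookup F k" by (simp add: sum.delta in_keys_iff)
  finally show "lookup F k = lookup (\<Sum>m\<in>keys F. qscale (lookup F m) (single m 1)) k" by simp
qed

lemma span_monomials: "qvs.span ((\<lambda>m. single m 1) ` A) = polys_in A"
proof (rule antisym)
  show "qvs.span ((\<lambda>m. single m 1) ` A) \<subseteq> polys_in A"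
    by (rule qvs.span_minimal[OF _ polys_in_subspace]) (auto simp: polys_in_def)
next
  show "polys_in A \<subseteq> qvs.span ((\<lambda>m. single m 1) ` A)"
  proof
    fix F assume "F \<in> polys_in A"
    hence "(\<Sum>m\<in>keys F. qscale (lookup F m) (single m 1)) \<in> qvs.span ((\<lambda>m. single m 1) ` A)"
      by (intro qvs.span_sum qvs.span_scale qvs.span_base) (auto simp: polys_in_def)
    thus "F \<in> qvs.span ((\<lambda>m. single m 1) ` A)" by (simp flip: poly_expand)
  qed
qed

lemma content_polys_eq: "content_polys \<mu> = polys_in {m. keys m \<subseteq> {1..} \<and> mono_content m = \<mu>}"
  unfolding content_polys_def span_monomials[symmetric] image_def by (rule arg_cong[of _ _ qvs.span]) auto

lemma hom_polys_eq: "hom_polys X d = polys_in {m. keys m \<subseteq> X \<and> mono_deg m = d}"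
  unfolding hom_polys_def polys_in_def by auto

lemma finite_monomials:
  assumes "finite S"
  shows "finite {m :: monomial. keys m \<subseteq> S \<and> mono_deg m \<le> d}"
proof -
  let ?A = "{m :: monomial. keys m \<subseteq> S \<and> mono_deg m \<le> d}"
  have "lookup ` ?A \<subseteq> {f. \<forall>x. (x \<in> S \<longrightarrow> f x \<in> {..d}) \<and> (x \<notin> S \<longrightarrow> f x = 0)}"
  proof safe
    fix m :: monomial and x assume a: "keys m \<subseteq> S" "mono_deg m \<le> d"
    { assume "x \<in> S"
      have "lookup m x \<le> mono_deg m"
      proof (cases "x \<in> keys m")
        case True thus ?thesis unfolding mono_deg_def by (intro member_le_sum) auto
      qed (auto simp: in_keys_iff)
      thus "lookup m x \<le> d" using a by simp }
    { assume "x \<notin> S"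
      thus "lookup m x = 0" using a by (auto simp: in_keys_iff subset_iff) }
  qed
  moreover have "finite {f. \<forall>x. (x \<in> S \<longrightarrow> f x \<in> {..d}) \<and> (x \<notin> S \<longrightarrow> f x = (0::nat))}"
    by (rule finite_set_of_finite_funs[OF assms]) simp
  ultimately have "finite (lookup ` ?A)" by (rule finite_subset)
  thus ?thesis by (rule finite_imageD) (auto intro!: inj_onI poly_mapping_eqI)
qed

section \<open>Antisymmetrisation\<close>

text \<open>
  A finite group of finitely supported permutations; the support condition makes the signs of
  its elements meaningful.
\<close>

definition fin_perm_group :: "(nat \<Rightarrow> nat) set \<Rightarrow> bool" where
  "fin_perm_group C \<longleftrightarrow> finite C \<and> id \<in> C \<and> (\<forall>\<sigma>\<in>C. permutation \<sigma>) \<and>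
     (\<forall>\<sigma>\<in>C. \<forall>\<tau>\<in>C. \<sigma> \<circ> \<tau> \<in> C) \<and> (\<forall>\<sigma>\<in>C. inv \<sigma> \<in> C)"

text \<open>
  The signed sum of all translates under \<open>C\<close>. For the column stabilizer of \<open>T\<close> this is the
  column antisymmetriser of \<open>T\<close>.
\<close>

definition antisymmetrize :: "(nat \<Rightarrow> nat) set \<Rightarrow> qpoly \<Rightarrow> qpoly" where
  "antisymmetrize C F = (\<Sum>\<sigma>\<in>C. qscale (of_int (sign \<sigma>)) (poly_act \<sigma> F))"

lemma fin_perm_group_permutes: "finite S \<Longrightarrow> fin_perm_group {\<sigma>. \<sigma> permutes S}"
  unfolding fin_perm_group_def
  by (auto intro: finite_permutations permutes_compose permutes_inv permutes_imp_permutation)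

lemma sign_act_sign [simp]:
  "of_int (sign \<sigma>) * (of_int (sign \<sigma>) * x) = (x::rat)"
  "of_int (sign \<sigma>) * of_int (sign \<sigma>) = (1::rat)"
  by (cases \<sigma> rule: sign_cases; simp)+

context
  fixes C assumes C: "fin_perm_group C"
begin

lemma fin_perm_group_facts:
  shows fin_perm_group_finite: "finite C" and fin_perm_group_id: "id \<in> C"
    and fin_perm_group_perm: "\<sigma> \<in> C \<Longrightarrow> permutation \<sigma>"
    and fin_perm_group_bij: "\<sigma> \<in> C \<Longrightarrow> bij \<sigma>"
    and fin_perm_group_comp: "\<sigma> \<in> C \<Longrightarrow> \<tau> \<in> C \<Longrightarrow> \<sigma> \<circ> \<tau> \<in> C"
    and fin_perm_group_inv: "\<sigma> \<in> C \<Longrightarrow> inv \<sigma> \<in> C"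
  using C permutation_bijective by (auto simp: fin_perm_group_def)

lemma fin_perm_group_card_pos: "card C > 0"
  using fin_perm_group_finite fin_perm_group_id by (auto simp: card_gt_0_iff)

lemma bij_betw_comp_left: "\<tau> \<in> C \<Longrightarrow> bij_betw (\<lambda>\<sigma>. \<tau> \<circ> \<sigma>) C C"
  by (rule bij_betw_byWitness[of _ "\<lambda>\<sigma>. inv \<tau> \<circ> \<sigma>"])
    (auto simp: fin_perm_group_comp fin_perm_group_inv o_assoc[symmetric] fun_eq_iff bij_is_surj surj_f_inv_f bij_is_inj fin_perm_group_bij)

lemma bij_betw_comp_right: "\<tau> \<in> C \<Longrightarrow> bij_betw (\<lambda>\<sigma>. \<sigma> \<circ> \<tau>) C C"
  by (rule bij_betw_byWitness[of _ "\<lambda>\<sigma>. \<sigma> \<circ> inv \<tau>"])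
    (auto simp: fin_perm_group_comp fin_perm_group_inv o_assoc[symmetric] fun_eq_iff bij_is_surj surj_f_inv_f bij_is_inj fin_perm_group_bij)

lemma bij_betw_inv: "bij_betw inv C C"
  by (rule bij_betw_byWitness[of _ inv]) (auto simp: fin_perm_group_inv inv_inv_eq fin_perm_group_bij)

lemma antisymmetrize_hom: "module_hom qscale qscale (antisymmetrize C)"
  unfolding antisymmetrize_def
  by unfold_locales
    (simp_all add: poly_act_add poly_act_scale fin_perm_group_bij qvs.scale_right_distrib sum.distrib qvs.scale_sum_right
       mult.commute)

lemma antisymmetrize_poly_act:
  assumes "\<tau> \<in> C"
  shows "antisymmetrize C (poly_act \<tau> F) = qscale (of_int (sign \<tau>)) (antisymmetrize C F)"
proof -
  have "qscale (of_int (sign \<tau>)) (antisymmetrize C F)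
      = (\<Sum>\<sigma>\<in>C. qscale (of_int (sign \<tau>) * of_int (sign \<sigma>)) (poly_act \<sigma> F))"
    by (simp add: antisymmetrize_def qvs.scale_sum_right)
  also have "\<dots> = (\<Sum>\<sigma>\<in>C. qscale (of_int (sign \<tau>) * of_int (sign (\<sigma> \<circ> \<tau>))) (poly_act (\<sigma> \<circ> \<tau>) F))"
    by (rule sum.reindex_bij_betw[OF bij_betw_comp_right[OF assms], symmetric])
  also have "\<dots> = antisymmetrize C (poly_act \<tau> F)"
    unfolding antisymmetrize_def using assms
    by (intro sum.cong) (simp_all add: sign_compose fin_perm_group_perm poly_act_comp fin_perm_group_bij mult.commute mult.left_commute)
  finally show ?thesis by simp
qed

lemma poly_act_antisymmetrize:
  assumes "\<tau> \<in> C"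
  shows "poly_act \<tau> (antisymmetrize C F) = qscale (of_int (sign \<tau>)) (antisymmetrize C F)"
proof -
  have "qscale (of_int (sign \<tau>)) (antisymmetrize C F)
      = (\<Sum>\<sigma>\<in>C. qscale (of_int (sign \<tau>) * of_int (sign \<sigma>)) (poly_act \<sigma> F))"
    by (simp add: antisymmetrize_def qvs.scale_sum_right)
  also have "\<dots> = (\<Sum>\<sigma>\<in>C. qscale (of_int (sign \<tau>) * of_int (sign (\<tau> \<circ> \<sigma>))) (poly_act (\<tau> \<circ> \<sigma>) F))"
    by (rule sum.reindex_bij_betw[OF bij_betw_comp_left[OF assms], symmetric])
  also have "\<dots> = poly_act \<tau> (antisymmetrize C F)"
    unfolding antisymmetrize_def using assms
    by (subst poly_act_sum) (auto intro!: sum.cong simp: sign_compose fin_perm_group_perm poly_act_comp fin_perm_group_bij poly_act_scale)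
  finally show ?thesis by simp
qed

lemma antisymmetrize_of_antisymmetric:
  assumes "\<And>\<sigma>. \<sigma> \<in> C \<Longrightarrow> poly_act \<sigma> F = qscale (of_int (sign \<sigma>)) F"
  shows "antisymmetrize C F = qscale (of_nat (card C)) F"
proof -
  have "antisymmetrize C F = (\<Sum>\<sigma>\<in>C. F)"
    unfolding antisymmetrize_def using assms by (intro sum.cong) simp_all
  also have "\<dots> = qscale (of_nat (card C)) F"
    by (rule poly_mapping_eqI) (simp add: lookup_sum del: sum_constant, simp)
  finally show ?thesis .
qed

lemma antisymmetrize_twice: "antisymmetrize C (antisymmetrize C F) = qscale (of_nat (card C)) (antisymmetrize C F)"
  by (rule antisymmetrize_of_antisymmetric) (rule poly_act_antisymmetrize)

lemma antisymmetrize_eq_0: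
  assumes "transpose a b \<in> C" "a \<noteq> b" "poly_act (transpose a b) F = F"
  shows "antisymmetrize C F = 0"
proof -
  have "antisymmetrize C F = qscale (-1) (antisymmetrize C F)"
    using antisymmetrize_poly_act[OF assms(1), of F] assms by (simp add: sign_swap_id)
  hence "lookup (antisymmetrize C F) m = - lookup (antisymmetrize C F) m" for m by (metis lookup_qscale mult_minus1)
  hence "lookup (antisymmetrize C F) m = 0" for m by (simp add: equal_neg_zero)
  thus ?thesis by (intro poly_mapping_eqI) auto
qed

lemma lookup_antisymmetrize: "lookup (antisymmetrize C F) m = (\<Sum>\<sigma>\<in>C. of_int (sign \<sigma>) * lookup F (mono_act (inv \<sigma>) m))"
  by (simp add: antisymmetrize_def lookup_sum lookup_poly_act fin_perm_group_bij)

end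

lemma antisymmetrize_0 [simp]: "fin_perm_group C \<Longrightarrow> antisymmetrize C 0 = 0"
  by (rule module_hom.zero[OF antisymmetrize_hom])

text \<open>
  The symmetric bilinear form for which the monomials are orthonormal. It is invariant under
  permutations of the variables, and positive definite.
\<close>

definition qinner :: "qpoly \<Rightarrow> qpoly \<Rightarrow> rat" where
  "qinner F H = (\<Sum>m\<in>keys F. lookup F m * lookup H m)"

lemma qinner_sum_superset: "finite A \<Longrightarrow> keys F \<subseteq> A \<Longrightarrow> qinner F H = (\<Sum>m\<in>A. lookup F m * lookup H m)"
  unfolding qinner_def by (rule sum.mono_neutral_left) (auto simp: in_keys_iff)

lemma qinner_commute: "qinner F H = qinner H F"
proof -
  have "qinner F H = (\<Sum>m\<in>keys F \<union> keys H. lookup F m * lookup H m)"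
    by (rule qinner_sum_superset) auto
  also have "\<dots> = (\<Sum>m\<in>keys F \<union> keys H. lookup H m * lookup F m)" by (simp add: mult.commute)
  also have "\<dots> = qinner H F" by (rule qinner_sum_superset[symmetric]) auto
  finally show ?thesis .
qed

lemma qinner_add_right: "qinner F (H + K) = qinner F H + qinner F K"
  by (simp add: qinner_def lookup_add ring_distribs sum.distrib)
lemma qinner_scale_right: "qinner F (qscale c H) = c * qinner F H"
  by (simp add: qinner_def sum_distrib_left mult_ac)
lemma qinner_sum_right: "qinner F (sum f A) = (\<Sum>a\<in>A. qinner F (f a))"
  by (simp add: qinner_def lookup_sum sum_distrib_left) (rule sum.swap)
lemma qinner_0_right [simp]: "qinner F 0 = 0" by (simp add: qinner_def)
lemma qinner_add_left: "qinner (H + K) F = qinner H F + qinner K F"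
  by (metis qinner_add_right qinner_commute)
lemma qinner_scale_left: "qinner (qscale c H) F = c * qinner H F"
  by (metis qinner_scale_right qinner_commute)
lemma qinner_sum_left: "qinner (sum f A) F = (\<Sum>a\<in>A. qinner (f a) F)"
  by (simp add: qinner_commute[of _ F] qinner_sum_right)
lemma qinner_0_left [simp]: "qinner 0 F = 0" by (simp add: qinner_def)

lemma qinner_self_eq_0: "qinner F F = 0 \<Longrightarrow> F = 0"
proof -
  assume "qinner F F = 0"
  hence "\<forall>m\<in>keys F. lookup F m * lookup F m = 0"
    unfolding qinner_def by (subst (asm) sum_nonneg_eq_0_iff) auto
  thus ?thesis by (intro poly_mapping_eqI) (auto simp: in_keys_iff)
qed

lemma qinner_span_eq_0:
  assumes "H \<in> qvs.span S" "\<And>s. s \<in> S \<Longrightarrow> qinner F s = 0"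
  shows "qinner F H = 0"
  using assms(1)
  by (induction rule: qvs.span_induct_alt) (auto simp: qinner_add_right qinner_scale_right assms)

lemma qinner_poly_act:
  assumes "bij \<sigma>"
  shows "qinner (poly_act \<sigma> F) H = qinner F (poly_act (inv \<sigma>) H)"
proof -
  have "qinner (poly_act \<sigma> F) H = (\<Sum>m\<in>mono_act \<sigma> ` keys F. lookup F (mono_act (inv \<sigma>) m) * lookup H m)"
    using assms by (simp add: qinner_def keys_poly_act lookup_poly_act)
  also have "\<dots> = qinner F (poly_act (inv \<sigma>) H)"
    using assms
    by (subst sum.reindex) (auto simp: qinner_def lookup_poly_act bij_imp_bij_inv inv_inv_eq intro: inj_on_subset[OF mono_act_inj])
  finally show ?thesis .
qed

lemma qinner_antisymmetrize:
  assumes C: "fin_perm_group C"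
  shows "qinner (antisymmetrize C F) H = qinner F (antisymmetrize C H)"
proof -
  have "qinner (antisymmetrize C F) H = (\<Sum>\<sigma>\<in>C. of_int (sign \<sigma>) * qinner F (poly_act (inv \<sigma>) H))"
    by (simp add: antisymmetrize_def qinner_sum_left qinner_scale_left qinner_poly_act fin_perm_group_bij[OF C])
  also have "\<dots> = (\<Sum>\<sigma>\<in>C. of_int (sign (inv \<sigma>)) * qinner F (poly_act (inv \<sigma>) H))"
    by (intro sum.cong) (auto simp: sign_inverse fin_perm_group_perm[OF C])
  also have "\<dots> = (\<Sum>\<sigma>\<in>C. of_int (sign \<sigma>) * qinner F (poly_act \<sigma> H))"
    by (rule sum.reindex_bij_betw[OF bij_betw_inv[OF C]])
  also have "\<dots> = qinner F (antisymmetrize C H)"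
    by (simp add: antisymmetrize_def qinner_sum_right qinner_scale_right)
  finally show ?thesis .
qed

text \<open>
  Gram--Schmidt orthogonalisation. Normalisation is not needed, so it works over the
  rationals.
\<close>

lemma orthogonal_decomposition_finite:
  assumes "finite B"
  shows "\<exists>w\<in>qvs.span B. \<forall>b\<in>qvs.span B. qinner (z - w) b = 0"
  using assms
proof (induction B arbitrary: z rule: finite_induct)
  case empty
  show ?case by (auto intro!: exI[of _ 0])
next
  case (insert x B)
  obtain x1 where x1: "x1 \<in> qvs.span B" "\<And>b. b \<in> qvs.span B \<Longrightarrow> qinner (x - x1) b = 0"
    using insert.IH by blast
  obtain z1 where z1: "z1 \<in> qvs.span B" "\<And>b. b \<in> qvs.span B \<Longrightarrow> qinner (z - z1) b = 0"
    using insert.IH by blast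
  define u where "u = x - x1"
  define c where "c = (if u = 0 then 0 else qinner (z - z1) u / qinner u u)"
  define w where "w = z1 + qscale c u"
  have u: "u \<in> qvs.span (insert x B)" unfolding u_def
    by (intro qvs.span_diff qvs.span_base subsetD[OF qvs.span_mono x1(1)]) auto
  have w: "w \<in> qvs.span (insert x B)" unfolding w_def
    by (intro qvs.span_add qvs.span_scale u subsetD[OF qvs.span_mono z1(1)]) auto
  have zw: "z - w = (z - z1) + qscale (-c) u" by (simp add: w_def)
  have 1: "qinner (z - w) b = 0" if "b \<in> qvs.span B" for b
    unfolding zw qinner_add_left qinner_scale_left using z1 x1 that by (simp add: u_def)
  have 2: "qinner (z - w) u = 0"
  proof (cases "u = 0")
    case False
    hence "qinner u u \<noteq> 0" using qinner_self_eq_0 by auto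
    thus ?thesis unfolding zw qinner_add_left qinner_scale_left using False by (simp add: c_def)
  qed simp
  have "qinner (z - w) b = 0" if b: "b \<in> qvs.span (insert x B)" for b
  proof -
    obtain k where k: "b - qscale k x \<in> qvs.span B" using b by (auto simp: qvs.span_insert)
    have "b - qscale k u = (b - qscale k x) + qscale k x1"
      by (simp add: u_def qvs.scale_right_diff_distrib)
    hence "b - qscale k u \<in> qvs.span B" using qvs.span_add[OF k qvs.span_scale[OF x1(1)]] by metis
    from 1[OF this] 2 have "qinner (z - w) ((b - qscale k u) + qscale k u) = 0"
      unfolding qinner_add_right qinner_scale_right by simp
    thus ?thesis by simp
  qed
  thus ?case using w by blast
qed

lemma orthogonal_decomposition:
  assumes "qvs.subspace W" "W \<subseteq> polys_in A" "finite A"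
  obtains w where "w \<in> W" "\<And>b. b \<in> W \<Longrightarrow> qinner (z - w) b = 0"
proof -
  obtain B where B: "B \<subseteq> W" "qvs.independent B" "W \<subseteq> qvs.span B"
    by (rule qvs.maximal_independent_subset)
  have "B \<subseteq> qvs.span ((\<lambda>m. single m 1) ` A)" unfolding span_monomials using B assms by auto
  hence fin: "finite B"
    using qvs.independent_span_bound[of "(\<lambda>m. single m 1) ` A" B] B assms by auto
  have "qvs.span B = W" using B qvs.span_minimal[OF _ assms(1)] by auto
  with orthogonal_decomposition_finite[OF fin, of z] that show ?thesis by auto
qed

section \<open>Diagrams, fillings and stabilizers\<close>

text \<open>
  Ferrers diagrams with a finite part: the finite ones and those with an infinite first row,
  which are treated together as far as possible.
\<close>

definition shape :: "diagram \<Rightarrow> bool" where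
  "shape D \<longleftrightarrow> ferrers D \<and> finite (fin_part D)"

text \<open>
  The boxes in columns of length at least 2. There are finitely many of them, and the column
  stabilizer fixes the entries of all other boxes.
\<close>

definition long :: "diagram \<Rightarrow> diagram" where
  "long D = {c \<in> D. (1, snd c) \<in> D}"

text \<open>
  Fillings by non-negative integers which vanish outside of the diagram and, if the diagram is
  infinite, also on its first row. The latter are the fillings \<open>M\<^sup>0\<close>.
\<close>

definition tab :: "diagram \<Rightarrow> (box \<Rightarrow> nat) \<Rightarrow> bool" where
  "tab D M \<longleftrightarrow> shape D \<and> (\<forall>c. c \<notin> D \<longrightarrow> M c = 0) \<and> (finite D \<or> (\<forall>j. M (0, j) = 0))"

text \<open>
  The monomials in the orbit of \<open>p\<^bsub>M,T\<^esub>\<close> under the row stabilizer.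
\<close>

definition orb :: "diagram \<Rightarrow> (box \<Rightarrow> nat) \<Rightarrow> (box \<Rightarrow> nat) \<Rightarrow> monomial set" where
  "orb D M T = (\<lambda>\<tau>. mono_act \<tau> (tab_mono D M T)) ` row_stab D T"

lemma specht_poly_eq: "specht_poly D M T = antisymmetrize (col_stab D T) (ind_poly (orb D M T))"
  by (simp add: specht_poly_def antisymmetrize_def ind_poly_def orb_def)

lemma ferrersD: "ferrers D \<Longrightarrow> (i, j) \<in> D \<Longrightarrow> i' \<le> i \<Longrightarrow> j' \<le> j \<Longrightarrow> (i', j') \<in> D"
  unfolding ferrers_def by blast

lemma finite_long: assumes "shape D" shows "finite (long D)"
proof (rule finite_subset)
  show "long D \<subseteq> fin_part D \<union> (\<lambda>c. (0, snd c)) ` fin_part D"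
    by (force simp: long_def fin_part_def image_iff)
qed (use assms in \<open>auto simp: shape_def\<close>)

lemma finite_column: assumes "shape D" shows "finite {c \<in> D. snd c = j}"
proof (rule finite_subset)
  show "{c \<in> D. snd c = j} \<subseteq> insert (0, j) (fin_part D)"
    by (auto simp: fin_part_def)
qed (use assms in \<open>auto simp: shape_def\<close>)

lemma long_iff: "shape D \<Longrightarrow> c \<in> D \<Longrightarrow> c' \<in> D \<Longrightarrow> snd c = snd c' \<Longrightarrow> c \<noteq> c' \<Longrightarrow> c \<in> long D"
proof -
  assume a: "shape D" "c \<in> D" "c' \<in> D" "snd c = snd c'" "c \<noteq> c'"
  have "fst c \<noteq> fst c'" using a by (simp add: prod_eq_iff)
  hence "1 \<le> fst c \<or> 1 \<le> fst c'" by linarith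
  hence "(1, snd c) \<in> D"
    using a ferrersD[of D "fst c" "snd c" 1 "snd c"] ferrersD[of D "fst c'" "snd c" 1 "snd c"]
    by (simp only: shape_def prod.collapse order.refl) (metis prod.collapse)
  thus ?thesis using a by (simp add: long_def)
qed

lemma long_column: "c \<in> long D \<Longrightarrow> c' \<in> D \<Longrightarrow> snd c' = snd c \<Longrightarrow> c' \<in> long D"
  by (simp add: long_def)

lemma fin_part_long: "shape D \<Longrightarrow> c \<in> fin_part D \<Longrightarrow> c \<in> long D"
  using ferrersD[of D "fst c" "snd c" 1 "snd c"] by (simp add: fin_part_def long_def shape_def)

lemma long_subset: "long D \<subseteq> D" by (auto simp: long_def)

lemma col_stab_D:
  assumes "\<sigma> \<in> col_stab D T" "c \<in> D"
  obtains c' where "c' \<in> D" "snd c' = snd c" "\<sigma> (T c) = T c'"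
proof -
  have "\<sigma> (T c) \<in> \<sigma> ` T ` {c' \<in> D. snd c' = snd c}" using assms by auto
  also have "\<dots> = T ` {c' \<in> D. snd c' = snd c}" using assms by (simp add: col_stab_def)
  finally show ?thesis using that by auto
qed

lemma row_stab_D:
  assumes "\<sigma> \<in> row_stab D T" "c \<in> D"
  obtains c' where "c' \<in> D" "fst c' = fst c" "\<sigma> (T c) = T c'"
proof -
  have "\<sigma> (T c) \<in> \<sigma> ` T ` {c' \<in> D. fst c' = fst c}" using assms by auto
  also have "\<dots> = T ` {c' \<in> D. fst c' = fst c}" using assms by (simp add: row_stab_def)
  finally show ?thesis using that by auto
qed

lemma col_stab_iff:
  assumes D: "shape D" and T: "inj_on T D"
  shows "\<sigma> \<in> col_stab D T \<longleftrightarrow>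
    \<sigma> permutes (T ` long D) \<and> (\<forall>c\<in>long D. \<exists>c'\<in>long D. snd c' = snd c \<and> \<sigma> (T c) = T c')"
proof
  assume s: "\<sigma> \<in> col_stab D T"
  hence p: "\<sigma> permutes T ` D" by (simp add: col_stab_def)
  have fixd: "\<sigma> x = x" if x: "x \<in> T ` D - T ` long D" for x
  proof -
    from x obtain c where c: "c \<in> D" "x = T c" "c \<notin> long D" by auto
    obtain c' where c': "c' \<in> D" "snd c' = snd c" "\<sigma> (T c) = T c'" using col_stab_D[OF s c(1)] .
    have "c' = c" using long_iff[OF D c(1) c'(1)] c c' by auto
    thus ?thesis using c c' by simp
  qed
  have "\<sigma> permutes (T ` long D)" using permutes_superset[OF p fixd] .
  moreover have "\<exists>c'\<in>long D. snd c' = snd c \<and> \<sigma> (T c) = T c'" if "c \<in> long D" for c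
  proof -
    have "c \<in> D" using that long_subset by auto
    from col_stab_D[OF s this] obtain c' where "c' \<in> D" "snd c' = snd c" "\<sigma> (T c) = T c'" .
    thus ?thesis using long_column[OF that, of c'] by blast
  qed
  ultimately show "\<sigma> permutes (T ` long D) \<and> (\<forall>c\<in>long D. \<exists>c'\<in>long D. snd c' = snd c \<and> \<sigma> (T c) = T c')"
    by auto
next
  assume s: "\<sigma> permutes (T ` long D) \<and> (\<forall>c\<in>long D. \<exists>c'\<in>long D. snd c' = snd c \<and> \<sigma> (T c) = T c')"
  hence p: "\<sigma> permutes T ` D" using permutes_subset long_subset by (metis image_mono)
  have "\<sigma> ` T ` {c \<in> D. snd c = j} = T ` {c \<in> D. snd c = j}" for j
  proof (rule endo_inj_surj)
    show "finite (T ` {c \<in> D. snd c = j})" using finite_column[OF D] by auto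
    show "inj_on \<sigma> (T ` {c \<in> D. snd c = j})" using permutes_inj_on[OF p] .
    show "\<sigma> ` T ` {c \<in> D. snd c = j} \<subseteq> T ` {c \<in> D. snd c = j}"
    proof
      fix x assume "x \<in> \<sigma> ` T ` {c \<in> D. snd c = j}"
      then obtain i where c: "(i, j) \<in> D" and x: "x = \<sigma> (T (i, j))" by auto
      have "\<sigma> (T (i, j)) \<in> T ` {c \<in> D. snd c = snd (i, j)}"
      proof (cases "(i, j) \<in> long D")
        case True
        then obtain c' where "c' \<in> long D" "snd c' = snd (i, j)" "\<sigma> (T (i, j)) = T c'" using s by blast
        thus ?thesis using long_subset[of D] by auto
      next
        case False
        hence "T (i, j) \<notin> T ` long D" using c T long_subset by (auto simp: inj_on_image_mem_iff)
        hence "\<sigma> (T (i, j)) = T (i, j)" using s by (auto dest: permutes_not_in)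
        thus ?thesis using c by auto
      qed
      thus "x \<in> T ` {c \<in> D. snd c = j}" unfolding x by simp
    qed
  qed
  thus "\<sigma> \<in> col_stab D T" using p by (simp add: col_stab_def)
qed

lemma inv_image_eq: "bij f \<Longrightarrow> f ` A = A \<Longrightarrow> inv f ` A = A"
  by (metis bij_is_inj image_inv_f_f)

lemma comp_image_eq: "f ` A = A \<Longrightarrow> g ` A = A \<Longrightarrow> (f \<circ> g) ` A = A"
  by (metis image_comp)

lemma col_stab_group:
  assumes D: "shape D" and T: "inj_on T D"
  shows "fin_perm_group (col_stab D T)"
proof -
  have fin: "finite (T ` long D)" using finite_long[OF D] by simp
  have sub: "col_stab D T \<subseteq> {\<sigma>. \<sigma> permutes (T ` long D)}" using col_stab_iff[OF D T] by auto
  have "finite (col_stab D T)" by (rule finite_subset[OF sub finite_permutations[OF fin]])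
  moreover have "permutation \<sigma>" if "\<sigma> \<in> col_stab D T" for \<sigma>
    using that sub permutes_imp_permutation[OF fin] by auto
  moreover have "id \<in> col_stab D T" by (simp add: col_stab_def)
  moreover have "\<sigma> \<circ> \<tau> \<in> col_stab D T" if "\<sigma> \<in> col_stab D T" "\<tau> \<in> col_stab D T" for \<sigma> \<tau>
    using that by (simp only: col_stab_def mem_Collect_eq permutes_compose comp_image_eq simp_thms)
  moreover have "inv \<sigma> \<in> col_stab D T" if "\<sigma> \<in> col_stab D T" for \<sigma>
  proof -
    have "\<sigma> permutes T ` D" "\<And>j. \<sigma> ` T ` {c \<in> D. snd c = j} = T ` {c \<in> D. snd c = j}"
      using that by (simp_all only: col_stab_def mem_Collect_eq)
    thus ?thesis unfolding col_stab_def mem_Collect_eq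
      by (intro conjI allI permutes_inv inv_image_eq[OF permutes_bij])
  qed
  ultimately show ?thesis by (simp add: fin_perm_group_def)
qed

lemma row_stab_bij: "\<tau> \<in> row_stab D T \<Longrightarrow> bij \<tau>"
  by (auto simp: row_stab_def permutes_bij)
lemma row_stab_comp: "\<sigma> \<in> row_stab D T \<Longrightarrow> \<tau> \<in> row_stab D T \<Longrightarrow> \<sigma> \<circ> \<tau> \<in> row_stab D T"
  by (simp only: row_stab_def mem_Collect_eq permutes_compose comp_image_eq simp_thms)
lemma row_stab_inv: "\<sigma> \<in> row_stab D T \<Longrightarrow> inv \<sigma> \<in> row_stab D T"
proof -
  assume "\<sigma> \<in> row_stab D T"
  hence "\<sigma> permutes T ` D" "\<And>j. \<sigma> ` T ` {c \<in> D. fst c = j} = T ` {c \<in> D. fst c = j}"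
    by (simp_all only: row_stab_def mem_Collect_eq)
  thus ?thesis unfolding row_stab_def mem_Collect_eq
    by (intro conjI allI permutes_inv inv_image_eq[OF permutes_bij])
qed
lemma row_stab_id: "id \<in> row_stab D T"
  by (simp add: row_stab_def)

lemma col_stab_bij: "\<tau> \<in> col_stab D T \<Longrightarrow> bij \<tau>"
  by (auto simp: col_stab_def permutes_bij)

lemma transpose_col_stab:
  assumes "c \<in> D" "c' \<in> D" "snd c = snd c'" "inj_on T D"
  shows "transpose (T c) (T c') \<in> col_stab D T"
proof -
  have "transpose (T c) (T c') ` T ` {x \<in> D. snd x = j} = T ` {x \<in> D. snd x = j}" for j
  proof (cases "j = snd c")
    case True thus ?thesis using assms by (intro permutes_image permutes_swap_id) auto
  next
    case False
    have "transpose (T c) (T c') x = x" if "x \<in> T ` {x \<in> D. snd x = j}" for x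
      using that False assms by (intro transpose_apply_other) (auto dest: inj_onD)
    thus ?thesis by auto
  qed
  moreover have "transpose (T c) (T c') permutes T ` D" using assms by (intro permutes_swap_id) auto
  ultimately show ?thesis by (simp add: col_stab_def)
qed

lemma transpose_row_stab:
  assumes "c \<in> D" "c' \<in> D" "fst c = fst c'" "inj_on T D"
  shows "transpose (T c) (T c') \<in> row_stab D T"
proof -
  have "transpose (T c) (T c') ` T ` {x \<in> D. fst x = j} = T ` {x \<in> D. fst x = j}" for j
  proof (cases "j = fst c")
    case True thus ?thesis using assms by (intro permutes_image permutes_swap_id) auto
  next
    case False
    have "transpose (T c) (T c') x = x" if "x \<in> T ` {x \<in> D. fst x = j}" for x
      using that False assms by (intro transpose_apply_other) (auto dest: inj_onD)
    thus ?thesis by auto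
  qed
  moreover have "transpose (T c) (T c') permutes T ` D" using assms by (intro permutes_swap_id) auto
  ultimately show ?thesis by (simp add: row_stab_def)
qed

section \<open>Monomials of tableaux and their row orbits\<close>

lemma tab_finite_support: assumes "tab D M" shows "finite {c \<in> D. M c \<noteq> 0}"
proof (cases "finite D")
  case False
  hence "{c \<in> D. M c \<noteq> 0} \<subseteq> fin_part D" using assms
    by (auto simp: fin_part_def tab_def) (metis not_gr_zero)
  thus ?thesis using assms by (auto simp: tab_def shape_def intro: finite_subset)
qed auto

lemma lookup_tab_mono:
  assumes "tab D M" "inj_on T D"
  shows "c \<in> D \<Longrightarrow> lookup (tab_mono D M T) (T c) = M c"
    and "x \<notin> T ` D \<Longrightarrow> lookup (tab_mono D M T) x = 0"
proof -
  note fin = tab_finite_support[OF assms(1)]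
  show "lookup (tab_mono D M T) (T c) = M c" if c: "c \<in> D"
  proof -
    have "lookup (tab_mono D M T) (T c) = (\<Sum>c'\<in>{c \<in> D. M c \<noteq> 0}. if c' = c then M c else 0)"
      unfolding tab_mono_def lookup_sum
      by (intro sum.cong) (use c assms in \<open>auto simp: lookup_single when_def dest: inj_onD\<close>)
    also have "\<dots> = M c" using fin c by (auto simp: sum.delta)
    finally show ?thesis .
  qed
  show "lookup (tab_mono D M T) x = 0" if "x \<notin> T ` D"
    unfolding tab_mono_def lookup_sum
    by (intro sum.neutral) (use that in \<open>auto simp: lookup_single when_def\<close>)
qed

lemma keys_tab_mono:
  assumes "tab D M" "inj_on T D"
  shows "keys (tab_mono D M T) = T ` {c \<in> D. M c \<noteq> 0}"
proof safe
  fix x assume x: "x \<in> keys (tab_mono D M T)"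
  then obtain c where "c \<in> D" "x = T c" using lookup_tab_mono(2)[OF assms, of x] by (metis imageE in_keys_iff)
  thus "x \<in> T ` {c \<in> D. M c \<noteq> 0}" using x lookup_tab_mono(1)[OF assms, of c] by (auto simp: in_keys_iff)
next
  fix i j assume "(i, j) \<in> D" "M (i, j) > 0"
  thus "T (i, j) \<in> keys (tab_mono D M T)" using lookup_tab_mono(1)[OF assms, of "(i, j)"] by (auto simp: in_keys_iff)
qed

lemma tab_mono_eqI:
  assumes "tab D M" "inj_on T D" "\<And>c. c \<in> D \<Longrightarrow> lookup m (T c) = M c" "keys m \<subseteq> T ` D"
  shows "tab_mono D M T = m"
proof (rule poly_mapping_eqI)
  fix x
  show "lookup (tab_mono D M T) x = lookup m x"
  proof (cases "x \<in> T ` D")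
    case True thus ?thesis using lookup_tab_mono(1)[OF assms(1,2)] assms(3) by auto
  next
    case False
    hence "lookup m x = 0" using assms(4) by (metis in_keys_iff subsetD)
    thus ?thesis using lookup_tab_mono(2)[OF assms(1,2) False] by simp
  qed
qed

lemma mono_content_tab_mono:
  assumes "tab D M" "inj_on T D"
  shows "mono_content (tab_mono D M T) = image_mset M (mset_set {c \<in> D. M c \<noteq> 0})"
proof -
  have i: "inj_on T {c \<in> D. M c \<noteq> 0}" using assms(2) by (rule inj_on_subset) auto
  have "mono_content (tab_mono D M T)
     = image_mset (lookup (tab_mono D M T) \<circ> T) (mset_set {c \<in> D. M c \<noteq> 0})"
    unfolding mono_content_def keys_tab_mono[OF assms] image_mset_mset_set[OF i, symmetric] multiset.map_comp ..
  also have "\<dots> = image_mset M (mset_set {c \<in> D. M c \<noteq> 0})"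
    by (intro image_mset_cong) (use tab_finite_support[OF assms(1)] lookup_tab_mono[OF assms] in auto)
  finally show ?thesis .
qed

lemma tab_mono_in_orb: "tab_mono D M T \<in> orb D M T"
  unfolding orb_def using row_stab_id[of D T] by (auto intro!: image_eqI[of _ _ id])

lemma mono_act_orb:
  assumes "\<tau> \<in> row_stab D T"
  shows "mono_act \<tau> ` orb D M T = orb D M T"
proof -
  have 1: "mono_act \<tau> ` orb D M T \<subseteq> orb D M T" if t: "\<tau> \<in> row_stab D T" for \<tau>
  proof
    fix q assume "q \<in> mono_act \<tau> ` orb D M T"
    then obtain \<sigma> where s: "\<sigma> \<in> row_stab D T" "q = mono_act \<tau> (mono_act \<sigma> (tab_mono D M T))"
      by (auto simp: orb_def)
    hence "q = mono_act (\<tau> \<circ> \<sigma>) (tab_mono D M T)"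
      using mono_act_comp[OF row_stab_bij[OF t] row_stab_bij[OF s(1)]] by simp
    thus "q \<in> orb D M T" using row_stab_comp[OF t s(1)] by (auto simp: orb_def)
  qed
  have "orb D M T = mono_act \<tau> ` mono_act (inv \<tau>) ` orb D M T"
    using row_stab_bij[OF assms] by (simp add: image_image)
  also have "\<dots> \<subseteq> mono_act \<tau> ` orb D M T" using 1[OF row_stab_inv[OF assms]] by (rule image_mono)
  finally show ?thesis using 1[OF assms] by auto
qed

lemma orb_content: "p \<in> orb D M T \<Longrightarrow> mono_content p = mono_content (tab_mono D M T)"
  unfolding orb_def using mono_content_act[OF row_stab_bij] by blast

lemma orb_keys:
  assumes "tab D M" "inj_on T D" "p \<in> orb D M T"
  shows "keys p \<subseteq> T ` D"
proof -
  obtain \<tau> where t: "\<tau> \<in> row_stab D T" "p = mono_act \<tau> (tab_mono D M T)" using assms(3) by (auto simp: orb_def)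
  hence "keys p \<subseteq> \<tau> ` T ` D" using keys_mono_act[OF row_stab_bij[OF t(1)]] keys_tab_mono[OF assms(1,2)] by auto
  also have "\<dots> = T ` D" using t by (auto simp: row_stab_def permutes_image)
  finally show ?thesis .
qed

lemma orb_keys_fin_part:
  assumes "tab D M" "inj_on T D" "p \<in> orb D M T" "\<And>j. M (0, j) = 0"
  shows "keys p \<subseteq> T ` fin_part D"
proof
  fix x assume x: "x \<in> keys p"
  obtain \<tau> where t: "\<tau> \<in> row_stab D T" "p = mono_act \<tau> (tab_mono D M T)" using assms(3) by (auto simp: orb_def)
  then obtain c where c: "c \<in> D" "M c \<noteq> 0" "x = \<tau> (T c)"
    using x keys_mono_act[OF row_stab_bij[OF t(1)]] keys_tab_mono[OF assms(1,2)] by auto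
  obtain c' where c': "c' \<in> D" "fst c' = fst c" "\<tau> (T c) = T c'" using row_stab_D[OF t(1) c(1)] .
  have "fst c > 0" using c assms(4) by (cases c) (auto intro: Nat.gr0I)
  thus "x \<in> T ` fin_part D" using c c' by (auto simp: fin_part_def)
qed

lemma finite_orb:
  assumes "tab D M" "inj_on T D"
  shows "finite (orb D M T)"
proof -
  have "\<exists>S. finite S \<and> (\<forall>p\<in>orb D M T. keys p \<subseteq> S)"
  proof (cases "finite D")
    case True thus ?thesis using orb_keys[OF assms] by blast
  next
    case False
    hence "\<forall>p\<in>orb D M T. keys p \<subseteq> T ` fin_part D" using orb_keys_fin_part[OF assms] assms by (auto simp: tab_def)
    moreover have "finite (T ` fin_part D)" using assms by (auto simp: tab_def shape_def)
    ultimately show ?thesis by blast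
  qed
  then obtain S where S: "finite S" "\<And>p. p \<in> orb D M T \<Longrightarrow> keys p \<subseteq> S" by auto
  have "orb D M T \<subseteq> {p. keys p \<subseteq> S \<and> mono_deg p \<le> mono_deg (tab_mono D M T)}"
    using S(2) orb_content by (auto simp flip: sum_mono_content)
  thus ?thesis using finite_monomials[OF S(1)] by (rule finite_subset)
qed

lemma row_stab_cong_rows:
  assumes "\<And>i. T ` {c \<in> D. fst c = i} = T' ` {c \<in> D. fst c = i}"
  shows "row_stab D T = row_stab D T'"
proof -
  have "T ` D = (\<Union>i. T ` {c \<in> D. fst c = i})" "T' ` D = (\<Union>i. T' ` {c \<in> D. fst c = i})" by auto
  hence "T ` D = T' ` D" using assms by simp
  thus ?thesis using assms by (simp add: row_stab_def)
qed

text \<open>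
  The row orbit depends on \<open>T\<close> only through the sets of entries of its rows: two fillings with
  the same rows differ by an element of the row stabilizer.
\<close>

lemma orb_cong_rows:
  assumes M: "tab D M" and T: "inj_on T D" "inj_on T' D"
    and rows: "\<And>i. T ` {c \<in> D. fst c = i} = T' ` {c \<in> D. fst c = i}"
  shows "orb D M T = orb D M T'"
proof -
  define \<rho> where "\<rho> = restrict_id (T' \<circ> inv_into D T) (T ` D)"
  have "T ` D = (\<Union>i. T ` {c \<in> D. fst c = i})" "T' ` D = (\<Union>i. T' ` {c \<in> D. fst c = i})" by auto
  hence TD: "T ` D = T' ` D" using rows by simp
  have "bij_betw (T' \<circ> inv_into D T) (T ` D) (T' ` D)"
    using T by (intro bij_betw_trans[of _ _ D]) (auto simp: bij_betw_inv_into inj_on_imp_bij_betw)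
  hence perm: "\<rho> permutes (T ` D)" unfolding \<rho>_def by (intro permutes_restrict_id) (simp add: TD)
  have \<rho>: "\<rho> (T c) = T' c" if "c \<in> D" for c using that T by (simp add: \<rho>_def)
  have "\<rho> ` T ` {c \<in> D. fst c = i} = T' ` {c \<in> D. fst c = i}" for i
    unfolding image_image by (intro image_cong) (auto simp: \<rho>)
  hence r: "\<rho> \<in> row_stab D T" using perm rows by (simp add: row_stab_def)
  have "tab_mono D M T' = mono_act \<rho> (tab_mono D M T)"
  proof (rule tab_mono_eqI[OF M T(2)])
    show "lookup (mono_act \<rho> (tab_mono D M T)) (T' c) = M c" if "c \<in> D" for c
      using lookup_mono_act_image[OF permutes_bij[OF perm], of "tab_mono D M T" "T c"]
        lookup_tab_mono(1)[OF M T(1) that] \<rho>[OF that] by simp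
    show "keys (mono_act \<rho> (tab_mono D M T)) \<subseteq> T' ` D"
      by (auto simp: keys_mono_act permutes_bij[OF perm] keys_tab_mono[OF M T(1)] \<rho>)
  qed
  hence "tab_mono D M T' \<in> orb D M T" using r by (auto simp: orb_def)
  hence sub: "orb D M T' \<subseteq> orb D M T"
    using mono_act_orb[of _ D T M] unfolding orb_def[of D M T'] row_stab_cong_rows[OF rows, symmetric] by blast
  have "tab_mono D M T = mono_act (inv \<rho>) (tab_mono D M T')"
    using \<open>tab_mono D M T' = _\<close> permutes_bij[OF perm] by simp
  hence "tab_mono D M T \<in> orb D M T'"
    using row_stab_inv[OF r] unfolding orb_def row_stab_cong_rows[OF rows] by auto
  hence "orb D M T \<subseteq> orb D M T'"
    using mono_act_orb[of _ D T' M] unfolding orb_def[of D M T] row_stab_cong_rows[OF rows] by blast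
  with sub show ?thesis by auto
qed

text \<open>
  Values of a filling outside of the diagram do not matter.
\<close>

lemma filling_cong:
  assumes "\<And>c. c \<in> D \<Longrightarrow> T c = T' c"
  shows "tab_mono D M T = tab_mono D M T'" "row_stab D T = row_stab D T'" "col_stab D T = col_stab D T'"
proof -
  show "tab_mono D M T = tab_mono D M T'" unfolding tab_mono_def using assms by (intro sum.cong) auto
  have *: "T ` {c \<in> D. P c} = T' ` {c \<in> D. P c}" for P using assms by (intro image_cong) auto
  have "T ` D = T' ` D" using assms by (intro image_cong) auto
  thus "row_stab D T = row_stab D T'" "col_stab D T = col_stab D T'"
    unfolding row_stab_def col_stab_def by (simp_all only: *)
qed

lemma specht_poly_cong: "(\<And>c. c \<in> D \<Longrightarrow> T c = T' c) \<Longrightarrow> specht_poly D M T = specht_poly D M T'"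
  using filling_cong[of D T T'] by (simp add: specht_poly_def)

section \<open>Equivariance\<close>

lemma tab_mono_act: "bij g \<Longrightarrow> tab D M \<Longrightarrow> inj_on T D \<Longrightarrow> tab_mono D M (g \<circ> T) = mono_act g (tab_mono D M T)"
proof (rule tab_mono_eqI)
  assume *: "bij g" "tab D M" "inj_on T D"
  show "inj_on (g \<circ> T) D" using * by (meson bij_is_inj comp_inj_on inj_on_subset subset_UNIV)
  show "lookup (mono_act g (tab_mono D M T)) ((g \<circ> T) c) = M c" if "c \<in> D" for c
    using * that by (simp add: lookup_mono_act_image lookup_tab_mono)
  show "keys (mono_act g (tab_mono D M T)) \<subseteq> (g \<circ> T) ` D" using * by (auto simp: keys_mono_act keys_tab_mono)
qed

lemma conj_permutes:
  fixes g :: "'a \<Rightarrow> 'a"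
  assumes "bij g"
  shows "g \<circ> \<tau> \<circ> inv g permutes g ` A \<longleftrightarrow> \<tau> permutes A"
proof -
  have 1: "g \<circ> \<tau> \<circ> inv g permutes g ` A" if "bij g" "\<tau> permutes A" for g \<tau> and A :: "'a set"
  proof (rule bij_imp_permutes)
    have "bij_betw g A (g ` A)" by (meson bij_is_inj inj_on_imp_bij_betw inj_on_subset subset_UNIV that(1))
    moreover have "bij_betw (inv g) (g ` A) A"
      by (meson bij_betw_inv_into_subset calculation subset_UNIV that(1))
    ultimately show "bij_betw (g \<circ> \<tau> \<circ> inv g) (g ` A) (g ` A)"
      using permutes_imp_bij[OF that(2)] by (metis bij_betw_trans)
    show "(g \<circ> \<tau> \<circ> inv g) x = x" if x: "x \<notin> g ` A" for x
    proof -
      have "inv g x \<notin> A" using x \<open>bij g\<close> by (metis bij_inv_eq_iff imageI)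
      thus ?thesis using permutes_not_in[OF \<open>\<tau> permutes A\<close>] \<open>bij g\<close> by (simp add: bij_is_surj surj_f_inv_f)
    qed
  qed
  show ?thesis
  proof
    assume "g \<circ> \<tau> \<circ> inv g permutes g ` A"
    from 1[OF bij_imp_bij_inv[OF assms] this]
    have "inv g \<circ> (g \<circ> \<tau> \<circ> inv g) \<circ> inv (inv g) permutes inv g ` g ` A" .
    also have "inv g \<circ> (g \<circ> \<tau> \<circ> inv g) \<circ> inv (inv g) = \<tau>" using assms
      by (simp add: fun_eq_iff inv_inv_eq bij_is_inj)
    also have "inv g ` g ` A = A" using assms by (simp add: bij_is_inj image_inv_f_f)
    finally show "\<tau> permutes A" .
  qed (rule 1[OF assms])
qed

lemma conj_stab:
  assumes g: "bij g"
  shows "row_stab D (g \<circ> T) = (\<lambda>\<tau>. g \<circ> \<tau> \<circ> inv g) ` row_stab D T"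
    and "col_stab D (g \<circ> T) = (\<lambda>\<tau>. g \<circ> \<tau> \<circ> inv g) ` col_stab D T"
proof -
  have im: "(g \<circ> \<tau> \<circ> inv g) ` (g \<circ> T) ` A = (g \<circ> T) ` A \<longleftrightarrow> \<tau> ` T ` A = T ` A" for \<tau> A
  proof -
    have "(g \<circ> \<tau> \<circ> inv g) ` (g \<circ> T) ` A = g ` (\<tau> ` T ` A)" using g by (auto simp: image_image bij_is_inj)
    moreover have "(g \<circ> T) ` A = g ` (T ` A)" by auto
    ultimately show ?thesis using g by (simp add: inj_image_eq_iff bij_is_inj)
  qed
  have p: "g \<circ> \<tau> \<circ> inv g permutes (g \<circ> T) ` D \<longleftrightarrow> \<tau> permutes T ` D" for \<tau>
    using conj_permutes[OF g, of \<tau> "T ` D"] by (simp add: image_comp)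
  have ex: "\<sigma> = g \<circ> (inv g \<circ> \<sigma> \<circ> g) \<circ> inv g" for \<sigma> using g by (auto simp: fun_eq_iff bij_is_surj surj_f_inv_f)
  show "row_stab D (g \<circ> T) = (\<lambda>\<tau>. g \<circ> \<tau> \<circ> inv g) ` row_stab D T"
  proof (intro set_eqI iffI)
    fix \<sigma> assume "\<sigma> \<in> row_stab D (g \<circ> T)"
    hence "g \<circ> (inv g \<circ> \<sigma> \<circ> g) \<circ> inv g \<in> row_stab D (g \<circ> T)" by (simp only: ex[of \<sigma>, symmetric])
    hence "inv g \<circ> \<sigma> \<circ> g \<in> row_stab D T" by (simp only: row_stab_def mem_Collect_eq im p simp_thms)
    thus "\<sigma> \<in> (\<lambda>\<tau>. g \<circ> \<tau> \<circ> inv g) ` row_stab D T" using ex by (metis imageI)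
  next
    fix \<sigma> assume "\<sigma> \<in> (\<lambda>\<tau>. g \<circ> \<tau> \<circ> inv g) ` row_stab D T"
    then obtain \<tau> where "\<tau> \<in> row_stab D T" "\<sigma> = g \<circ> \<tau> \<circ> inv g" by blast
    thus "\<sigma> \<in> row_stab D (g \<circ> T)" by (simp only: row_stab_def im p mem_Collect_eq simp_thms)
  qed
  show "col_stab D (g \<circ> T) = (\<lambda>\<tau>. g \<circ> \<tau> \<circ> inv g) ` col_stab D T"
  proof (intro set_eqI iffI)
    fix \<sigma> assume "\<sigma> \<in> col_stab D (g \<circ> T)"
    hence "g \<circ> (inv g \<circ> \<sigma> \<circ> g) \<circ> inv g \<in> col_stab D (g \<circ> T)" by (simp only: ex[of \<sigma>, symmetric])
    hence "inv g \<circ> \<sigma> \<circ> g \<in> col_stab D T" by (simp only: col_stab_def mem_Collect_eq im p simp_thms)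
    thus "\<sigma> \<in> (\<lambda>\<tau>. g \<circ> \<tau> \<circ> inv g) ` col_stab D T" using ex by (metis imageI)
  next
    fix \<sigma> assume "\<sigma> \<in> (\<lambda>\<tau>. g \<circ> \<tau> \<circ> inv g) ` col_stab D T"
    then obtain \<tau> where "\<tau> \<in> col_stab D T" "\<sigma> = g \<circ> \<tau> \<circ> inv g" by blast
    thus "\<sigma> \<in> col_stab D (g \<circ> T)" by (simp only: col_stab_def im p mem_Collect_eq simp_thms)
  qed
qed

lemma sign_conj:
  assumes "permutation \<sigma>" "bij g"
  shows "sign (g \<circ> \<sigma> \<circ> inv g) = sign \<sigma>"
proof -
  obtain S where S: "finite S" "\<sigma> permutes S" using assms(1) by (rule permutation_permutesE)
  have i: "inj_on g S" using assms(2) by (meson bij_is_inj inj_on_subset subset_UNIV)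
  have "map_permutation S g \<sigma> = g \<circ> \<sigma> \<circ> inv g"
  proof
    fix x
    show "map_permutation S g \<sigma> x = (g \<circ> \<sigma> \<circ> inv g) x"
    proof (cases "x \<in> g ` S")
      case True
      then obtain y where "y \<in> S" "x = g y" by auto
      thus ?thesis using i assms(2) by (simp add: map_permutation_def bij_is_inj)
    next
      case False
      hence "inv g x \<notin> S" using assms(2) by (metis bij_inv_eq_iff imageI)
      thus ?thesis using False assms(2) permutes_not_in[OF S(2)] by (simp add: map_permutation_def bij_is_surj surj_f_inv_f)
    qed
  qed
  thus ?thesis using sign_map_permutation[OF i S(2,1)] by simp
qed

lemma orb_act:
  assumes g: "bij g" and M: "tab D M" and T: "inj_on T D"
  shows "orb D M (g \<circ> T) = mono_act g ` orb D M T"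
proof -
  have "mono_act (g \<circ> \<tau> \<circ> inv g) (mono_act g p) = mono_act g (mono_act \<tau> p)" if "\<tau> \<in> row_stab D T" for \<tau> p
    using g row_stab_bij[OF that] by (simp add: mono_act_comp bij_comp bij_imp_bij_inv)
  thus ?thesis
    unfolding orb_def conj_stab(1)[OF g] tab_mono_act[OF g M T] image_image by (rule image_cong[OF refl])
qed

lemma specht_poly_act:
  assumes g: "bij g" and M: "tab D M" and T: "inj_on T D"
  shows "specht_poly D M (g \<circ> T) = poly_act g (specht_poly D M T)"
proof -
  have D: "shape D" using M by (simp add: tab_def)
  note C = col_stab_group[OF D T]
  have i: "inj_on (\<lambda>\<tau>. g \<circ> \<tau> \<circ> inv g) (col_stab D T)"
    by (rule inj_on_inverseI[of _ "\<lambda>\<tau>. inv g \<circ> \<tau> \<circ> g"]) (use g in \<open>auto simp: fun_eq_iff bij_is_inj\<close>)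
  have "specht_poly D M (g \<circ> T) = (\<Sum>\<sigma>\<in>col_stab D T. qscale (of_int (sign (g \<circ> \<sigma> \<circ> inv g)))
        (poly_act (g \<circ> \<sigma> \<circ> inv g) (poly_act g (ind_poly (orb D M T)))))"
    unfolding specht_poly_eq antisymmetrize_def conj_stab(2)[OF g] orb_act[OF assms] poly_act_ind_poly[OF g, symmetric]
    by (subst sum.reindex[OF i]) simp
  also have "\<dots> = (\<Sum>\<sigma>\<in>col_stab D T. poly_act g (qscale (of_int (sign \<sigma>)) (poly_act \<sigma> (ind_poly (orb D M T)))))"
    using g by (intro sum.cong)
     (simp_all add: sign_conj fin_perm_group_perm[OF C] poly_act_scale poly_act_comp fin_perm_group_bij[OF C] bij_comp bij_imp_bij_inv)
  also have "\<dots> = poly_act g (specht_poly D M T)"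
    by (simp add: specht_poly_eq antisymmetrize_def poly_act_sum g)
  finally show ?thesis .
qed

section \<open>Dependence on the long columns only\<close>

lemma fin_part_eq_long:
  assumes "shape D" "shape D'" "fin_part D = fin_part D'"
  shows "long D = long D'"
proof -
  have 1: "c \<in> long D'" if "c \<in> long D" "shape D" "shape D'" "fin_part D = fin_part D'" for c D D'
  proof -
    obtain i j where c: "c = (i, j)" by (cases c)
    have "(1, j) \<in> fin_part D" using that(1) by (simp add: c long_def fin_part_def)
    hence 2: "(1, j) \<in> D'" unfolding that(4) by (simp add: fin_part_def)
    have "c \<in> D'"
    proof (cases "i = 0")
      case True
      thus ?thesis using ferrersD[OF _ 2, of 0 j] that(3) by (simp add: c shape_def)
    next
      case False
      hence "c \<in> fin_part D" using that(1) by (simp add: c long_def fin_part_def)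
      thus ?thesis unfolding that(4) by (simp add: fin_part_def)
    qed
    thus ?thesis using 2 by (simp add: c long_def)
  qed
  show ?thesis using 1[of _ D D'] 1[of _ D' D] assms by auto
qed

text \<open>
  If \<open>M\<close> vanishes on the first row, then the permutations of the first row of \<open>T\<close> act
  trivially on the monomials in the row orbit, and only the finite part matters.
\<close>

lemma orb_fin_part:
  assumes M: "tab D M" and T: "inj_on T D" and z: "\<And>j. M (0, j) = 0"
  shows "orb D M T = orb (fin_part D) M T"
proof -
  have sub: "fin_part D \<subseteq> D" by (auto simp: fin_part_def)
  have s: "{c \<in> D. M c \<noteq> 0} = {c \<in> fin_part D. M c \<noteq> 0}"
    using z by (auto simp: fin_part_def) (metis not_gr_zero)
  have tm: "tab_mono (fin_part D) M T = tab_mono D M T" unfolding tab_mono_def s ..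
  have k: "keys (tab_mono D M T) \<subseteq> T ` fin_part D"
    unfolding keys_tab_mono[OF M T] s by blast
  have row: "{c \<in> fin_part D. fst c = i} = (if i = 0 then {} else {c \<in> D. fst c = i})" for i
    by (auto simp: fin_part_def)
  show ?thesis
  proof (intro antisym subsetI)
    fix p assume "p \<in> orb D M T"
    then obtain \<tau> where t: "\<tau> \<in> row_stab D T" "p = mono_act \<tau> (tab_mono D M T)" by (auto simp: orb_def)
    define \<rho> where "\<rho> = restrict_id \<tau> (T ` fin_part D)"
    have "\<tau> ` T ` fin_part D = T ` fin_part D"
    proof -
      have e: "fin_part D = (\<Union>i\<in>{0<..}. {c \<in> D. fst c = i})" by (auto simp: fin_part_def)
      have "\<tau> ` T ` {c \<in> D. fst c = i} = T ` {c \<in> D. fst c = i}" for i using t by (simp add: row_stab_def)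
      thus ?thesis by (simp only: e image_UN)
    qed
    hence "bij_betw \<tau> (T ` fin_part D) (T ` fin_part D)"
      unfolding bij_betw_def using inj_on_subset[OF bij_is_inj[OF row_stab_bij[OF t(1)]] subset_UNIV] by blast
    hence p1: "\<rho> permutes T ` fin_part D" unfolding \<rho>_def by (rule permutes_restrict_id)
    have "\<rho> ` T ` {c \<in> fin_part D. fst c = i} = T ` {c \<in> fin_part D. fst c = i}" for i
    proof -
      have "\<rho> ` T ` {c \<in> fin_part D. fst c = i} = \<tau> ` T ` {c \<in> fin_part D. fst c = i}"
        by (intro image_cong) (auto simp: \<rho>_def)
      also have "\<dots> = T ` {c \<in> fin_part D. fst c = i}" using t by (simp add: row row_stab_def)
      finally show ?thesis .
    qed
    hence "\<rho> \<in> row_stab (fin_part D) T" using p1 by (simp add: row_stab_def)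
    moreover have "p = mono_act \<rho> (tab_mono D M T)" unfolding t(2)
    proof (rule mono_act_cong[OF row_stab_bij[OF t(1)] permutes_bij[OF p1]])
      show "\<tau> x = \<rho> x" if "x \<in> keys (tab_mono D M T)" for x
        using subsetD[OF k that] by (simp add: \<rho>_def)
    qed
    ultimately show "p \<in> orb (fin_part D) M T" by (auto simp: orb_def tm)
  next
    fix p assume "p \<in> orb (fin_part D) M T"
    then obtain \<tau> where t: "\<tau> \<in> row_stab (fin_part D) T" "p = mono_act \<tau> (tab_mono D M T)" by (auto simp: orb_def tm)
    hence tp: "\<tau> permutes T ` fin_part D" by (simp add: row_stab_def)
    have "\<tau> ` T ` {c \<in> D. fst c = i} = T ` {c \<in> D. fst c = i}" for i
    proof (cases "i = 0")
      case True
      have "\<tau> x = x" if x: "x \<in> T ` {c \<in> D. fst c = 0}" for x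
      proof (rule permutes_not_in[OF tp])
        obtain c where c: "x = T c" "c \<in> D" "fst c = 0" using x by blast
        have n: "c \<notin> fin_part D" using c(3) by (simp add: fin_part_def)
        show "x \<notin> T ` fin_part D" unfolding c(1) inj_on_image_mem_iff[OF T c(2) sub] by (rule n)
      qed
      hence "\<tau> ` T ` {c \<in> D. fst c = 0} = (\<lambda>x. x) ` T ` {c \<in> D. fst c = 0}"
        by (rule image_cong[OF refl])
      thus ?thesis by (simp only: True image_ident)
    next
      case False
      have "\<tau> ` T ` {c \<in> fin_part D. fst c = i} = T ` {c \<in> fin_part D. fst c = i}"
        using t(1) by (simp only: row_stab_def mem_Collect_eq)
      thus ?thesis using False by (simp only: row if_False)
    qed
    moreover have "\<tau> permutes T ` D" by (rule permutes_subset[OF tp]) (rule image_mono[OF sub])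
    ultimately have "\<tau> \<in> row_stab D T" by (simp only: row_stab_def mem_Collect_eq simp_thms)
    thus "p \<in> orb D M T" using t(2) by (auto simp: orb_def)
  qed
qed

text \<open>
  If \<open>M\<close> vanishes on the first row, then \<open>F\<^bsub>M,T\<^esub>\<close> depends only on the finite part of the shape
  and on the entries of \<open>T\<close> in the columns of length at least 2. This compares infinite shapes
  with large finite ones.
\<close>

lemma specht_poly_long:
  assumes M: "tab D M" "tab D' M" and T: "inj_on T D" "inj_on T' D'" and z: "\<And>j. M (0, j) = 0"
    and D: "fin_part D = fin_part D'" and TT': "\<And>c. c \<in> long D \<Longrightarrow> T c = T' c"
  shows "specht_poly D M T = specht_poly D' M T'"
proof -
  have sh: "shape D" "shape D'" using M by (auto simp: tab_def)
  have l: "long D = long D'" using fin_part_eq_long[OF sh D] .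
  have i: "T ` long D = T' ` long D'" unfolding l[symmetric] using TT' by (rule image_cong[OF refl])
  have C: "col_stab D T = col_stab D' T'"
  proof (rule set_eqI)
    fix \<sigma>
    show "\<sigma> \<in> col_stab D T \<longleftrightarrow> \<sigma> \<in> col_stab D' T'"
      unfolding col_stab_iff[OF sh(1) T(1)] col_stab_iff[OF sh(2) T(2)] i l[symmetric] using TT' by auto
  qed
  have f: "T c = T' c" if "c \<in> fin_part D" for c using fin_part_long[OF sh(1) that] TT' by auto
  have "orb D M T = orb (fin_part D) M T" by (rule orb_fin_part[OF M(1) T(1) z])
  also have "\<dots> = orb (fin_part D) M T'"
  proof -
    have 1: "tab_mono (fin_part D) M T = tab_mono (fin_part D) M T'" by (rule filling_cong(1)) (rule f)
    have 2: "row_stab (fin_part D) T = row_stab (fin_part D) T'" by (rule filling_cong(2)) (rule f)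
    show ?thesis unfolding orb_def 1 2 ..
  qed
  also have "\<dots> = orb D' M T'" unfolding D by (rule orb_fin_part[OF M(2) T(2) z, symmetric])
  finally have "orb D M T = orb D' M T'" .
  thus ?thesis unfolding specht_poly_eq C by simp
qed

section \<open>Comparing sums over sets of equal size\<close>

text \<open>
  If the values at the elements of \<open>A\<close> outside of \<open>B\<close> are at least those at the elements of
  \<open>B\<close> outside of \<open>A\<close>, then exchanging these elements along a bijection compares the sums.
\<close>

lemma sum_exchange:
  fixes f :: "'a \<Rightarrow> nat"
  assumes "finite A" "finite B" "card A = card B"
    and "\<And>a b. a \<in> A - B \<Longrightarrow> b \<in> B - A \<Longrightarrow> f b \<le> f a"
  shows "sum f B \<le> sum f A"
    and "A \<noteq> B \<Longrightarrow> (\<And>a b. a \<in> A - B \<Longrightarrow> b \<in> B - A \<Longrightarrow> f b < f a) \<Longrightarrow> sum f B < sum f A"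
proof -
  have "card (A - B) = card (B - A)"
    using assms(1-3) by (metis Int_commute add_left_cancel card_Diff_subset_Int card_Int_Diff finite_Int)
  then obtain h where h: "bij_betw h (A - B) (B - A)"
    using assms finite_same_card_bij by (metis finite_Diff)
  have A: "sum f A = sum f (A \<inter> B) + sum f (A - B)"
    using assms sum.Int_Diff by metis
  have B: "sum f B = sum f (A \<inter> B) + (\<Sum>a\<in>A - B. f (h a))"
    using assms sum.Int_Diff[of B f A] sum.reindex_bij_betw[OF h, of f] by (simp add: Int_commute)
  have hB: "h a \<in> B - A" if "a \<in> A - B" for a using h that by (auto simp: bij_betw_def)
  show "sum f B \<le> sum f A" unfolding A B by (intro add_left_mono sum_mono assms(4) hB)
  show "sum f B < sum f A" if "A \<noteq> B" "\<And>a b. a \<in> A - B \<Longrightarrow> b \<in> B - A \<Longrightarrow> f b < f a"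
  proof -
    have "A - B \<noteq> {}" using that(1) assms by (metis Diff_eq_empty_iff card_subset_eq)
    thus ?thesis unfolding A B using that(2) hB assms by (intro add_strict_left_mono sum_strict_mono) auto
  qed
qed

lemma sum_initial_segment:
  fixes A :: "nat set"
  assumes "finite A"
  shows "\<Sum>{..<card A} \<le> \<Sum>A" and "\<Sum>A = \<Sum>{..<card A} \<Longrightarrow> A = {..<card A}"
proof -
  have *: "b < a" if "a \<in> A - {..<card A}" "b \<in> {..<card A} - A" for a b using that by auto
  show "\<Sum>{..<card A} \<le> \<Sum>A"
    using sum_exchange(1)[of A "{..<card A}" "\<lambda>x. x"] assms * by (simp add: less_imp_le)
  show "A = {..<card A}" if "\<Sum>A = \<Sum>{..<card A}"
    using sum_exchange(2)[of A "{..<card A}" "\<lambda>x. x"] assms * that by (metis card_lessThan finite_lessThan less_imp_le less_irrefl_nat)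
qed

lemma downward_closed_initial_segment:
  fixes S :: "nat set"
  assumes "finite S" "\<And>i i'. i \<in> S \<Longrightarrow> i' \<le> i \<Longrightarrow> i' \<in> S"
  shows "S = {..<card S}"
proof -
  have "\<exists>k. k \<notin> S" using assms(1) by (metis ex_new_if_finite infinite_UNIV_nat)
  define k where "k = (LEAST k. k \<notin> S)"
  have "k \<notin> S" "\<And>j. j < k \<Longrightarrow> j \<in> S"
    using LeastI_ex[OF \<open>\<exists>k. k \<notin> S\<close>] not_less_Least by (auto simp: k_def)
  hence "S = {..<k}" using assms(2) by (auto simp: not_le[symmetric])
  thus ?thesis by simp
qed

section \<open>Column and row lengths\<close>

text \<open>
  The lengths of columns and rows. An infinite row has length \<open>0\<close> by the convention for
  cardinalities.
\<close>

definition collen :: "diagram \<Rightarrow> nat \<Rightarrow> nat" where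
  "collen D j = card {c \<in> D. snd c = j}"

definition rowlen :: "diagram \<Rightarrow> nat \<Rightarrow> nat" where
  "rowlen D i = card {c \<in> D. fst c = i}"

lemma collen_iff:
  assumes "shape D"
  shows "(i, j) \<in> D \<longleftrightarrow> i < collen D j"
proof -
  have e: "{i. (i, j) \<in> D} = fst ` {c \<in> D. snd c = j}" by (force simp: image_iff)
  have i: "inj_on fst {c \<in> D. snd c = j}" by (auto simp: inj_on_def)
  have "{i. (i, j) \<in> D} = {..<card {i. (i, j) \<in> D}}"
  proof (rule downward_closed_initial_segment)
    show "finite {i. (i, j) \<in> D}" unfolding e using finite_column[OF assms] by auto
  qed (use assms in \<open>auto simp: shape_def dest: ferrersD\<close>)
  also have "card {i. (i, j) \<in> D} = collen D j" unfolding e collen_def using card_image[OF i] .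
  finally show ?thesis by auto
qed

lemma rowlen_iff:
  assumes "ferrers D" "finite {c \<in> D. fst c = i}"
  shows "(i, j) \<in> D \<longleftrightarrow> j < rowlen D i"
proof -
  have e: "{j. (i, j) \<in> D} = snd ` {c \<in> D. fst c = i}" by (force simp: image_iff)
  have i: "inj_on snd {c \<in> D. fst c = i}" by (auto simp: inj_on_def)
  have "{j. (i, j) \<in> D} = {..<card {j. (i, j) \<in> D}}"
  proof (rule downward_closed_initial_segment)
    show "finite {j. (i, j) \<in> D}" unfolding e using assms by auto
  qed (use assms in \<open>auto dest: ferrersD\<close>)
  also have "card {j. (i, j) \<in> D} = rowlen D i" unfolding e rowlen_def using card_image[OF i] .
  finally show ?thesis by auto
qed

lemma partition_infty_shape: "partition_infty D \<Longrightarrow> shape D"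
  by (simp add: partition_infty_def shape_def)

lemma partition_infty_eqI:
  assumes D: "partition_infty D" "partition_infty D'"
    and r: "\<And>i. i > 0 \<Longrightarrow> rowlen D i = rowlen D' i"
  shows "D = D'"
proof (rule set_eqI)
  fix c :: box
  obtain i j where c: "c = (i, j)" by (cases c)
  have f: "finite {c \<in> D. fst c = i}" if "partition_infty D" "i > 0" for D
  proof (rule finite_subset)
    show "{c \<in> D. fst c = i} \<subseteq> fin_part D" using that by (auto simp: fin_part_def)
  qed (use that in \<open>simp add: partition_infty_def\<close>)
  show "c \<in> D \<longleftrightarrow> c \<in> D'"
  proof (cases "i = 0")
    case False
    thus ?thesis using rowlen_iff[of D i j] rowlen_iff[of D' i j] f[of D] f[of D'] D r[of i]
      by (simp add: c partition_infty_def)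
  qed (use D in \<open>simp add: c partition_infty_def\<close>)
qed

section \<open>Column antisymmetrisers acting on row orbits\<close>

text \<open>
  The statistic \<open>n(D) = \<Sum>\<^sub>i i \<lambda>\<^sub>i\<close>, where the rows are counted from 0; the first row contributes
  nothing.
\<close>

definition nval :: "diagram \<Rightarrow> nat" where
  "nval D = (\<Sum>c\<in>fin_part D. fst c)"

lemma nval_long: "shape D \<Longrightarrow> nval D = (\<Sum>c\<in>long D. fst c)"
  unfolding nval_def
  by (rule sum.mono_neutral_left) (auto simp: finite_long fin_part_long, auto simp: fin_part_def long_def)

text \<open>
  Suppose that no two entries of one column of \<open>T\<close> lie in the same row of \<open>T'\<close>. Sum, over the
  entries \<open>x\<close> of the columns of length at least 2 of \<open>T\<close>, the row number \<open>r x\<close> of \<open>x\<close> in \<open>T'\<close>.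
  In each column of \<open>T\<close> the row numbers are distinct, so the sum is at least \<open>n(D)\<close>; and the
  sum of all row numbers in \<open>T'\<close> is \<open>n(D')\<close>. Since \<open>n(D') \<le> n(D)\<close>, equality holds throughout:
  the row numbers in each column of \<open>T\<close> are \<open>0, 1, 2, \<dots>\<close> in some order, so an element of the
  column stabilizer moves each entry into its row.
\<close>

lemma row_transversal_columns:
  assumes D: "partition_infty D" "partition_infty D'"
    and T: "bij_betw T D {1..}" "bij_betw T' D' {1..}"
    and n: "nval D' \<le> nval D"
    and inj: "\<And>c c' e e'. c \<in> D \<Longrightarrow> c' \<in> D \<Longrightarrow> snd c = snd c' \<Longrightarrow> c \<noteq> c' \<Longrightarrow>
                e \<in> D' \<Longrightarrow> e' \<in> D' \<Longrightarrow> T' e = T c \<Longrightarrow> T' e' = T c' \<Longrightarrow> fst e \<noteq> fst e'"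
  shows "D = D' \<and> (\<exists>\<sigma>\<in>col_stab D T. \<forall>i. T' ` {c \<in> D. fst c = i} = (\<sigma> \<circ> T) ` {c \<in> D. fst c = i})"
proof -
  note sh = partition_infty_shape[OF D(1)] partition_infty_shape[OF D(2)]
  have iT: "inj_on T D" "inj_on T' D'" using T by (auto simp: bij_betw_def)
  have fl: "finite (long D)" using finite_long[OF sh(1)] .
  define r where "r x = fst (inv_into D' T' x)" for x
  have r: "r (T' c) = fst c" if "c \<in> D'" for c using that iT by (simp add: r_def)
  have onto: "\<exists>e\<in>D'. T' e = T c" if "c \<in> D" for c
  proof -
    have "T c \<in> T' ` D'" using T that by (auto simp: bij_betw_def)
    thus ?thesis by auto
  qed
  have rinj: "r (T c) \<noteq> r (T c')" if "c \<in> D" "c' \<in> D" "snd c = snd c'" "c \<noteq> c'" for c c'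
    using onto[OF that(1)] onto[OF that(2)] inj[OF that] r by metis
  define Cj where "Cj j = {c \<in> long D. snd c = j}" for j
  have fC: "finite (Cj j)" for j using fl by (auto simp: Cj_def)
  have iC: "inj_on (\<lambda>c. r (T c)) (Cj j)" for j
  proof (rule inj_onI, rule ccontr)
    fix c c' assume a: "c \<in> Cj j" "c' \<in> Cj j" "r (T c) = r (T c')" "c \<noteq> c'"
    have "c \<in> D" "c' \<in> D" using a(1,2) by (simp_all add: Cj_def long_def)
    thus False using rinj[of c c'] a by (simp add: Cj_def)
  qed
  have iC2: "inj_on fst (Cj j)" for j
    by (auto simp: Cj_def inj_on_def)
  have Cfst: "fst ` Cj j = {..<card (Cj j)}" for j
  proof -
    have "fst ` Cj j = {..<card (fst ` Cj j)}"
    proof (rule downward_closed_initial_segment)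
      show "finite (fst ` Cj j)" using fC by auto
      fix i i' assume "i \<in> fst ` Cj j" "i' \<le> i"
      then obtain i1 where "(i1, j) \<in> D" "(1, j) \<in> D" "i' \<le> i1" by (auto simp: Cj_def long_def)
      hence "(i', j) \<in> Cj j" using sh(1) ferrersD[of D i1 j i' j] by (simp add: Cj_def long_def shape_def)
      thus "i' \<in> fst ` Cj j" by force
    qed
    thus ?thesis using card_image[OF iC2] by metis
  qed
  have sums: "(\<Sum>c\<in>Cj j. fst c) = \<Sum>{..<card (Cj j)}" "(\<Sum>c\<in>Cj j. r (T c)) = \<Sum>((\<lambda>c. r (T c)) ` Cj j)" for j
    using sum.reindex[OF iC2[of j], of "\<lambda>x. x"] sum.reindex[OF iC[of j], of "\<lambda>x. x"] Cfst[of j] by simp_all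
  have cards: "card ((\<lambda>c. r (T c)) ` Cj j) = card (Cj j)" for j using card_image[OF iC] .
  \<comment> \<open>The lower bound: distinct row numbers have at least the sum of \<open>0, 1, 2, \<dots>\<close>\<close>
  have colle: "(\<Sum>c\<in>Cj j. fst c) \<le> (\<Sum>c\<in>Cj j. r (T c))" for j
    unfolding sums using sum_initial_segment(1)[of "(\<lambda>c. r (T c)) ` Cj j"] fC cards[of j] by simp
  have group: "(\<Sum>j\<in>snd ` long D. \<Sum>c\<in>Cj j. h c) = (\<Sum>c\<in>long D. h c)" for h :: "box \<Rightarrow> nat"
    unfolding Cj_def using fl by (intro sum.group) auto
  let ?L = "T ` long D" and ?F = "T' ` fin_part D'"
  have iL: "inj_on T (long D)" using iT(1) long_subset by (rule inj_on_subset)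
  have iF: "inj_on T' (fin_part D')" using iT(2) by (rule inj_on_subset) (auto simp: fin_part_def)
  have fF: "finite ?F" using sh(2) by (auto simp: shape_def)
  have rF: "r x = 0" if "x \<in> {1..}" "x \<notin> ?F" for x
  proof -
    have "x \<in> T' ` D'" using that(1) bij_betw_imp_surj_on[OF T(2)] by simp
    then obtain e where e: "e \<in> D'" "x = T' e" by auto
    hence "e \<notin> fin_part D'" using that(2) by blast
    thus ?thesis using e r[OF e(1)] by (simp add: fin_part_def)
  qed
  have rF': "r x > 0" if "x \<in> ?F" for x using that r by (auto simp: fin_part_def)
  have L1: "?L \<subseteq> {1..}" using T(1) long_subset[of D] by (auto simp: bij_betw_def)
  have sL: "(\<Sum>c\<in>long D. r (T c)) = sum r ?L" using sum.reindex[OF iL, of r] by simp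
  have sF: "sum r ?F = nval D'" using sum.reindex[OF iF, of r] r by (simp add: nval_def fin_part_def)
  have sLF: "sum r ?L = sum r (?L \<inter> ?F)"
  proof (rule sum.mono_neutral_right)
    show "\<forall>x\<in>?L - ?L \<inter> ?F. r x = 0"
    proof
      fix x assume "x \<in> ?L - ?L \<inter> ?F"
      hence "x \<in> {1..}" "x \<notin> ?F" using L1 by (simp_all add: subset_iff)
      thus "r x = 0" by (rule rF)
    qed
  qed (use fl in auto)
  have c1: "nval D \<le> sum r ?L" unfolding sL[symmetric] nval_long[OF sh(1)] group[symmetric] by (intro sum_mono colle)
  have c2: "sum r (?L \<inter> ?F) \<le> sum r ?F" by (rule sum_mono2) (use fF in auto)
  have eq: "sum r (?L \<inter> ?F) = sum r ?F" "nval D = sum r ?L" using c1 c2 sLF sF n by linarith+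
  \<comment> \<open>By equality, all entries with a positive row number in \<open>T'\<close> are among those of the long
    columns of \<open>T\<close>.\<close>
  have FL: "?F \<subseteq> ?L"
  proof (rule ccontr)
    assume "\<not> ?F \<subseteq> ?L"
    hence "?L \<inter> ?F \<subset> ?F" by auto
    hence "sum r (?L \<inter> ?F) < sum r ?F"
    proof -
      obtain x where x: "x \<in> ?F" "x \<notin> ?L" using \<open>\<not> ?F \<subseteq> ?L\<close> by auto
      show ?thesis by (rule sum_strict_mono2[of ?F "?L \<inter> ?F" x r, OF fF _ _ rF'[OF x(1)]]) (use x in auto)
    qed
    thus False using eq by simp
  qed
  have colimg: "(\<lambda>c. r (T c)) ` Cj j = fst ` Cj j" if j: "j \<in> snd ` long D" for j
  proof -
    have "(\<Sum>j\<in>snd ` long D. \<Sum>c\<in>Cj j. fst c) = (\<Sum>j\<in>snd ` long D. \<Sum>c\<in>Cj j. r (T c))"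
      unfolding group using eq(2) nval_long[OF sh(1)] sL by simp
    from sum_mono_inv[OF this _ j] have "(\<Sum>c\<in>Cj j. fst c) = (\<Sum>c\<in>Cj j. r (T c))" using fl colle by auto
    hence "\<Sum>((\<lambda>c. r (T c)) ` Cj j) = \<Sum>{..<card ((\<lambda>c. r (T c)) ` Cj j)}" using sums cards by simp
    from sum_initial_segment(2)[OF _ this] fC cards Cfst show ?thesis by auto
  qed
  \<comment> \<open>The box in the column of \<open>c\<close> whose entry lies, in \<open>T'\<close>, in the row of \<open>c\<close>\<close>
  define h where "h c = inv_into (Cj (snd c)) (\<lambda>c. r (T c)) (fst c)" for c
  have h: "h c \<in> long D" "snd (h c) = snd c" "r (T (h c)) = fst c" if "c \<in> long D" for c
  proof -
    have "c \<in> Cj (snd c)" using that by (simp add: Cj_def)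
    hence "fst c \<in> (\<lambda>c. r (T c)) ` Cj (snd c)" using colimg[of "snd c"] that by auto
    from inv_into_into[OF this] f_inv_into_f[OF this]
    show "h c \<in> long D" "snd (h c) = snd c" "r (T (h c)) = fst c" by (auto simp: h_def Cj_def)
  qed
  define \<sigma> where "\<sigma> = restrict_id (T \<circ> h \<circ> inv_into (long D) T) ?L"
  have \<sigma>: "\<sigma> (T c) = T (h c)" if "c \<in> long D" for c using that iL by (simp add: \<sigma>_def)
  have hinj: "inj_on h (long D)"
    by (rule inj_onI) (metis h(2,3) prod_eqI)
  have perm: "\<sigma> permutes ?L"
  proof (rule inj_imp_permutes)
    show "inj_on \<sigma> ?L"
    proof (rule inj_onI, clarsimp)
      fix a b a' b' assume a: "(a, b) \<in> long D" "(a', b') \<in> long D" "\<sigma> (T (a, b)) = \<sigma> (T (a', b'))"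
      hence "T (h (a, b)) = T (h (a', b'))" using \<sigma> by metis
      hence "h (a, b) = h (a', b')" using inj_onD[OF iL] h(1) a(1,2) by metis
      thus "T (a, b) = T (a', b')" using inj_onD[OF hinj] a(1,2) by metis
    qed
  qed (use fl h(1) \<sigma> in \<open>auto simp: \<sigma>_def restrict_id_def\<close>)
  have col: "\<sigma> \<in> col_stab D T"
    unfolding col_stab_iff[OF sh(1) iT(1)] using perm h(1,2) \<sigma> by metis
  have r\<sigma>: "r (\<sigma> (T c)) = fst c" if "c \<in> D" for c
  proof (cases "c \<in> long D")
    case True thus ?thesis using \<sigma> h by simp
  next
    case False
    hence notL: "T c \<notin> ?L" using iT that long_subset by (auto simp: inj_on_image_mem_iff)
    have "fst c = 0" using False that fin_part_long[OF sh(1), of c] by (auto simp: fin_part_def)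
    moreover have "\<sigma> (T c) = T c" using notL by (simp add: \<sigma>_def)
    moreover have "r (T c) = 0" using rF[OF bij_betw_apply[OF T(1) that]] notL FL by blast
    ultimately show ?thesis by simp
  qed
  have p1: "\<sigma> permutes {1..}" using permutes_subset[OF perm L1] .
  have im: "(\<sigma> \<circ> T) ` {c \<in> D. fst c = i} = {x \<in> {1..}. r x = i}" for i
  proof (intro equalityI subsetI)
    fix x assume "x \<in> (\<sigma> \<circ> T) ` {c \<in> D. fst c = i}"
    then obtain c where "c \<in> D" "fst c = i" "x = \<sigma> (T c)" by auto
    moreover have "T c \<in> {1..}" using T(1) \<open>c \<in> D\<close> by (auto simp: bij_betw_def)
    ultimately show "x \<in> {x \<in> {1..}. r x = i}" using r\<sigma> permutes_in_image[OF p1] by auto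
  next
    fix x assume x: "x \<in> {x \<in> {1..}. r x = i}"
    hence "x \<in> \<sigma> ` T ` D" using T(1) permutes_image[OF p1] by (simp add: bij_betw_def)
    then obtain c where "c \<in> D" "x = \<sigma> (T c)" by auto
    thus "x \<in> (\<sigma> \<circ> T) ` {c \<in> D. fst c = i}" using r\<sigma> x by auto
  qed
  have im': "T' ` {c \<in> D'. fst c = i} = {x \<in> {1..}. r x = i}" for i
  proof (intro equalityI subsetI)
    fix x assume "x \<in> T' ` {c \<in> D'. fst c = i}"
    then obtain c where c: "c \<in> D'" "fst c = i" "x = T' c" by blast
    have "T' c \<in> {1..}" by (rule bij_betw_apply[OF T(2) c(1)])
    thus "x \<in> {x \<in> {1..}. r x = i}" using r c by simp
  next
    fix x assume x: "x \<in> {x \<in> {1..}. r x = i}"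
    hence "x \<in> T' ` D'" using T(2) by (simp add: bij_betw_def)
    thus "x \<in> T' ` {c \<in> D'. fst c = i}" using r x by auto
  qed
  have "rowlen D i = rowlen D' i" for i
  proof -
    have "inj_on (\<sigma> \<circ> T) {c \<in> D. fst c = i}"
      by (rule comp_inj_on[OF inj_on_subset[OF iT(1)] permutes_inj_on[OF perm]]) auto
    hence "card ((\<sigma> \<circ> T) ` {c \<in> D. fst c = i}) = rowlen D i" unfolding rowlen_def by (rule card_image)
    moreover have "card (T' ` {c \<in> D'. fst c = i}) = rowlen D' i"
      unfolding rowlen_def by (rule card_image) (rule inj_on_subset[OF iT(2)], auto)
    ultimately show ?thesis using im im' by simp
  qed
  hence "D = D'" using partition_infty_eqI[OF D] by auto
  thus ?thesis using im im' col by auto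
qed

text \<open>
  If two entries of one column of \<open>T\<close> lie in the same row of \<open>T'\<close>, then their transposition
  fixes the row orbit and the antisymmetriser annihilates its sum. Otherwise \<open>T'\<close> has the rows
  of \<open>\<sigma> \<circ> T\<close> for some \<open>\<sigma>\<close> in the column stabilizer.
\<close>

lemma kappa_orb:
  assumes D: "partition_infty D" "partition_infty D'"
    and T: "bij_betw T D {1..}" "bij_betw T' D' {1..}"
    and n: "nval D' \<le> nval D" and M: "tab D' M"
  shows "\<exists>s. antisymmetrize (col_stab D T) (ind_poly (orb D' M T')) = qscale s (specht_poly D M T) \<and> (D \<noteq> D' \<longrightarrow> s = 0)"
proof (cases "\<exists>c\<in>D. \<exists>c'\<in>D. \<exists>e\<in>D'. \<exists>e'\<in>D'. snd c = snd c' \<and> c \<noteq> c' \<and> T' e = T c \<and> T' e' = T c' \<and> fst e = fst e'")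
  case True
  have iT: "inj_on T D" "inj_on T' D'" using T by (auto simp: bij_betw_def)
  obtain c c' e e' where c: "c \<in> D" "c' \<in> D" "e \<in> D'" "e' \<in> D'" "snd c = snd c'" "c \<noteq> c'"
    "T' e = T c" "T' e' = T c'" "fst e = fst e'" using True by blast
  have 1: "transpose (T c) (T c') \<in> col_stab D T" using transpose_col_stab[OF c(1,2,5) iT(1)] .
  have 2: "transpose (T c) (T c') \<in> row_stab D' T'" using transpose_row_stab[OF c(3,4,9) iT(2)] c by simp
  have "antisymmetrize (col_stab D T) (ind_poly (orb D' M T')) = 0"
  proof (rule antisymmetrize_eq_0[OF col_stab_group[OF partition_infty_shape[OF D(1)] iT(1)] 1])
    show "T c \<noteq> T c'" using c iT by (auto dest: inj_onD)
    show "poly_act (transpose (T c) (T c')) (ind_poly (orb D' M T')) = ind_poly (orb D' M T')"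
      by (simp add: poly_act_ind_poly mono_act_orb[OF 2])
  qed
  thus ?thesis by (intro exI[of _ 0]) simp
next
  case False
  have iT: "inj_on T D" "inj_on T' D'" using T by (auto simp: bij_betw_def)
  have "D = D' \<and> (\<exists>\<sigma>\<in>col_stab D T. \<forall>i. T' ` {c \<in> D. fst c = i} = (\<sigma> \<circ> T) ` {c \<in> D. fst c = i})"
    by (rule row_transversal_columns[OF D T n]) (use False in blast)
  then obtain \<sigma> where \<sigma>: "D = D'" "\<sigma> \<in> col_stab D T"
    "\<And>i. T' ` {c \<in> D. fst c = i} = (\<sigma> \<circ> T) ` {c \<in> D. fst c = i}" by blast
  note C = col_stab_group[OF partition_infty_shape[OF D(1)] iT(1)]
  have b: "bij \<sigma>" using col_stab_bij[OF \<sigma>(2)] .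
  have M': "tab D M" using M \<sigma>(1) by simp
  have "inj_on (\<sigma> \<circ> T) D" using iT(1) b by (meson bij_is_inj comp_inj_on inj_on_subset subset_UNIV)
  hence "orb D M T' = orb D M (\<sigma> \<circ> T)" using iT \<sigma> by (intro orb_cong_rows[OF M']) auto
  also have "\<dots> = mono_act \<sigma> ` orb D M T" by (rule orb_act[OF b M' iT(1)])
  finally have "antisymmetrize (col_stab D T) (ind_poly (orb D' M T')) = antisymmetrize (col_stab D T) (poly_act \<sigma> (ind_poly (orb D M T)))"
    by (simp add: \<sigma>(1)[symmetric] poly_act_ind_poly[OF b])
  also have "\<dots> = qscale (of_int (sign \<sigma>)) (specht_poly D M T)"
    by (simp add: antisymmetrize_poly_act[OF C \<sigma>(2)] specht_poly_eq)
  finally show ?thesis using \<sigma>(1) by blast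
qed

lemma kappa_specht:
  assumes D: "partition_infty D" "partition_infty D'"
    and T: "bij_betw T D {1..}" "bij_betw T' D' {1..}"
    and n: "nval D' \<le> nval D" and M: "tab D' M"
  shows "\<exists>s. antisymmetrize (col_stab D T) (specht_poly D' M T') = qscale s (specht_poly D M T) \<and> (D \<noteq> D' \<longrightarrow> s = 0)"
proof -
  have iT: "inj_on T D" "inj_on T' D'" using T by (auto simp: bij_betw_def)
  note C = col_stab_group[OF partition_infty_shape[OF D(1)] iT(1)]
  have "\<exists>s. antisymmetrize (col_stab D T) (ind_poly (orb D' M (\<tau> \<circ> T'))) = qscale s (specht_poly D M T) \<and> (D \<noteq> D' \<longrightarrow> s = 0)"
    if t: "\<tau> \<in> col_stab D' T'" for \<tau>
  proof (rule kappa_orb[OF D T(1) _ n M])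
    have "\<tau> permutes {1..}" using t T(2) by (simp add: col_stab_def bij_betw_def)
    thus "bij_betw (\<tau> \<circ> T') D' {1..}" using T(2) permutes_imp_bij by (metis bij_betw_trans)
  qed
  then obtain s where s: "\<And>\<tau>. \<tau> \<in> col_stab D' T' \<Longrightarrow>
      antisymmetrize (col_stab D T) (ind_poly (orb D' M (\<tau> \<circ> T'))) = qscale (s \<tau>) (specht_poly D M T) \<and> (D \<noteq> D' \<longrightarrow> s \<tau> = 0)"
    by metis
  have "specht_poly D' M T' = (\<Sum>\<tau>\<in>col_stab D' T'. qscale (of_int (sign \<tau>)) (ind_poly (orb D' M (\<tau> \<circ> T'))))"
    unfolding specht_poly_eq antisymmetrize_def
    by (intro sum.cong refl) (simp add: poly_act_ind_poly[OF col_stab_bij] orb_act[OF col_stab_bij M iT(2)])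
  hence "antisymmetrize (col_stab D T) (specht_poly D' M T')
     = (\<Sum>\<tau>\<in>col_stab D' T'. qscale (of_int (sign \<tau>)) (antisymmetrize (col_stab D T) (ind_poly (orb D' M (\<tau> \<circ> T')))))"
    by (simp add: module_hom.sum[OF antisymmetrize_hom[OF C]] module_hom.scale[OF antisymmetrize_hom[OF C]])
  also have "\<dots> = (\<Sum>\<tau>\<in>col_stab D' T'. qscale (of_int (sign \<tau>) * s \<tau>) (specht_poly D M T))"
    using s by (intro sum.cong) simp_all
  also have "\<dots> = qscale (\<Sum>\<tau>\<in>col_stab D' T'. of_int (sign \<tau>) * s \<tau>) (specht_poly D M T)"
    by (simp add: qvs.scale_sum_left)
  finally show ?thesis using s by (intro exI[of _ "\<Sum>\<tau>\<in>col_stab D' T'. of_int (sign \<tau>) * s \<tau>"]) (auto intro!: sum.neutral)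
qed

text \<open>
  The column antisymmetriser of \<open>T\<close> maps the whole representation spanned by the \<open>F\<^bsub>M,T'\<^esub>\<close> into
  the multiples of \<open>F\<^bsub>M,T\<^esub>\<close>, or to \<open>0\<close> if the shapes differ, provided that \<open>n(D') \<le> n(D)\<close>.
\<close>

lemma kappa_span:
  assumes D: "partition_infty D" "partition_infty D'"
    and T: "bij_betw T D {1..}"
    and n: "nval D' \<le> nval D" and M: "tab D' M"
    and F: "F \<in> qvs.span {specht_poly D' M T' | T'. bij_betw T' D' {1..}}"
  shows "\<exists>s. antisymmetrize (col_stab D T) F = qscale s (specht_poly D M T) \<and> (D \<noteq> D' \<longrightarrow> s = 0)"
proof -
  have iT: "inj_on T D" using T by (auto simp: bij_betw_def)
  note C = col_stab_group[OF partition_infty_shape[OF D(1)] iT(1)]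
  note h = antisymmetrize_hom[OF C]
  show ?thesis using F
  proof (induction rule: qvs.span_induct_alt)
    case base
    show ?case by (intro exI[of _ 0]) (simp add: C)
  next
    case (step c x y)
    obtain T' where x: "x = specht_poly D' M T'" "bij_betw T' D' {1..}" using step by auto
    obtain s where s: "antisymmetrize (col_stab D T) x = qscale s (specht_poly D M T)" "D \<noteq> D' \<longrightarrow> s = 0"
      using kappa_specht[OF D T x(2) n M] x(1) by auto
    obtain s' where s': "antisymmetrize (col_stab D T) y = qscale s' (specht_poly D M T)" "D \<noteq> D' \<longrightarrow> s' = 0"
      using step by auto
    show ?case
      using s s' by (intro exI[of _ "c * s + s'"]) (simp add: module_hom.add[OF h] module_hom.scale[OF h] qvs.scale_left_distrib)
  qed
qed

section \<open>Rearrangements of rows and columns\<close>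

text \<open>
  Summation by parts: \<open>j\<close> is the number of \<open>k\<close> with \<open>1 \<le> k \<le> j\<close>.
\<close>

lemma sum_times_index:
  fixes g :: "nat \<Rightarrow> nat"
  shows "(\<Sum>j<l. g j * j) = (\<Sum>k\<in>{1..<l}. \<Sum>j\<in>{k..<l}. g j)"
proof (induction l)
  case (Suc l)
  show ?case
  proof (cases "l = 0")
    case False
    have "(\<Sum>k\<in>{1..<Suc l}. \<Sum>j\<in>{k..<Suc l}. g j) = (\<Sum>k\<in>{1..<Suc l}. (\<Sum>j\<in>{k..<l}. g j) + g l)"
      by (intro sum.cong) auto
    also have "\<dots> = (\<Sum>k\<in>{1..<l}. \<Sum>j\<in>{k..<l}. g j) + l * g l"
      using False by (simp add: sum.distrib)
    finally show ?thesis using Suc by simp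
  qed simp
qed simp

text \<open>
  The rearrangement inequality for a weakly increasing sequence, with the case of equality.
\<close>

lemma row_rearrangement:
  fixes f :: "nat \<Rightarrow> nat"
  assumes \<pi>: "\<pi> permutes {..<l}" and f: "\<And>j j'. j < j' \<Longrightarrow> j' < l \<Longrightarrow> f j \<le> f j'"
  shows "(\<Sum>j<l. f (\<pi> j) * j) \<le> (\<Sum>j<l. f j * j)"
    and "(\<Sum>j<l. f (\<pi> j) * j) = (\<Sum>j<l. f j * j) \<Longrightarrow> j < l \<Longrightarrow> f (\<pi> j) = f j"
proof -
  have tail: "(\<Sum>j\<in>{k..<l}. f (\<pi> j)) \<le> (\<Sum>j\<in>{k..<l}. f j)" for k
  proof -
    have i: "inj_on \<pi> {k..<l}" using permutes_inj_on[OF \<pi>] .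
    have "\<pi> ` {k..<l} \<subseteq> {..<l}" using permutes_in_image[OF \<pi>] by force
    hence "sum f (\<pi> ` {k..<l}) \<le> sum f {k..<l}"
      using f by (intro sum_exchange(1)) (auto simp: card_image[OF i] not_le subset_iff)
    thus ?thesis using sum.reindex[OF i, of f] by simp
  qed
  show "(\<Sum>j<l. f (\<pi> j) * j) \<le> (\<Sum>j<l. f j * j)"
    unfolding sum_times_index[of "\<lambda>j. f (\<pi> j)"] sum_times_index[of f] by (intro sum_mono tail)
  assume eq: "(\<Sum>j<l. f (\<pi> j) * j) = (\<Sum>j<l. f j * j)"
  have eqs: "(\<Sum>j\<in>{k..<l}. f (\<pi> j)) = (\<Sum>j\<in>{k..<l}. f j)" for k
  proof (cases "k = 0")
    case True
    thus ?thesis using sum.permute[OF \<pi>, of f] by (simp add: atLeast0LessThan comp_def)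
  next
    case False
    show ?thesis
    proof (cases "k < l")
      case True
      have "(\<Sum>k\<in>{1..<l}. \<Sum>j\<in>{k..<l}. f (\<pi> j)) = (\<Sum>k\<in>{1..<l}. \<Sum>j\<in>{k..<l}. f j)"
        using eq unfolding sum_times_index[of "\<lambda>j. f (\<pi> j)"] sum_times_index[of f] .
      from sum_mono_inv[OF this tail] show ?thesis using True False by auto
    qed auto
  qed
  assume j: "j < l"
  have "(\<Sum>j\<in>{j..<l}. g j) = g j + (\<Sum>j\<in>{Suc j..<l}. g j)" for g :: "nat \<Rightarrow> nat"
    using j by (simp add: sum.atLeast_Suc_lessThan)
  from this[of f] this[of "\<lambda>j. f (\<pi> j)"] eqs[of j] eqs[of "Suc j"] show "f (\<pi> j) = f j" by linarith
qed

lemma strict_mono_self_map: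
  fixes h :: "nat \<Rightarrow> nat"
  assumes "\<And>i i'. i < i' \<Longrightarrow> i' < l \<Longrightarrow> h i < h i'" "\<And>i. i < l \<Longrightarrow> h i < l" "i < l"
  shows "h i = i"
proof -
  have ge: "i \<le> h i" if "i < l" for i using that
  proof (induction i)
    case (Suc i)
    thus ?case using assms(1)[of i "Suc i"] by simp
  qed simp
  have inj: "inj_on h {..<l}" using assms(1) by (intro linorder_inj_onI) force+
  have "h ` {..<l} = {..<l}" by (rule endo_inj_surj) (use inj assms(2) in auto)
  hence "(\<Sum>i<l. h i) = (\<Sum>i<l. i)" using sum.reindex[OF inj, of "\<lambda>x. x"] by simp
  from sum_mono_inv[OF this[symmetric]] ge assms(3) show ?thesis by auto
qed

section \<open>Triangularity\<close>

text \<open>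
  The sum of all entries, each multiplied by the number of its column. The support is used
  instead of \<open>D\<close> since \<open>D\<close> may be infinite.
\<close>

definition sval :: "diagram \<Rightarrow> (box \<Rightarrow> nat) \<Rightarrow> nat" where
  "sval D M = (\<Sum>c\<in>{c \<in> D. M c \<noteq> 0}. M c * snd c)"

text \<open>
  The same statistic for a monomial, whose exponents are placed in the boxes by means of \<open>T\<close>.
  It is invariant under the column stabilizer, and on the row orbit of a semi-standard tableau
  its maximum is attained only at \<open>p\<^bsub>M,T\<^esub>\<close>.
\<close>

definition mono_sval :: "diagram \<Rightarrow> (box \<Rightarrow> nat) \<Rightarrow> monomial \<Rightarrow> nat" where
  "mono_sval D T p = (\<Sum>x\<in>keys p. lookup p x * snd (inv_into D T x))"

lemma mono_sval_col:
  assumes "\<sigma> \<in> col_stab D T" "inj_on T D" "keys p \<subseteq> T ` D"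
  shows "mono_sval D T (mono_act \<sigma> p) = mono_sval D T p"
proof -
  have b: "bij \<sigma>" using col_stab_bij[OF assms(1)] .
  have i: "inj_on \<sigma> (keys p)" using b by (meson bij_is_inj inj_on_subset subset_UNIV)
  have e: "snd (inv_into D T (\<sigma> x)) = snd (inv_into D T x)" if x: "x \<in> keys p" for x
  proof -
    obtain c where c: "c \<in> D" "x = T c" using x assms(3) by blast
    obtain c' where "c' \<in> D" "snd c' = snd c" "\<sigma> (T c) = T c'" using col_stab_D[OF assms(1) c(1)] .
    thus ?thesis using c assms(2) by simp
  qed
  show ?thesis unfolding mono_sval_def keys_mono_act[OF b]
    by (subst sum.reindex[OF i]) (auto intro!: sum.cong simp: lookup_mono_act_image[OF b] e)
qed

text \<open>
  A finite union of rows of \<open>D\<close> that contains all boxes with non-zero entries, namely the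
  finite part if \<open>D\<close> is infinite.
\<close>

definition carrier_boxes :: "diagram \<Rightarrow> diagram" where
  "carrier_boxes D = (if finite D then D else fin_part D)"

lemma carrier_boxes:
  assumes "tab D M"
  shows "finite (carrier_boxes D)" "{c \<in> D. M c \<noteq> 0} \<subseteq> carrier_boxes D" "carrier_boxes D \<subseteq> D"
    and "c \<in> carrier_boxes D \<Longrightarrow> c' \<in> D \<Longrightarrow> fst c' = fst c \<Longrightarrow> c' \<in> carrier_boxes D"
  using assms by (auto simp: carrier_boxes_def tab_def shape_def fin_part_def) (metis not_gr_zero)

lemma carrier_row_finite: "tab D M \<Longrightarrow> c \<in> carrier_boxes D \<Longrightarrow> finite {c' \<in> D. fst c' = fst c}"
  by (rule finite_subset[OF _ carrier_boxes(1)]) (auto intro: carrier_boxes(4))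

lemma mono_sval_eq:
  assumes M: "tab D M" and T: "inj_on T D" and k: "keys p \<subseteq> T ` carrier_boxes D"
  shows "mono_sval D T p = (\<Sum>i\<in>fst ` carrier_boxes D. \<Sum>j<rowlen D i. lookup p (T (i, j)) * j)"
proof -
  let ?E = "carrier_boxes D"
  have iE: "inj_on T ?E" using T carrier_boxes(3)[OF M] by (rule inj_on_subset)
  have "mono_sval D T p = (\<Sum>x\<in>T ` ?E. lookup p x * snd (inv_into D T x))"
    unfolding mono_sval_def by (rule sum.mono_neutral_left) (use k carrier_boxes(1)[OF M] in \<open>auto simp: in_keys_iff\<close>)
  also have "\<dots> = (\<Sum>c\<in>?E. lookup p (T c) * snd c)"
    using carrier_boxes(3)[OF M] T by (subst sum.reindex[OF iE]) (auto intro!: sum.cong simp: subset_iff)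
  also have "\<dots> = (\<Sum>i\<in>fst ` ?E. \<Sum>c\<in>{c \<in> ?E. fst c = i}. lookup p (T c) * snd c)"
    by (rule sum.group[symmetric]) (use carrier_boxes(1)[OF M] in auto)
  also have "\<dots> = (\<Sum>i\<in>fst ` ?E. \<Sum>j<rowlen D i. lookup p (T (i, j)) * j)"
  proof (rule sum.cong[OF refl])
    fix i assume i: "i \<in> fst ` ?E"
    then obtain c0 where c0: "c0 \<in> ?E" "fst c0 = i" by auto
    have "{c \<in> ?E. fst c = i} = {c \<in> D. fst c = i}"
      using carrier_boxes(3)[OF M] carrier_boxes(4)[OF M c0(1)] c0(2) by auto
    also have "\<dots> = (\<lambda>j. (i, j)) ` {..<rowlen D i}"
      using rowlen_iff[of D i] carrier_row_finite[OF M c0(1)] c0(2) M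
      by (auto simp: tab_def shape_def image_iff)
    finally show "(\<Sum>c\<in>{c \<in> ?E. fst c = i}. lookup p (T c) * snd c) = (\<Sum>j<rowlen D i. lookup p (T (i, j)) * j)"
      by (simp add: sum.reindex inj_on_def)
  qed
  finally show ?thesis .
qed

lemma mono_sval_tab_mono:
  assumes "tab D M" "inj_on T D"
  shows "mono_sval D T (tab_mono D M T) = sval D M"
proof -
  have i: "inj_on T {c \<in> D. M c \<noteq> 0}" using assms(2) by (rule inj_on_subset) auto
  show ?thesis unfolding mono_sval_def sval_def keys_tab_mono[OF assms]
    by (subst sum.reindex[OF i]) (auto intro!: sum.cong simp: lookup_tab_mono[OF assms] assms(2))
qed

lemma orb_sval:
  assumes M: "tab D M" and T: "inj_on T D" and ss: "semistandard D M" and p: "p \<in> orb D M T"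
  shows "mono_sval D T p \<le> sval D M"
    and "mono_sval D T p = sval D M \<Longrightarrow> p = tab_mono D M T"
proof -
  let ?E = "carrier_boxes D"
  note E = carrier_boxes[OF M]
  have D: "ferrers D" using M by (simp add: tab_def shape_def)
  obtain \<tau> where \<tau>: "\<tau> \<in> row_stab D T" "p = mono_act \<tau> (tab_mono D M T)" using p by (auto simp: orb_def)
  have b: "bij \<tau>" using row_stab_bij[OF \<tau>(1)] .
  have \<tau>i: "inv \<tau> \<in> row_stab D T" using row_stab_inv[OF \<tau>(1)] .
  have kp: "keys p \<subseteq> T ` ?E"
  proof
    fix x assume "x \<in> keys p"
    then obtain c where c: "c \<in> D" "M c \<noteq> 0" "x = \<tau> (T c)" unfolding \<tau>(2) keys_mono_act[OF b] keys_tab_mono[OF M T] by auto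
    obtain c' where c': "c' \<in> D" "fst c' = fst c" "\<tau> (T c) = T c'" using row_stab_D[OF \<tau>(1) c(1)] .
    have "c \<in> ?E" using c E(2) by auto
    from E(4)[OF this c'(1,2)] show "x \<in> T ` ?E" using c c' by auto
  qed
  have k0: "keys (tab_mono D M T) \<subseteq> T ` ?E" unfolding keys_tab_mono[OF M T] using E(2) by auto
  have rowl: "(i, j) \<in> D \<longleftrightarrow> j < rowlen D i" if "i \<in> fst ` ?E" for i j
    using rowlen_iff[OF D] carrier_row_finite[OF M] that by auto
  have ex: "\<exists>\<pi>. \<pi> permutes {..<rowlen D i} \<and> (\<forall>j<rowlen D i. lookup p (T (i, j)) = M (i, \<pi> j))" if i: "i \<in> fst ` ?E" for i
  proof -
    define g where "g j = snd (inv_into D T (inv \<tau> (T (i, j))))" for j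
    have g: "(i, g j) \<in> D" "inv \<tau> (T (i, j)) = T (i, g j)" if "j < rowlen D i" for j
    proof -
      have ij: "(i, j) \<in> D" using that rowl[OF i] by simp
      obtain c' where "c' \<in> D" "fst c' = fst (i, j)" "inv \<tau> (T (i, j)) = T c'" using row_stab_D[OF \<tau>i ij] .
      thus "(i, g j) \<in> D" "inv \<tau> (T (i, j)) = T (i, g j)" using T by (cases c', simp add: g_def)+
    qed
    have gi: "inj_on g {..<rowlen D i}"
    proof (rule inj_onI)
      fix j j' assume "j \<in> {..<rowlen D i}" "j' \<in> {..<rowlen D i}" "g j = g j'"
      hence a: "j < rowlen D i" "j' < rowlen D i" and "inv \<tau> (T (i, j)) = inv \<tau> (T (i, j'))" using g(2) by auto
      hence "T (i, j) = T (i, j')" using b by (metis bij_inv_eq_iff)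
      thus "j = j'" using T rowl[OF i] a by (auto dest: inj_onD)
    qed
    define \<pi> where "\<pi> = restrict_id g {..<rowlen D i}"
    have "\<pi> permutes {..<rowlen D i}"
    proof (rule inj_imp_permutes)
      show "inj_on \<pi> {..<rowlen D i}" using gi by (auto simp: inj_on_def \<pi>_def)
      show "\<pi> j \<in> {..<rowlen D i}" if "j \<in> {..<rowlen D i}" for j
        using that g(1)[of j] rowl[OF i] by (auto simp: \<pi>_def)
    qed (auto simp: \<pi>_def)
    moreover have "lookup p (T (i, j)) = M (i, \<pi> j)" if "j < rowlen D i" for j
      using that g[OF that] lookup_tab_mono(1)[OF M T] by (simp add: \<tau>(2) lookup_mono_act[OF b] \<pi>_def)
    ultimately show ?thesis by blast
  qed
  then obtain \<pi> where \<pi>: "\<And>i. i \<in> fst ` ?E \<Longrightarrow> \<pi> i permutes {..<rowlen D i}"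
    "\<And>i j. i \<in> fst ` ?E \<Longrightarrow> j < rowlen D i \<Longrightarrow> lookup p (T (i, j)) = M (i, \<pi> i j)" by metis
  have inc: "M (i, j) \<le> M (i, j')" if "j < j'" "j' < rowlen D i" "i \<in> fst ` ?E" for i j j'
    using ss that rowl[OF that(3)] by (auto simp: semistandard_def)
  have s1: "mono_sval D T p = (\<Sum>i\<in>fst ` ?E. \<Sum>j<rowlen D i. M (i, \<pi> i j) * j)"
    unfolding mono_sval_eq[OF M T kp] by (intro sum.cong) (use \<pi> in auto)
  have s0: "sval D M = (\<Sum>i\<in>fst ` ?E. \<Sum>j<rowlen D i. M (i, j) * j)"
    unfolding mono_sval_tab_mono[OF M T, symmetric] mono_sval_eq[OF M T k0]
    by (intro sum.cong) (use rowl lookup_tab_mono(1)[OF M T] in auto)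
  have le: "(\<Sum>j<rowlen D i. M (i, \<pi> i j) * j) \<le> (\<Sum>j<rowlen D i. M (i, j) * j)" if "i \<in> fst ` ?E" for i
    by (rule row_rearrangement(1)[OF \<pi>(1)[OF that]]) (rule inc[OF _ _ that])
  show "mono_sval D T p \<le> sval D M" unfolding s1 s0 by (intro sum_mono le)
  assume eq: "mono_sval D T p = sval D M"
  have row: "M (i, \<pi> i j) = M (i, j)" if i: "i \<in> fst ` ?E" and j: "j < rowlen D i" for i j
  proof (rule row_rearrangement(2)[OF \<pi>(1)[OF i] _ _ j])
    show "(\<Sum>j<rowlen D i. M (i, \<pi> i j) * j) = (\<Sum>j<rowlen D i. M (i, j) * j)"
      using sum_mono_inv[OF eq[unfolded s1 s0] le i] E(1) by auto
  qed (rule inc[OF _ _ i])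
  have pc: "lookup p (T c) = M c" if c: "c \<in> D" for c
  proof (cases "c \<in> ?E")
    case True
    obtain i j where ij: "c = (i, j)" by (cases c)
    have i: "i \<in> fst ` ?E" using True ij by force
    have j: "j < rowlen D i" using c ij rowl[OF i] by simp
    show ?thesis using \<pi>(2)[OF i j] row[OF i j] ij by simp
  next
    case False
    have "T c \<notin> T ` ?E" unfolding inj_on_image_mem_iff[OF T c E(3)] by (rule False)
    hence "lookup p (T c) = 0" using kp by (auto simp: in_keys_iff)
    moreover have "M c = 0" using False c E(2) by auto
    ultimately show ?thesis by simp
  qed
  show "p = tab_mono D M T"
    by (rule tab_mono_eqI[symmetric, OF M T pc]) (use kp E(3) in auto)
qed

text \<open>
  If an element of the column stabilizer maps the monomial of one semi-standard filling to
  that of another, then it preserves the order in each column and is therefore trivial.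
\<close>

lemma column_rigid:
  assumes M: "tab D M" "tab D M'" and T: "inj_on T D" and ss: "semistandard D M" "semistandard D M'"
    and \<sigma>: "\<sigma> \<in> col_stab D T" "tab_mono D M T = mono_act \<sigma> (tab_mono D M' T)"
  shows "\<sigma> = id" and "M = M'"
proof -
  have D: "shape D" using M by (simp add: tab_def)
  have b: "bij \<sigma>" using col_stab_bij[OF \<sigma>(1)] .
  have "\<sigma> (T (i, j)) = T (i, j)" if ij: "(i, j) \<in> D" for i j
  proof -
    have "\<exists>i'. (i', j) \<in> D \<and> \<sigma> (T (i, j)) = T (i', j)" if "i < collen D j" for i
    proof -
      have "(i, j) \<in> D" using collen_iff[OF D] that by simp
      from col_stab_D[OF \<sigma>(1) this] obtain c' where "c' \<in> D" "snd c' = snd (i, j)" "\<sigma> (T (i, j)) = T c'" .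
      thus ?thesis by (cases c') auto
    qed
    then obtain h where h: "\<And>i. i < collen D j \<Longrightarrow> (h i, j) \<in> D" "\<And>i. i < collen D j \<Longrightarrow> \<sigma> (T (i, j)) = T (h i, j)" by metis
    have Mh: "M (h i, j) = M' (i, j)" if "i < collen D j" for i
    proof -
      have "M (h i, j) = lookup (tab_mono D M T) (\<sigma> (T (i, j)))" using lookup_tab_mono(1)[OF M(1) T h(1)[OF that]] h(2)[OF that] by simp
      also have "\<dots> = lookup (tab_mono D M' T) (T (i, j))" unfolding \<sigma>(2) by (rule lookup_mono_act_image[OF b])
      also have "\<dots> = M' (i, j)" using lookup_tab_mono(1)[OF M(2) T] that collen_iff[OF D] by simp
      finally show ?thesis .
    qed
    have lt: "M (i, j) < M (i', j)" "M' (i, j) < M' (i', j)" if "i < i'" "i' < collen D j" for i i'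
      using ss that collen_iff[OF D, of _ j] by (auto simp: semistandard_def)
    have "h i = i"
    proof (rule strict_mono_self_map[of "collen D j"])
      fix i i' assume a: "i < i'" "i' < collen D j"
      have "M (h i, j) < M (h i', j)" using lt(2)[OF a] Mh a by simp
      moreover have "h i < collen D j" using h(1)[of i] a collen_iff[OF D, of "h i" j] by simp
      ultimately show "h i < h i'" using lt(1)[of "h i'" "h i"] by (metis linorder_neqE_nat less_asym less_irrefl)
    next
      show "h i < collen D j" if "i < collen D j" for i using h(1)[OF that] collen_iff[OF D, of "h i" j] by simp
      show "i < collen D j" using ij collen_iff[OF D] by simp
    qed
    thus ?thesis using h(2) ij collen_iff[OF D] by simp
  qed
  hence fixd: "\<sigma> (T c) = T c" if "c \<in> D" for c using that by (cases c) auto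
  show "\<sigma> = id"
  proof
    fix x
    show "\<sigma> x = id x"
    proof (cases "x \<in> T ` D")
      case True thus ?thesis using fixd by auto
    next
      case False thus ?thesis using \<sigma>(1) by (auto simp: col_stab_def dest: permutes_not_in)
    qed
  qed
  hence "tab_mono D M T = tab_mono D M' T" using \<sigma>(2) by simp
  hence "M c = M' c" if "c \<in> D" for c using lookup_tab_mono(1)[OF M(1) T that] lookup_tab_mono(1)[OF M(2) T that] by simp
  moreover have "M c = M' c" if "c \<notin> D" for c using M that unfolding tab_def by metis
  ultimately show "M = M'" by blast
qed

text \<open>
  A term \<open>\<sigma> q\<close> of \<open>F\<^bsub>M',T\<^esub>\<close>, with \<open>q\<close> in the row orbit of \<open>M'\<close>, can only be \<open>p\<^bsub>M,T\<^esub>\<close> if \<open>q\<close> has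
  the value \<open>sval D M\<close>. Under the assumption this is at least the maximal value on the orbit,
  so \<open>q\<close> is the monomial of \<open>M'\<close> itself.
\<close>

lemma lookup_specht_triangular:
  assumes M: "tab D M" "tab D M'" and T: "inj_on T D" and ss: "semistandard D M" "semistandard D M'"
    and s: "sval D M' \<le> sval D M"
  shows "lookup (specht_poly D M' T) (tab_mono D M T) = (if M' = M then 1 else 0)"
proof -
  have D: "shape D" using M by (simp add: tab_def)
  note C = col_stab_group[OF D T]
  \<comment> \<open>Only the identity contributes to the coefficient.\<close>
  have key: "\<sigma> = id \<and> M = M'" if \<sigma>: "\<sigma> \<in> col_stab D T" "mono_act (inv \<sigma>) (tab_mono D M T) \<in> orb D M' T" for \<sigma>
  proof -
    let ?q = "mono_act (inv \<sigma>) (tab_mono D M T)"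
    have "mono_sval D T ?q = sval D M"
      unfolding mono_sval_tab_mono[OF M(1) T, symmetric]
      by (rule mono_sval_col[OF fin_perm_group_inv[OF C \<sigma>(1)] T]) (auto simp: keys_tab_mono[OF M(1) T])
    hence "mono_sval D T ?q = sval D M'" using orb_sval(1)[OF M(2) T ss(2) \<sigma>(2)] s by simp
    from orb_sval(2)[OF M(2) T ss(2) \<sigma>(2) this] have "tab_mono D M T = mono_act \<sigma> (tab_mono D M' T)"
      using col_stab_bij[OF \<sigma>(1)] by (metis mono_act_inv(1))
    from column_rigid[OF M T ss \<sigma>(1) this] show ?thesis by simp
  qed
  have "lookup (specht_poly D M' T) (tab_mono D M T)
      = (\<Sum>\<sigma>\<in>col_stab D T. if \<sigma> = id then (if M' = M then 1 else 0) else 0)"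
    unfolding specht_poly_eq lookup_antisymmetrize[OF C]
  proof (rule sum.cong[OF refl])
    fix \<sigma> assume \<sigma>: "\<sigma> \<in> col_stab D T"
    show "of_int (sign \<sigma>) * lookup (ind_poly (orb D M' T)) (mono_act (inv \<sigma>) (tab_mono D M T)) =
         (if \<sigma> = id then (if M' = M then 1 else 0) else (0::rat))"
      using key[OF \<sigma>] tab_mono_in_orb[of D M T] by (auto simp: lookup_ind_poly[OF finite_orb[OF M(2) T]])
  qed
  also have "\<dots> = (if M' = M then 1 else 0)" using fin_perm_group_id[OF C] fin_perm_group_finite[OF C] by (simp add: sum.delta)
  finally show ?thesis .
qed

section \<open>Straightening\<close>

text \<open>
  Permutations which preserve the classes of \<open>k\<close> are products of transpositions within the
  classes.
\<close>

lemma class_permutes_induct: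
  assumes fin: "finite D" and \<sigma>: "\<sigma> permutes D" "\<And>c. c \<in> D \<Longrightarrow> k (\<sigma> c) = k c"
    and id: "P id"
    and step: "\<And>a b \<tau>. a \<in> D \<Longrightarrow> b \<in> D \<Longrightarrow> a \<noteq> b \<Longrightarrow> k a = k b \<Longrightarrow> \<tau> permutes D \<Longrightarrow> P \<tau> \<Longrightarrow> P (transpose a b \<circ> \<tau>)"
  shows "P \<sigma>"
  using \<sigma>
proof (induction "card {x \<in> D. \<sigma> x \<noteq> x}" arbitrary: \<sigma> rule: less_induct)
  case less
  show ?case
  proof (cases "\<exists>a\<in>D. \<sigma> a \<noteq> a")
    case False
    hence "\<sigma> = id" using less.prems(1) by (auto simp: fun_eq_iff dest: permutes_not_in)
    thus ?thesis using id by simp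
  next
    case True
    then obtain a where a: "a \<in> D" "\<sigma> a \<noteq> a" by auto
    define b where "b = \<sigma> a"
    define \<tau> where "\<tau> = transpose a b \<circ> \<sigma>"
    have b: "b \<in> D" "a \<noteq> b" "k a = k b"
      using a less.prems permutes_in_image[OF less.prems(1)] by (auto simp: b_def)
    have \<tau>p: "\<tau> permutes D" unfolding \<tau>_def
      by (rule permutes_compose[OF less.prems(1) permutes_swap_id[OF a(1) b(1)]])
    have \<sigma>b: "\<sigma> b \<noteq> b" using a permutes_inj[OF less.prems(1)] by (metis b_def injD)
    have "{x \<in> D. \<tau> x \<noteq> x} \<subset> {x \<in> D. \<sigma> x \<noteq> x}"
    proof
      show "{x \<in> D. \<tau> x \<noteq> x} \<subseteq> {x \<in> D. \<sigma> x \<noteq> x}"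
      proof
        fix x assume x: "x \<in> {x \<in> D. \<tau> x \<noteq> x}"
        have "\<sigma> x \<noteq> x"
        proof
          assume e: "\<sigma> x = x"
          hence "x \<noteq> a" "x \<noteq> b" using a \<sigma>b by auto
          thus False using x e by (simp add: \<tau>_def)
        qed
        thus "x \<in> {x \<in> D. \<sigma> x \<noteq> x}" using x by simp
      qed
      have "a \<notin> {x \<in> D. \<tau> x \<noteq> x}" by (simp add: \<tau>_def b_def)
      thus "{x \<in> D. \<tau> x \<noteq> x} \<noteq> {x \<in> D. \<sigma> x \<noteq> x}" using a by blast
    qed
    hence "card {x \<in> D. \<tau> x \<noteq> x} < card {x \<in> D. \<sigma> x \<noteq> x}" using fin by (intro psubset_card_mono) auto
    moreover have "k (\<tau> c) = k c" if "c \<in> D" for c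
    proof -
      have "k (transpose a b y) = k y" for y using b(3) by (simp add: transpose_def)
      thus ?thesis using less.prems(2)[OF that] by (simp add: \<tau>_def)
    qed
    ultimately have "P \<tau>" using less.hyps \<tau>p by blast
    from step[OF a(1) b \<tau>p this] show ?thesis by (simp add: \<tau>_def o_assoc)
  qed
qed

text \<open>
  The Garnir boxes for \<open>(i, j)\<close> and \<open>(i, j + 1)\<close>: column \<open>j\<close> from row \<open>i\<close> on and column
  \<open>j + 1\<close> up to row \<open>i\<close>. Their number exceeds the length of column \<open>j\<close> by one.
\<close>

definition garnir :: "diagram \<Rightarrow> nat \<Rightarrow> nat \<Rightarrow> diagram" where
  "garnir D i j = {c \<in> D. snd c = j \<and> i \<le> fst c} \<union> {c \<in> D. snd c = Suc j \<and> fst c \<le> i}"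

lemma garnir_subset: "garnir D i j \<subseteq> D" by (auto simp: garnir_def)

lemma eq_neg_self_imp_zero: "(x :: qpoly) = - x \<Longrightarrow> x = 0"
proof (rule poly_mapping_eqI)
  fix m assume "x = - x"
  hence "lookup x m = - lookup x m" by (metis lookup_uminus)
  thus "lookup x m = lookup 0 m" by simp
qed

text \<open>
  The straightening algorithm, in a form that applies to fillings with entries as well as to
  bijective fillings. A function \<open>\<phi>\<close> on a set of fillings that is closed under permutations of
  the boxes, antisymmetric in the columns and subject to the Garnir relations takes values in
  \<open>S\<close> as soon as its values at the semi-standard fillings are in \<open>S\<close>. The full symmetric group
  of the Garnir boxes is used instead of coset representatives; this costs the non-zero factor
  \<open>card P0\<close>. Termination is measured by the sums of the entries weighted with the column
  number and, if these agree, with the row number.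
\<close>

lemma straightening:
  fixes \<phi> :: "(box \<Rightarrow> nat) \<Rightarrow> qpoly"
  assumes D: "ferrers D" "finite D" and S: "qvs.subspace S"
    and cl: "\<And>N \<sigma>. N \<in> \<N> \<Longrightarrow> \<sigma> permutes D \<Longrightarrow> N \<circ> \<sigma> \<in> \<N>"
    and zero: "\<And>N c. N \<in> \<N> \<Longrightarrow> c \<notin> D \<Longrightarrow> N c = 0"
    and col: "\<And>N a b. N \<in> \<N> \<Longrightarrow> a \<in> D \<Longrightarrow> b \<in> D \<Longrightarrow> snd a = snd b \<Longrightarrow> a \<noteq> b \<Longrightarrow> \<phi> (N \<circ> transpose a b) = - \<phi> N"
    and gar: "\<And>N i j. N \<in> \<N> \<Longrightarrow> (i, j) \<in> D \<Longrightarrow> (i, Suc j) \<in> D \<Longrightarrow>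
        (\<Sum>\<sigma>\<in>{\<sigma>. \<sigma> permutes garnir D i j}. qscale (of_int (sign \<sigma>)) (\<phi> (N \<circ> \<sigma>))) = 0"
    and ss: "\<And>N. N \<in> \<N> \<Longrightarrow> semistandard D N \<Longrightarrow> \<phi> N \<in> S"
    and N: "N \<in> \<N>"
  shows "\<phi> N \<in> S"
proof -
  define W where "W = sum N D"
  define K where "K = (\<Sum>c\<in>D. fst c + snd c)"
  define s where "s N = (\<Sum>c\<in>D. N c * snd c)" for N :: "box \<Rightarrow> nat"
  define t where "t N = (\<Sum>c\<in>D. N c * fst c)" for N :: "box \<Rightarrow> nat"
  have K: "fst c \<le> K" "snd c \<le> K" if "c \<in> D" for c
    using member_le_sum[OF that, of "\<lambda>c. fst c + snd c"] D(2) by (auto simp: K_def)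
  have sb: "s N \<le> W * K" "t N \<le> W * K" if "sum N D = W" for N
    unfolding s_def t_def that[symmetric] sum_distrib_right by (intro sum_mono mult_left_mono K; simp)+
  have colperm: "\<phi> (N \<circ> \<sigma>) = qscale (of_int (sign \<sigma>)) (\<phi> N)"
    if "N \<in> \<N>" "\<sigma> permutes D" "\<And>c. c \<in> D \<Longrightarrow> snd (\<sigma> c) = snd c" for N \<sigma>
  proof -
    have "\<forall>N\<in>\<N>. \<phi> (N \<circ> \<sigma>) = qscale (of_int (sign \<sigma>)) (\<phi> N)"
    proof (rule class_permutes_induct[OF D(2) that(2), of snd])
      fix a b \<tau> assume a: "a \<in> D" "b \<in> D" "a \<noteq> b" "snd a = snd b" "\<tau> permutes D"
        and IH: "\<forall>N\<in>\<N>. \<phi> (N \<circ> \<tau>) = qscale (of_int (sign \<tau>)) (\<phi> N)"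
      have sg: "sign (transpose a b \<circ> \<tau>) = - sign \<tau>"
        using a(3) permutes_imp_permutation[OF D(2) a(5)] by (simp add: sign_compose permutation_swap_id sign_swap_id)
      show "\<forall>N\<in>\<N>. \<phi> (N \<circ> (transpose a b \<circ> \<tau>)) = qscale (of_int (sign (transpose a b \<circ> \<tau>))) (\<phi> N)"
      proof
        fix N assume N: "N \<in> \<N>"
        have "\<phi> (N \<circ> transpose a b \<circ> \<tau>) = qscale (of_int (sign \<tau>)) (\<phi> (N \<circ> transpose a b))"
          using IH cl[OF N permutes_swap_id[OF a(1,2)]] by blast
        also have "\<dots> = qscale (of_int (sign \<tau>)) (- \<phi> N)" using col[OF N a(1,2,4,3)] by simp
        finally show "\<phi> (N \<circ> (transpose a b \<circ> \<tau>)) = qscale (of_int (sign (transpose a b \<circ> \<tau>))) (\<phi> N)"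
          by (simp add: sg o_assoc)
      qed
    qed (use that(3) in auto)
    thus ?thesis using that(1) by blast
  qed
  have total: "sum (N \<circ> \<sigma>) D = sum N D" if "\<sigma> permutes D" for N :: "box \<Rightarrow> nat" and \<sigma>
    using sum.permute[OF that, of N] by simp
  have "\<forall>N. N \<in> \<N> \<longrightarrow> sum N D = W \<longrightarrow> \<phi> N \<in> S"
  proof (rule allI)
    fix N :: "box \<Rightarrow> nat"
    show "N \<in> \<N> \<longrightarrow> sum N D = W \<longrightarrow> \<phi> N \<in> S"
    proof (induction N rule: wf_induct_rule[OF wf_measures[of "[\<lambda>N. W * K - s N, \<lambda>N. W * K - t N]"]])
      case (1 N)
      have IH: "\<phi> (N \<circ> \<sigma>) \<in> S" if "N \<in> \<N>" "sum N D = W" "\<sigma> permutes D" "s N < s (N \<circ> \<sigma>) \<or> s N = s (N \<circ> \<sigma>) \<and> t N < t (N \<circ> \<sigma>)" for \<sigma>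
      proof -
        have W': "sum (N \<circ> \<sigma>) D = W" using total[OF that(3)] that(2) by simp
        have "W * K - s (N \<circ> \<sigma>) < W * K - s N \<or> W * K - s (N \<circ> \<sigma>) = W * K - s N \<and> W * K - t (N \<circ> \<sigma>) < W * K - t N"
          using that(4) sb[OF W'] by linarith
        hence "(N \<circ> \<sigma>, N) \<in> measures [\<lambda>N. W * K - s N, \<lambda>N. W * K - t N]" by simp
        from 1[OF this] show ?thesis using cl[OF that(1,3)] W' by blast
      qed
      show ?case
      proof (intro impI)
        assume N: "N \<in> \<N>" "sum N D = W"
        \<comment> \<open>Equal entries in a column, an inversion in a column, or strictly increasing
          columns\<close>
        consider (eq) a b where "a \<in> D" "b \<in> D" "a \<noteq> b" "snd a = snd b" "N a = N b"
          | (inv) a b where "a \<in> D" "b \<in> D" "snd a = snd b" "fst a < fst b" "N b < N a"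
          | (strict) "\<And>i i' j. (i, j) \<in> D \<Longrightarrow> (i', j) \<in> D \<Longrightarrow> i < i' \<Longrightarrow> N (i, j) < N (i', j)"
        proof (cases "\<exists>i i' j. (i, j) \<in> D \<and> (i', j) \<in> D \<and> i < i' \<and> \<not> N (i, j) < N (i', j)")
          case True
          then obtain i i' j where h: "(i, j) \<in> D" "(i', j) \<in> D" "i < i'" "N (i', j) \<le> N (i, j)" by (auto simp: not_less)
          show ?thesis
          proof (cases "N (i', j) = N (i, j)")
            case True thus ?thesis using that(1)[of "(i, j)" "(i', j)"] h by simp
          next
            case False thus ?thesis using that(2)[of "(i, j)" "(i', j)"] h by simp
          qed
        next
          case False thus ?thesis using that(3) by blast
        qed
        thus "\<phi> N \<in> S"
        proof cases
          case eq
          have "N \<circ> transpose a b = N" using eq(5) by (auto simp: fun_eq_iff transpose_def)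
          hence "\<phi> N = - \<phi> N" using col[OF N(1) eq(1,2,4,3)] by simp
          hence "\<phi> N = 0" by (rule eq_neg_self_imp_zero)
          thus ?thesis using qvs.subspace_0[OF S] by simp
        next
          case inv
          have ab: "a \<noteq> b" using inv by auto
          have p: "transpose a b permutes D" using permutes_swap_id[OF inv(1,2)] .
          have split: "(\<Sum>c\<in>D. f c) = f a + f b + (\<Sum>c\<in>D - {a, b}. f c)" for f :: "box \<Rightarrow> nat"
          proof -
            have "(\<Sum>c\<in>D. f c) = f a + (\<Sum>c\<in>D - {a}. f c)" using D(2) inv(1) by (rule sum.remove)
            also have "(\<Sum>c\<in>D - {a}. f c) = f b + (\<Sum>c\<in>D - {a} - {b}. f c)"
              using D(2) inv(2) ab by (intro sum.remove) auto
            also have "D - {a} - {b} = D - {a, b}" by auto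
            finally show ?thesis by (simp add: add.assoc)
          qed
          have rest: "(\<Sum>c\<in>D - {a, b}. (N \<circ> transpose a b) c * w c) = (\<Sum>c\<in>D - {a, b}. N c * w c)" for w
            by (intro sum.cong) (auto simp: transpose_def)
          have s_eq: "s N = s (N \<circ> transpose a b)"
            unfolding s_def split[of "\<lambda>c. N c * snd c"] split[of "\<lambda>c. (N \<circ> transpose a b) c * snd c"] rest
            using inv(3) by simp
          obtain d e where de: "N a = N b + Suc d" "fst b = fst a + Suc e"
            using inv(4,5) less_imp_Suc_add by (metis add_Suc_right)
          have "t N < t (N \<circ> transpose a b)"
            unfolding t_def split[of "\<lambda>c. N c * fst c"] split[of "\<lambda>c. (N \<circ> transpose a b) c * fst c"] rest
            using de by (simp add: algebra_simps)
          hence "\<phi> (N \<circ> transpose a b) \<in> S" using IH[OF N p] s_eq by blast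
          hence "- \<phi> N \<in> S" using col[OF N(1) inv(1,2,3) ab] by simp
          from qvs.subspace_neg[OF S this] show ?thesis by simp
        next
          case strict
          \<comment> \<open>Now only the rows have to be considered, and it suffices to compare neighbours.\<close>
          show ?thesis
          proof (cases "\<exists>i j. (i, j) \<in> D \<and> (i, Suc j) \<in> D \<and> N (i, Suc j) < N (i, j)")
            case False
            have row: "(i, j') \<in> D \<Longrightarrow> j < j' \<Longrightarrow> N (i, j) \<le> N (i, j')" for i j j'
            proof (induction j')
              case (Suc j')
              have d: "(i, j') \<in> D" using ferrersD[OF D(1) Suc.prems(1), of i j'] by simp
              hence "N (i, j') \<le> N (i, Suc j')" using False Suc.prems(1) by (metis not_le)
              thus ?case using Suc.IH[OF d] Suc.prems(2) by (cases "j = j'") auto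
            qed simp
            have "semistandard D N" unfolding semistandard_def using zero[OF N(1)] row strict by blast
            thus ?thesis using ss N by blast
          next
            case True
            then obtain i j where ij: "(i, j) \<in> D" "(i, Suc j) \<in> D" "N (i, Suc j) < N (i, j)" by blast
            define A where "A = {c \<in> D. snd c = j \<and> i \<le> fst c}"
            define B where "B = {c \<in> D. snd c = Suc j \<and> fst c \<le> i}"
            have G: "garnir D i j = A \<union> B" by (simp add: garnir_def A_def B_def)
            have fin: "finite A" "finite B" using D(2) by (auto simp: A_def B_def)
            have disj: "A \<inter> B = {}" by (auto simp: A_def B_def)
            \<comment> \<open>The Garnir entries in column \<open>j\<close> exceed all those in column \<open>j + 1\<close>.\<close>
            have AB: "N b < N a" if aA: "a \<in> A" and bB: "b \<in> B" for a b
            proof -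
              obtain i1 where a: "a = (i1, j)" "(i1, j) \<in> D" "i \<le> i1" using aA by (cases a) (simp add: A_def)
              obtain i2 where b: "b = (i2, Suc j)" "(i2, Suc j) \<in> D" "i2 \<le> i" using bB by (cases b) (simp add: B_def)
              have "N (i, j) \<le> N a" using strict[OF ij(1) a(2)] a by (cases "i = i1") auto
              moreover have "N b \<le> N (i, Suc j)" using strict[OF b(2) ij(2)] b by (cases "i = i2") auto
              ultimately show ?thesis using ij(3) by linarith
            qed
            define P where "P = {\<sigma>. \<sigma> permutes A \<union> B}"
            \<comment> \<open>The permutations that do not exchange boxes between the two columns; their
              terms all equal \<open>\<phi> N\<close>. The other ones move larger entries to the right.\<close>
            define P0 where "P0 = {\<sigma> \<in> P. \<sigma> ` B = B}"
            have finP: "finite P" unfolding P_def using fin by (intro finite_permutations) auto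
            have P0: "P0 \<subseteq> P" by (auto simp: P0_def)
            have PD: "\<sigma> permutes D" if "\<sigma> \<in> P" for \<sigma>
              using that permutes_subset[of \<sigma> "A \<union> B" D] by (auto simp: P_def A_def B_def)
            have term0: "qscale (of_int (sign \<sigma>)) (\<phi> (N \<circ> \<sigma>)) = \<phi> N" if "\<sigma> \<in> P0" for \<sigma>
            proof -
              have p: "\<sigma> permutes A \<union> B" "\<sigma> ` B = B" using that by (auto simp: P0_def P_def)
              have "\<sigma> ` A = A"
              proof -
                have "\<sigma> ` A = \<sigma> ` ((A \<union> B) - B)" using disj by (intro arg_cong[of _ _ "image \<sigma>"]) auto
                also have "\<dots> = (A \<union> B) - B" using image_set_diff[OF permutes_inj[OF p(1)], of "A \<union> B" B] permutes_image[OF p(1)] p(2) by simp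
                finally show ?thesis using disj by auto
              qed
              have "snd (\<sigma> c) = snd c" if "c \<in> D" for c
              proof -
                consider "c \<in> A" | "c \<in> B" | "c \<notin> A \<union> B" by auto
                thus ?thesis
                proof cases
                  case 1 hence "\<sigma> c \<in> A" using \<open>\<sigma> ` A = A\<close> by blast
                  thus ?thesis using 1 by (simp add: A_def)
                next
                  case 2 hence "\<sigma> c \<in> B" using p(2) by blast
                  thus ?thesis using 2 by (simp add: B_def)
                next
                  case 3 thus ?thesis using permutes_not_in[OF p(1)] by simp
                qed
              qed
              from colperm[OF N(1) PD this] that P0 show ?thesis by (auto simp: subset_iff)
            qed
            have term1: "\<phi> (N \<circ> \<sigma>) \<in> S" if \<sigma>: "\<sigma> \<in> P - P0" for \<sigma>
            proof -
              have p: "\<sigma> permutes A \<union> B" "\<sigma> ` B \<noteq> B" using \<sigma> by (auto simp: P0_def P_def)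
              have sub: "A \<union> B \<subseteq> D" by (auto simp: A_def B_def)
              have i: "inj_on \<sigma> B" using permutes_inj_on[OF p(1)] .
              have im: "\<sigma> ` B \<subseteq> A \<union> B" using permutes_image[OF p(1)] by auto
              have "sum N B < sum N (\<sigma> ` B)"
              proof (rule sum_exchange(2))
                show "card (\<sigma> ` B) = card B" using card_image[OF i] .
                fix a b assume "a \<in> \<sigma> ` B - B" "b \<in> B - \<sigma> ` B"
                hence ab: "a \<in> A" "b \<in> B" using im by auto
                show "N b < N a" by (rule AB[OF ab])
                thus "N b \<le> N a" by (rule less_imp_le)
              qed (use fin p(2) in auto)
              hence lt: "(\<Sum>c\<in>B. N c) < (\<Sum>c\<in>B. N (\<sigma> c))" using sum.reindex[OF i, of N] by simp
              have split: "s N' = (\<Sum>c\<in>D - (A \<union> B). N' c * snd c) + j * (\<Sum>c\<in>A \<union> B. N' c) + (\<Sum>c\<in>B. N' c)" for N' :: "box \<Rightarrow> nat"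
              proof -
                have "s N' = (\<Sum>c\<in>D - (A \<union> B). N' c * snd c) + (\<Sum>c\<in>A \<union> B. N' c * snd c)"
                  unfolding s_def using sub D(2) by (rule sum.subset_diff)
                also have "(\<Sum>c\<in>A \<union> B. N' c * snd c) = (\<Sum>c\<in>A. N' c * snd c) + (\<Sum>c\<in>B. N' c * snd c)"
                  using fin disj by (rule sum.union_disjoint)
                also have "(\<Sum>c\<in>A. N' c * snd c) = j * (\<Sum>c\<in>A. N' c)" by (simp add: sum_distrib_left A_def mult.commute)
                also have "(\<Sum>c\<in>B. N' c * snd c) = j * (\<Sum>c\<in>B. N' c) + (\<Sum>c\<in>B. N' c)"
                  unfolding sum_distrib_left sum.distrib[symmetric] by (rule sum.cong) (simp_all add: B_def)
                also have "j * (\<Sum>c\<in>A. N' c) + (j * (\<Sum>c\<in>B. N' c) + (\<Sum>c\<in>B. N' c)) = j * (\<Sum>c\<in>A \<union> B. N' c) + (\<Sum>c\<in>B. N' c)"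
                  using sum.union_disjoint[OF fin disj, of N'] by (simp add: algebra_simps)
                finally show ?thesis by simp
              qed
              have e1: "(\<Sum>c\<in>D - (A \<union> B). (N \<circ> \<sigma>) c * snd c) = (\<Sum>c\<in>D - (A \<union> B). N c * snd c)"
                using permutes_not_in[OF p(1)] by (intro sum.cong) auto
              have e2: "(\<Sum>c\<in>A \<union> B. (N \<circ> \<sigma>) c) = (\<Sum>c\<in>A \<union> B. N c)" using sum.permute[OF p(1), of N] by simp
              have "s N < s (N \<circ> \<sigma>)" unfolding split[of N] split[of "N \<circ> \<sigma>"] e1 e2 using lt by simp
              moreover have "\<sigma> permutes D" using PD \<sigma> by blast
              ultimately show ?thesis using IH[OF N] by blast
            qed
            have "0 = (\<Sum>\<sigma>\<in>P. qscale (of_int (sign \<sigma>)) (\<phi> (N \<circ> \<sigma>)))"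
              using gar[OF N(1) ij(1,2)] by (simp add: P_def G)
            also have "\<dots> = (\<Sum>\<sigma>\<in>P - P0. qscale (of_int (sign \<sigma>)) (\<phi> (N \<circ> \<sigma>))) + (\<Sum>\<sigma>\<in>P0. qscale (of_int (sign \<sigma>)) (\<phi> (N \<circ> \<sigma>)))"
              using P0 finP by (rule sum.subset_diff)
            also have "(\<Sum>\<sigma>\<in>P0. qscale (of_int (sign \<sigma>)) (\<phi> (N \<circ> \<sigma>))) = (\<Sum>\<sigma>\<in>P0. \<phi> N)" using term0 by (rule sum.cong[OF refl])
            also have "\<dots> = qscale (of_nat (card P0)) (\<phi> N)"
              by (rule poly_mapping_eqI) (simp add: lookup_sum del: sum_constant, simp)
            finally have z: "0 = (\<Sum>\<sigma>\<in>P - P0. qscale (of_int (sign \<sigma>)) (\<phi> (N \<circ> \<sigma>))) + qscale (of_nat (card P0)) (\<phi> N)" .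
            have "qscale (of_nat (card P0)) (\<phi> N) = - (\<Sum>\<sigma>\<in>P - P0. qscale (of_int (sign \<sigma>)) (\<phi> (N \<circ> \<sigma>)))"
              by (rule minus_unique[OF z[symmetric], symmetric])
            also have "\<dots> \<in> S" using term1 by (intro qvs.subspace_neg[OF S] qvs.subspace_sum[OF S] qvs.subspace_scale[OF S])
            finally have 2: "qscale (of_nat (card P0)) (\<phi> N) \<in> S" .
            have "id \<in> P0" by (simp add: P0_def P_def)
            hence "card P0 \<noteq> 0" using finite_subset[OF P0 finP] by auto
            hence "\<phi> N = qscale (1 / of_nat (card P0)) (qscale (of_nat (card P0)) (\<phi> N))" by simp
            also have "\<dots> \<in> S" by (rule qvs.subspace_scale[OF S 2])
            finally show ?thesis .
          qed
        qed
      qed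
    qed
  qed
  thus ?thesis using N W_def by blast
qed

section \<open>Garnir relations\<close>

lemma card_garnir:
  assumes "shape D" "(i, j) \<in> D" "(i, Suc j) \<in> D"
  shows "finite (garnir D i j)" "card (garnir D i j) = Suc (collen D j)"
proof -
  have l: "i < collen D j" "i < collen D (Suc j)" using assms collen_iff by auto
  have G: "garnir D i j = (\<lambda>i'. (i', j)) ` {i..<collen D j} \<union> (\<lambda>i'. (i', Suc j)) ` {..i}"
  proof (rule set_eqI)
    fix c :: box
    obtain i1 j1 where c: "c = (i1, j1)" by (cases c)
    show "c \<in> garnir D i j \<longleftrightarrow> c \<in> (\<lambda>i'. (i', j)) ` {i..<collen D j} \<union> (\<lambda>i'. (i', Suc j)) ` {..i}"
      using l by (auto simp: c garnir_def collen_iff[OF assms(1)])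
  qed
  show "finite (garnir D i j)" unfolding G by simp
  show "card (garnir D i j) = Suc (collen D j)" unfolding G
    by (subst card_Un_disjoint) (use l in \<open>auto simp: card_image inj_on_def\<close>)
qed

lemma collen_antimono: "shape D \<Longrightarrow> collen D (Suc j) \<le> collen D j"
proof (rule ccontr)
  assume D: "shape D" and "\<not> collen D (Suc j) \<le> collen D j"
  hence "(collen D j, Suc j) \<in> D" by (simp add: collen_iff)
  hence "(collen D j, j) \<in> D" using D ferrersD[of D "collen D j" "Suc j" "collen D j" j] by (simp add: shape_def)
  thus False using D by (simp add: collen_iff)
qed

text \<open>
  Each element of the column stabilizer permutes the entries of the columns of \<open>T\<close>. Since
  there are more Garnir boxes than rows in their two columns, two Garnir entries end up in the
  same row, and the antisymmetriser annihilates the corresponding row orbit sum.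
\<close>

lemma specht_garnir:
  assumes M: "tab D M" and T: "inj_on T D" and ij: "(i, j) \<in> D" "(i, Suc j) \<in> D"
  shows "antisymmetrize {\<sigma>. \<sigma> permutes T ` garnir D i j} (specht_poly D M T) = 0"
proof -
  have D: "shape D" using M by (simp add: tab_def)
  let ?H = "T ` garnir D i j"
  note G = card_garnir[OF D ij]
  have C: "fin_perm_group {\<sigma>. \<sigma> permutes ?H}" using G by (intro fin_perm_group_permutes) auto
  note h = antisymmetrize_hom[OF C]
  have "antisymmetrize {\<sigma>. \<sigma> permutes ?H} (ind_poly (orb D M (\<tau> \<circ> T))) = 0" if \<tau>: "\<tau> \<in> col_stab D T" for \<tau>
  proof -
    have b: "bij \<tau>" using col_stab_bij[OF \<tau>] .
    have iT: "inj_on (\<tau> \<circ> T) D" using b T by (meson bij_is_inj comp_inj_on inj_on_subset subset_UNIV)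
    have Cg: "fin_perm_group (col_stab D T)" by (rule col_stab_group[OF D T])
    have ex: "\<exists>e\<in>D. snd e = snd c \<and> (\<tau> \<circ> T) e = T c" if c: "c \<in> D" for c
    proof -
      from col_stab_D[OF fin_perm_group_inv[OF Cg \<tau>] c] obtain e where e: "e \<in> D" "snd e = snd c" "inv \<tau> (T c) = T e" .
      thus ?thesis using b by (metis bij_inv_eq_iff comp_apply)
    qed
    \<comment> \<open>The row in which \<open>\<tau> \<circ> T\<close> contains the entry \<open>T c\<close>; the column is that of \<open>c\<close>.\<close>
    define r where "r c = fst (SOME e. e \<in> D \<and> snd e = snd c \<and> (\<tau> \<circ> T) e = T c)" for c
    have r: "(r c, snd c) \<in> D \<and> (\<tau> \<circ> T) (r c, snd c) = T c" if "c \<in> D" for c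
    proof -
      define e where "e = (SOME e. e \<in> D \<and> snd e = snd c \<and> (\<tau> \<circ> T) e = T c)"
      have "e \<in> D \<and> snd e = snd c \<and> (\<tau> \<circ> T) e = T c" unfolding e_def by (rule someI_ex) (use ex[OF that] in blast)
      moreover have "r c = fst e" by (simp add: r_def e_def)
      ultimately show ?thesis by (metis prod.collapse)
    qed
    have "r ` garnir D i j \<subseteq> {..<collen D j}"
    proof
      fix x assume "x \<in> r ` garnir D i j"
      then obtain c where c: "c \<in> garnir D i j" "x = r c" by auto
      have "c \<in> D" "snd c = j \<or> snd c = Suc j" using c by (auto simp: garnir_def)
      hence "x < collen D j \<or> x < collen D (Suc j)" using r[of c] c(2) collen_iff[OF D, of "r c" "snd c"] by auto
      thus "x \<in> {..<collen D j}" using collen_antimono[OF D, of j] by auto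
    qed
    hence "card (r ` garnir D i j) \<le> collen D j" using card_mono[of "{..<collen D j}"] by simp
    hence "\<not> inj_on r (garnir D i j)" using pigeonhole[of r "garnir D i j"] G by simp
    then obtain c c' where c: "c \<in> garnir D i j" "c' \<in> garnir D i j" "c \<noteq> c'" "r c = r c'" by (auto simp: inj_on_def)
    have cD: "c \<in> D" "c' \<in> D" using c garnir_subset by auto
    have ne: "T c \<noteq> T c'" using c cD T by (auto dest: inj_onD)
    have tr: "transpose (T c) (T c') \<in> row_stab D (\<tau> \<circ> T)"
      using transpose_row_stab[OF _ _ _ iT, of "(r c, snd c)" "(r c', snd c')"] r[OF cD(1)] r[OF cD(2)] c(4) by simp
    show ?thesis
    proof (rule antisymmetrize_eq_0[OF C _ ne])
      show "transpose (T c) (T c') \<in> {\<sigma>. \<sigma> permutes ?H}" using c by (auto intro: permutes_swap_id)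
      show "poly_act (transpose (T c) (T c')) (ind_poly (orb D M (\<tau> \<circ> T))) = ind_poly (orb D M (\<tau> \<circ> T))"
        by (simp add: poly_act_ind_poly mono_act_orb[OF tr])
    qed
  qed
  moreover have "specht_poly D M T = (\<Sum>\<tau>\<in>col_stab D T. qscale (of_int (sign \<tau>)) (ind_poly (orb D M (\<tau> \<circ> T))))"
    unfolding specht_poly_eq antisymmetrize_def
    by (intro sum.cong refl) (simp add: poly_act_ind_poly[OF col_stab_bij] orb_act[OF col_stab_bij M T])
  ultimately show ?thesis
    by (simp add: module_hom.sum[OF h] module_hom.scale[OF h])
qed

lemma sum_permutes_transfer:
  assumes "inj_on T G" "finite G"
  shows "(\<Sum>\<sigma>\<in>{\<sigma>. \<sigma> permutes G}. f (sign \<sigma>) (map_permutation G T \<sigma>)) = (\<Sum>\<pi>\<in>{\<pi>. \<pi> permutes T ` G}. f (sign \<pi>) \<pi>)"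
proof -
  have bij: "bij_betw (map_permutation G T) {\<sigma>. \<sigma> permutes G} {\<pi>. \<pi> permutes T ` G}"
    using bij_betw_permutations[OF inj_on_imp_bij_betw[OF assms(1)]]
    by (simp add: map_permutation_def[abs_def] restrict_id_def comp_def)
  show ?thesis
    by (subst sum.reindex_bij_betw[OF bij, symmetric]) (auto intro!: sum.cong simp: sign_map_permutation[OF assms(1) _ assms(2)])
qed

text \<open>
  A permutation \<open>\<sigma>\<close> of some boxes corresponds to the permutation \<open>map_permutation G T \<sigma>\<close> of
  their entries.
\<close>

lemma filling_permute:
  assumes T: "inj_on T D" and G: "G \<subseteq> D" and \<sigma>: "\<sigma> permutes G" and c: "c \<in> D"
  shows "map_permutation G T \<sigma> (T c) = T (\<sigma> c)"
proof (cases "c \<in> G")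
  case True
  thus ?thesis using map_permutation_apply[OF inj_on_subset[OF T G]] by blast
next
  case False
  hence "T c \<notin> T ` G" unfolding inj_on_image_mem_iff[OF T c G] .
  thus ?thesis using permutes_not_in[OF \<sigma> False] by (simp add: map_permutation_def)
qed

text \<open>
  Straightening of the bijective filling. The values outside of \<open>D\<close> are normalised to \<open>0\<close>, as
  the definition of semi-standard fillings demands.
\<close>

lemma specht_straightening:
  assumes D: "ferrers D" "finite D" and M: "tab D M" and T: "bij_betw T D X" "\<And>c. c \<notin> D \<Longrightarrow> T c = 0"
  shows "specht_poly D M T \<in> qvs.span {specht_poly D M N | N. bij_betw N D X \<and> semistandard D N}"
proof (rule straightening[OF D qvs.subspace_span, where \<N> = "{N. bij_betw N D X \<and> (\<forall>c. c \<notin> D \<longrightarrow> N c = 0)}"])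
  have sh: "shape D" using M by (simp add: tab_def)
  have perm: "specht_poly D M (N \<circ> \<sigma>) = poly_act (map_permutation G N \<sigma>) (specht_poly D M N)"
    if N: "inj_on N D" and G: "G \<subseteq> D" and \<sigma>: "\<sigma> permutes G" for N \<sigma> G
  proof -
    have "map_permutation G N \<sigma> permutes N ` G"
      by (rule map_permutation_permutes[OF inj_on_imp_bij_betw[OF inj_on_subset[OF N G]] \<sigma>])
    from specht_poly_act[OF permutes_bij[OF this] M N]
    show ?thesis using filling_permute[OF N G \<sigma>] specht_poly_cong[of D "N \<circ> \<sigma>" "map_permutation G N \<sigma> \<circ> N" M] by simp
  qed
  fix N assume N: "N \<in> {N. bij_betw N D X \<and> (\<forall>c. c \<notin> D \<longrightarrow> N c = 0)}"
  hence iN: "inj_on N D" by (simp add: bij_betw_def)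
  { fix \<sigma> assume \<sigma>: "\<sigma> permutes D"
    show "N \<circ> \<sigma> \<in> {N. bij_betw N D X \<and> (\<forall>c. c \<notin> D \<longrightarrow> N c = 0)}"
      using N bij_betw_trans[OF permutes_imp_bij[OF \<sigma>]] permutes_not_in[OF \<sigma>] by fastforce }
  { fix c assume "c \<notin> D" thus "N c = 0" using N by blast }
  { fix a b assume a: "a \<in> D" "b \<in> D" "snd a = snd b" "a \<noteq> b"
    have ne: "N a \<noteq> N b" using a iN by (auto dest: inj_onD)
    have "specht_poly D M (N \<circ> transpose a b) = poly_act (transpose (N a) (N b)) (specht_poly D M N)"
      using perm[OF iN subset_refl permutes_swap_id[OF a(1,2)]] by (simp add: map_permutation_transpose[OF iN a(1,2)])
    also have "\<dots> = - specht_poly D M N"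
      using poly_act_antisymmetrize[OF col_stab_group[OF sh iN] transpose_col_stab[OF a(1-3) iN]] ne
      by (simp add: specht_poly_eq sign_swap_id)
    finally show "specht_poly D M (N \<circ> transpose a b) = - specht_poly D M N" . }
  { fix i j assume ij: "(i, j) \<in> D" "(i, Suc j) \<in> D"
    have "(\<Sum>\<sigma>\<in>{\<sigma>. \<sigma> permutes garnir D i j}. qscale (of_int (sign \<sigma>)) (specht_poly D M (N \<circ> \<sigma>)))
        = (\<Sum>\<sigma>\<in>{\<sigma>. \<sigma> permutes garnir D i j}. qscale (of_int (sign \<sigma>)) (poly_act (map_permutation (garnir D i j) N \<sigma>) (specht_poly D M N)))"
      by (intro sum.cong refl) (simp add: perm[OF iN garnir_subset])
    also have "\<dots> = antisymmetrize {\<sigma>. \<sigma> permutes N ` garnir D i j} (specht_poly D M N)"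
      unfolding antisymmetrize_def by (rule sum_permutes_transfer[OF inj_on_subset[OF iN garnir_subset] card_garnir(1)[OF sh ij]])
    also have "\<dots> = 0" by (rule specht_garnir[OF M iN ij])
    finally show "(\<Sum>\<sigma>\<in>{\<sigma>. \<sigma> permutes garnir D i j}. qscale (of_int (sign \<sigma>)) (specht_poly D M (N \<circ> \<sigma>))) = 0" . }
  { assume "semistandard D N"
    thus "specht_poly D M N \<in> qvs.span {specht_poly D M N | N. bij_betw N D X \<and> semistandard D N}"
      using N by (intro qvs.span_base) auto }
qed (use T in auto)

section \<open>The modules of infinite shape\<close>

text \<open>
  The span of \<open>F\<^bsub>M,T\<^esub>\<close> for all bijective fillings, standard or not. In contrast to the span over
  the standard fillings it is obviously invariant.
\<close>

definition V_all :: "diagram \<Rightarrow> (box \<Rightarrow> nat) \<Rightarrow> qpoly set" where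
  "V_all D M = qvs.span {specht_poly D M T | T. bij_betw T D {1..}}"

text \<open>
  A finite diagram with its first row continued to infinity.
\<close>

definition inf_shape :: "diagram \<Rightarrow> diagram" where
  "inf_shape D = D \<union> {c. fst c = 0}"

text \<open>
  The continuation of a bijective filling of a finite diagram by \<open>{1..card D}\<close>. The boxes
  added to the first row get the remaining numbers in increasing order: box \<open>(0, j)\<close> is
  preceded by \<open>j\<close> boxes in the first row and by the finite part.
\<close>

definition inf_filling :: "diagram \<Rightarrow> (box \<Rightarrow> nat) \<Rightarrow> box \<Rightarrow> nat" where
  "inf_filling D T c = (if c \<in> D then T c else snd c + card (fin_part D) + 1)"

lemma fin_part_inf_shape: "fin_part (inf_shape D) = fin_part D"
  by (auto simp: fin_part_def inf_shape_def)

lemma partition_infty_inf_shape: "ferrers D \<Longrightarrow> finite D \<Longrightarrow> partition_infty (inf_shape D)"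
  unfolding partition_infty_def fin_part_inf_shape
  by (auto simp: ferrers_def inf_shape_def fin_part_def)

lemma row0:
  assumes "ferrers D" "finite D"
  shows "(0, j) \<in> D \<longleftrightarrow> j < rowlen D 0" "card D = rowlen D 0 + card (fin_part D)"
proof -
  show "(0, j) \<in> D \<longleftrightarrow> j < rowlen D 0" using rowlen_iff[OF assms(1)] assms(2) by simp
  have "D = {c \<in> D. fst c = 0} \<union> fin_part D" by (auto simp: fin_part_def)
  hence "card D = card ({c \<in> D. fst c = 0} \<union> fin_part D)" by simp
  also have "\<dots> = rowlen D 0 + card (fin_part D)"
    unfolding rowlen_def using assms by (intro card_Un_disjoint) (auto simp: fin_part_def)
  finally show "card D = rowlen D 0 + card (fin_part D)" .
qed

lemma inf_filling_bij:
  assumes D: "ferrers D" "finite D" and T: "bij_betw T D {1..card D}"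
  shows "bij_betw (inf_filling D T) (inf_shape D) {1..}"
proof -
  let ?r = "rowlen D 0" and ?f = "card (fin_part D)"
  note r = row0[OF D]
  have e: "inf_shape D - D = (\<lambda>j. (0, j)) ` {?r..}"
  proof (rule set_eqI)
    fix c :: box
    obtain i j where c: "c = (i, j)" by (cases c)
    show "c \<in> inf_shape D - D \<longleftrightarrow> c \<in> (\<lambda>j. (0, j)) ` {?r..}"
      using r(1)[of j] by (auto simp: inf_shape_def c)
  qed
  have f: "inf_filling D T (0, j) = j + ?f + 1" if "j \<ge> ?r" for j
    using that r(1)[of j] by (simp add: inf_filling_def)
  have "bij_betw (inf_filling D T) (inf_shape D - D) {card D + 1..}"
    unfolding e
  proof (rule bij_betw_byWitness[where f' = "\<lambda>x. (0, x - ?f - 1)"])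
    show "\<forall>a\<in>Pair 0 ` {?r..}. (0, inf_filling D T a - ?f - 1) = a" by (auto simp: f)
    show "\<forall>a'\<in>{card D + 1..}. inf_filling D T (0, a' - ?f - 1) = a'"
    proof
      fix x assume "x \<in> {card D + 1..}"
      hence "x - ?f - 1 \<ge> ?r" "x \<ge> ?f + 1" using r(2) by auto
      thus "inf_filling D T (0, x - ?f - 1) = x" using f by simp
    qed
    show "inf_filling D T ` Pair 0 ` {?r..} \<subseteq> {card D + 1..}" using r(2) by (auto simp: f)
    show "(\<lambda>x. (0, x - ?f - 1)) ` {card D + 1..} \<subseteq> Pair 0 ` {?r..}" using r(2) by auto
  qed
  moreover have "bij_betw (inf_filling D T) D {1..card D}"
    using T by (rule bij_betw_cong[THEN iffD1, rotated]) (simp add: inf_filling_def)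
  ultimately have "bij_betw (inf_filling D T) (D \<union> (inf_shape D - D)) ({1..card D} \<union> {card D + 1..})"
    by (intro bij_betw_combine) auto
  moreover have "D \<union> (inf_shape D - D) = inf_shape D" by (auto simp: inf_shape_def)
  moreover have "{1..card D} \<union> {card D + 1..} = {1..}" by auto
  ultimately show ?thesis by simp
qed

lemma inf_filling_standard:
  assumes D: "ferrers D" "finite D" and T: "bij_betw T D {1..card D}" and ss: "semistandard D T"
  shows "inf_filling D T \<in> standard_infty (inf_shape D)"
proof -
  note r = row0[OF D] and b = inf_filling_bij[OF D T]
  have i: "inj_on T D" using T by (simp add: bij_betw_def)
  have le: "T c \<le> card D" if "c \<in> D" for c using bij_betw_apply[OF T that] by simp
  have row: "inf_filling D T (i, j) < inf_filling D T (i, j')"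
    if c: "(i, j) \<in> inf_shape D" "(i, j') \<in> inf_shape D" "j < j'" for i j j'
  proof (cases "(i, j') \<in> D")
    case True
    hence d: "(i, j) \<in> D" using ferrersD[OF D(1) True, of i j] c by simp
    have "T (i, j) \<le> T (i, j')" using ss d True c(3) by (auto simp: semistandard_def)
    moreover have "T (i, j) \<noteq> T (i, j')" using inj_onD[OF i _ d True] c(3) by auto
    ultimately show ?thesis using d True by (simp add: inf_filling_def)
  next
    case False
    hence i0: "i = 0" using c by (simp add: inf_shape_def)
    show ?thesis
    proof (cases "(i, j) \<in> D")
      case True
      thus ?thesis using False le[OF True] r i0 by (simp add: inf_filling_def)
    next
      case False
      thus ?thesis using \<open>(i, j') \<notin> D\<close> c by (simp add: inf_filling_def)
    qed
  qed
  have col: "inf_filling D T (i, j) < inf_filling D T (i', j)"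
    if c: "(i, j) \<in> inf_shape D" "(i', j) \<in> inf_shape D" "i < i'" for i i' j
  proof -
    have d': "(i', j) \<in> D" using c by (auto simp: inf_shape_def)
    hence d: "(i, j) \<in> D" using ferrersD[OF D(1) d', of i j] c by simp
    have "T (i, j) < T (i', j)" using ss d d' c(3) by (auto simp: semistandard_def)
    thus ?thesis using d d' by (simp add: inf_filling_def)
  qed
  show ?thesis unfolding standard_infty_def using b row col by blast
qed

lemma specht_poly_inf_shape:
  assumes D: "ferrers D" "finite D" and T: "bij_betw T D {1..card D}" and M: "tab D M" "\<And>j. M (0, j) = 0"
  shows "specht_poly (inf_shape D) M (inf_filling D T) = specht_poly D M T" "tab (inf_shape D) M"
proof -
  have sh: "shape D" using M by (simp add: tab_def)
  show t: "tab (inf_shape D) M"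
    using partition_infty_shape[OF partition_infty_inf_shape[OF D]] M by (auto simp: tab_def inf_shape_def)
  show "specht_poly (inf_shape D) M (inf_filling D T) = specht_poly D M T"
  proof (rule specht_poly_long[OF t M(1) _ _ M(2) fin_part_inf_shape])
    show "inj_on (inf_filling D T) (inf_shape D)" using inf_filling_bij[OF D T] by (simp add: bij_betw_def)
    show "inj_on T D" using T by (simp add: bij_betw_def)
    fix c assume "c \<in> long (inf_shape D)"
    hence "c \<in> D" using fin_part_eq_long[OF _ sh fin_part_inf_shape] t long_subset[of D] by (auto simp: tab_def)
    thus "inf_filling D T c = T c" by (simp add: inf_filling_def)
  qed
qed

text \<open>
  An infinite diagram whose first row is cut off such that \<open>n\<close> boxes and all columns of length
  at least 2 remain.
\<close>

lemma truncate_shape: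
  assumes D: "partition_infty D" and n: "n \<ge> card (fin_part D)" "\<And>c. c \<in> long D \<Longrightarrow> snd c < n - card (fin_part D)"
  defines "D' \<equiv> fin_part D \<union> {0} \<times> {..<n - card (fin_part D)}"
  shows "ferrers D'" "finite D'" "card D' = n" "inf_shape D' = D" "fin_part D' = fin_part D" "long D \<subseteq> D'"
proof -
  have sh: "shape D" by (rule partition_infty_shape[OF D])
  have finf: "finite (fin_part D)" using D by (simp add: partition_infty_def)
  show fin: "finite D'" using finf by (simp add: D'_def)
  show fp: "fin_part D' = fin_part D" by (auto simp: D'_def fin_part_def)
  show lD: "long D \<subseteq> D'"
  proof
    fix c assume c: "c \<in> long D"
    show "c \<in> D'"
    proof (cases "fst c = 0")
      case True thus ?thesis using n(2)[OF c] by (cases c) (simp add: D'_def)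
    next
      case False thus ?thesis using c by (cases c) (simp add: D'_def fin_part_def long_def)
    qed
  qed
  show "ferrers D'" unfolding ferrers_def
  proof (intro allI impI)
    fix i j i' j' assume a: "(i, j) \<in> D'" "i' \<le> i" "j' \<le> j"
    show "(i', j') \<in> D'"
    proof (cases "i = 0")
      case True thus ?thesis using a by (auto simp: D'_def fin_part_def)
    next
      case False
      hence f: "(i, j) \<in> fin_part D" using a by (auto simp: D'_def)
      show ?thesis
      proof (cases "i' = 0")
        case True
        have "j < n - card (fin_part D)" using n(2)[OF fin_part_long[OF sh f]] by simp
        thus ?thesis using True a by (simp add: D'_def)
      next
        case False
        hence "(i', j') \<in> fin_part D" using f a D ferrersD[of D i j i' j'] by (auto simp: fin_part_def partition_infty_def)
        thus ?thesis by (simp add: D'_def)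
      qed
    qed
  qed
  have "fin_part D \<inter> {0} \<times> {..<n - card (fin_part D)} = {}" by (auto simp: fin_part_def)
  thus "card D' = n" unfolding D'_def using finf n(1) by (subst card_Un_disjoint) (auto simp: card_cartesian_product)
  show "inf_shape D' = D"
  proof (rule set_eqI)
    fix c :: box
    show "c \<in> inf_shape D' \<longleftrightarrow> c \<in> D"
      using D by (cases c) (auto simp: inf_shape_def D'_def fin_part_def partition_infty_def)
  qed
qed

lemma infinite_tab_first_row: "partition_infty D \<Longrightarrow> tab D M \<Longrightarrow> M (0, j) = 0"
proof -
  assume a: "partition_infty D" "tab D M"
  have "infinite D"
  proof
    assume "finite D"
    moreover have "range (\<lambda>j. (0, j)) \<subseteq> D" using a by (auto simp: partition_infty_def)
    ultimately have "finite (range (\<lambda>j::nat. (0::nat, j)))" by (rule rev_finite_subset)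
    hence "finite (UNIV :: nat set)" by (rule finite_imageD) (auto simp: inj_on_def)
    thus False by simp
  qed
  thus ?thesis using a by (auto simp: tab_def)
qed

lemma finite_filling_ex:
  assumes L: "L \<subseteq> D'" "finite D'" "T ` L \<subseteq> {1..card D'}" "inj_on T L"
  shows "\<exists>T'. bij_betw T' D' {1..card D'} \<and> (\<forall>c\<in>L. T' c = T c) \<and> (\<forall>c. c \<notin> D' \<longrightarrow> T' c = 0)"
proof -
  have "card (D' - L) = card ({1..card D'} - T ` L)"
    using L card_image[OF L(4)] by (simp add: card_Diff_subset finite_subset[OF L(1,2)])
  then obtain g where g: "bij_betw g (D' - L) ({1..card D'} - T ` L)"
    using L(2) finite_same_card_bij[of "D' - L"] by auto
  define T' where "T' c = (if c \<in> L then T c else if c \<in> D' then g c else 0)" for c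
  have "bij_betw T' L (T ` L)" using inj_on_imp_bij_betw[OF L(4)]
    by (rule bij_betw_cong[THEN iffD1, rotated]) (simp add: T'_def)
  moreover have "bij_betw T' (D' - L) ({1..card D'} - T ` L)" using g
    by (rule bij_betw_cong[THEN iffD1, rotated]) (simp add: T'_def)
  ultimately have "bij_betw T' (L \<union> (D' - L)) (T ` L \<union> ({1..card D'} - T ` L))"
    by (rule bij_betw_combine) auto
  moreover have "L \<union> (D' - L) = D'" "T ` L \<union> ({1..card D'} - T ` L) = {1..card D'}" using L by auto
  ultimately have "bij_betw T' D' {1..card D'}" by simp
  moreover have "\<forall>c. c \<notin> D' \<longrightarrow> T' c = 0" using L(1) by (auto simp: T'_def)
  ultimately show ?thesis by (intro exI[of _ T']) (simp add: T'_def)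
qed

text \<open>
  Straightening in a large finite diagram expresses \<open>F\<^bsub>M,T\<^esub>\<close> through standard fillings.
\<close>

lemma V_infty_eq:
  assumes D: "partition_infty D" and M: "tab D M"
  shows "V_infty D M = V_all D M"
proof (rule antisym)
  show "V_infty D M \<subseteq> V_all D M" unfolding V_infty_def V_all_def
    by (rule qvs.span_mono) (auto simp: standard_infty_def)
  have z: "M (0, j) = 0" for j using infinite_tab_first_row[OF D M] .
  have "specht_poly D M T \<in> V_infty D M" if T: "bij_betw T D {1..}" for T
  proof -
    have iT: "inj_on T D" using T by (simp add: bij_betw_def)
    have sh: "shape D" by (rule partition_infty_shape[OF D])
    have fl: "finite (long D)" by (rule finite_long[OF sh])
    \<comment> \<open>Large enough for the long columns and their entries\<close>
    define n where "n = card (fin_part D) + (\<Sum>c\<in>long D. Suc (snd c)) + (\<Sum>c\<in>long D. T c)"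
    have n1: "n \<ge> card (fin_part D)" by (simp add: n_def)
    have n2: "snd c < n - card (fin_part D)" if "c \<in> long D" for c
      using member_le_sum[OF that, of "\<lambda>c. Suc (snd c)"] fl by (simp add: n_def)
    have n3: "T c \<le> n" if "c \<in> long D" for c
      using member_le_sum[OF that, of T] fl by (simp add: n_def)
    define D' where "D' = fin_part D \<union> {0} \<times> {..<n - card (fin_part D)}"
    note D' = truncate_shape[OF D n1 n2, folded D'_def]
    have T1: "T ` long D \<subseteq> {1..card D'}"
    proof
      fix x assume "x \<in> T ` long D"
      then obtain c where c: "c \<in> long D" "x = T c" by blast
      have "T c \<in> {1..}" using c long_subset by (intro bij_betw_apply[OF T]) auto
      thus "x \<in> {1..card D'}" using n3[OF c(1)] c D'(3) by simp
    qed
    obtain T' where T': "bij_betw T' D' {1..card D'}" "\<And>c. c \<in> long D \<Longrightarrow> T' c = T c" "\<And>c. c \<notin> D' \<Longrightarrow> T' c = 0"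
      using finite_filling_ex[OF D'(6,2) T1 inj_on_subset[OF iT long_subset]] by blast
    have M': "tab D' M"
    proof -
      have "M c = 0" if "c \<notin> D'" for c
      proof (cases "c \<in> D")
        case True
        hence "fst c = 0" using that by (auto simp: D'_def fin_part_def)
        thus ?thesis using z by (cases c) simp
      next
        case False thus ?thesis using M unfolding tab_def by blast
      qed
      thus ?thesis using D'(1,2,5) sh by (simp add: tab_def shape_def)
    qed
    have "specht_poly D M T = specht_poly D' M T'"
      by (rule specht_poly_long[OF M M' iT _ z D'(5)[symmetric]]) (use T' in \<open>auto simp: bij_betw_def\<close>)
    also have "\<dots> \<in> qvs.span {specht_poly D' M N | N. bij_betw N D' {1..card D'} \<and> semistandard D' N}"
      by (rule specht_straightening[OF D'(1,2) M' T'(1,3)])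
    also have "\<dots> \<subseteq> V_infty D M" unfolding V_infty_def
    proof (rule qvs.span_mono, clarify)
      fix N assume N: "bij_betw N D' {1..card D'}" "semistandard D' N"
      show "\<exists>T. specht_poly D' M N = specht_poly D M T \<and> T \<in> standard_infty D"
        using specht_poly_inf_shape(1)[OF D'(1,2) N(1) M' z] inf_filling_standard[OF D'(1,2) N] D'(4) by metis
    qed
    finally show ?thesis .
  qed
  thus "V_all D M \<subseteq> V_infty D M" unfolding V_all_def V_infty_def
    by (intro qvs.span_minimal qvs.subspace_span) auto
qed

section \<open>Irreducibility\<close>

text \<open>
  Linear subspaces stable under \<open>G\<close>.
\<close>

definition inv_sub :: "(nat \<Rightarrow> nat) set \<Rightarrow> qpoly set \<Rightarrow> bool" where
  "inv_sub G U \<longleftrightarrow> qvs.subspace U \<and> (\<forall>g\<in>G. \<forall>u\<in>U. poly_act g u \<in> U)"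

lemma inv_subI: "qvs.subspace U \<Longrightarrow> (\<And>g u. g \<in> G \<Longrightarrow> u \<in> U \<Longrightarrow> poly_act g u \<in> U) \<Longrightarrow> inv_sub G U"
  by (simp add: inv_sub_def)

lemma inv_sub_span:
  assumes "\<And>g. g \<in> G \<Longrightarrow> bij g" "\<And>g s. g \<in> G \<Longrightarrow> s \<in> S \<Longrightarrow> poly_act g s \<in> qvs.span S"
  shows "inv_sub G (qvs.span S)"
proof (rule inv_subI[OF qvs.subspace_span])
  fix g u assume g: "g \<in> G" and u: "u \<in> qvs.span S"
  note h = poly_act_hom[OF assms(1)[OF g]]
  show "poly_act g u \<in> qvs.span S" using u
  proof (induction rule: qvs.span_induct_alt)
    case base thus ?case by (simp add: module_hom.zero[OF h] qvs.span_zero)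
  next
    case (step c x y)
    thus ?case by (simp add: module_hom.add[OF h] module_hom.scale[OF h] qvs.span_add qvs.span_scale assms(2)[OF g])
  qed
qed

lemma S_N_bij: "g \<in> S_N \<Longrightarrow> bij g" by (auto simp: S_N_def permutes_bij)

lemma S_infty_subset: "S_infty \<subseteq> S_N"
  by (auto simp: S_infty_def S_N_def intro: permutes_subset)

lemma V_all_inv:
  assumes G: "G \<subseteq> S_N" and M: "tab D M"
  shows "inv_sub G (V_all D M)"
  unfolding V_all_def
proof (rule inv_sub_span)
  show "bij g" if "g \<in> G" for g using that G S_N_bij by blast
  fix g s assume g: "g \<in> G" and s: "s \<in> {specht_poly D M T |T. bij_betw T D {1..}}"
  obtain T where T: "s = specht_poly D M T" "bij_betw T D {1..}" using s by blast
  have gp: "g permutes {1..}" using g G by (auto simp: S_N_def)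
  have "poly_act g s = specht_poly D M (g \<circ> T)"
    using specht_poly_act[OF permutes_bij[OF gp] M, of T] T by (simp add: bij_betw_def)
  moreover have "bij_betw (g \<circ> T) D {1..}" by (rule bij_betw_trans[OF T(2) permutes_imp_bij[OF gp]])
  ultimately show "poly_act g s \<in> qvs.span {specht_poly D M T |T. bij_betw T D {1..}}"
    by (intro qvs.span_base) blast
qed

text \<open>
  Although two bijective fillings need not differ by an element of \<open>S_infty\<close>, their Specht
  polynomials do, since these depend only on the finitely many entries in the columns of
  length at least 2.
\<close>

lemma S_infty_transitive:
  assumes D: "partition_infty D" and M: "tab D M" and T: "bij_betw T D {1..}" "bij_betw T' D {1..}"
  shows "\<exists>g\<in>S_infty. specht_poly D M T' = poly_act g (specht_poly D M T)"
proof -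
  have iT: "inj_on T D" "inj_on T' D" using T by (auto simp: bij_betw_def)
  have sh: "shape D" by (rule partition_infty_shape[OF D])
  let ?L = "long D"
  have fl: "finite ?L" by (rule finite_long[OF sh])
  have iL: "inj_on T ?L" "inj_on T' ?L" using iT long_subset by (auto intro: inj_on_subset)
  have pos: "T c \<ge> 1" "T' c \<ge> 1" if "c \<in> ?L" for c
    using bij_betw_apply[OF T(1) subsetD[OF long_subset that]] bij_betw_apply[OF T(2) subsetD[OF long_subset that]] by simp_all
  define n where "n = (\<Sum>c\<in>?L. T c) + (\<Sum>c\<in>?L. T' c)"
  have sub: "T ` ?L \<subseteq> {1..n}" "T' ` ?L \<subseteq> {1..n}"
    using pos member_le_sum[of _ ?L T] member_le_sum[of _ ?L T'] fl by (fastforce simp: n_def)+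
  have "card ({1..n} - T ` ?L) = card ({1..n} - T' ` ?L)"
    using sub card_image[OF iL(1)] card_image[OF iL(2)] fl by (simp add: card_Diff_subset)
  then obtain h where h: "bij_betw h ({1..n} - T ` ?L) ({1..n} - T' ` ?L)"
    using finite_same_card_bij[of "{1..n} - T ` ?L"] by auto
  define g where "g x = (if x \<in> T ` ?L then T' (inv_into ?L T x) else if x \<in> {1..n} then h x else x)" for x
  have gT: "g (T c) = T' c" if "c \<in> ?L" for c using that iL by (simp add: g_def)
  have "bij_betw (T' \<circ> inv_into ?L T) (T ` ?L) (T' ` ?L)"
    by (rule bij_betw_trans[OF bij_betw_inv_into[OF inj_on_imp_bij_betw[OF iL(1)]] inj_on_imp_bij_betw[OF iL(2)]])
  hence "bij_betw g (T ` ?L) (T' ` ?L)"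
    by (rule bij_betw_cong[THEN iffD1, rotated]) (simp add: g_def)
  moreover have "bij_betw g ({1..n} - T ` ?L) ({1..n} - T' ` ?L)" using h
    by (rule bij_betw_cong[THEN iffD1, rotated]) (simp add: g_def)
  ultimately have "bij_betw g (T ` ?L \<union> ({1..n} - T ` ?L)) (T' ` ?L \<union> ({1..n} - T' ` ?L))"
    by (rule bij_betw_combine) auto
  moreover have "T ` ?L \<union> ({1..n} - T ` ?L) = {1..n}" "T' ` ?L \<union> ({1..n} - T' ` ?L) = {1..n}" using sub by auto
  ultimately have "bij_betw g {1..n} {1..n}" by simp
  hence gp: "g permutes {1..n}" by (rule bij_imp_permutes) (use sub in \<open>auto simp: g_def\<close>)
  have gi: "g permutes {1..}" by (rule permutes_subset[OF gp]) auto
  have "poly_act g (specht_poly D M T) = specht_poly D M (g \<circ> T)"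
    by (rule specht_poly_act[OF permutes_bij[OF gp] M iT(1), symmetric])
  also have "\<dots> = specht_poly D M T'"
  proof (rule specht_poly_long[OF M M _ iT(2) infinite_tab_first_row[OF D M] refl])
    show "inj_on (g \<circ> T) D" using comp_inj_on[OF iT(1) permutes_inj_on[OF gp]] .
    show "(g \<circ> T) c = T' c" if "c \<in> long D" for c using gT[OF that] by simp
  qed
  finally have "specht_poly D M T' = poly_act g (specht_poly D M T)" ..
  moreover have "g \<in> S_infty" unfolding S_infty_def using gp by blast
  ultimately show ?thesis by blast
qed

lemma col_stab_S_infty:
  assumes D: "partition_infty D" and T: "bij_betw T D {1..}"
  shows "col_stab D T \<subseteq> S_infty"
proof
  fix \<sigma> assume s: "\<sigma> \<in> col_stab D T"
  have sh: "shape D" by (rule partition_infty_shape[OF D])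
  have p: "\<sigma> permutes (T ` long D)" using s col_stab_iff[OF sh, of T] T by (simp add: bij_betw_def)
  have fl: "finite (T ` long D)" using finite_long[OF sh] by simp
  have "T ` long D \<subseteq> {1..Max (T ` long D)}"
    using fl bij_betw_apply[OF T] long_subset[of D] by (fastforce simp: subset_iff)
  hence "\<sigma> permutes {1..Max (T ` long D)}" by (rule permutes_subset[OF p])
  thus "\<sigma> \<in> S_infty" by (auto simp: S_infty_def)
qed

text \<open>
  A non-zero element \<open>u\<close> of \<open>V_all D M\<close> is not orthogonal to this space, and its product with
  \<open>F\<^bsub>M,T\<^esub>\<close> is that of its image under the column antisymmetriser with a row orbit sum. So some
  antisymmetriser maps \<open>u\<close> to a non-zero multiple of \<open>F\<^bsub>M,T\<^esub>\<close>, which generates.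
\<close>

lemma V_all_irreducible:
  assumes D: "partition_infty D" and M: "tab D M" and G: "S_infty \<subseteq> G" "G \<subseteq> S_N"
    and U: "inv_sub G U" "U \<subseteq> V_all D M" "U \<noteq> {0}"
  shows "U = V_all D M"
proof -
  have sU: "qvs.subspace U" using U by (simp add: inv_sub_def)
  have sh: "shape D" by (rule partition_infty_shape[OF D])
  have C: "fin_perm_group (col_stab D T)" if "bij_betw T D {1..}" for T
    using col_stab_group[OF sh] that by (simp add: bij_betw_def)
  obtain u where u: "u \<in> U" "u \<noteq> 0" using U(3) qvs.subspace_0[OF sU] by blast
  have "\<exists>T. bij_betw T D {1..} \<and> antisymmetrize (col_stab D T) u \<noteq> 0"
  proof (rule ccontr)
    assume no: "\<not> ?thesis"
    have "qinner u u = 0"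
    proof (rule qinner_span_eq_0)
      show "u \<in> qvs.span {specht_poly D M T |T. bij_betw T D {1..}}" using u U(2) by (auto simp: V_all_def)
      fix s assume "s \<in> {specht_poly D M T |T. bij_betw T D {1..}}"
      then obtain T where T: "s = specht_poly D M T" "bij_betw T D {1..}" by blast
      have "qinner u s = qinner (antisymmetrize (col_stab D T) u) (ind_poly (orb D M T))"
        unfolding T(1) specht_poly_eq qinner_antisymmetrize[OF C[OF T(2)]] ..
      thus "qinner u s = 0" using no T(2) by simp
    qed
    thus False using qinner_self_eq_0 u by blast
  qed
  then obtain T where T: "bij_betw T D {1..}" "antisymmetrize (col_stab D T) u \<noteq> 0" by blast
  obtain s where s: "antisymmetrize (col_stab D T) u = qscale s (specht_poly D M T)"
    using kappa_span[OF D D T(1) order_refl M, of u] u U(2) by (auto simp: V_all_def)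
  have "antisymmetrize (col_stab D T) u \<in> U" unfolding antisymmetrize_def
    using col_stab_S_infty[OF D T(1)] G(1) U(1) u(1)
    by (intro qvs.subspace_sum[OF sU] qvs.subspace_scale[OF sU]) (auto simp: inv_sub_def)
  moreover have "s \<noteq> 0" using s T by auto
  moreover have "qscale (1 / s) (qscale s (specht_poly D M T)) \<in> U"
    by (rule qvs.subspace_scale[OF sU]) (use calculation s in simp)
  ultimately have F: "specht_poly D M T \<in> U" by simp
  have "specht_poly D M T' \<in> U" if "bij_betw T' D {1..}" for T'
    using S_infty_transitive[OF D M T(1) that] F U(1) G(1) by (auto simp: inv_sub_def)
  hence "V_all D M \<subseteq> U" unfolding V_all_def by (intro qvs.span_minimal sU) blast
  thus ?thesis using U(2) by blast
qed

lemma ex_filling: "partition_infty D \<Longrightarrow> \<exists>T. bij_betw T D {1::nat..}"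
proof -
  assume D: "partition_infty D"
  define n where "n = card (fin_part D) + (\<Sum>c\<in>long D. Suc (snd c))"
  have n1: "n \<ge> card (fin_part D)" by (simp add: n_def)
  have n2: "snd c < n - card (fin_part D)" if "c \<in> long D" for c
    using member_le_sum[OF that, of "\<lambda>c. Suc (snd c)"] finite_long[OF partition_infty_shape[OF D]] by (simp add: n_def)
  note D' = truncate_shape[OF D n1 n2]
  obtain T where "bij_betw T (fin_part D \<union> {0} \<times> {..<n - card (fin_part D)}) {1..card (fin_part D \<union> {0} \<times> {..<n - card (fin_part D)})}"
    using finite_same_card_bij[OF D'(2), of "{1..card (fin_part D \<union> {0} \<times> {..<n - card (fin_part D)})}"] by auto
  from inf_filling_bij[OF D'(1,2) this] show ?thesis using D'(4) by auto
qed

lemma V_all_nonzero: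
  assumes D: "partition_infty D" and M: "tab D M" "semistandard D M"
  shows "V_all D M \<noteq> {0}"
proof -
  obtain T :: "box \<Rightarrow> nat" where T: "bij_betw T D {1..}" using ex_filling[OF D] by blast
  have "lookup (specht_poly D M T) (tab_mono D M T) = 1"
    using lookup_specht_triangular[OF M(1) M(1) _ M(2) M(2)] T by (simp add: bij_betw_def)
  hence "specht_poly D M T \<noteq> 0" by auto
  moreover have "specht_poly D M T \<in> V_all D M" unfolding V_all_def using T by (intro qvs.span_base) blast
  ultimately show ?thesis by blast
qed

section \<open>Sums over monomials which extend a given one\<close>

text \<open>
  \<open>q\<close> arises from \<open>p\<close> by deleting some variables, with their exponents.
\<close>

definition submono :: "monomial \<Rightarrow> monomial \<Rightarrow> bool" where
  "submono q p \<longleftrightarrow> (\<forall>x\<in>keys q. lookup q x = lookup p x)"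

text \<open>
  The sum of the coefficients of \<open>F\<close> at all monomials that extend \<open>q\<close>. As a function of \<open>q\<close> it
  gives the coefficients of the image of \<open>F\<close> under the map that sends each monomial to the sum
  of its submonomials.
\<close>

definition ext_sum :: "qpoly \<Rightarrow> monomial \<Rightarrow> rat" where
  "ext_sum F q = (\<Sum>p\<in>{p \<in> keys F. submono q p}. lookup F p)"

text \<open>
  The polynomials whose image under this map has only terms in at least \<open>j\<close> variables.
\<close>

definition ext_kernel :: "nat \<Rightarrow> qpoly set" where
  "ext_kernel j = {F. \<forall>q. card (keys q) < j \<longrightarrow> ext_sum F q = 0}"

lemma ext_sum_superset: "finite A \<Longrightarrow> keys F \<subseteq> A \<Longrightarrow> ext_sum F q = (\<Sum>p\<in>{p \<in> A. submono q p}. lookup F p)"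
  unfolding ext_sum_def by (rule sum.mono_neutral_left) (auto simp: in_keys_iff)

lemma ext_sum_add: "ext_sum (F + H) q = ext_sum F q + ext_sum H q"
proof -
  let ?A = "keys F \<union> keys H"
  have k: "keys (F + H) \<subseteq> ?A" by (rule Poly_Mapping.keys_add)
  show ?thesis
    using ext_sum_superset[of ?A F q] ext_sum_superset[of ?A H q] ext_sum_superset[OF _ k, of q]
    by (simp add: lookup_add sum.distrib)
qed

lemma ext_sum_scale: "ext_sum (qscale c F) q = c * ext_sum F q"
proof -
  have k: "keys (qscale c F) \<subseteq> keys F" by (auto simp: in_keys_iff)
  show ?thesis using ext_sum_superset[OF _ k, of q] by (simp add: ext_sum_def sum_distrib_left)
qed

lemma ext_sum_0 [simp]: "ext_sum 0 q = 0" by (simp add: ext_sum_def)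

lemma ext_sum_sum: "ext_sum (sum f A) q = (\<Sum>a\<in>A. ext_sum (f a) q)"
  by (induction A rule: infinite_finite_induct) (simp_all add: ext_sum_add)

lemma submono_act: "bij \<sigma> \<Longrightarrow> submono q (mono_act \<sigma> p) \<longleftrightarrow> submono (mono_act (inv \<sigma>) q) p"
proof -
  assume b: "bij \<sigma>"
  have bi: "bij (inv \<sigma>)" by (rule bij_imp_bij_inv[OF b])
  have "submono (mono_act (inv \<sigma>) q) p \<longleftrightarrow> (\<forall>x\<in>keys q. lookup q x = lookup p (inv \<sigma> x))"
    by (simp add: submono_def keys_mono_act[OF bi] lookup_mono_act_image[OF bi])
  thus ?thesis by (simp add: submono_def lookup_mono_act[OF b])
qed

lemma ext_sum_act:
  assumes b: "bij \<sigma>"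
  shows "ext_sum (poly_act \<sigma> F) q = ext_sum F (mono_act (inv \<sigma>) q)"
proof -
  have e: "{p \<in> keys (poly_act \<sigma> F). submono q p} = mono_act \<sigma> ` {p \<in> keys F. submono (mono_act (inv \<sigma>) q) p}"
    unfolding keys_poly_act[OF b] using submono_act[OF b, of q] by blast
  show ?thesis unfolding ext_sum_def e
    by (subst sum.reindex[OF inj_on_subset[OF mono_act_inj[OF b]]]) (simp_all add: lookup_poly_act[OF b] b)
qed

lemma ext_kernel_subspace: "qvs.subspace (ext_kernel j)"
  by (rule qvs.subspaceI) (auto simp: ext_kernel_def ext_sum_add ext_sum_scale)

lemma card_keys_act: "bij \<sigma> \<Longrightarrow> card (keys (mono_act \<sigma> q)) = card (keys q)"
  using card_image[OF inj_on_subset[OF bij_is_inj subset_UNIV]] by (simp add: keys_mono_act)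

lemma ext_kernel_act: "bij \<sigma> \<Longrightarrow> F \<in> ext_kernel j \<Longrightarrow> poly_act \<sigma> F \<in> ext_kernel j"
  by (simp add: ext_kernel_def ext_sum_act card_keys_act bij_imp_bij_inv)

lemma polys_in_act:
  assumes "bij \<sigma>" "\<And>m. m \<in> A \<Longrightarrow> mono_act \<sigma> m \<in> A" "F \<in> polys_in A"
  shows "poly_act \<sigma> F \<in> polys_in A"
  using assms by (auto simp: polys_in_def keys_poly_act)

text \<open>
  If \<open>q\<close> has fewer variables than there are boxes in the finite part, then among the entries
  in the columns of length at least 2 there are two in the same column that do not occur in
  \<open>q\<close>. Their transposition fixes \<open>q\<close> and changes the sign of \<open>F\<close>.
\<close>

lemma antisymmetric_ext_kernel:
  assumes D: "shape D" and T: "inj_on T D"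
    and F: "\<And>c c'. c \<in> D \<Longrightarrow> c' \<in> D \<Longrightarrow> snd c = snd c' \<Longrightarrow> c \<noteq> c' \<Longrightarrow> poly_act (transpose (T c) (T c')) F = - F"
  shows "F \<in> ext_kernel (card (fin_part D))"
proof -
  have "ext_sum F q = 0" if q: "card (keys q) < card (fin_part D)" for q
  proof -
    have fl: "finite (long D)" by (rule finite_long[OF D])
    \<comment> \<open>The long boxes whose variable does not occur in \<open>q\<close> are more than the long columns.\<close>
    define Z where "Z = {c \<in> long D. lookup q (T c) = 0}"
    have "\<exists>c\<in>Z. \<exists>c'\<in>Z. c \<noteq> c' \<and> snd c = snd c'"
    proof (rule ccontr)
      assume "\<not> ?thesis"
      hence iZ: "inj_on snd Z" by (auto simp: inj_on_def)
      have fZ: "finite Z" using fl by (simp add: Z_def)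
      have fpl: "fin_part D \<subseteq> long D" using fin_part_long[OF D] by blast
      have "card Z = card (snd ` Z)" using card_image[OF iZ] by simp
      also have "\<dots> \<le> card (snd ` (long D - fin_part D))"
      proof (rule card_mono)
        show "snd ` Z \<subseteq> snd ` (long D - fin_part D)"
        proof
          fix j assume "j \<in> snd ` Z"
          then obtain i where ij: "(i, j) \<in> long D" by (auto simp: Z_def)
          hence "(0, j) \<in> D" using D ferrersD[of D i j 0 j] by (auto simp: long_def shape_def)
          hence "(0, j) \<in> long D - fin_part D" using ij by (auto simp: long_def fin_part_def)
          thus "j \<in> snd ` (long D - fin_part D)" by force
        qed
      qed (use fl in auto)
      also have "\<dots> \<le> card (long D - fin_part D)" using fl by (intro card_image_le) auto
      also have "\<dots> = card (long D) - card (fin_part D)" using fl fpl by (simp add: card_Diff_subset finite_subset)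
      finally have "card Z + card (fin_part D) \<le> card (long D)" using card_mono[OF fl fpl] by linarith
      moreover have "card (long D - Z) = card (long D) - card Z"
        using fZ by (intro card_Diff_subset) (auto simp: Z_def)
      moreover have "card (long D - Z) \<le> card (keys q)"
      proof -
        have "card (long D - Z) = card (T ` (long D - Z))"
          using inj_on_subset[OF T, of "long D - Z"] long_subset by (intro card_image[symmetric]) blast
        also have "\<dots> \<le> card (keys q)" by (rule card_mono) (auto simp: Z_def in_keys_iff)
        finally show ?thesis .
      qed
      ultimately show False using q by linarith
    qed
    then obtain c c' where c: "c \<in> Z" "c' \<in> Z" "c \<noteq> c'" "snd c = snd c'" by blast
    have cD: "c \<in> D" "c' \<in> D" using c long_subset by (auto simp: Z_def)
    let ?t = "transpose (T c) (T c')"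
    have bt: "bij ?t" by simp
    have "mono_act (inv ?t) q = q"
    proof (rule poly_mapping_eqI)
      fix x
      have z: "lookup q (T c) = 0" "lookup q (T c') = 0" using c by (auto simp: Z_def)
      show "lookup (mono_act (inv ?t) q) x = lookup q x"
        using z by (simp add: lookup_mono_act transpose_def)
    qed
    hence "ext_sum F q = ext_sum (poly_act ?t F) q" using ext_sum_act[OF bt, of F q] by simp
    also have "\<dots> = ext_sum (qscale (-1) F) q" using F[OF cD c(4,3)] by simp
    also have "\<dots> = - ext_sum F q" unfolding ext_sum_scale by simp
    finally show ?thesis by simp
  qed
  thus ?thesis by (simp add: ext_kernel_def)
qed

lemma specht_antisym:
  assumes M: "tab D M" and T: "inj_on T D" and \<sigma>: "\<sigma> \<in> col_stab D T"
  shows "poly_act \<sigma> (specht_poly D M T) = qscale (of_int (sign \<sigma>)) (specht_poly D M T)"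
  unfolding specht_poly_eq using M T \<sigma> by (intro poly_act_antisymmetrize col_stab_group) (auto simp: tab_def)

lemma specht_transpose:
  assumes M: "tab D M" and T: "inj_on T D" and c: "c \<in> D" "c' \<in> D" "snd c = snd c'" "c \<noteq> c'"
  shows "poly_act (transpose (T c) (T c')) (specht_poly D M T) = - specht_poly D M T"
proof -
  have "T c \<noteq> T c'" using c T by (auto dest: inj_onD)
  thus ?thesis using specht_antisym[OF M T transpose_col_stab[OF c(1-3) T]] by (simp add: sign_swap_id)
qed

lemma specht_in_ext_kernel: "tab D M \<Longrightarrow> inj_on T D \<Longrightarrow> specht_poly D M T \<in> ext_kernel (card (fin_part D))"
proof -
  assume a: "tab D M" "inj_on T D"
  show ?thesis by (rule antisymmetric_ext_kernel[OF _ a(2) specht_transpose[OF a]]) (use a in \<open>simp add: tab_def\<close>)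
qed

lemma specht_keys:
  assumes M: "tab D M" and T: "inj_on T D" and m: "m \<in> keys (specht_poly D M T)"
  shows "keys m \<subseteq> T ` D" "mono_content m = mono_content (tab_mono D M T)"
proof -
  have C: "fin_perm_group (col_stab D T)" using M T by (intro col_stab_group) (auto simp: tab_def)
  have "lookup (specht_poly D M T) m \<noteq> 0" using m by (simp add: in_keys_iff)
  then obtain \<sigma> where \<sigma>: "\<sigma> \<in> col_stab D T" "lookup (ind_poly (orb D M T)) (mono_act (inv \<sigma>) m) \<noteq> 0"
    unfolding specht_poly_eq lookup_antisymmetrize[OF C] by (metis (no_types, lifting) mult_zero_right sum.neutral)
  have o: "mono_act (inv \<sigma>) m \<in> orb D M T" using \<sigma>(2) lookup_ind_poly[OF finite_orb[OF M T]] by (metis (full_types))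
  have b: "bij \<sigma>" using col_stab_bij[OF \<sigma>(1)] .
  have m: "m = mono_act \<sigma> (mono_act (inv \<sigma>) m)" using b by simp
  have "keys m = \<sigma> ` keys (mono_act (inv \<sigma>) m)" by (subst m) (rule keys_mono_act[OF b])
  also have "\<dots> \<subseteq> \<sigma> ` T ` D" using orb_keys[OF M T o] by (rule image_mono)
  also have "\<dots> = T ` D" using \<sigma>(1) by (simp add: col_stab_def permutes_image)
  finally show "keys m \<subseteq> T ` D" .
  show "mono_content m = mono_content (tab_mono D M T)"
    using orb_content[OF o] mono_content_act[OF bij_imp_bij_inv[OF b]] by simp
qed

section \<open>Polynomials antisymmetric in the columns which satisfy the Garnir relations\<close>

text \<open>
  A triangular system of linear functionals with diagonal entries 1 can be solved. Indices
  with equal values of \<open>s\<close> are allowed, as the matrix is the identity on each such class.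
\<close>

lemma triangular_solve:
  fixes L :: "'i \<Rightarrow> qpoly \<Rightarrow> rat" and s :: "'i \<Rightarrow> nat"
  assumes fin: "finite I"
    and lin: "\<And>i x y c. L i (x - qscale c y) = L i x - c * L i y"
    and tri: "\<And>i j. i \<in> I \<Longrightarrow> j \<in> I \<Longrightarrow> s j \<le> s i \<Longrightarrow> L i (F j) = (if i = j then 1 else 0)"
  shows "\<exists>z\<in>qvs.span (F ` I). \<forall>i\<in>I. L i (y - z) = 0"
  using fin tri
proof (induction I rule: finite_ranking_induct[where f = "\<lambda>i. - int (s i)"])
  case empty
  show ?case by (intro bexI[of _ 0] qvs.span_zero) simp
next
  case (insert i I)
  show ?case
  proof (cases "i \<in> I")
    case True thus ?thesis using insert.IH insert.prems by (metis insert_absorb)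
  next
    case False
    obtain z where z: "z \<in> qvs.span (F ` I)" "\<forall>j\<in>I. L j (y - z) = 0" using insert.IH insert.prems by auto
    define z' where "z' = z + qscale (L i (y - z)) (F i)"
    have e: "y - z' = (y - z) - qscale (L i (y - z)) (F i)" by (simp add: z'_def)
    have "z' \<in> qvs.span (F ` insert i I)" unfolding z'_def
      by (intro qvs.span_add qvs.span_scale subsetD[OF qvs.span_mono z(1)] qvs.span_base) auto
    moreover have "L i (y - z') = 0" unfolding e lin using insert.prems[of i i] by simp
    moreover have "L j (y - z') = 0" if "j \<in> I" for j
    proof -
      have "s i \<le> s j" using insert.hyps(2)[OF that] by simp
      hence "L j (F i) = 0" using insert.prems[of j i] that False by auto
      thus ?thesis unfolding e lin using z(2) that by simp
    qed
    ultimately show ?thesis by (intro bexI[of _ z']) auto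
  qed
qed

text \<open>
  The polynomials that are antisymmetric in the columns of \<open>T\<close> and satisfy the Garnir
  relations.
\<close>

definition garnir_closed :: "diagram \<Rightarrow> (box \<Rightarrow> nat) \<Rightarrow> qpoly set" where
  "garnir_closed D T = {y.
     (\<forall>c\<in>D. \<forall>c'\<in>D. snd c = snd c' \<longrightarrow> c \<noteq> c' \<longrightarrow> poly_act (transpose (T c) (T c')) y = - y) \<and>
     (\<forall>i j. (i, j) \<in> D \<longrightarrow> (i, Suc j) \<in> D \<longrightarrow> antisymmetrize {\<sigma>. \<sigma> permutes T ` garnir D i j} y = 0)}"

lemma garnir_closed_subspace:
  assumes "shape D"
  shows "qvs.subspace (garnir_closed D T)"
proof -
  have h: "module_hom qscale qscale (antisymmetrize {\<sigma>. \<sigma> permutes T ` garnir D i j})" if "(i, j) \<in> D" "(i, Suc j) \<in> D" for i j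
    using card_garnir(1)[OF assms that] by (intro antisymmetrize_hom fin_perm_group_permutes) auto
  show ?thesis
    by (rule qvs.subspaceI)
      (simp_all add: garnir_closed_def poly_act_0 poly_act_add poly_act_scale
         module_hom.zero[OF h] module_hom.add[OF h] module_hom.scale[OF h])
qed

text \<open>
  The coefficients of \<open>y\<close>, as a function of the filling by exponents, obey the rules of
  straightening.
\<close>

lemma garnir_closed_vanish:
  assumes D: "ferrers D" "finite D" and T: "inj_on T D" and y: "y \<in> garnir_closed D T"
    and k: "y \<in> polys_in A" "\<And>m. m \<in> A \<Longrightarrow> keys m \<subseteq> T ` D"
    and ss: "\<And>N. semistandard D N \<Longrightarrow> lookup y (tab_mono D N T) = 0"
  shows "y = 0"
proof -
  have sh: "shape D" using D by (simp add: shape_def fin_part_def)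
  define \<N> where "\<N> = {N :: box \<Rightarrow> nat. \<forall>c. c \<notin> D \<longrightarrow> N c = 0}"
  have tab: "tab D N" if "N \<in> \<N>" for N using that sh D by (simp add: tab_def \<N>_def)
  \<comment> \<open>Coefficients are read as constant polynomials, since straightening is stated for
    polynomials as values.\<close>
  define \<phi> where "\<phi> N = single (0 :: monomial) (lookup y (tab_mono D N T))" for N
  have cl: "N \<circ> \<sigma> \<in> \<N>" if "N \<in> \<N>" "\<sigma> permutes D" for N \<sigma>
    using that permutes_in_image[OF that(2)] unfolding \<N>_def mem_Collect_eq by (metis comp_apply)
  have perm: "\<phi> (N \<circ> \<sigma>) = single 0 (lookup (poly_act (map_permutation G T \<sigma>) y) (tab_mono D N T))"
    if N: "N \<in> \<N>" and G: "G \<subseteq> D" and \<sigma>: "\<sigma> permutes G" for N \<sigma> G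
  proof -
    let ?p = "map_permutation G T \<sigma>"
    have "?p permutes T ` G" by (rule map_permutation_permutes[OF inj_on_imp_bij_betw[OF inj_on_subset[OF T G]] \<sigma>])
    hence b: "bij ?p" by (rule permutes_bij)
    have \<sigma>D: "\<sigma> permutes D" by (rule permutes_subset[OF \<sigma> G])
    have "tab_mono D (N \<circ> \<sigma>) T = mono_act (inv ?p) (tab_mono D N T)"
    proof (rule tab_mono_eqI[OF tab[OF cl[OF N \<sigma>D]] T])
      fix c assume c: "c \<in> D"
      have "lookup (mono_act (inv ?p) (tab_mono D N T)) (T c) = lookup (tab_mono D N T) (?p (T c))"
        by (simp add: lookup_mono_act[OF bij_imp_bij_inv[OF b]] inv_inv_eq[OF b])
      also have "\<dots> = N (\<sigma> c)"
        using lookup_tab_mono(1)[OF tab[OF N] T] c permutes_in_image[OF \<sigma>D] by (simp add: filling_permute[OF T G \<sigma> c])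
      finally show "lookup (mono_act (inv ?p) (tab_mono D N T)) (T c) = (N \<circ> \<sigma>) c" by simp
    next
      have "?p permutes T ` D" by (rule permutes_subset[OF \<open>?p permutes T ` G\<close> image_mono[OF G]])
      hence "inv ?p ` T ` D = T ` D" by (intro permutes_image permutes_inv)
      thus "keys (mono_act (inv ?p) (tab_mono D N T)) \<subseteq> T ` D"
        unfolding keys_mono_act[OF bij_imp_bij_inv[OF b]] keys_tab_mono[OF tab[OF N] T] by blast
    qed
    thus ?thesis by (simp add: \<phi>_def lookup_poly_act[OF b])
  qed
  have main: "\<phi> N \<in> {0}" if N: "N \<in> \<N>" for N
  proof (rule straightening[OF D, where \<N> = \<N>])
    show "qvs.subspace {0}" by (rule qvs.subspace_single_0)
    fix N assume N: "N \<in> \<N>"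
    { fix a b assume a: "a \<in> D" "b \<in> D" "snd a = snd b" "a \<noteq> b"
      have "poly_act (transpose (T a) (T b)) y = - y" using y a by (simp add: garnir_closed_def)
      thus "\<phi> (N \<circ> transpose a b) = - \<phi> N"
        using perm[OF N subset_refl permutes_swap_id[OF a(1,2)]]
        by (simp add: map_permutation_transpose[OF T a(1,2)] \<phi>_def single_uminus) }
    { fix i j assume ij: "(i, j) \<in> D" "(i, Suc j) \<in> D"
      let ?G = "garnir D i j"
      have C: "fin_perm_group {\<sigma>. \<sigma> permutes T ` ?G}"
        using card_garnir(1)[OF sh ij] by (intro fin_perm_group_permutes) auto
      have "(\<Sum>\<sigma>\<in>{\<sigma>. \<sigma> permutes ?G}. qscale (of_int (sign \<sigma>)) (\<phi> (N \<circ> \<sigma>)))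
        = (\<Sum>\<sigma>\<in>{\<sigma>. \<sigma> permutes ?G}. qscale (of_int (sign \<sigma>))
              (single 0 (lookup (poly_act (map_permutation ?G T \<sigma>) y) (tab_mono D N T))))"
        by (intro sum.cong refl) (simp add: perm[OF N garnir_subset])
      also have "\<dots> = (\<Sum>\<pi>\<in>{\<sigma>. \<sigma> permutes T ` ?G}. qscale (of_int (sign \<pi>)) (single 0 (lookup (poly_act \<pi> y) (tab_mono D N T))))"
        by (rule sum_permutes_transfer[OF inj_on_subset[OF T garnir_subset] card_garnir(1)[OF sh ij]])
      also have "\<dots> = single 0 (lookup (antisymmetrize {\<sigma>. \<sigma> permutes T ` ?G} y) (tab_mono D N T))"
        by (rule poly_mapping_eqI) (simp add: antisymmetrize_def lookup_sum lookup_single when_def)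
      also have "\<dots> = 0" using y ij by (simp add: garnir_closed_def)
      finally show "(\<Sum>\<sigma>\<in>{\<sigma>. \<sigma> permutes ?G}. qscale (of_int (sign \<sigma>)) (\<phi> (N \<circ> \<sigma>))) = 0" . }
    { assume "semistandard D N" thus "\<phi> N \<in> {0}" using ss by (simp add: \<phi>_def) }
  qed (use N cl in \<open>auto simp: \<N>_def\<close>)
  show "y = 0"
  proof (rule poly_mapping_eqI)
    fix p
    show "lookup y p = lookup 0 p"
    proof (cases "p \<in> keys y")
      case True
      hence kp: "keys p \<subseteq> T ` D" using k by (auto simp: polys_in_def)
      define N where "N c = (if c \<in> D then lookup p (T c) else 0)" for c
      have N: "N \<in> \<N>" by (simp add: \<N>_def N_def)
      have "tab_mono D N T = p" by (rule tab_mono_eqI[OF tab[OF N] T _ kp]) (simp add: N_def)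
      moreover have "\<phi> N = 0" using main[OF N] by simp
      hence "lookup (\<phi> N) 0 = 0" by simp
      ultimately show ?thesis by (simp add: \<phi>_def)
    qed (simp add: in_keys_iff)
  qed
qed

lemma garnir_closed_span:
  assumes D: "ferrers D" "finite D" and T: "inj_on T D" and y: "y \<in> garnir_closed D T"
    and k: "y \<in> polys_in {m. keys m \<subseteq> T ` D \<and> mono_content m = b}"
  shows "y \<in> qvs.span {specht_poly D M T | M. tab D M \<and> semistandard D M \<and> mono_content (tab_mono D M T) = b}"
proof -
  have sh: "shape D" using D by (simp add: shape_def fin_part_def)
  define A where "A = {m. keys m \<subseteq> T ` D \<and> mono_content m = b}"
  have finA: "finite A"
    by (rule finite_subset[OF _ finite_monomials[of "T ` D" "sum_mset b"]]) (use D in \<open>auto simp: A_def simp flip: sum_mono_content\<close>)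
  define I where "I = {M. semistandard D M \<and> tab_mono D M T \<in> A}"
  have tab: "tab D M" if "semistandard D M" for M using that sh D by (auto simp: tab_def semistandard_def)
  have inj: "inj_on (\<lambda>M. tab_mono D M T) I"
  proof (rule inj_onI)
    fix M M' assume a: "M \<in> I" "M' \<in> I" "tab_mono D M T = tab_mono D M' T"
    have t: "tab D M" "tab D M'" using a tab by (auto simp: I_def)
    show "M = M'"
    proof
      fix c
      show "M c = M' c"
        using lookup_tab_mono(1)[OF t(1) T, of c] lookup_tab_mono(1)[OF t(2) T, of c] a(3) t unfolding tab_def by metis
    qed
  qed
  have finI: "finite I" by (rule finite_imageD[OF finite_subset[OF _ finA] inj]) (auto simp: I_def)
  have "\<exists>z\<in>qvs.span ((\<lambda>M. specht_poly D M T) ` I). \<forall>M\<in>I. lookup (y - z) (tab_mono D M T) = 0"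
  proof (rule triangular_solve[OF finI, where s = "sval D"])
    fix M M' assume a: "M \<in> I" "M' \<in> I" "sval D M' \<le> sval D M"
    have t: "semistandard D M" "semistandard D M'" using a by (auto simp: I_def)
    show "lookup (specht_poly D M' T) (tab_mono D M T) = (if M = M' then 1 else 0)"
      using lookup_specht_triangular[OF tab[OF t(1)] tab[OF t(2)] T t a(3)] by auto
  qed (simp add: lookup_minus)
  then obtain z where z: "z \<in> qvs.span ((\<lambda>M. specht_poly D M T) ` I)" "\<And>M. M \<in> I \<Longrightarrow> lookup (y - z) (tab_mono D M T) = 0" by blast
  have spA: "specht_poly D M T \<in> polys_in A" if "M \<in> I" for M
  proof -
    have ss: "semistandard D M" "tab_mono D M T \<in> A" using that by (auto simp: I_def)
    show ?thesis using specht_keys[OF tab[OF ss(1)] T] ss(2) by (auto simp: polys_in_def A_def)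
  qed
  have spG: "specht_poly D M T \<in> garnir_closed D T" if "M \<in> I" for M
  proof -
    have "tab D M" using that tab by (auto simp: I_def)
    thus ?thesis using specht_transpose[OF _ T] specht_garnir[OF _ T] by (simp add: garnir_closed_def)
  qed
  have zA: "z \<in> polys_in A" using z(1) qvs.span_minimal[OF _ polys_in_subspace, of "(\<lambda>M. specht_poly D M T) ` I" A] spA by blast
  have zG: "z \<in> garnir_closed D T" using z(1) qvs.span_minimal[OF _ garnir_closed_subspace[OF sh], of "(\<lambda>M. specht_poly D M T) ` I" T] spG by blast
  have "y - z = 0"
  proof (rule garnir_closed_vanish[OF D T])
    show "y - z \<in> garnir_closed D T" by (rule qvs.subspace_diff[OF garnir_closed_subspace[OF sh] y zG])
    show yzA: "y - z \<in> polys_in A" using qvs.subspace_diff[OF polys_in_subspace _ zA] k by (simp add: A_def)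
    show "keys m \<subseteq> T ` D" if "m \<in> A" for m using that by (simp add: A_def)
    show "lookup (y - z) (tab_mono D N T) = 0" if "semistandard D N" for N
    proof (cases "tab_mono D N T \<in> A")
      case True thus ?thesis using z(2) that by (simp add: I_def)
    next
      case False
      hence "tab_mono D N T \<notin> keys (y - z)" using yzA by (auto simp: polys_in_def)
      thus ?thesis by (simp add: in_keys_iff)
    qed
  qed
  hence "y = z" by simp
  moreover have "(\<lambda>M. specht_poly D M T) ` I \<subseteq> {specht_poly D M T | M. tab D M \<and> semistandard D M \<and> mono_content (tab_mono D M T) = b}"
    using tab by (auto simp: I_def A_def)
  ultimately show ?thesis using z(1) qvs.span_mono by blast
qed

section \<open>Spanning in finitely many variables\<close>

text \<open>
  A partition of a finite set into blocks consists of the columns of a filling of a Ferrers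
  diagram: the blocks are ordered by decreasing size.
\<close>

lemma blocks_to_filling:
  fixes P :: "nat set set"
  assumes X: "finite X" "\<Union>P = X" and disj: "pairwise disjnt P" and ne: "{} \<notin> P"
  obtains D T where "ferrers D" "finite D" "bij_betw T D X"
    "bij_betw (\<lambda>j. T ` {c \<in> D. snd c = j}) {j. (0, j) \<in> D} P"
proof -
  have fP: "finite P" using X finite_UnionD by blast
  have fB: "finite B" if "B \<in> P" for B using X that by (metis Union_upper finite_subset)
  obtain xs where xs: "set xs = P" "distinct xs" using finite_distinct_list[OF fP] by blast
  define L where "L = rev (sort_key card xs)"
  have L: "set L = P" "distinct L" using xs by (simp_all add: L_def)
  have "sorted_wrt (\<lambda>B B'. card B' \<le> card B) L"
    unfolding L_def sorted_wrt_rev using sorted_sort_key[of card xs] by (simp add: sorted_map)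
  hence desc: "card (L ! j) \<le> card (L ! j')" if "j' \<le> j" "j < length L" for j j'
    using that sorted_wrt_nth_less[of _ L j' j] by (cases "j' = j") auto
  define D where "D = {(i, j). j < length L \<and> i < card (L ! j)}"
  define T where "T c = sorted_list_of_set (L ! snd c) ! fst c" for c :: box
  have LP: "L ! j \<in> P" if "j < length L" for j using that L by auto
  have D1: "ferrers D" unfolding ferrers_def
  proof (intro allI impI)
    fix i j i' j' assume a: "(i, j) \<in> D" "i' \<le> i" "j' \<le> j"
    hence "j < length L" "i < card (L ! j)" by (auto simp: D_def)
    moreover from this have "card (L ! j) \<le> card (L ! j')" using desc a by blast
    ultimately show "(i', j') \<in> D" using a by (simp add: D_def)
  qed
  have Ds: "D = (\<Union>j<length L. (\<lambda>i. (i, j)) ` {..<card (L ! j)})" by (auto simp: D_def)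
  have D2: "finite D" unfolding Ds by auto
  have col: "T ` {c \<in> D. snd c = j} = L ! j" if j: "j < length L" for j
  proof -
    have "{c \<in> D. snd c = j} = (\<lambda>i. (i, j)) ` {..<card (L ! j)}" using j by (auto simp: D_def)
    hence "T ` {c \<in> D. snd c = j} = (\<lambda>i. sorted_list_of_set (L ! j) ! i) ` {..<length (sorted_list_of_set (L ! j))}"
      by (simp add: T_def image_image)
    also have "\<dots> = set (sorted_list_of_set (L ! j))" by (auto simp: set_conv_nth)
    also have "\<dots> = L ! j" using fB[OF LP[OF j]] by simp
    finally show ?thesis .
  qed
  have iT: "inj_on T D"
  proof (rule inj_onI)
    fix c c' assume c: "c \<in> D" "c' \<in> D" "T c = T c'"
    have j: "snd c < length L" "snd c' < length L" using c by (auto simp: D_def)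
    have "T c \<in> L ! snd c" "T c' \<in> L ! snd c'"
      unfolding col[OF j(1), symmetric] col[OF j(2), symmetric] using c(1,2) by blast+
    hence "L ! snd c = L ! snd c'"
      using disj LP[OF j(1)] LP[OF j(2)] c(3) by (auto simp: pairwise_def disjnt_iff)
    hence jj: "snd c = snd c'" using L(2) j by (simp add: nth_eq_iff_index_eq)
    have "fst c < length (sorted_list_of_set (L ! snd c))" "fst c' < length (sorted_list_of_set (L ! snd c))"
      using c jj by (auto simp: D_def)
    hence "fst c = fst c'" using c(3) jj by (simp add: T_def nth_eq_iff_index_eq)
    thus "c = c'" using jj by (simp add: prod_eq_iff)
  qed
  have "T ` D = (\<Union>j<length L. T ` {c \<in> D. snd c = j})" by (auto simp: D_def)
  also have "\<dots> = (\<Union>j<length L. L ! j)" using col by simp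
  also have "\<dots> = \<Union>(set L)" by (auto simp: set_conv_nth)
  finally have "bij_betw T D X" using iT X L by (simp add: bij_betw_def)
  moreover have z: "{j. (0, j) \<in> D} = {..<length L}"
  proof -
    have "0 < card (L ! j)" if "j < length L" for j
      using LP[OF that] ne fB[OF LP[OF that]] unfolding card_gt_0_iff by metis
    thus ?thesis by (auto simp: D_def)
  qed
  have "bij_betw (\<lambda>j. T ` {c \<in> D. snd c = j}) {j. (0, j) \<in> D} P"
    unfolding z
  proof (rule bij_betw_imageI)
    show "inj_on (\<lambda>j. T ` {c \<in> D. snd c = j}) {..<length L}"
      using col L(2) by (auto simp: inj_on_def nth_eq_iff_index_eq)
    have "(\<lambda>j. T ` {c \<in> D. snd c = j}) ` {..<length L} = (\<lambda>j. L ! j) ` {..<length L}"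
      using col by (intro image_cong) auto
    also have "\<dots> = P" using L by (auto simp: set_conv_nth)
    finally show "(\<lambda>j. T ` {c \<in> D. snd c = j}) ` {..<length L} = P" .
  qed
  ultimately show ?thesis using that D1 D2 by blast
qed

lemma antisym_col_stab:
  assumes D: "shape D" and T: "inj_on T D"
    and y: "\<And>c c'. c \<in> D \<Longrightarrow> c' \<in> D \<Longrightarrow> snd c = snd c' \<Longrightarrow> c \<noteq> c' \<Longrightarrow> poly_act (transpose (T c) (T c')) y = - y"
    and \<sigma>: "\<sigma> \<in> col_stab D T"
  shows "poly_act \<sigma> y = qscale (of_int (sign \<sigma>)) y"
proof -
  have p: "\<sigma> permutes T ` long D" and
    q: "\<And>c. c \<in> long D \<Longrightarrow> \<exists>c'\<in>long D. snd c' = snd c \<and> \<sigma> (T c) = T c'"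
    using \<sigma> unfolding col_stab_iff[OF D T] by blast+
  have fl: "finite (T ` long D)" using finite_long[OF D] by simp
  have k: "snd (inv_into D T (T c)) = snd c" if "c \<in> long D" for c
    using that T long_subset by (metis inv_into_f_f subsetD)
  show ?thesis
  proof (rule class_permutes_induct[OF fl p, where k = "\<lambda>x. snd (inv_into D T x)"])
    fix x assume "x \<in> T ` long D"
    then obtain c where c: "c \<in> long D" "x = T c" by blast
    obtain c' where "c' \<in> long D" "snd c' = snd c" "\<sigma> (T c) = T c'" using q[OF c(1)] by blast
    thus "snd (inv_into D T (\<sigma> x)) = snd (inv_into D T x)" using k c by simp
  next
    fix a b \<tau> assume a: "a \<in> T ` long D" "b \<in> T ` long D" "a \<noteq> b" "snd (inv_into D T a) = snd (inv_into D T b)"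
      and \<tau>: "\<tau> permutes T ` long D" "poly_act \<tau> y = qscale (of_int (sign \<tau>)) y"
    obtain c where c: "c \<in> long D" "a = T c" using a(1) by blast
    obtain c' where c': "c' \<in> long D" "b = T c'" using a(2) by blast
    have "poly_act (transpose a b) y = - y"
      unfolding c(2) c'(2) by (rule y) (use a c c' k long_subset[of D] in auto)
    moreover have "sign (transpose a b \<circ> \<tau>) = - sign \<tau>"
      using a(3) permutes_imp_permutation[OF fl \<tau>(1)] by (simp add: sign_compose permutation_swap_id sign_swap_id)
    ultimately show "poly_act (transpose a b \<circ> \<tau>) y = qscale (of_int (sign (transpose a b \<circ> \<tau>))) y"
      by (simp add: poly_act_comp permutes_bij[OF \<tau>(1)] \<tau>(2) poly_act_scale)
  next
    show "poly_act id y = qscale (of_int (sign id)) y" by (simp only: poly_act_id sign_id of_int_1 qvs.scale_one)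
  qed
qed

text \<open>
  Entries below the first row of a semi-standard filling are positive, since columns increase
  strictly.
\<close>

lemma support_semistandard:
  assumes "tab D M" "semistandard D M"
  shows "fin_part D \<subseteq> {c \<in> D. M c \<noteq> 0}" "(\<And>j. M (0, j) = 0) \<Longrightarrow> {c \<in> D. M c \<noteq> 0} = fin_part D"
proof -
  show *: "fin_part D \<subseteq> {c \<in> D. M c \<noteq> 0}"
  proof
    fix c assume "c \<in> fin_part D"
    then obtain i j where c: "c = (i, j)" "(i, j) \<in> D" "0 < i" by (cases c) (auto simp: fin_part_def)
    have "(0, j) \<in> D" using ferrersD[OF _ c(2), of 0 j] assms by (simp add: tab_def shape_def)
    hence "M (0, j) < M (i, j)" using assms(2) c by (simp add: semistandard_def)
    thus "c \<in> {c \<in> D. M c \<noteq> 0}" using c by simp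
  qed
  assume z: "\<And>j. M (0, j) = 0"
  show "{c \<in> D. M c \<noteq> 0} = fin_part D"
  proof (rule antisym[OF _ *])
    show "{c \<in> D. M c \<noteq> 0} \<subseteq> fin_part D"
    proof
      fix c assume "c \<in> {c \<in> D. M c \<noteq> 0}"
      thus "c \<in> fin_part D" using z by (cases c; cases "fst c") (auto simp: fin_part_def)
    qed
  qed
qed

text \<open>
  The submonomial in the variables from \<open>S\<close>.
\<close>

definition restrict_mono :: "nat set \<Rightarrow> monomial \<Rightarrow> monomial" where
  "restrict_mono S p = Poly_Mapping.mapp (\<lambda>x v. if x \<in> S then v else 0) p"

lemma lookup_restrict_mono: "lookup (restrict_mono S p) x = (if x \<in> S then lookup p x else 0)"
  by (auto simp: restrict_mono_def lookup_mapp when_def in_keys_iff)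

lemma keys_restrict_mono: "keys (restrict_mono S p) = keys p \<inter> S"
  by (auto simp: in_keys_iff lookup_restrict_mono split: if_splits)

text \<open>
  The exponents at all elements of \<open>X\<close>, zeros included.
\<close>

lemma content_with_zeros:
  assumes "finite X" "keys p \<subseteq> X"
  shows "image_mset (lookup p) (mset_set X) = mono_content p + replicate_mset (card X - card (keys p)) 0"
proof -
  have "mset_set X = mset_set (keys p) + mset_set (X - keys p)"
    using assms by (metis Diff_disjoint Un_Diff_cancel finite_Diff finite_keys mset_set_Union sup.absorb_iff2)
  moreover have "image_mset (lookup p) (mset_set (X - keys p)) = image_mset (\<lambda>_. 0) (mset_set (X - keys p))"
    using assms by (intro image_mset_cong) (auto simp: in_keys_iff)
  ultimately show ?thesis using assms
    by (simp add: mono_content_def image_mset_const_eq card_Diff_subset)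
qed

text \<open>
  Two monomials in \<open>X\<close> with the same content that agree on \<open>S\<close> differ by a permutation that
  fixes \<open>S\<close> pointwise.
\<close>

lemma same_content_permutation:
  assumes X: "finite X" "keys p \<subseteq> X" "keys p0 \<subseteq> X" and cont: "mono_content p = mono_content p0"
    and S: "S \<subseteq> X" "\<And>x. x \<in> S \<Longrightarrow> lookup p x = lookup p0 x"
  shows "\<exists>\<rho>. \<rho> permutes (X - S) \<and> p = mono_act (inv \<rho>) p0"
proof -
  have fS: "finite S" using X(1) S(1) by (rule finite_subset[rotated])
  have "card (keys p) = card (keys p0)" using cont by (metis size_mono_content)
  hence eqX: "image_mset (lookup p) (mset_set X) = image_mset (lookup p0) (mset_set X)"
    unfolding content_with_zeros[OF X(1,2)] content_with_zeros[OF X(1,3)] using cont by simp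
  have "mset_set X = mset_set S + mset_set (X - S)"
    using S(1) fS X(1) by (metis Diff_disjoint Un_Diff_cancel finite_Diff mset_set_Union sup.absorb_iff2)
  moreover have "image_mset (lookup p) (mset_set S) = image_mset (lookup p0) (mset_set S)"
    using S fS by (intro image_mset_cong) auto
  ultimately have "image_mset (lookup p) (mset_set (X - S)) = image_mset (lookup p0) (mset_set (X - S))"
    using eqX by simp
  then obtain \<rho> where \<rho>: "\<rho> permutes (X - S)" "\<forall>x\<in>X - S. lookup p x = lookup p0 (\<rho> x)"
    using image_mset_eq_implies_permutes[of "X - S"] X(1) by blast
  have \<rho>X: "\<rho> permutes X" by (rule permutes_subset[OF \<rho>(1)]) auto
  have b: "bij \<rho>" by (rule permutes_bij[OF \<rho>(1)])
  have "p = mono_act (inv \<rho>) p0"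
  proof (rule poly_mapping_eqI)
    fix x
    have "lookup p x = lookup p0 (\<rho> x)"
    proof (cases "x \<in> X - S")
      case True thus ?thesis using \<rho>(2) by blast
    next
      case False
      hence "\<rho> x = x" by (rule permutes_not_in[OF \<rho>(1)])
      moreover have "lookup p x = lookup p0 x"
      proof (cases "x \<in> S")
        case True thus ?thesis by (rule S(2))
      next
        case False
        hence "x \<notin> keys p" "x \<notin> keys p0" using \<open>x \<notin> X - S\<close> X by blast+
        thus ?thesis by (simp add: in_keys_iff)
      qed
      ultimately show ?thesis by simp
    qed
    thus "lookup p x = lookup (mono_act (inv \<rho>) p0) x"
      by (simp add: lookup_mono_act[OF bij_imp_bij_inv[OF b]] inv_inv_eq[OF b])
  qed
  thus ?thesis using \<rho>(1) by blast
qed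

text \<open>
  Let \<open>S\<close> be the set of entries of \<open>T\<close> in the finite part. All of these variables occur in
  each monomial of the row orbit. The elements of the orbit with a given restriction \<open>q\<close> to
  \<open>S\<close> are precisely the monomials of the given content that extend \<open>q\<close>, because the exponents
  in the first row may be permuted arbitrarily. So the coefficients of \<open>y\<close> at them add up to
  \<open>ext_sum y q\<close>. If \<open>M\<close> has a non-zero entry in the first row, then \<open>q\<close> has too few variables
  for this to be non-zero.
\<close>

lemma row_sum_zero:
  assumes D: "finite D" and T: "inj_on T D" and M: "tab D M" "semistandard D M" and nz: "M (0, j0) \<noteq> 0"
    and y: "y \<in> polys_in {m. keys m \<subseteq> T ` D \<and> mono_content m = mono_content (tab_mono D M T)}"
      "y \<in> ext_kernel (card {c \<in> D. M c \<noteq> 0})"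
  shows "(\<Sum>p\<in>orb D M T. lookup y p) = 0"
proof -
  let ?X = "T ` D" and ?S = "T ` fin_part D"
  define A where "A = {m. keys m \<subseteq> ?X \<and> mono_content m = mono_content (tab_mono D M T)}"
  have sub: "fin_part D \<subseteq> D" by (auto simp: fin_part_def)
  have fS: "finite ?S" "finite ?X" using D sub by (auto intro: finite_subset)
  have SX: "?S \<subseteq> ?X" using sub by auto
  have finA: "finite A"
    by (rule finite_subset[OF _ finite_monomials[OF fS(2), of "mono_deg (tab_mono D M T)"]]) (auto simp: A_def simp flip: sum_mono_content)
  have fo: "finite (orb D M T)" by (rule finite_orb[OF M(1) T])
  have oA: "orb D M T \<subseteq> A" using orb_keys[OF M(1) T] orb_content by (auto simp: A_def)
  have low: "?S \<subseteq> keys p" if p: "p \<in> orb D M T" for p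
  proof
    fix x assume "x \<in> ?S"
    then obtain c where c: "c \<in> D" "0 < fst c" "x = T c" by (auto simp: fin_part_def)
    obtain \<tau> where \<tau>: "\<tau> \<in> row_stab D T" "p = mono_act \<tau> (tab_mono D M T)" using p by (auto simp: orb_def)
    have b: "bij \<tau>" by (rule row_stab_bij[OF \<tau>(1)])
    obtain c' where c': "c' \<in> D" "fst c' = fst c" "inv \<tau> (T c) = T c'" using row_stab_D[OF row_stab_inv[OF \<tau>(1)] c(1)] .
    have "c' \<in> fin_part D" using c c' by (simp add: fin_part_def)
    hence "M c' \<noteq> 0" using support_semistandard(1)[OF M] by blast
    hence "lookup p x \<noteq> 0" unfolding \<tau>(2) c(3) lookup_mono_act[OF b] c'(3) lookup_tab_mono(1)[OF M(1) T c'(1)] .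
    thus "x \<in> keys p" by (simp add: in_keys_iff)
  qed
  have inner: "(\<Sum>p\<in>{p \<in> orb D M T. restrict_mono ?S p = q}. lookup y p) = 0" if q: "q \<in> restrict_mono ?S ` orb D M T" for q
  proof -
    obtain p0 where p0: "p0 \<in> orb D M T" "q = restrict_mono ?S p0" using q by blast
    have kq: "keys q = ?S" using low[OF p0(1)] by (auto simp: p0(2) keys_restrict_mono)
    have "{p \<in> A. submono q p} = {p \<in> orb D M T. restrict_mono ?S p = q}"
    proof (intro equalityI subsetI)
      fix p assume p: "p \<in> {p \<in> orb D M T. restrict_mono ?S p = q}"
      hence "submono q p" by (auto simp: submono_def keys_restrict_mono lookup_restrict_mono)
      thus "p \<in> {p \<in> A. submono q p}" using p oA by blast
    next
      fix p assume p: "p \<in> {p \<in> A. submono q p}"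
      have agree: "lookup p x = lookup p0 x" if "x \<in> ?S" for x
      proof -
        have "lookup q x = lookup p x" using p that unfolding submono_def kq by blast
        thus ?thesis using that by (simp add: p0(2) lookup_restrict_mono)
      qed
      have p0A: "p0 \<in> A" using p0 oA by blast
      have "mono_content p = mono_content p0" "keys p \<subseteq> ?X" "keys p0 \<subseteq> ?X" using p p0A by (simp_all add: A_def)
      from same_content_permutation[OF fS(2) this(2,3,1) SX agree] obtain \<rho>
        where \<rho>: "\<rho> permutes (?X - ?S)" "p = mono_act (inv \<rho>) p0" by blast
      have fixS: "\<rho> x = x" if "x \<in> ?S" for x using permutes_not_in[OF \<rho>(1)] that by blast
      have \<rho>X: "\<rho> permutes ?X" by (rule permutes_subset[OF \<rho>(1)]) auto
      have "\<rho> ` T ` {c \<in> D. fst c = i} = T ` {c \<in> D. fst c = i}" for i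
      proof (cases "i = 0")
        case True
        have "?X - ?S = T ` (D - fin_part D)" using inj_on_image_set_diff[OF T _ sub, of D] by auto
        also have "D - fin_part D = {c \<in> D. fst c = 0}" by (auto simp: fin_part_def)
        finally show ?thesis using permutes_image[OF \<rho>(1)] True by simp
      next
        case False
        hence "T ` {c \<in> D. fst c = i} \<subseteq> ?S" by (auto simp: fin_part_def)
        hence "\<rho> ` T ` {c \<in> D. fst c = i} = (\<lambda>x. x) ` T ` {c \<in> D. fst c = i}"
          using fixS by (intro image_cong) auto
        thus ?thesis by simp
      qed
      hence r: "\<rho> \<in> row_stab D T" using \<rho>X by (simp add: row_stab_def)
      have "p \<in> orb D M T" using mono_act_orb[OF row_stab_inv[OF r]] p0(1) \<rho>(2) by blast
      moreover have "restrict_mono ?S p = q"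
        by (rule poly_mapping_eqI) (simp add: p0(2) lookup_restrict_mono agree)
      ultimately show "p \<in> {p \<in> orb D M T. restrict_mono ?S p = q}" by blast
    qed
    moreover have "ext_sum y q = (\<Sum>p\<in>{p \<in> A. submono q p}. lookup y p)"
      by (rule ext_sum_superset[OF finA]) (use y(1) in \<open>simp add: polys_in_def A_def\<close>)
    moreover have "ext_sum y q = 0"
    proof -
      have "(0, j0) \<in> D" using nz M(1) unfolding tab_def by metis
      hence "(0, j0) \<in> {c \<in> D. M c \<noteq> 0} - fin_part D" using nz by (simp add: fin_part_def)
      hence "fin_part D \<noteq> {c \<in> D. M c \<noteq> 0}" by (metis Diff_iff)
      hence "fin_part D \<subset> {c \<in> D. M c \<noteq> 0}" using support_semistandard(1)[OF M] by (rule psubsetI[rotated])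
      hence "card (fin_part D) < card {c \<in> D. M c \<noteq> 0}" using D by (intro psubset_card_mono) auto
      moreover have "card (keys q) = card (fin_part D)" unfolding kq using inj_on_subset[OF T sub] by (rule card_image)
      ultimately show ?thesis using y(2) by (simp add: ext_kernel_def)
    qed
    ultimately show ?thesis by simp
  qed
  have "(\<Sum>p\<in>orb D M T. lookup y p) = (\<Sum>q\<in>restrict_mono ?S ` orb D M T. \<Sum>p\<in>{p \<in> orb D M T. restrict_mono ?S p = q}. lookup y p)"
    by (rule sum.group[symmetric]) (use fo in auto)
  also have "\<dots> = 0" using inner by (rule sum.neutral[rule_format])
  finally show ?thesis .
qed

text \<open>
  A measure for which one block of size \<open>k + 1\<close> counts more than \<open>n\<close> blocks of size at most
  \<open>k\<close>. A partition of \<open>{1..n}\<close> has at most \<open>n\<close> blocks.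
\<close>

definition weight :: "nat \<Rightarrow> nat set set \<Rightarrow> nat" where
  "weight n P = (\<Sum>B\<in>P. (n + 1) ^ card B)"

text \<open>
  Transpositions within a block change the sign.
\<close>

definition antisym_on :: "nat set set \<Rightarrow> qpoly \<Rightarrow> bool" where
  "antisym_on P y \<longleftrightarrow> (\<forall>B\<in>P. \<forall>a\<in>B. \<forall>a'\<in>B. a \<noteq> a' \<longrightarrow> poly_act (transpose a a') y = - y)"

text \<open>
  An invariant space of polynomials in \<open>x\<^sub>1, \<dots>, x\<^sub>n\<close> contains, unless it vanishes, a non-zero
  element that is antisymmetric in the columns of some filling and satisfies the Garnir
  relations. Choose the columns as blocks of maximal weight. If some Garnir relation failed,
  then antisymmetrising over its \<open>collen D j + 1\<close> entries would produce a non-zero element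
  that is antisymmetric in these entries and still antisymmetric in the columns before column
  \<open>j\<close>. With the remaining entries as singletons this gives a partition of larger weight.
\<close>

lemma garnir_closed_ex:
  assumes X: "qvs.subspace X" "X \<noteq> {0}"
    and inv: "\<And>\<sigma> x. \<sigma> permutes {1..n} \<Longrightarrow> x \<in> X \<Longrightarrow> poly_act \<sigma> x \<in> X"
  obtains D T y where "ferrers D" "finite D" "bij_betw T D {1..n}" "y \<in> X" "y \<noteq> 0" "y \<in> garnir_closed D T"
proof -
  \<comment> \<open>Partitions into blocks for which a non-zero antisymmetric element exists; the partition
    into singletons is one.\<close>
  define good where "good P \<longleftrightarrow> \<Union>P = {1..n} \<and> pairwise disjnt P \<and> {} \<notin> P \<and> (\<exists>y\<in>X. y \<noteq> 0 \<and> antisym_on P y)" for P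
  have fin: "finite {P. good P}"
    by (rule finite_subset[of _ "Pow (Pow {1..n})"]) (auto simp: good_def)
  have "good ((\<lambda>x. {x}) ` {1..n})"
  proof -
    obtain y where "y \<in> X" "y \<noteq> 0" using X qvs.subspace_0 by blast
    thus ?thesis by (auto simp: good_def antisym_on_def pairwise_def disjnt_iff)
  qed
  hence "weight n ` {P. good P} \<noteq> {}" by auto
  from Max_in[OF _ this] fin obtain P where P: "good P" "weight n P = Max (weight n ` {P. good P})" by force
  have max: "weight n P' \<le> weight n P" if "good P'" for P'
    unfolding P(2) using fin that by (intro Max_ge) auto
  obtain y where y: "y \<in> X" "y \<noteq> 0" "antisym_on P y" using P by (auto simp: good_def)
  obtain D T where D: "ferrers D" "finite D" "bij_betw T D {1..n}"
    and cols: "bij_betw (\<lambda>j. T ` {c \<in> D. snd c = j}) {j. (0, j) \<in> D} P"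
    using blocks_to_filling[of "{1..n}" P] P(1) unfolding good_def by auto
  have sh: "shape D" using D by (simp add: shape_def fin_part_def)
  have iT: "inj_on T D" using D by (simp add: bij_betw_def)
  define Bl where "Bl j = T ` {c \<in> D. snd c = j}" for j
  have BlP: "Bl j \<in> P" if "(0, j) \<in> D" for j using cols that unfolding Bl_def bij_betw_def by blast
  have cardBl: "card (Bl j) = collen D j" for j
    unfolding Bl_def collen_def by (rule card_image) (rule inj_on_subset[OF iT], auto)
  have tr: "poly_act (transpose (T c) (T c')) y = - y" if "c \<in> D" "c' \<in> D" "snd c = snd c'" "c \<noteq> c'" for c c'
  proof -
    have "(fst c, snd c) \<in> D" using that(1) by simp
    from ferrersD[OF D(1) this, of 0 "snd c"] have "(0, snd c) \<in> D" by simp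
    hence "Bl (snd c) \<in> P" by (rule BlP)
    moreover have "T c \<in> Bl (snd c)" "T c' \<in> Bl (snd c)" using that by (auto simp: Bl_def)
    moreover have "T c \<noteq> T c'" using that iT by (auto dest: inj_onD)
    ultimately show ?thesis using y(3) by (simp add: antisym_on_def)
  qed
  have "antisymmetrize {\<sigma>. \<sigma> permutes T ` garnir D i j} y = 0" if ij: "(i, j) \<in> D" "(i, Suc j) \<in> D" for i j
  proof (rule ccontr)
    let ?H = "T ` garnir D i j"
    assume nz: "antisymmetrize {\<sigma>. \<sigma> permutes ?H} y \<noteq> 0"
    note G = card_garnir[OF sh ij]
    have C: "fin_perm_group {\<sigma>. \<sigma> permutes ?H}" using G by (intro fin_perm_group_permutes) auto
    have HX: "?H \<subseteq> {1..n}" using garnir_subset D(3) by (metis bij_betw_imp_surj_on image_mono)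
    have cardH: "card ?H = Suc (collen D j)" using G card_image[OF inj_on_subset[OF iT garnir_subset]] by simp
    let ?z = "antisymmetrize {\<sigma>. \<sigma> permutes ?H} y"
    have zX: "?z \<in> X" unfolding antisymmetrize_def
      using inv[OF permutes_subset[OF _ HX]] y(1) by (intro qvs.subspace_sum[OF X(1)] qvs.subspace_scale[OF X(1)]) auto
    \<comment> \<open>The blocks before column \<open>j\<close>, the Garnir entries, and singletons\<close>
    define Q where "Q = Bl ` {..<j}"
    define R where "R = (\<lambda>x. {x}) ` ({1..n} - \<Union>Q - ?H)"
    define P' where "P' = insert ?H (Q \<union> R)"
    have d0: "(0, j') \<in> D" if "j' \<le> j" for j' using ferrersD[OF D(1) ij(1), of 0 j'] that by simp
    have BlX: "Bl j' \<subseteq> {1..n}" for j' using D(3) by (auto simp: Bl_def bij_betw_def)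
    have disjBl: "disjnt (Bl j1) (Bl j2)" if "j1 \<noteq> j2" for j1 j2
      using that iT by (auto simp: Bl_def disjnt_iff dest: inj_onD)
    have disjH: "disjnt (Bl j') ?H" if "j' < j" for j'
    proof -
      have "False" if "x \<in> Bl j'" "x \<in> ?H" for x
      proof -
        obtain c where c: "c \<in> D" "snd c = j'" "x = T c" using \<open>x \<in> Bl j'\<close> by (auto simp: Bl_def)
        obtain e where e: "e \<in> garnir D i j" "x = T e" using \<open>x \<in> ?H\<close> by blast
        have "c = e" using inj_onD[OF iT _ c(1), of e] c e garnir_subset by auto
        hence "snd c = j \<or> snd c = Suc j" using e by (auto simp: garnir_def)
        thus False using c(2) \<open>j' < j\<close> by auto
      qed
      thus ?thesis by (auto simp: disjnt_iff)
    qed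
    have "good P'" unfolding good_def
    proof (intro conjI)
      show "\<Union>P' = {1..n}" using HX BlX by (auto simp: P'_def R_def Q_def)
      show "pairwise disjnt P'"
      proof (rule pairwiseI)
        have u1: "B = ?H" if "B \<in> P'" "x \<in> B" "x \<in> ?H" for B x
        proof -
          have "x \<notin> Bl j'" if "j' < j" for j' using disjH[OF that] \<open>x \<in> ?H\<close> unfolding disjnt_iff by blast
          thus ?thesis using that unfolding P'_def Q_def R_def by blast
        qed
        have u2: "B = Bl j'" if "B \<in> P'" "x \<in> B" "x \<in> Bl j'" "j' < j" for B x j'
        proof -
          have "x \<notin> ?H" using disjH[OF that(4)] that(3) unfolding disjnt_iff by blast
          moreover have "j'' = j'" if "x \<in> Bl j''" for j''
            using disjBl[of j'' j'] that \<open>x \<in> Bl j'\<close> unfolding disjnt_iff by blast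
          ultimately show ?thesis using that unfolding P'_def Q_def R_def by blast
        qed
        have u3: "B = {x}" if "B \<in> P'" "x \<in> B" "x \<notin> ?H" "\<And>j'. j' < j \<Longrightarrow> x \<notin> Bl j'" for B x
          using that unfolding P'_def Q_def R_def by blast
        fix B B' assume B: "B \<in> P'" "B' \<in> P'" "B \<noteq> B'"
        show "disjnt B B'" unfolding disjnt_iff
        proof (intro allI notI)
          fix x assume x: "x \<in> B \<and> x \<in> B'"
          consider "x \<in> ?H" | j' where "j' < j" "x \<in> Bl j'" | "x \<notin> ?H" "\<And>j'. j' < j \<Longrightarrow> x \<notin> Bl j'" by blast
          thus False
          proof cases
            case 1 thus False using u1[of B x] u1[of B' x] B x by simp
          next
            case 2 thus False using u2[of B x] u2[of B' x] B x by simp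
          next
            case 3 thus False using u3[of B x] u3[of B' x] B x by simp
          qed
        qed
      qed
      show "{} \<notin> P'"
      proof -
        have "Bl j' \<noteq> {}" if "j' < j" for j' using d0[of j'] that by (auto simp: Bl_def)
        moreover have "?H \<noteq> {}" using cardH by (metis card.empty nat.distinct(1))
        ultimately show ?thesis by (auto simp: P'_def Q_def R_def)
      qed
      show "\<exists>y\<in>X. y \<noteq> 0 \<and> antisym_on P' y"
      proof (intro bexI[of _ ?z] conjI zX nz)
        show "antisym_on P' ?z" unfolding antisym_on_def
        proof (intro ballI impI)
          fix B a a' assume B: "B \<in> P'" and a: "a \<in> B" "a' \<in> B" "a \<noteq> a'"
          let ?t = "transpose a a'"
          \<comment> \<open>For the old blocks: transpositions of elements outside of \<open>?H\<close> commute with the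
            antisymmetriser.\<close>
          consider "B = ?H" | j' where "j' < j" "B = Bl j'" | "B \<in> R" using B by (auto simp: P'_def Q_def)
          thus "poly_act ?t ?z = - ?z"
          proof cases
            case 1
            hence "?t \<in> {\<sigma>. \<sigma> permutes ?H}" using a by (auto intro: permutes_swap_id)
            from poly_act_antisymmetrize[OF C this] show ?thesis using a by (simp add: sign_swap_id)
          next
            case 2
            have BP: "B \<in> P" using BlP[OF d0] 2 by simp
            have ty: "poly_act ?t y = - y" using y(3) BP a by (simp add: antisym_on_def)
            have comm: "poly_act ?t (poly_act \<sigma> y) = poly_act \<sigma> (poly_act ?t y)" if s: "\<sigma> permutes ?H" for \<sigma>
            proof -
              have nH: "a \<notin> ?H" "a' \<notin> ?H" using disjH[OF 2(1)] a 2(2) by (auto simp: disjnt_iff)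
              have fx: "\<sigma> a = a" "\<sigma> a' = a'" using permutes_not_in[OF s] nH by auto
              have "?t \<circ> \<sigma> = \<sigma> \<circ> ?t"
              proof
                fix x
                have "\<sigma> x = a \<longleftrightarrow> x = a" "\<sigma> x = a' \<longleftrightarrow> x = a'" using fx permutes_inj[OF s] by (metis injD)+
                thus "(?t \<circ> \<sigma>) x = (\<sigma> \<circ> ?t) x" using fx by (simp add: transpose_def)
              qed
              thus ?thesis using poly_act_comp[of ?t \<sigma> y] poly_act_comp[of \<sigma> ?t y] permutes_bij[OF s] by simp
            qed
            have "poly_act ?t ?z = antisymmetrize {\<sigma>. \<sigma> permutes ?H} (poly_act ?t y)"
              unfolding antisymmetrize_def by (simp add: poly_act_sum poly_act_scale comm)
            thus ?thesis unfolding ty by (simp add: module_hom.neg[OF antisymmetrize_hom[OF C]])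
          next
            case 3 thus ?thesis using a by (auto simp: R_def)
          qed
        qed
      qed
    qed
    hence le: "weight n P' \<le> weight n P" by (rule max)
    define l where "l = {j. (0, j) \<in> D}"
    have wP: "weight n P = (\<Sum>j\<in>l. (n + 1) ^ collen D j)"
      unfolding weight_def l_def using sum.reindex_bij_betw[OF cols, of "\<lambda>B. (n + 1) ^ card B"] cardBl by (simp add: Bl_def)
    have fP: "finite P" using P(1) finite_UnionD[of P] by (auto simp: good_def)
    have cl: "card l = card P" unfolding l_def using bij_betw_same_card[OF cols] .
    have "card P \<le> n"
    proof -
      have "card P \<le> card (\<Union>P)"
      proof -
        obtain f where f: "\<And>B. B \<in> P \<Longrightarrow> f B \<in> B" using P(1) unfolding good_def by (metis all_not_in_conv)
        have "inj_on f P"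
        proof (rule inj_onI)
          fix B B' assume "B \<in> P" "B' \<in> P" "f B = f B'"
          thus "B = B'" using f[of B] f[of B'] P(1) unfolding good_def pairwise_def disjnt_iff by metis
        qed
        moreover have "f ` P \<subseteq> \<Union>P" using f by blast
        ultimately show ?thesis using P(1) by (intro card_inj_on_le[of f]) (auto simp: good_def)
      qed
      thus ?thesis using P(1) by (simp add: good_def)
    qed
    have fl: "finite l" using bij_betw_finite[OF cols] fP by (simp add: l_def)
    have lsub: "{..<j} \<subseteq> l" using d0 by (auto simp: l_def)
    have mono: "collen D j' \<le> collen D j" if "j \<le> j'" for j'
      using lift_Suc_antimono_le[of "collen D", OF collen_antimono[OF sh] that] .
    have "weight n P = (\<Sum>j'\<in>l - {..<j}. (n + 1) ^ collen D j') + (\<Sum>j'<j. (n + 1) ^ collen D j')"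
      unfolding wP using sum.subset_diff[OF lsub fl] .
    also have "(\<Sum>j'\<in>l - {..<j}. (n + 1) ^ collen D j') \<le> (\<Sum>j'\<in>l - {..<j}. (n + 1) ^ collen D j)"
      by (intro sum_mono power_increasing mono) auto
    also have "\<dots> = card (l - {..<j}) * (n + 1) ^ collen D j" by simp
    also have "\<dots> \<le> n * (n + 1) ^ collen D j"
      using \<open>card P \<le> n\<close> cl card_mono[OF fl, of "l - {..<j}"] by (intro mult_right_mono) auto
    also have "\<dots> < (n + 1) ^ Suc (collen D j)" by simp
    finally have "weight n P < (n + 1) ^ card ?H + (\<Sum>j'<j. (n + 1) ^ collen D j')" by (simp add: cardH)
    also have "(\<Sum>j'<j. (n + 1) ^ collen D j') = (\<Sum>B\<in>Q. (n + 1) ^ card B)"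
    proof -
      have "inj_on Bl {..<j}"
      proof (rule inj_onI, rule ccontr)
        fix j1 j2 assume a: "j1 \<in> {..<j}" "j2 \<in> {..<j}" "Bl j1 = Bl j2" "j1 \<noteq> j2"
        have "Bl j1 = {}" using disjBl[OF a(4)] a(3) by (auto simp: disjnt_def)
        thus False using d0[of j1] a(1) by (auto simp: Bl_def)
      qed
      thus ?thesis unfolding Q_def by (simp add: sum.reindex cardBl)
    qed
    also have "(n + 1) ^ card ?H + (\<Sum>B\<in>Q. (n + 1) ^ card B) = (\<Sum>B\<in>insert ?H Q. (n + 1) ^ card B)"
    proof (rule sum.insert[symmetric])
      show "finite Q" by (simp add: Q_def)
      show "?H \<notin> Q"
      proof
        assume "?H \<in> Q"
        then obtain j' where "j' < j" "?H = Bl j'" by (auto simp: Q_def)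
        hence "?H = {}" using disjH[of j'] by (simp add: disjnt_def)
        thus False using cardH by (metis card.empty nat.distinct(1))
      qed
    qed
    also have "\<dots> \<le> weight n P'" unfolding weight_def
      by (rule sum_mono2) (auto simp: P'_def Q_def R_def)
    finally show False using le by simp
  qed
  hence "y \<in> garnir_closed D T" using tr by (simp add: garnir_closed_def)
  thus ?thesis using that D y by blast
qed

text \<open>
  The Specht polynomials in \<open>x\<^sub>1, \<dots>, x\<^sub>n\<close> of content \<open>b\<close> for semi-standard fillings \<open>M\<close> of
  finite shapes with first row zero.
\<close>

definition finite_specht :: "nat \<Rightarrow> nat multiset \<Rightarrow> qpoly set" where
  "finite_specht n b = {specht_poly D M T | D M T. ferrers D \<and> finite D \<and> bij_betw T D {1..n} \<and>
      tab D M \<and> semistandard D M \<and> (\<forall>j. M (0, j) = 0) \<and> mono_content (tab_mono D M T) = b}"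

text \<open>
  The Specht polynomials with first row zero span the polynomials of content \<open>b\<close> that are
  killed by all maps to fewer variables.
\<close>

lemma finite_spanning:
  assumes F: "F \<in> polys_in {m. keys m \<subseteq> {1..n} \<and> mono_content m = b}" "F \<in> ext_kernel (size b)"
  shows "F \<in> qvs.span (finite_specht n b)"
proof -
  define A where "A = {m. keys m \<subseteq> {1..n} \<and> mono_content m = b}"
  define W where "W = qvs.span (finite_specht n b)"
  have finA: "finite A"
    by (rule finite_subset[OF _ finite_monomials[of "{1..n}" "sum_mset b"]]) (auto simp: A_def simp flip: sum_mono_content)
  have gen: "s \<in> polys_in A \<inter> ext_kernel (size b)" if "s \<in> finite_specht n b" for s
  proof -
    obtain D M T where s: "s = specht_poly D M T" "bij_betw T D {1..n}" "tab D M" "semistandard D M"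
      "\<forall>j. M (0, j) = 0" "mono_content (tab_mono D M T) = b" using \<open>s \<in> finite_specht n b\<close> by (auto simp: finite_specht_def)
    have iT: "inj_on T D" using s(2) by (simp add: bij_betw_def)
    have "size b = card (keys (tab_mono D M T))" unfolding s(6)[symmetric] by (rule size_mono_content)
    also have "\<dots> = card (fin_part D)"
      unfolding keys_tab_mono[OF s(3) iT] support_semistandard(2)[OF s(3,4) s(5)[rule_format]]
      by (rule card_image[OF inj_on_subset[OF iT]]) (auto simp: fin_part_def)
    finally have "s \<in> ext_kernel (size b)" using specht_in_ext_kernel[OF s(3) iT] s(1) by simp
    moreover have "s \<in> polys_in A"
      using specht_keys[OF s(3) iT] s(1,2,6) by (auto simp: polys_in_def A_def bij_betw_def)
    ultimately show ?thesis by blast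
  qed
  have sub: "qvs.subspace (polys_in A \<inter> ext_kernel (size b))" by (rule qvs.subspace_inter[OF polys_in_subspace ext_kernel_subspace])
  have WK: "W \<subseteq> polys_in A \<inter> ext_kernel (size b)" unfolding W_def by (rule qvs.span_minimal[OF _ sub]) (use gen in blast)
  have sW: "qvs.subspace W" by (simp add: W_def)
  have invW: "inv_sub {\<sigma>. \<sigma> permutes {1..n}} W" unfolding W_def
  proof (rule inv_sub_span)
    fix g s assume g: "g \<in> {\<sigma>. \<sigma> permutes {1..n}}" and "s \<in> finite_specht n b"
    then obtain D M T where s: "s = specht_poly D M T" "ferrers D" "finite D" "bij_betw T D {1..n}" "tab D M" "semistandard D M"
      "\<forall>j. M (0, j) = 0" "mono_content (tab_mono D M T) = b" by (auto simp: finite_specht_def)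
    have iT: "inj_on T D" using s(4) by (simp add: bij_betw_def)
    have b: "bij g" using g permutes_bij by blast
    have "poly_act g s = specht_poly D M (g \<circ> T)" unfolding s(1) by (rule specht_poly_act[OF b s(5) iT, symmetric])
    moreover have "bij_betw (g \<circ> T) D {1..n}"
      using bij_betw_trans[OF s(4) permutes_imp_bij[of g "{1..n}"]] g by blast
    moreover have "mono_content (tab_mono D M (g \<circ> T)) = b"
      using s(8) by (simp add: tab_mono_act[OF b s(5) iT] mono_content_act[OF b])
    ultimately have "poly_act g s \<in> finite_specht n b" using s(2,3,5,6,7) unfolding finite_specht_def by blast
    thus "poly_act g s \<in> qvs.span (finite_specht n b)" by (rule qvs.span_base)
  qed (auto simp: permutes_bij)
  \<comment> \<open>The orthogonal complement in \<open>K\<^sub>b\<close>\<close>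
  define X where "X = {x \<in> polys_in A \<inter> ext_kernel (size b). \<forall>w\<in>W. qinner x w = 0}"
  have sX: "qvs.subspace X"
    by (rule qvs.subspaceI)
      (auto simp: X_def qinner_add_left qinner_scale_left qvs.subspace_0[OF polys_in_subspace] qvs.subspace_0[OF ext_kernel_subspace]
        qvs.subspace_add[OF polys_in_subspace] qvs.subspace_add[OF ext_kernel_subspace] qvs.subspace_scale[OF polys_in_subspace] qvs.subspace_scale[OF ext_kernel_subspace])
  have X0: "X = {0}"
  proof (rule ccontr)
    assume "X \<noteq> {0}"
    have invX: "poly_act \<sigma> x \<in> X" if s: "\<sigma> permutes {1..n}" and x: "x \<in> X" for \<sigma> x
    proof -
      have b: "bij \<sigma>" by (rule permutes_bij[OF s])
      have "poly_act \<sigma> x \<in> polys_in A"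
      proof (rule polys_in_act[OF b])
        fix m assume m: "m \<in> A"
        have "keys (mono_act \<sigma> m) \<subseteq> \<sigma> ` {1..n}" using m keys_mono_act[OF b] by (auto simp: A_def)
        thus "mono_act \<sigma> m \<in> A" using m mono_content_act[OF b] permutes_image[OF s] by (simp add: A_def)
      qed (use x in \<open>simp add: X_def\<close>)
      moreover have "poly_act \<sigma> x \<in> ext_kernel (size b)" using x ext_kernel_act[OF b] by (simp add: X_def)
      moreover have "qinner (poly_act \<sigma> x) w = 0" if "w \<in> W" for w
        using invW permutes_inv[OF s] that x by (simp add: qinner_poly_act[OF b] X_def inv_sub_def)
      ultimately show ?thesis by (simp add: X_def)
    qed
    obtain D T y where D: "ferrers D" "finite D" "bij_betw T D {1..n}" and y: "y \<in> X" "y \<noteq> 0" "y \<in> garnir_closed D T"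
      using garnir_closed_ex[OF sX \<open>X \<noteq> {0}\<close> invX] by blast
    have iT: "inj_on T D" "T ` D = {1..n}" using D by (auto simp: bij_betw_def)
    have sh: "shape D" using D by (simp add: shape_def fin_part_def)
    have yA: "y \<in> polys_in {m. keys m \<subseteq> T ` D \<and> mono_content m = b}" and yK: "y \<in> ext_kernel (size b)"
      using y(1) iT by (simp_all add: X_def A_def)
    have "qinner y y = 0"
    proof (rule qinner_span_eq_0[OF garnir_closed_span[OF D(1,2) iT(1) y(3) yA]])
      fix s assume "s \<in> {specht_poly D M T |M. tab D M \<and> semistandard D M \<and> mono_content (tab_mono D M T) = b}"
      then obtain M where M: "s = specht_poly D M T" "tab D M" "semistandard D M" "mono_content (tab_mono D M T) = b" by blast
      show "qinner y s = 0"
      proof (cases "\<forall>j. M (0, j) = 0")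
        case True
        hence "s \<in> finite_specht n b" using M D unfolding finite_specht_def by blast
        hence "s \<in> W" unfolding W_def by (rule qvs.span_base)
        thus ?thesis using y(1) by (simp add: X_def)
      next
        case False
        then obtain j0 where nz: "M (0, j0) \<noteq> 0" by blast
        have C: "fin_perm_group (col_stab D T)" by (rule col_stab_group[OF sh iT(1)])
        have "size b = card (keys (tab_mono D M T))" unfolding M(4)[symmetric] by (rule size_mono_content)
        also have "\<dots> = card {c \<in> D. M c \<noteq> 0}"
          unfolding keys_tab_mono[OF M(2) iT(1)] by (rule card_image[OF inj_on_subset[OF iT(1)]]) auto
        finally have k: "size b = card {c \<in> D. M c \<noteq> 0}" .
        have "qinner y s = qinner (antisymmetrize (col_stab D T) y) (ind_poly (orb D M T))"
          unfolding M(1) specht_poly_eq qinner_antisymmetrize[OF C] ..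
        also have "antisymmetrize (col_stab D T) y = qscale (of_nat (card (col_stab D T))) y"
        proof (rule antisymmetrize_of_antisymmetric[OF C antisym_col_stab[OF sh iT(1)]])
          show "poly_act (transpose (T c) (T c')) y = - y" if "c \<in> D" "c' \<in> D" "snd c = snd c'" "c \<noteq> c'" for c c'
            using y(3) that by (simp add: garnir_closed_def)
        qed
        also have "qinner (qscale (of_nat (card (col_stab D T))) y) (ind_poly (orb D M T))
            = of_nat (card (col_stab D T)) * (\<Sum>p\<in>orb D M T. lookup y p)"
        proof -
          have "qinner y (single p 1) = lookup y p" for p
            by (subst qinner_commute) (simp add: qinner_def)
          thus ?thesis by (simp add: qinner_scale_left ind_poly_def qinner_sum_right sum_distrib_left)
        qed
        also have "(\<Sum>p\<in>orb D M T. lookup y p) = 0"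
          by (rule row_sum_zero[OF D(2) iT(1) M(2,3) nz]) (use yA yK M(4) k in simp_all)
        finally show ?thesis by simp
      qed
    qed
    thus False using qinner_self_eq_0 y(2) by blast
  qed
  obtain w where w: "w \<in> W" "\<And>b. b \<in> W \<Longrightarrow> qinner (F - w) b = 0"
    using orthogonal_decomposition[OF sW, of A F] WK finA by auto
  have "F - w \<in> polys_in A \<inter> ext_kernel (size b)"
    by (rule qvs.subspace_diff[OF sub]) (use F w(1) WK in \<open>auto simp: A_def\<close>)
  hence "F - w \<in> X" using w(2) by (simp add: X_def)
  hence "F = w" using X0 by simp
  thus ?thesis using w(1) by (simp add: W_def)
qed

section \<open>Filtrations with irreducible factors\<close>

text \<open>
  Irreducibility of an invariant space of polynomials.
\<close>

definition irred :: "(nat \<Rightarrow> nat) set \<Rightarrow> qpoly set \<Rightarrow> bool" where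
  "irred G Y \<longleftrightarrow> inv_sub G Y \<and> Y \<noteq> {0} \<and> (\<forall>U. inv_sub G U \<longrightarrow> U \<subseteq> Y \<longrightarrow> U = {0} \<or> U = Y)"

text \<open>
  A relation between representatives that induces an isomorphism from \<open>B / A\<close> to \<open>B' / A'\<close>: it
  is linear and equivariant, each element of \<open>B\<close> and of \<open>B'\<close> occurs in it, and related
  elements vanish modulo \<open>A\<close> and \<open>A'\<close> simultaneously.
\<close>

definition subq_rel :: "(nat \<Rightarrow> nat) set \<Rightarrow> (qpoly \<Rightarrow> qpoly \<Rightarrow> bool) \<Rightarrow> qpoly set \<Rightarrow> qpoly set \<Rightarrow> qpoly set \<Rightarrow> qpoly set \<Rightarrow> bool" where
  "subq_rel G R A B A' B' \<longleftrightarrow>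
     (\<forall>x x'. R x x' \<longrightarrow> x \<in> B \<and> x' \<in> B') \<and>
     (\<forall>x x' y y'. R x x' \<longrightarrow> R y y' \<longrightarrow> R (x + y) (x' + y')) \<and>
     (\<forall>c x x'. R x x' \<longrightarrow> R (qscale c x) (qscale c x')) \<and>
     (\<forall>g\<in>G. \<forall>x x'. R x x' \<longrightarrow> R (poly_act g x) (poly_act g x')) \<and>
     (\<forall>x\<in>B. \<exists>x'. R x x') \<and> (\<forall>x'\<in>B'. \<exists>x. R x x') \<and>
     (\<forall>x x'. R x x' \<longrightarrow> (x \<in> A \<longleftrightarrow> x' \<in> A'))"

lemma subq_relI:
  assumes "\<And>x x'. R x x' \<Longrightarrow> x \<in> B" "\<And>x x'. R x x' \<Longrightarrow> x' \<in> B'"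
    "\<And>x x' y y'. R x x' \<Longrightarrow> R y y' \<Longrightarrow> R (x + y) (x' + y')"
    "\<And>c x x'. R x x' \<Longrightarrow> R (qscale c x) (qscale c x')"
    "\<And>g x x'. g \<in> G \<Longrightarrow> R x x' \<Longrightarrow> R (poly_act g x) (poly_act g x')"
    "\<And>x. x \<in> B \<Longrightarrow> \<exists>x'. R x x'" "\<And>x'. x' \<in> B' \<Longrightarrow> \<exists>x. R x x'"
    "\<And>x x'. R x x' \<Longrightarrow> x \<in> A \<longleftrightarrow> x' \<in> A'"
  shows "subq_rel G R A B A' B'"
  unfolding subq_rel_def by (intro conjI allI impI ballI) (rule assms; assumption)+

lemma subq_relD:
  assumes "subq_rel G R A B A' B'"
  shows "R x x' \<Longrightarrow> x \<in> B" "R x x' \<Longrightarrow> x' \<in> B'"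
    "R x x' \<Longrightarrow> R y y' \<Longrightarrow> R (x + y) (x' + y')"
    "R x x' \<Longrightarrow> R (qscale c x) (qscale c x')"
    "g \<in> G \<Longrightarrow> R x x' \<Longrightarrow> R (poly_act g x) (poly_act g x')"
    "x \<in> B \<Longrightarrow> \<exists>x'. R x x'" "x' \<in> B' \<Longrightarrow> \<exists>x. R x x'"
    "R x x' \<Longrightarrow> x \<in> A \<longleftrightarrow> x' \<in> A'"
  using assms unfolding subq_rel_def by simp_all

text \<open>
  The subquotients \<open>B / A\<close> and \<open>B' / A'\<close> are isomorphic.
\<close>

definition subq_iso :: "(nat \<Rightarrow> nat) set \<Rightarrow> qpoly set \<Rightarrow> qpoly set \<Rightarrow> qpoly set \<Rightarrow> qpoly set \<Rightarrow> bool" where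
  "subq_iso G A B A' B' \<longleftrightarrow> (\<exists>R. subq_rel G R A B A' B')"

lemma subq_iso_trans:
  assumes "subq_iso G A B A' B'" "subq_iso G A' B' A'' B''"
  shows "subq_iso G A B A'' B''"
proof -
  obtain R where R: "subq_rel G R A B A' B'" using assms by (auto simp: subq_iso_def)
  obtain R' where R': "subq_rel G R' A' B' A'' B''" using assms by (auto simp: subq_iso_def)
  note R = subq_relD[OF R] and R' = subq_relD[OF R']
  have "subq_rel G (\<lambda>x z. \<exists>y. R x y \<and> R' y z) A B A'' B''"
  proof (rule subq_relI)
    fix x z assume "\<exists>y. R x y \<and> R' y z"
    then obtain y where y: "R x y" "R' y z" by blast
    show "x \<in> B" by (rule R(1)[OF y(1)])
    show "z \<in> B''" by (rule R'(2)[OF y(2)])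
    show "x \<in> A \<longleftrightarrow> z \<in> A''" using R(8)[OF y(1)] R'(8)[OF y(2)] by simp
    show "\<exists>y. R (qscale c x) y \<and> R' y (qscale c z)" for c using R(4)[OF y(1)] R'(4)[OF y(2)] by (intro exI conjI)
    show "\<exists>y. R (poly_act g x) y \<and> R' y (poly_act g z)" if "g \<in> G" for g
      using R(5)[OF that y(1)] R'(5)[OF that y(2)] by (intro exI conjI)
    fix x' z' assume "\<exists>y. R x' y \<and> R' y z'"
    then obtain y' where y': "R x' y'" "R' y' z'" by blast
    show "\<exists>y. R (x + x') y \<and> R' y (z + z')" using R(3)[OF y(1) y'(1)] R'(3)[OF y(2) y'(2)] by (intro exI conjI)
  next
    fix x assume "x \<in> B"
    then obtain y where y: "R x y" using R(6) by blast
    then obtain z where "R' y z" using R'(6)[OF R(2)[OF y]] by blast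
    thus "\<exists>z y. R x y \<and> R' y z" using y by blast
  next
    fix z assume "z \<in> B''"
    then obtain y where y: "R' y z" using R'(7) by blast
    then obtain x where "R x y" using R(7)[OF R'(1)[OF y]] by blast
    thus "\<exists>x y. R x y \<and> R' y z" using y by blast
  qed
  thus ?thesis by (auto simp: subq_iso_def)
qed

text \<open>
  \<open>A\<close> is a maximal proper invariant subspace of \<open>B\<close>; equivalently, \<open>B / A\<close> is irreducible.
\<close>

definition simple_step :: "(nat \<Rightarrow> nat) set \<Rightarrow> qpoly set \<Rightarrow> qpoly set \<Rightarrow> bool" where
  "simple_step G A B \<longleftrightarrow> inv_sub G A \<and> inv_sub G B \<and> A \<subseteq> B \<and> A \<noteq> B \<and>
     (\<forall>C. inv_sub G C \<longrightarrow> A \<subseteq> C \<longrightarrow> C \<subseteq> B \<longrightarrow> C = A \<or> C = B)"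

lemma simple_step_of_irred:
  assumes A: "inv_sub G A" and B: "inv_sub G B" and AB: "A \<subseteq> B" and Y: "irred G Y" and iso: "subq_iso G A B {0} Y"
  shows "simple_step G A B"
proof -
  obtain R where R: "subq_rel G R A B {0} Y" using iso by (auto simp: subq_iso_def)
  have sA: "qvs.subspace A" using A by (simp add: inv_sub_def)
  note R' = subq_relD[OF R]
  have R0: "x \<in> A \<longleftrightarrow> y = 0" if "R x y" for x y using R'(8)[OF that] by simp
  note dom = R'(6) and ran = R'(7) and RB = R'(1,2) and Radd = R'(3) and Rscale = R'(4) and Ract = R'(5)
  have Rdiff: "R (x - x') (y - y')" if "R x y" "R x' y'" for x y x' y'
    using Radd[OF that(1) Rscale[OF that(2), of "-1"]] by simp
  have "A \<noteq> B"
  proof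
    assume "A = B"
    hence "Y \<subseteq> {0}" using R0 ran RB by blast
    moreover have "0 \<in> Y" using Y qvs.subspace_0 by (auto simp: irred_def inv_sub_def)
    ultimately show False using Y by (auto simp: irred_def)
  qed
  moreover have "C = A \<or> C = B" if C: "inv_sub G C" "A \<subseteq> C" "C \<subseteq> B" for C
  proof -
    have sC: "qvs.subspace C" using C by (simp add: inv_sub_def)
    define U where "U = {y. \<exists>x\<in>C. R x y}"
    have "inv_sub G U"
    proof (rule inv_subI[OF qvs.subspaceI])
      have "R 0 0"
      proof -
        obtain y where "R 0 y" using dom qvs.subspace_0[OF sA] AB by blast
        thus ?thesis using R0 qvs.subspace_0[OF sA] by blast
      qed
      thus "0 \<in> U" using qvs.subspace_0[OF sC] by (auto simp: U_def)
      show "x + y \<in> U" if "x \<in> U" "y \<in> U" for x y using that Radd qvs.subspace_add[OF sC] unfolding U_def by blast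
      show "qscale c x \<in> U" if "x \<in> U" for c x using that Rscale qvs.subspace_scale[OF sC] unfolding U_def by blast
      show "poly_act g x \<in> U" if "g \<in> G" "x \<in> U" for g x using that Ract C(1) unfolding U_def inv_sub_def by blast
    qed
    moreover have "U \<subseteq> Y" using RB by (auto simp: U_def)
    ultimately consider "U = {0}" | "U = Y" using Y unfolding irred_def by blast
    thus ?thesis
    proof cases
      case 1
      have "C \<subseteq> A"
      proof
        fix x assume x: "x \<in> C"
        then obtain y where "R x y" using dom C by blast
        hence "y \<in> U" using x by (auto simp: U_def)
        thus "x \<in> A" using 1 R0[OF \<open>R x y\<close>] by blast
      qed
      thus ?thesis using C by blast
    next
      case 2
      have "B \<subseteq> C"
      proof
        fix x assume x: "x \<in> B"
        then obtain y where y: "R x y" using dom by blast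
        hence "y \<in> U" using 2 RB by blast
        then obtain x' where x': "x' \<in> C" "R x' y" by (auto simp: U_def)
        have "x - x' \<in> A" using Rdiff[OF y x'(2)] R0 by (metis diff_self)
        hence "x' + (x - x') \<in> C" using qvs.subspace_add[OF sC x'(1)] C(2) by blast
        thus "x \<in> C" by simp
      qed
      thus ?thesis using C by blast
    qed
  qed
  ultimately show ?thesis using A B AB by (simp add: simple_step_def)
qed

text \<open>
  \<open>filt G V U ls W\<close>: there is a chain of invariant subspaces from \<open>U\<close> up to \<open>W\<close> whose
  successive quotients are isomorphic to the irreducible spaces \<open>V l\<close>, for the elements \<open>l\<close> of
  the list \<open>ls\<close> in their order.
\<close>

inductive filt :: "(nat \<Rightarrow> nat) set \<Rightarrow> ('l \<Rightarrow> qpoly set) \<Rightarrow> qpoly set \<Rightarrow> 'l list \<Rightarrow> qpoly set \<Rightarrow> bool"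
  for G V where
  filt_nil: "inv_sub G U \<Longrightarrow> filt G V U [] U"
| filt_step: "filt G V U ls W \<Longrightarrow> inv_sub G W' \<Longrightarrow> W \<subseteq> W' \<Longrightarrow> irred G (V l) \<Longrightarrow> subq_iso G W W' {0} (V l) \<Longrightarrow>
     filt G V U (ls @ [l]) W'"

lemma filt_inv: "filt G V U ls W \<Longrightarrow> inv_sub G U \<and> inv_sub G W \<and> U \<subseteq> W"
  by (induction rule: filt.induct) auto

lemma filt_append:
  assumes "filt G V W ls' X" "filt G V U ls W"
  shows "filt G V U (ls @ ls') X"
  using assms
proof (induction rule: filt.induct)
  case (filt_step W ls' X X' l)
  thus ?case using filt.filt_step[of G V U "ls @ ls'" X X' l] by simp
qed simp

text \<open>
  Preimages under an equivariant linear map. The inclusion of \<open>B\<close> in the image makes the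
  quotients of the preimages isomorphic to those of the given chain.
\<close>

lemma filt_pullback:
  assumes "filt G V A ls B"
    and W: "inv_sub G W" and \<phi>: "module_hom qscale qscale \<phi>" "\<And>g x. g \<in> G \<Longrightarrow> \<phi> (poly_act g x) = poly_act g (\<phi> x)"
    and "B \<subseteq> \<phi> ` W"
  shows "filt G V (W \<inter> \<phi> -` A) ls (W \<inter> \<phi> -` B)"
proof -
  have sW: "qvs.subspace W" using W by (simp add: inv_sub_def)
  note h = module_hom.add[OF \<phi>(1)] module_hom.scale[OF \<phi>(1)] module_hom.zero[OF \<phi>(1)]
  have inv: "inv_sub G (W \<inter> \<phi> -` C)" if C: "inv_sub G C" for C
  proof (rule inv_subI[OF qvs.subspaceI])
    have sC: "qvs.subspace C" using C by (simp add: inv_sub_def)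
    show "0 \<in> W \<inter> \<phi> -` C" by (simp add: h qvs.subspace_0[OF sC] qvs.subspace_0[OF sW])
    show "x + y \<in> W \<inter> \<phi> -` C" if "x \<in> W \<inter> \<phi> -` C" "y \<in> W \<inter> \<phi> -` C" for x y
      using that by (simp add: h qvs.subspace_add[OF sC] qvs.subspace_add[OF sW])
    show "qscale c x \<in> W \<inter> \<phi> -` C" if "x \<in> W \<inter> \<phi> -` C" for c x
      using that by (simp add: h qvs.subspace_scale[OF sC] qvs.subspace_scale[OF sW])
    show "poly_act g x \<in> W \<inter> \<phi> -` C" if "g \<in> G" "x \<in> W \<inter> \<phi> -` C" for g x
      using that W C by (simp add: \<phi>(2) inv_sub_def)
  qed
  show ?thesis using assms(1) \<open>B \<subseteq> \<phi> ` W\<close>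
  proof (induction rule: filt.induct)
    case (filt_nil U)
    show ?case by (rule filt.filt_nil[OF inv[OF filt_nil(1)]])
  next
    case (filt_step U ls B B' l)
    obtain R where R: "subq_rel G R B B' {0} (V l)" using filt_step by (auto simp: subq_iso_def)
    note R' = subq_relD[OF R]
    have "subq_rel G (\<lambda>x y. x \<in> W \<and> R (\<phi> x) y) (W \<inter> \<phi> -` B) (W \<inter> \<phi> -` B') {0} (V l)"
    proof (rule subq_relI)
      fix x y assume xy: "x \<in> W \<and> R (\<phi> x) y"
      show "x \<in> W \<inter> \<phi> -` B'" using xy R'(1)[of "\<phi> x" y] by simp
      show "y \<in> V l" using xy R'(2)[of "\<phi> x" y] by simp
      show "(x \<in> W \<inter> \<phi> -` B) = (y \<in> {0})" using xy R'(8)[of "\<phi> x" y] by simp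
      show "qscale c x \<in> W \<and> R (\<phi> (qscale c x)) (qscale c y)" for c
        using xy R'(4) qvs.subspace_scale[OF sW] by (simp add: h)
      show "poly_act g x \<in> W \<and> R (\<phi> (poly_act g x)) (poly_act g y)" if "g \<in> G" for g
        using xy R'(5)[OF that] W \<phi>(2)[OF that] that by (simp add: inv_sub_def)
      fix x' y' assume x'y': "x' \<in> W \<and> R (\<phi> x') y'"
      show "x + x' \<in> W \<and> R (\<phi> (x + x')) (y + y')"
        using xy x'y' R'(3) qvs.subspace_add[OF sW] by (simp add: h)
    next
      fix x assume "x \<in> W \<inter> \<phi> -` B'"
      thus "\<exists>y. x \<in> W \<and> R (\<phi> x) y" using R'(6)[of "\<phi> x"] by simp
    next
      fix y assume "y \<in> V l"
      then obtain z where z: "R z y" using R'(7) by blast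
      have "z \<in> \<phi> ` W" using R'(1)[OF z] filt_step.prems by (rule subsetD[rotated])
      then obtain x where "x \<in> W" "z = \<phi> x" by (rule imageE)
      thus "\<exists>x. x \<in> W \<and> R (\<phi> x) y" using z by (intro exI[of _ x]) simp
    qed
    hence "subq_iso G (W \<inter> \<phi> -` B) (W \<inter> \<phi> -` B') {0} (V l)" by (auto simp: subq_iso_def)
    moreover have "filt G V (W \<inter> \<phi> -` U) ls (W \<inter> \<phi> -` B)" using filt_step by blast
    ultimately show ?case using filt_step by (intro filt.filt_step inv) auto
  qed
qed

text \<open>
  For irreducible spaces, independence in the sense of a direct sum follows if no space is
  contained in the sum of the preceding ones.
\<close>

lemma filt_independent:
  assumes "\<And>l. l \<in> set ls \<Longrightarrow> irred G (V l)"
    and "\<And>i. i < length ls \<Longrightarrow> \<not> V (ls ! i) \<subseteq> qvs.span (\<Union>l\<in>set (take i ls). V l)"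
    and G: "\<And>g. g \<in> G \<Longrightarrow> bij g"
  shows "filt G V {0} ls (qvs.span (\<Union>l\<in>set ls. V l))"
  using assms(1,2)
proof (induction ls rule: rev_induct)
  case Nil
  have "inv_sub G {0}" by (rule inv_subI) (auto simp: qvs.subspace_single_0 poly_act_0 G)
  thus ?case using filt_nil by simp
next
  case (snoc l ls)
  let ?U = "qvs.span (\<Union>l\<in>set ls. V l)"
  have "filt G V {0} ls ?U"
  proof (rule snoc.IH)
    show "irred G (V l)" if "l \<in> set ls" for l using snoc.prems(1) that by simp
    show "\<not> V (ls ! i) \<subseteq> qvs.span (\<Union>l\<in>set (take i ls). V l)" if "i < length ls" for i
      using snoc.prems(2)[of i] that by (simp add: nth_append)
  qed
  note filtU = this
  have irr: "irred G (V l)" using snoc.prems(1) by simp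
  have iV: "inv_sub G (V l)" using irr by (simp add: irred_def)
  have sV: "qvs.subspace (V l)" using iV by (simp add: inv_sub_def)
  have iU: "inv_sub G ?U" using filt_inv[OF filtU] by simp
  let ?W = "qvs.span (\<Union>l\<in>set (ls @ [l]). V l)"
  have spanV: "qvs.span (V l) = V l" using sV by (simp add: qvs.span_eq_iff)
  have "?W = qvs.span ((\<Union>l\<in>set ls. V l) \<union> V l)" by (rule arg_cong[of _ _ qvs.span]) auto
  also have "\<dots> = {x + y |x y. x \<in> ?U \<and> y \<in> V l}"
    unfolding qvs.span_Un spanV ..
  finally have W: "?W = {x + y |x y. x \<in> ?U \<and> y \<in> V l}" .
  have "inv_sub G ?W"
  proof (rule inv_sub_span[OF G])
    fix g s assume g: "g \<in> G" "s \<in> (\<Union>l\<in>set (ls @ [l]). V l)"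
    then obtain l' where l': "l' \<in> set (ls @ [l])" "s \<in> V l'" by blast
    hence "poly_act g s \<in> V l'" using snoc.prems(1)[OF l'(1)] g(1) by (simp add: irred_def inv_sub_def)
    thus "poly_act g s \<in> ?W" using l'(1) by (intro qvs.span_base) blast
  qed
  moreover have "?U \<subseteq> ?W" by (rule qvs.span_mono) auto
  moreover have "subq_iso G ?U ?W {0} (V l)"
  proof -
    have nV: "\<not> V l \<subseteq> ?U" using snoc.prems(2)[of "length ls"] by simp
    have "inv_sub G (?U \<inter> V l)" using iU iV by (auto simp: inv_sub_def qvs.subspace_inter)
    hence "?U \<inter> V l = {0} \<or> ?U \<inter> V l = V l" using irr by (simp add: irred_def)
    hence inter: "?U \<inter> V l = {0}" using nV by blast
    \<comment> \<open>Related to \<open>x\<close> is its component in \<open>V l\<close>.\<close>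
    have "subq_rel G (\<lambda>x y. y \<in> V l \<and> x - y \<in> ?U) ?U ?W {0} (V l)"
    proof (rule subq_relI)
      fix x y assume xy: "y \<in> V l \<and> x - y \<in> ?U"
      thus "x \<in> ?W" unfolding W by (intro CollectI exI[of _ "x - y"] exI[of _ y]) simp
      show "y \<in> V l" using xy by simp
      show "(x \<in> ?U) = (y \<in> {0})"
      proof
        assume "x \<in> ?U"
        hence "x - (x - y) \<in> ?U" using xy qvs.span_diff by blast
        hence "y \<in> ?U \<inter> V l" using xy by simp
        thus "y \<in> {0}" unfolding inter .
      qed (use xy in auto)
      have "qscale c (x - y) \<in> ?U" for c using xy by (intro qvs.span_scale) simp
      thus "qscale c y \<in> V l \<and> qscale c x - qscale c y \<in> ?U" for c
        using xy qvs.subspace_scale[OF sV] by (simp add: qvs.scale_right_diff_distrib)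
      have "poly_act g x - poly_act g y \<in> ?U" if g: "g \<in> G" for g
      proof -
        have "poly_act g (x - y) \<in> ?U" using xy iU g by (simp add: inv_sub_def)
        thus ?thesis by (simp only: module_hom.diff[OF poly_act_hom[OF G[OF g]]])
      qed
      thus "poly_act g y \<in> V l \<and> poly_act g x - poly_act g y \<in> ?U" if "g \<in> G" for g
        using xy iV that by (simp add: inv_sub_def)
      fix x' y' assume x'y': "y' \<in> V l \<and> x' - y' \<in> ?U"
      have "(x - y) + (x' - y') \<in> ?U" using xy x'y' by (intro qvs.span_add) simp_all
      moreover have "(x - y) + (x' - y') = x + x' - (y + y')" by (simp add: algebra_simps)
      ultimately show "y + y' \<in> V l \<and> x + x' - (y + y') \<in> ?U"
        using xy x'y' qvs.subspace_add[OF sV] by simp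
    next
      fix x assume "x \<in> ?W"
      then obtain u v where "x = u + v" "u \<in> ?U" "v \<in> V l" unfolding W by blast
      thus "\<exists>x'. x' \<in> V l \<and> x - x' \<in> ?U" by (intro exI[of _ v]) simp
    next
      fix x' assume "x' \<in> V l"
      thus "\<exists>x. x' \<in> V l \<and> x - x' \<in> ?U" by (intro exI[of _ x']) (simp add: qvs.span_zero)
    qed
    thus ?thesis by (auto simp: subq_iso_def)
  qed
  ultimately show ?case using irr filtU by (intro filt_step) auto
qed

section \<open>The tableaux of infinite shape\<close>

text \<open>
  Tableaux of infinite shape, paired with their shapes, as indices of the composition factors.
\<close>

type_synonym label = "diagram \<times> inf_tableau"

text \<open>
  The multiplicities are disregarded here, so that different labels may give the same space.
\<close>

definition V_label :: "label \<Rightarrow> qpoly set" where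
  "V_label l = V_infty (fst l) (fst (snd l))"

text \<open>
  \<open>M\<close> is the finite part of some tableau of infinite shape \<open>D\<close>.
\<close>

definition valid_label :: "diagram \<Rightarrow> (box \<Rightarrow> nat) \<Rightarrow> bool" where
  "valid_label D M \<longleftrightarrow> partition_infty D \<and> semistandard (fin_part D) M \<and> (\<forall>c\<in>fin_part D. 0 < M c)"

lemma label_iff: "(D, (M, m)) \<in> inf_tableaux_content \<mu> \<longleftrightarrow>
    valid_label D M \<and> 0 \<notin># m \<and> m + image_mset M (mset_set (fin_part D)) = \<mu>"
  by (auto simp: inf_tableaux_content_def SSYT_infty_def tab_content_def valid_label_def)

lemma valid_labelD:
  assumes "valid_label D M"
  shows "partition_infty D" "tab D M" "semistandard D M" "\<And>j. M (0, j) = 0" "{c \<in> D. M c \<noteq> 0} = fin_part D"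
    "c \<in> fin_part D \<longleftrightarrow> M c \<noteq> 0"
proof -
  show D: "partition_infty D" using assms by (simp add: valid_label_def)
  have ss: "semistandard (fin_part D) M" and pos: "\<And>c. c \<in> fin_part D \<Longrightarrow> 0 < M c" using assms by (auto simp: valid_label_def)
  have out: "M c = 0" if "c \<notin> fin_part D" for c using ss that unfolding semistandard_def by blast
  show "c \<in> fin_part D \<longleftrightarrow> M c \<noteq> 0" using pos[of c] out[of c] by (cases "c \<in> fin_part D") simp_all
  show z: "M (0, j) = 0" for j by (rule out) (simp add: fin_part_def)
  have "M c = 0" if "c \<notin> D" for c by (rule out) (use that in \<open>auto simp: fin_part_def\<close>)
  thus t: "tab D M" using z partition_infty_shape[OF D] by (simp add: tab_def)
  show "{c \<in> D. M c \<noteq> 0} = fin_part D"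
  proof (intro equalityI subsetI)
    fix c assume c: "c \<in> {c \<in> D. M c \<noteq> 0}"
    show "c \<in> fin_part D" by (rule ccontr) (use c out[of c] in simp)
  next
    fix c assume c: "c \<in> fin_part D"
    thus "c \<in> {c \<in> D. M c \<noteq> 0}" using pos[OF c] by (simp add: fin_part_def)
  qed
  show "semistandard D M" unfolding semistandard_def
  proof (intro conjI allI impI)
    fix c assume "c \<notin> D" thus "M c = 0" using t unfolding tab_def by blast
  next
    fix i j j' assume a: "(i, j) \<in> D" "(i, j') \<in> D" "j < j'"
    show "M (i, j) \<le> M (i, j')"
    proof (cases "i = 0")
      case False
      hence "(i, j) \<in> fin_part D" "(i, j') \<in> fin_part D" using a by (auto simp: fin_part_def)
      thus ?thesis using ss a(3) unfolding semistandard_def by blast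
    qed (simp add: z)
  next
    fix i i' j assume a: "(i, j) \<in> D" "(i', j) \<in> D" "i < i'"
    have f: "(i', j) \<in> fin_part D" using a by (auto simp: fin_part_def)
    show "M (i, j) < M (i', j)"
    proof (cases "i = 0")
      case False
      hence "(i, j) \<in> fin_part D" using a by (auto simp: fin_part_def)
      thus ?thesis using ss a(3) f unfolding semistandard_def by blast
    qed (simp add: z pos[OF f])
  qed
qed

lemma V_label_irred:
  assumes G: "S_infty \<subseteq> G" "G \<subseteq> S_N" and v: "valid_label D M"
  shows "irred G (V_infty D M)"
proof -
  note D = valid_labelD[OF v]
  show ?thesis unfolding irred_def V_infty_eq[OF D(1,2)]
    using V_all_inv[OF G(2) D(2)] V_all_nonzero[OF D(1-3)] V_all_irreducible[OF D(1,2) G] by blast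
qed

text \<open>
  The functional that takes the coefficient at \<open>p\<^bsub>M,T\<^esub>\<close> after applying the column
  antisymmetriser of \<open>T\<close> vanishes on the spaces in \<open>S\<close>, but not at \<open>F\<^bsub>M,T\<^esub>\<close>.
\<close>

lemma V_label_independent:
  assumes v: "valid_label D M"
    and S: "\<And>D' M'. (D', M') \<in> S \<Longrightarrow> valid_label D' M' \<and> (D', M') \<noteq> (D, M) \<and> nval D' \<le> nval D \<and> (D' = D \<longrightarrow> sval D M' \<le> sval D M)"
  shows "\<not> V_infty D M \<subseteq> qvs.span (\<Union>(D', M')\<in>S. V_infty D' M')"
proof
  assume sub: "V_infty D M \<subseteq> qvs.span (\<Union>(D', M')\<in>S. V_infty D' M')"
  note D = valid_labelD[OF v]
  obtain T :: "box \<Rightarrow> nat" where T: "bij_betw T D {1..}" using ex_filling[OF D(1)] by blast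
  have iT: "inj_on T D" using T by (simp add: bij_betw_def)
  have C: "fin_perm_group (col_stab D T)" by (rule col_stab_group[OF partition_infty_shape[OF D(1)] iT])
  define L where "L F = lookup (antisymmetrize (col_stab D T) F) (tab_mono D M T)" for F
  note h = antisymmetrize_hom[OF C]
  have L: "L (F + H) = L F + L H" "L (qscale c F) = c * L F" "L 0 = 0" for F H c
    by (simp_all add: L_def module_hom.add[OF h] module_hom.scale[OF h] C lookup_add)
  have LS: "L F = 0" if F: "F \<in> V_infty D' M'" and DS: "(D', M') \<in> S" for F D' M'
  proof -
    have s: "valid_label D' M'" "(D', M') \<noteq> (D, M)" "nval D' \<le> nval D" "D' = D \<longrightarrow> sval D M' \<le> sval D M"
      using S[OF DS] by auto
    note D' = valid_labelD[OF s(1)]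
    obtain c where c: "antisymmetrize (col_stab D T) F = qscale c (specht_poly D M' T)" "D \<noteq> D' \<longrightarrow> c = 0"
      using kappa_span[OF D(1) D'(1) T s(3) D'(2) F[unfolded V_infty_eq[OF D'(1,2)] V_all_def]] by blast
    show ?thesis
    proof (cases "D = D'")
      case True
      hence "M' \<noteq> M" "sval D M' \<le> sval D M" "tab D M'" "semistandard D M'" using s D' by auto
      thus ?thesis using lookup_specht_triangular[OF D(2) _ iT D(3)] by (simp add: L_def c)
    next
      case False thus ?thesis using c by (simp add: L_def)
    qed
  qed
  have "L F = 0" if "F \<in> qvs.span (\<Union>(D', M')\<in>S. V_infty D' M')" for F
    using that by (induction rule: qvs.span_induct_alt) (use LS in \<open>auto simp: L\<close>)
  moreover have "specht_poly D M T \<in> V_infty D M"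
    unfolding V_infty_eq[OF D(1,2)] V_all_def using T by (intro qvs.span_base) blast
  ultimately have "L (specht_poly D M T) = 0" using sub by blast
  moreover have "antisymmetrize (col_stab D T) (specht_poly D M T) = qscale (of_nat (card (col_stab D T))) (specht_poly D M T)"
    unfolding specht_poly_eq by (rule antisymmetrize_twice[OF C])
  ultimately have "of_nat (card (col_stab D T)) * lookup (specht_poly D M T) (tab_mono D M T) = (0 :: rat)" by (simp add: L_def)
  thus False using lookup_specht_triangular[OF D(2,2) iT D(3,3) order_refl] fin_perm_group_card_pos[OF C] by simp
qed

text \<open>
  For a fixed content, the filling of the finite part determines the multiplicities. So
  different labels give different fillings, whose spaces are independent.
\<close>

lemma filt_labels:
  assumes G: "S_infty \<subseteq> G" "G \<subseteq> S_N" and fin: "finite I" and I: "I \<subseteq> inf_tableaux_content \<mu>"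
  shows "\<exists>ls. distinct ls \<and> set ls = I \<and> filt G V_label {0} ls (qvs.span (\<Union>l\<in>I. V_label l))"
proof -
  define sv where "sv l = sval (fst l) (fst (snd l))" for l :: label
  define K where "K = Suc (\<Sum>l\<in>I. sv l)"
  \<comment> \<open>The lexicographic order by \<open>nval\<close> and \<open>sval\<close>, encoded in one number since \<open>sval\<close> stays
    below \<open>K\<close>\<close>
  define key where "key l = nval (fst l) * K + sv l" for l :: label
  have svK: "sv l < K" if "l \<in> I" for l using member_le_sum[OF that, of sv] fin by (simp add: K_def)
  have key: "nval (fst l') \<le> nval (fst l) \<and> (nval (fst l') = nval (fst l) \<longrightarrow> sv l' \<le> sv l)"
    if "key l' \<le> key l" "l \<in> I" "l' \<in> I" for l l'
  proof
    show "nval (fst l') \<le> nval (fst l)"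
    proof (rule ccontr)
      assume "\<not> ?thesis"
      hence "Suc (nval (fst l)) * K \<le> nval (fst l') * K" by (intro mult_right_mono) auto
      thus False using that(1) svK[OF that(2)] by (simp add: key_def)
    qed
    show "nval (fst l') = nval (fst l) \<longrightarrow> sv l' \<le> sv l"
    proof
      assume "nval (fst l') = nval (fst l)"
      thus "sv l' \<le> sv l" using that(1) by (simp add: key_def)
    qed
  qed
  obtain xs where xs: "set xs = I" "distinct xs" using finite_distinct_list[OF fin] by blast
  define ls where "ls = sort_key key xs"
  have ls: "set ls = I" "distinct ls" using xs by (simp_all add: ls_def)
  have "sorted (map key ls)" by (simp add: ls_def)
  have val: "valid_label (fst l) (fst (snd l))" if "l \<in> I" for l
    using that I label_iff[of "fst l" "fst (snd l)" "snd (snd l)" \<mu>] by auto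
  have eqI: "l = l'" if "l \<in> I" "l' \<in> I" "fst l = fst l'" "fst (snd l) = fst (snd l')" for l l'
  proof -
    have "(fst l, (fst (snd l), snd (snd l))) \<in> inf_tableaux_content \<mu>" "(fst l', (fst (snd l'), snd (snd l'))) \<in> inf_tableaux_content \<mu>"
      using that(1,2) I by auto
    hence "snd (snd l) = snd (snd l')" unfolding label_iff that(3,4) by (metis add_right_cancel)
    thus ?thesis using that(3,4) by (simp add: prod_eq_iff)
  qed
  have "filt G V_label {0} ls (qvs.span (\<Union>l\<in>set ls. V_label l))"
  proof (rule filt_independent)
    show "irred G (V_label l)" if "l \<in> set ls" for l
      unfolding V_label_def using that ls(1) by (intro V_label_irred[OF G] val) simp
    show "bij g" if "g \<in> G" for g using that G(2) S_N_bij by blast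
    fix i assume i: "i < length ls"
    let ?l = "ls ! i"
    have lI: "?l \<in> I" using i ls(1) by auto
    have "\<not> V_infty (fst ?l) (fst (snd ?l)) \<subseteq> qvs.span (\<Union>(D', M')\<in>(\<lambda>l. (fst l, fst (snd l))) ` set (take i ls). V_infty D' M')"
    proof (rule V_label_independent[OF val[OF lI]])
      fix D' M' assume "(D', M') \<in> (\<lambda>l. (fst l, fst (snd l))) ` set (take i ls)"
      then obtain l' where l': "l' \<in> set (take i ls)" "D' = fst l'" "M' = fst (snd l')" by blast
      then obtain i' where i': "i' < i" "l' = ls ! i'" using i by (auto simp: in_set_conv_nth)
      have l'I: "l' \<in> I" using i' i ls(1) by auto
      have "l' \<noteq> ?l" using ls(2) i i' by (simp add: nth_eq_iff_index_eq)
      hence ne: "(D', M') \<noteq> (fst ?l, fst (snd ?l))" using eqI[OF l'I lI] l' by auto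
      have "key l' \<le> key ?l" using sorted_nth_mono[OF \<open>sorted (map key ls)\<close>, of i' i] i i' by simp
      from key[OF this lI l'I] show "valid_label D' M' \<and> (D', M') \<noteq> (fst ?l, fst (snd ?l)) \<and> nval D' \<le> nval (fst ?l) \<and>
          (D' = fst ?l \<longrightarrow> sval (fst ?l) M' \<le> sval (fst ?l) (fst (snd ?l)))"
        using ne val[OF l'I] l' by (auto simp: sv_def)
    qed
    moreover have "(\<Union>(D', M')\<in>(\<lambda>l. (fst l, fst (snd l))) ` set (take i ls). V_infty D' M') = (\<Union>l\<in>set (take i ls). V_label l)"
      by (simp add: V_label_def)
    ultimately show "\<not> V_label (ls ! i) \<subseteq> qvs.span (\<Union>l\<in>set (take i ls). V_label l)" by (simp add: V_label_def)
  qed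
  thus ?thesis using ls by auto
qed

lemma fin_part_bounds:
  assumes D: "partition_infty D" and c: "(i, j) \<in> fin_part D"
  shows "i \<le> card (fin_part D)" "j \<le> card (fin_part D)"
proof -
  have f: "finite (fin_part D)" using D by (simp add: partition_infty_def)
  have F: "ferrers D" using D by (simp add: partition_infty_def)
  have c': "(i, j) \<in> D" "0 < i" using c by (auto simp: fin_part_def)
  have "(\<lambda>i. (i, j)) ` {1..i} \<subseteq> fin_part D"
    using ferrersD[OF F c'(1)] by (auto simp: fin_part_def)
  from card_mono[OF f this] show "i \<le> card (fin_part D)" by (simp add: card_image inj_on_def)
  have "(\<lambda>j. (i, j)) ` {..j} \<subseteq> fin_part D"
    using ferrersD[OF F c'(1)] c'(2) by (auto simp: fin_part_def)
  from card_mono[OF f this] show "j \<le> card (fin_part D)" by (simp add: card_image inj_on_def)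
qed

lemma finite_labels: "finite (inf_tableaux_content \<mu>)"
proof -
  let ?k = "size \<mu>"
  let ?S = "{f. \<forall>c. (c \<in> {..?k} \<times> {..?k} \<longrightarrow> f c \<in> {..sum_mset \<mu>}) \<and> (c \<notin> {..?k} \<times> {..?k} \<longrightarrow> f c = (0::nat))}"
  have "finite ?S" by (rule finite_set_of_finite_funs) auto
  moreover have "(\<lambda>l. fst (snd l)) ` inf_tableaux_content \<mu> \<subseteq> ?S"
  proof
    fix M assume "M \<in> (\<lambda>l. fst (snd l)) ` inf_tableaux_content \<mu>"
    then obtain D m where "(D, (M, m)) \<in> inf_tableaux_content \<mu>" by auto
    hence v: "valid_label D M" and \<mu>: "m + image_mset M (mset_set (fin_part D)) = \<mu>" by (simp_all add: label_iff)
    note D = valid_labelD[OF v]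
    have fin: "finite (fin_part D)" using D by (simp add: partition_infty_def)
    have k: "card (fin_part D) \<le> ?k" unfolding \<mu>[symmetric] by simp
    have M0: "M c = 0" if "c \<notin> fin_part D" for c
    proof (cases "c \<in> D")
      case True thus ?thesis using that D(5) by blast
    next
      case False thus ?thesis using D(2) unfolding tab_def by blast
    qed
    have "M c \<le> sum_mset \<mu>" for c
    proof (cases "c \<in> fin_part D")
      case True
      have "M c \<le> (\<Sum>c\<in>fin_part D. M c)" using fin True by (intro member_le_sum) auto
      also have "\<dots> \<le> sum_mset \<mu>" unfolding \<mu>[symmetric] by (simp add: sum_unfold_sum_mset)
      finally show ?thesis .
    qed (simp add: M0)
    moreover have "M c = 0" if "c \<notin> {..?k} \<times> {..?k}" for c
    proof (rule M0, rule notI)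
      assume "c \<in> fin_part D"
      hence "fst c \<le> card (fin_part D)" "snd c \<le> card (fin_part D)" using fin_part_bounds[OF D(1), of "fst c" "snd c"] by auto
      thus False using that k by (cases c) auto
    qed
    ultimately show "M \<in> ?S" by blast
  qed
  ultimately have "finite ((\<lambda>l. fst (snd l)) ` inf_tableaux_content \<mu>)" by (rule finite_subset[rotated])
  moreover have "inj_on (\<lambda>l. fst (snd l)) (inf_tableaux_content \<mu>)"
  proof (rule inj_onI)
    fix l l' assume l: "l \<in> inf_tableaux_content \<mu>" "l' \<in> inf_tableaux_content \<mu>" "fst (snd l) = fst (snd l')"
    obtain D M m where 1: "l = (D, (M, m))" by (metis prod.collapse)
    obtain D' M' m' where 2: "l' = (D', (M', m'))" by (metis prod.collapse)
    have M: "M' = M" using l 1 2 by simp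
    have v: "valid_label D M" "valid_label D' M" using l unfolding 1 2 M label_iff by auto
    note D = valid_labelD[OF v(1)] and D' = valid_labelD[OF v(2)]
    have fp: "fin_part D = fin_part D'"
    proof (rule set_eqI)
      fix c
      have "c \<in> fin_part D \<longleftrightarrow> M c \<noteq> 0" "c \<in> fin_part D' \<longleftrightarrow> M c \<noteq> 0"
        by (rule D(6), rule D'(6))
      thus "c \<in> fin_part D \<longleftrightarrow> c \<in> fin_part D'" by simp
    qed
    have "D = D'"
    proof (rule set_eqI)
      fix c :: box
      show "c \<in> D \<longleftrightarrow> c \<in> D'"
      proof (cases "fst c = 0")
        case True thus ?thesis using D(1) D'(1) by (cases c) (simp add: partition_infty_def)
      next
        case False
        hence "c \<in> D \<longleftrightarrow> c \<in> fin_part D" "c \<in> D' \<longleftrightarrow> c \<in> fin_part D'" by (auto simp: fin_part_def)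
        thus ?thesis using fp by simp
      qed
    qed
    moreover have "m = m'" using l fp unfolding 1 2 M label_iff by (metis add_right_cancel)
    ultimately show "l = l'" using 1 2 M by simp
  qed
  ultimately show ?thesis by (rule finite_imageD)
qed

section \<open>The filtration of the polynomials of a given content\<close>

lemma submono_keys: "submono q p \<Longrightarrow> keys q \<subseteq> keys p"
  by (auto simp: submono_def in_keys_iff)

lemma submono_restrict: "submono q p \<Longrightarrow> q = restrict_mono (keys q) p"
  by (rule poly_mapping_eqI) (auto simp: submono_def lookup_restrict_mono in_keys_iff)

lemma submono_trans: "submono q' q \<Longrightarrow> submono q p \<Longrightarrow> submono q' p"
  using submono_keys[of q' q] by (auto simp: submono_def)

text \<open>
  The simultaneous action on both monomials preserves the relation.
\<close>

lemma submono_act_iff: "bij \<sigma> \<Longrightarrow> submono (mono_act \<sigma> q) (mono_act \<sigma> p) \<longleftrightarrow> submono q p"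
  by (simp add: submono_act)

lemma finite_submonos: "finite {q. \<exists>p\<in>keys F. submono q p}" for F :: qpoly
proof (rule finite_subset)
  show "{q. \<exists>p\<in>keys F. submono q p} \<subseteq> (\<Union>p\<in>keys F. (\<lambda>S. restrict_mono S p) ` Pow (keys p))"
  proof
    fix q assume "q \<in> {q. \<exists>p\<in>keys F. submono q p}"
    then obtain p where p: "p \<in> keys F" "submono q p" by blast
    have "q \<in> (\<lambda>S. restrict_mono S p) ` Pow (keys p)"
      using submono_restrict[OF p(2)] submono_keys[OF p(2)] by (intro image_eqI[of _ _ "keys q"]) simp_all
    thus "q \<in> (\<Union>p\<in>keys F. (\<lambda>S. restrict_mono S p) ` Pow (keys p))" using p(1) by (rule UN_I[rotated])
  qed
qed auto

text \<open>
  The part in exactly \<open>j\<close> variables of the image of \<open>F\<close> under the map that sends each monomial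
  to the sum of its submonomials. The sum runs over the finite set of those monomials that can
  occur.
\<close>

definition ext_part :: "nat \<Rightarrow> qpoly \<Rightarrow> qpoly" where
  "ext_part j F = (\<Sum>q\<in>{q. \<exists>p\<in>keys F. submono q p}. single q (if card (keys q) = j then ext_sum F q else 0))"

lemma lookup_ext_part: "lookup (ext_part j F) q = (if card (keys q) = j then ext_sum F q else 0)"
proof -
  let ?Q = "{q. \<exists>p\<in>keys F. submono q p}"
  have "lookup (ext_part j F) q = (\<Sum>q'\<in>?Q. if q' = q then (if card (keys q) = j then ext_sum F q else 0) else 0)"
    unfolding ext_part_def lookup_sum by (intro sum.cong) (auto simp: lookup_single)
  also have "\<dots> = (if q \<in> ?Q then (if card (keys q) = j then ext_sum F q else 0) else 0)"
    using finite_submonos by (simp add: sum.delta)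
  also have "\<dots> = (if card (keys q) = j then ext_sum F q else 0)"
  proof (cases "q \<in> ?Q")
    case False
    hence "{p \<in> keys F. submono q p} = {}" by blast
    hence "ext_sum F q = 0" by (simp only: ext_sum_def sum.empty)
    thus ?thesis by simp
  qed simp
  finally show ?thesis .
qed

lemma ext_part_hom: "module_hom qscale qscale (ext_part j)"
  by unfold_locales (auto intro!: poly_mapping_eqI simp: lookup_ext_part lookup_add ext_sum_add ext_sum_scale)

lemma ext_part_act: "bij g \<Longrightarrow> ext_part j (poly_act g F) = poly_act g (ext_part j F)"
  by (rule poly_mapping_eqI) (simp add: lookup_ext_part lookup_poly_act ext_sum_act card_keys_act bij_imp_bij_inv)

text \<open>
  The monomials of content \<open>\<mu>\<close>.
\<close>

definition content_monos :: "nat multiset \<Rightarrow> monomial set" where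
  "content_monos \<mu> = {m. keys m \<subseteq> {1..} \<and> mono_content m = \<mu>}"

text \<open>
  The component of content \<open>b\<close>.
\<close>

definition content_part :: "nat multiset \<Rightarrow> qpoly \<Rightarrow> qpoly" where
  "content_part b F = (\<Sum>m\<in>keys F. single m (if mono_content m = b then lookup F m else 0))"

lemma lookup_content_part: "lookup (content_part b F) m = (if mono_content m = b then lookup F m else 0)"
proof -
  have "lookup (content_part b F) m = (\<Sum>m'\<in>keys F. if m' = m then (if mono_content m = b then lookup F m else 0) else 0)"
    unfolding content_part_def lookup_sum by (intro sum.cong) (auto simp: lookup_single)
  thus ?thesis by (simp add: sum.delta in_keys_iff)
qed

lemma content_part_hom: "module_hom qscale qscale (content_part b)"
  by unfold_locales (auto intro!: poly_mapping_eqI simp: lookup_content_part lookup_add)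

lemma content_part_act: "bij g \<Longrightarrow> content_part b (poly_act g F) = poly_act g (content_part b F)"
  by (rule poly_mapping_eqI) (simp add: lookup_content_part lookup_poly_act mono_content_act bij_imp_bij_inv)

lemma content_monos_size: "m \<in> content_monos \<mu> \<Longrightarrow> card (keys m) = size \<mu>"
  using size_mono_content[of m] by (simp add: content_monos_def)

text \<open>
  A monomial in as many variables as the content demands is extended only by itself.
\<close>

lemma ext_sum_top:
  assumes F: "F \<in> polys_in (content_monos \<mu>)" and q: "card (keys q) = size \<mu>"
  shows "ext_sum F q = lookup F q"
proof -
  have "{p \<in> keys F. submono q p} = {p \<in> keys F. p = q}"
  proof (intro Collect_cong conj_cong refl iffI)
    fix p assume p: "p \<in> keys F" "submono q p"
    have "card (keys p) = card (keys q)" using content_monos_size[of p \<mu>] F p(1) q by (auto simp: polys_in_def)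
    hence "keys q = keys p" using submono_keys[OF p(2)] by (metis card_subset_eq finite_keys)
    hence "q = restrict_mono (keys p) p" using submono_restrict[OF p(2)] by simp
    also have "\<dots> = p" by (rule poly_mapping_eqI) (simp add: lookup_restrict_mono in_keys_iff)
    finally show "p = q" by simp
  qed (simp add: submono_def)
  also have "\<dots> = (if q \<in> keys F then {q} else {})" by auto
  finally show ?thesis by (simp add: ext_sum_def in_keys_iff)
qed

text \<open>
  The number of monomials of content \<open>b\<close> between \<open>q'\<close> and \<open>p\<close> is the same for all \<open>p\<close> of
  content \<open>\<mu>\<close> that extend \<open>q'\<close>.
\<close>

lemma card_between:
  assumes p: "p1 \<in> content_monos \<mu>" "p2 \<in> content_monos \<mu>" and q': "submono q' p1" "submono q' p2"
  shows "card {q. mono_content q = b \<and> submono q' q \<and> submono q p1} = card {q. mono_content q = b \<and> submono q' q \<and> submono q p2}"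
proof -
  let ?X = "keys p1 \<union> keys p2"
  have X: "finite ?X" "keys p1 \<subseteq> ?X" "keys p2 \<subseteq> ?X" "mono_content p1 = mono_content p2" "keys q' \<subseteq> ?X"
    using p submono_keys[OF q'(1)] by (auto simp: content_monos_def)
  have agree: "lookup p1 x = lookup p2 x" if "x \<in> keys q'" for x
  proof -
    have "lookup q' x = lookup p1 x" "lookup q' x = lookup p2 x" using q' that unfolding submono_def by blast+
    thus ?thesis by simp
  qed
  from same_content_permutation[OF X agree] obtain \<rho>
    where \<rho>: "\<rho> permutes (?X - keys q')" "p1 = mono_act (inv \<rho>) p2" by blast
  have b: "bij \<rho>" by (rule permutes_bij[OF \<rho>(1)])
  have bi: "bij (inv \<rho>)" by (rule bij_imp_bij_inv[OF b])
  have p2: "p2 = mono_act \<rho> p1" using \<rho>(2) b by simp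
  have q2: "mono_act \<rho> q' = q'"
  proof -
    have "mono_act \<rho> q' = mono_act id q'"
      by (rule mono_act_cong[OF b]) (use permutes_not_in[OF \<rho>(1)] in auto)
    thus ?thesis by simp
  qed
  have "bij_betw (mono_act \<rho>) {q. mono_content q = b \<and> submono q' q \<and> submono q p1} {q. mono_content q = b \<and> submono q' q \<and> submono q p2}"
  proof (rule bij_betw_byWitness[where f' = "mono_act (inv \<rho>)"])
    have 1: "submono q' (mono_act \<rho> q) \<longleftrightarrow> submono q' q" "submono (mono_act \<rho> q) p2 \<longleftrightarrow> submono q p1" for q
      using submono_act_iff[OF b, of q' q] submono_act_iff[OF b, of q p1] unfolding q2 p2 by simp_all
    show "mono_act \<rho> ` {q. mono_content q = b \<and> submono q' q \<and> submono q p1} \<subseteq> {q. mono_content q = b \<and> submono q' q \<and> submono q p2}"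
      by (auto simp: 1 mono_content_act[OF b])
    show "mono_act (inv \<rho>) ` {q. mono_content q = b \<and> submono q' q \<and> submono q p2} \<subseteq> {q. mono_content q = b \<and> submono q' q \<and> submono q p1}"
    proof
      fix r assume "r \<in> mono_act (inv \<rho>) ` {q. mono_content q = b \<and> submono q' q \<and> submono q p2}"
      then obtain q where q: "r = mono_act (inv \<rho>) q" "mono_content q = b" "submono q' q" "submono q p2" by blast
      have "q = mono_act \<rho> r" using q(1) b by simp
      thus "r \<in> {q. mono_content q = b \<and> submono q' q \<and> submono q p1}"
        using 1[of r] q mono_content_act[OF b, of r] by simp
    qed
  qed (use b in auto)
  thus ?thesis by (rule bij_betw_same_card)
qed

text \<open>
  Let \<open>q'\<close> have fewer than \<open>j\<close> variables. By a double count, the coefficients at the monomials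
  of content \<open>b\<close> that extend \<open>q'\<close> add up to the sum of the coefficients of \<open>F\<close> at all
  extensions of \<open>q'\<close>, each counted as often as there are monomials of content \<open>b\<close> in between.
  This number does not depend on the extension, so that the result is a multiple of
  \<open>ext_sum F q' = 0\<close>.
\<close>

lemma content_part_ext_part:
  assumes F: "F \<in> polys_in (content_monos \<mu>)" "F \<in> ext_kernel j" and b: "size b = j"
  shows "content_part b (ext_part j F) \<in> polys_in (content_monos b) \<inter> ext_kernel j"
proof
  let ?G = "content_part b (ext_part j F)"
  define Q where "Q = {q. \<exists>p\<in>keys F. submono q p}"
  have finQ: "finite Q" unfolding Q_def by (rule finite_submonos)
  have lG: "lookup ?G q = (if mono_content q = b then ext_sum F q else 0)" for q
    using size_mono_content[of q] b by (auto simp: lookup_content_part lookup_ext_part)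
  have GQ: "keys ?G \<subseteq> {q \<in> Q. mono_content q = b}"
  proof
    fix q assume "q \<in> keys ?G"
    hence q: "mono_content q = b" "ext_sum F q \<noteq> 0" by (auto simp: in_keys_iff lG split: if_splits)
    have "{p \<in> keys F. submono q p} \<noteq> {}" using q(2) unfolding ext_sum_def by force
    thus "q \<in> {q \<in> Q. mono_content q = b}" using q(1) by (auto simp: Q_def)
  qed
  show "?G \<in> polys_in (content_monos b)"
    unfolding polys_in_def
  proof (intro CollectI subsetI)
    fix q assume "q \<in> keys ?G"
    hence q: "mono_content q = b" "q \<in> Q" using GQ by auto
    then obtain p where p: "p \<in> keys F" "submono q p" by (auto simp: Q_def)
    have "keys p \<subseteq> {1..}" using F(1) p(1) by (auto simp: polys_in_def content_monos_def)
    thus "q \<in> content_monos b" using q submono_keys[OF p(2)] by (auto simp: content_monos_def)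
  qed
  have "ext_sum ?G q' = 0" if q': "card (keys q') < j" for q'
  proof -
    define N where "N p = card {q. mono_content q = b \<and> submono q' q \<and> submono q p}" for p
    have "ext_sum ?G q' = (\<Sum>q\<in>{q \<in> {q \<in> Q. mono_content q = b}. submono q' q}. lookup ?G q)"
      by (rule ext_sum_superset) (use finQ GQ in auto)
    also have "\<dots> = (\<Sum>q\<in>{q \<in> Q. mono_content q = b \<and> submono q' q}. \<Sum>p\<in>{p \<in> keys F. submono q p}. lookup F p)"
      by (intro sum.cong) (auto simp: lG ext_sum_def)
    also have "\<dots> = (\<Sum>p\<in>keys F. \<Sum>q\<in>{q \<in> {q \<in> Q. mono_content q = b \<and> submono q' q}. submono q p}. lookup F p)"
      by (rule sum.swap_restrict) (use finQ in auto)
    also have "\<dots> = (\<Sum>p\<in>keys F. of_nat (N p) * lookup F p)"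
    proof (rule sum.cong[OF refl])
      fix p assume "p \<in> keys F"
      hence "{q \<in> {q \<in> Q. mono_content q = b \<and> submono q' q}. submono q p} = {q. mono_content q = b \<and> submono q' q \<and> submono q p}"
        by (auto simp: Q_def)
      thus "(\<Sum>q\<in>{q \<in> {q \<in> Q. mono_content q = b \<and> submono q' q}. submono q p}. lookup F p) = of_nat (N p) * lookup F p"
        by (simp add: N_def)
    qed
    also have "\<dots> = (\<Sum>p\<in>{p \<in> keys F. submono q' p}. of_nat (N p) * lookup F p)"
    proof (rule sum.mono_neutral_right)
      show "\<forall>p\<in>keys F - {p \<in> keys F. submono q' p}. of_nat (N p) * lookup F p = 0"
      proof
        fix p assume "p \<in> keys F - {p \<in> keys F. submono q' p}"
        hence "{q. mono_content q = b \<and> submono q' q \<and> submono q p} = {}" using submono_trans by blast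
        hence "N p = 0" unfolding N_def by (simp only: card.empty)
        thus "of_nat (N p) * lookup F p = 0" by simp
      qed
    qed auto
    also have "\<dots> = 0"
    proof (cases "{p \<in> keys F. submono q' p} = {}")
      case False
      then obtain p0 where p0: "p0 \<in> keys F" "submono q' p0" by blast
      have N: "N p = N p0" if "p \<in> {p \<in> keys F. submono q' p}" for p
        unfolding N_def by (rule card_between[of _ \<mu>]) (use that p0 F(1) in \<open>auto simp: polys_in_def\<close>)
      have "(\<Sum>p\<in>{p \<in> keys F. submono q' p}. of_nat (N p) * lookup F p) = of_nat (N p0) * ext_sum F q'"
        unfolding ext_sum_def sum_distrib_left by (rule sum.cong) (use N in auto)
      also have "ext_sum F q' = 0" using F(2) q' by (simp add: ext_kernel_def)
      finally show ?thesis by simp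
    next
      case True
      show ?thesis unfolding True by simp
    qed
    finally show ?thesis .
  qed
  thus "?G \<in> ext_kernel j" by (simp add: ext_kernel_def)
qed

text \<open>
  An element of \<open>K\<^sub>b\<close> involves only finitely many variables, and Specht polynomials of finite
  shape with first row zero are Specht polynomials of infinite shape.
\<close>

lemma harmonic_spanned:
  assumes F: "F \<in> polys_in (content_monos b)" "F \<in> ext_kernel (size b)"
  shows "F \<in> qvs.span (\<Union>(D, M)\<in>{(D, M). valid_label D M \<and> image_mset M (mset_set (fin_part D)) = b}. V_infty D M)"
proof -
  define n where "n = Max (insert 0 (\<Union>m\<in>keys F. keys m))"
  have kn: "x \<le> n" if "m \<in> keys F" "x \<in> keys m" for m x
    unfolding n_def by (rule Max_ge) (use that in auto)
  have "F \<in> polys_in {m. keys m \<subseteq> {1..n} \<and> mono_content m = b}"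
    using F(1) kn by (fastforce simp: polys_in_def content_monos_def)
  from finite_spanning[OF this F(2)] have "F \<in> qvs.span (finite_specht n b)" .
  also have "\<dots> \<subseteq> qvs.span (\<Union>(D, M)\<in>{(D, M). valid_label D M \<and> image_mset M (mset_set (fin_part D)) = b}. V_infty D M)"
  proof (rule qvs.span_mono, rule subsetI)
    fix s assume "s \<in> finite_specht n b"
    then obtain D M T where s: "s = specht_poly D M T" "ferrers D" "finite D" "bij_betw T D {1..n}" "tab D M" "semistandard D M"
      "\<And>j. M (0, j) = 0" "mono_content (tab_mono D M T) = b" unfolding finite_specht_def by blast
    have T: "bij_betw T D {1..card D}" using s(4) bij_betw_same_card[OF s(4)] by simp
    let ?D = "inf_shape D"
    have supp: "{c \<in> D. M c \<noteq> 0} = fin_part D" by (rule support_semistandard(2)[OF s(5,6,7)])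
    have iT: "inj_on T D" using T by (simp add: bij_betw_def)
    have D: "partition_infty ?D" by (rule partition_infty_inf_shape[OF s(2,3)])
    have out: "M c = 0" if "c \<notin> fin_part D" for c
      using that s(5) supp unfolding tab_def by blast
    have v: "valid_label ?D M" unfolding valid_label_def fin_part_inf_shape
    proof (intro conjI D ballI)
      show "0 < M c" if "c \<in> fin_part D" for c using that supp by blast
      show "semistandard (fin_part D) M" unfolding semistandard_def
        using s(6) out unfolding semistandard_def by (simp add: fin_part_def)
    qed
    have "image_mset M (mset_set (fin_part ?D)) = b"
      unfolding fin_part_inf_shape s(8)[symmetric] mono_content_tab_mono[OF s(5) iT] supp ..
    moreover have "s \<in> V_infty ?D M"
    proof -
      have "specht_poly ?D M (inf_filling D T) = s"
        using specht_poly_inf_shape(1)[OF s(2,3) T s(5,7)] s(1) by simp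
      moreover have "bij_betw (inf_filling D T) ?D {1..}" by (rule inf_filling_bij[OF s(2,3) T])
      ultimately show ?thesis
        unfolding V_infty_eq[OF D valid_labelD(2)[OF v]] V_all_def by (intro qvs.span_base) blast
    qed
    ultimately show "s \<in> (\<Union>(D, M)\<in>{(D, M). valid_label D M \<and> image_mset M (mset_set (fin_part D)) = b}. V_infty D M)"
      using v by blast
  qed
  finally show ?thesis .
qed

lemma V_infty_harmonic:
  assumes v: "valid_label D M" and b: "image_mset M (mset_set (fin_part D)) = b"
  shows "V_infty D M \<subseteq> polys_in (content_monos b) \<inter> ext_kernel (size b)"
proof -
  note D = valid_labelD[OF v]
  have sb: "size b = card (fin_part D)" unfolding b[symmetric] by simp
  show ?thesis unfolding V_infty_eq[OF D(1,2)] V_all_def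
  proof (rule qvs.span_minimal[OF _ qvs.subspace_inter[OF polys_in_subspace ext_kernel_subspace]], rule subsetI)
    fix s assume "s \<in> {specht_poly D M T | T. bij_betw T D {1..}}"
    then obtain T where T: "s = specht_poly D M T" "bij_betw T D {1..}" by blast
    have iT: "inj_on T D" "T ` D = {1..}" using T(2) by (auto simp: bij_betw_def)
    have "s \<in> ext_kernel (size b)" unfolding T(1) sb by (rule specht_in_ext_kernel[OF D(2) iT(1)])
    moreover have "s \<in> polys_in (content_monos b)"
      unfolding T(1) polys_in_def
    proof (intro CollectI subsetI)
      fix m assume m: "m \<in> keys (specht_poly D M T)"
      have "keys m \<subseteq> {1..}" using specht_keys(1)[OF D(2) iT(1) m] iT(2) by simp
      moreover have "mono_content m = b"
        unfolding specht_keys(2)[OF D(2) iT(1) m] mono_content_tab_mono[OF D(2) iT(1)] D(5) b ..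
      ultimately show "m \<in> content_monos b" by (simp add: content_monos_def)
    qed
    ultimately show "s \<in> polys_in (content_monos b) \<inter> ext_kernel (size b)" by blast
  qed
qed

text \<open>
  A monomial of any given content in the variables after \<open>x\<^sub>N\<close>.
\<close>

lemma ex_mono_of_content: "0 \<notin># m \<Longrightarrow> \<exists>r. keys r = {N + 1..N + size m} \<and> mono_content r = m"
proof (induction m)
  case empty
  show ?case by (intro exI[of _ 0]) (simp add: mono_content_def)
next
  case (add h m)
  then obtain r where r: "keys r = {N + 1..N + size m}" "mono_content r = m" by auto
  define x where "x = N + size m + 1"
  define r' where "r' = r + single x h"
  have h: "h > 0" using add.prems by auto
  have "x \<notin> keys r" using r(1) by (simp add: x_def)
  hence rx: "lookup r x = 0" by (metis in_keys_iff)
  have l: "lookup r' y = (if y = x then h else lookup r y)" for y using rx by (simp add: r'_def lookup_add lookup_single when_def)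
  have k: "keys r' = insert x (keys r)"
  proof (rule set_eqI)
    fix y show "y \<in> keys r' \<longleftrightarrow> y \<in> insert x (keys r)" using h by (cases "y = x") (simp_all add: in_keys_iff l)
  qed
  have "mono_content r' = add_mset h (image_mset (lookup r') (mset_set (keys r)))"
    unfolding mono_content_def k using rx by (simp add: l in_keys_iff)
  also have "image_mset (lookup r') (mset_set (keys r)) = mono_content r"
    unfolding mono_content_def by (intro image_mset_cong) (auto simp: l rx in_keys_iff)
  finally have "mono_content r' = add_mset h m" using r by simp
  moreover have "keys r' = {N + 1..N + size (add_mset h m)}" unfolding k r(1) x_def by auto
  ultimately show ?case by blast
qed

lemma mono_content_add:
  assumes "keys p \<inter> keys r = {}"
  shows "keys (p + r) = keys p \<union> keys r" "mono_content (p + r) = mono_content p + mono_content r"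
proof -
  have l: "x \<in> keys p \<Longrightarrow> lookup (p + r) x = lookup p x" "x \<in> keys r \<Longrightarrow> lookup (p + r) x = lookup r x" for x
    using assms by (auto simp: lookup_add in_keys_iff)
  show k: "keys (p + r) = keys p \<union> keys r" by (auto simp: in_keys_iff lookup_add)
  have "mono_content (p + r) = image_mset (lookup (p + r)) (mset_set (keys p)) + image_mset (lookup (p + r)) (mset_set (keys r))"
    unfolding mono_content_def k using assms by (simp add: mset_set_Union)
  also have "\<dots> = mono_content p + mono_content r"
    unfolding mono_content_def by (intro arg_cong2[of _ _ _ _ "(+)"] image_mset_cong) (auto simp: l)
  finally show "mono_content (p + r) = mono_content p + mono_content r" .
qed

text \<open>
  Multiplication of \<open>H\<close> by a monomial \<open>r\<close> in fresh variables gives a preimage: a submonomial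
  in \<open>\<bar>b\<bar>\<close> variables that involves some of \<open>r\<close> involves fewer than \<open>\<bar>b\<bar>\<close> variables of \<open>H\<close>.
\<close>

lemma ext_part_surj:
  assumes H: "H \<in> polys_in (content_monos b)" "H \<in> ext_kernel (size b)" and m: "0 \<notin># m"
  shows "\<exists>F\<in>polys_in (content_monos (b + m)) \<inter> ext_kernel (size b). ext_part (size b) F = H"
proof -
  define N where "N = Max (insert 0 (\<Union>m\<in>keys H. keys m))"
  have kN: "x \<le> N" if "p \<in> keys H" "x \<in> keys p" for p x
    unfolding N_def by (rule Max_ge) (use that in auto)
  obtain r where r: "keys r = {N + 1..N + size m}" "mono_content r = m" using ex_mono_of_content[OF m] by blast
  have fresh: "keys p \<inter> keys r = {}" if "p \<in> keys H" for p using kN[OF that] r(1) by force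
  define F where "F = (\<Sum>p\<in>keys H. single (p + r) (lookup H p))"
  have es: "ext_sum (single s c) q = (if submono q s then c else 0)" for s q and c :: rat
    using ext_sum_superset[of "{s}" "single s c" q] by (cases "submono q s") (auto simp: Collect_conv_if)
  have sub: "submono q (p + r) \<longleftrightarrow> submono (restrict_mono (keys r) q) r \<and> submono (restrict_mono (- keys r) q) p"
    if p: "p \<in> keys H" for p q
  proof -
    have "lookup (p + r) x = (if x \<in> keys r then lookup r x else lookup p x)" for x
      using fresh[OF p] by (auto simp: lookup_add in_keys_iff)
    thus ?thesis by (auto simp: submono_def keys_restrict_mono lookup_restrict_mono)
  qed
  have eF: "ext_sum F q = (if submono (restrict_mono (keys r) q) r then ext_sum H (restrict_mono (- keys r) q) else 0)" for q
  proof -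
    have "ext_sum F q = (\<Sum>p\<in>keys H. if submono q (p + r) then lookup H p else 0)"
      unfolding F_def ext_sum_sum es ..
    also have "\<dots> = (\<Sum>p\<in>keys H. if submono (restrict_mono (keys r) q) r \<and> submono (restrict_mono (- keys r) q) p then lookup H p else 0)"
      by (intro sum.cong refl) (simp add: sub)
    also have "\<dots> = (if submono (restrict_mono (keys r) q) r then ext_sum H (restrict_mono (- keys r) q) else 0)"
      by (simp add: ext_sum_def sum.inter_filter)
    finally show ?thesis .
  qed
  have Hz: "ext_sum H q = 0" if "card (keys q) < size b" for q using H(2) that by (simp add: ext_kernel_def)
  have "F \<in> ext_kernel (size b)"
    unfolding ext_kernel_def
  proof (intro CollectI allI impI)
    fix q :: monomial assume q: "card (keys q) < size b"
    have "card (keys (restrict_mono (- keys r) q)) \<le> card (keys q)"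
      unfolding keys_restrict_mono by (rule card_mono) auto
    thus "ext_sum F q = 0" using q Hz by (simp add: eF)
  qed
  moreover have "F \<in> polys_in (content_monos (b + m))"
    unfolding F_def
  proof (rule qvs.subspace_sum[OF polys_in_subspace])
    fix p assume p: "p \<in> keys H"
    hence pb: "keys p \<subseteq> {1..}" "mono_content p = b" using H(1) by (auto simp: polys_in_def content_monos_def)
    have "p + r \<in> content_monos (b + m)"
      unfolding content_monos_def using mono_content_add[OF fresh[OF p]] pb r by auto
    thus "single (p + r) (lookup H p) \<in> polys_in (content_monos (b + m))" by (simp add: polys_in_def)
  qed
  moreover have "ext_part (size b) F = H"
  proof (rule poly_mapping_eqI)
    fix q
    show "lookup (ext_part (size b) F) q = lookup H q"
    proof (cases "card (keys q) = size b")
      case False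
      hence "q \<notin> keys H" using H(1) content_monos_size[of q b] by (auto simp: polys_in_def)
      thus ?thesis using False by (simp add: lookup_ext_part in_keys_iff)
    next
      case True
      show ?thesis
      proof (cases "keys q \<inter> keys r = {}")
        case dis: True
        have 1: "restrict_mono (- keys r) q = q" using dis
          by (intro poly_mapping_eqI) (auto simp: lookup_restrict_mono in_keys_iff)
        have "restrict_mono (keys r) q = 0" using dis
          by (intro poly_mapping_eqI) (auto simp: lookup_restrict_mono in_keys_iff)
        hence 2: "submono (restrict_mono (keys r) q) r" by (simp add: submono_def)
        show ?thesis using True 2 by (simp add: lookup_ext_part eF 1 ext_sum_top[OF H(1)])
      next
        case False
        hence "card (keys (restrict_mono (- keys r) q)) < card (keys q)"
          unfolding keys_restrict_mono by (intro psubset_card_mono) auto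
        hence "ext_sum F q = 0" using Hz True by (simp add: eF)
        moreover have "q \<notin> keys H" using False fresh[of q] by auto
        ultimately show ?thesis by (simp add: lookup_ext_part in_keys_iff)
      qed
    qed
  qed
  ultimately show ?thesis by blast
qed

lemma content_split:
  fixes F :: qpoly
  assumes "finite B" "\<And>m. m \<in> keys F \<Longrightarrow> mono_content m \<in> B"
  shows "F = (\<Sum>b\<in>B. content_part b F)"
proof (rule poly_mapping_eqI)
  fix m
  have "lookup (\<Sum>b\<in>B. content_part b F) m = (\<Sum>b\<in>B. if b = mono_content m then lookup F m else 0)"
    unfolding lookup_sum by (intro sum.cong) (auto simp: lookup_content_part)
  also have "\<dots> = lookup F m" using assms by (auto simp: sum.delta in_keys_iff)
  finally show "lookup F m = lookup (\<Sum>b\<in>B. content_part b F) m" ..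
qed

lemma submono_content: "submono q p \<Longrightarrow> mono_content q \<subseteq># mono_content p"
proof -
  assume s: "submono q p"
  have "mono_content q = image_mset (lookup p) (mset_set (keys q))"
    unfolding mono_content_def using s by (intro image_mset_cong) (auto simp: submono_def)
  also have "\<dots> \<subseteq># mono_content p" unfolding mono_content_def
    by (intro image_mset_subseteq_mono subset_imp_msubset_mset_set submono_keys[OF s]) simp
  finally show ?thesis .
qed

text \<open>
  The filtration of the polynomials of content \<open>\<mu>\<close>.
\<close>

definition layer :: "nat multiset \<Rightarrow> nat \<Rightarrow> qpoly set" where
  "layer \<mu> j = polys_in (content_monos \<mu>) \<inter> ext_kernel j"

lemma content_monos_act:
  assumes "g \<in> S_N" "m \<in> content_monos \<mu>"
  shows "mono_act g m \<in> content_monos \<mu>"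
proof -
  have g: "g permutes {1..}" using assms(1) by (simp add: S_N_def)
  have "keys (mono_act g m) \<subseteq> g ` {1..}" using assms(2) by (auto simp: keys_mono_act[OF permutes_bij[OF g]] content_monos_def)
  thus ?thesis using assms(2) permutes_image[OF g] by (simp add: content_monos_def mono_content_act[OF permutes_bij[OF g]])
qed

lemma layer_inv:
  assumes "G \<subseteq> S_N"
  shows "inv_sub G (layer \<mu> j)"
proof (rule inv_subI)
  show "qvs.subspace (layer \<mu> j)" unfolding layer_def by (rule qvs.subspace_inter[OF polys_in_subspace ext_kernel_subspace])
  fix g u assume g: "g \<in> G" and u: "u \<in> layer \<mu> j"
  have gN: "g \<in> S_N" using g assms by blast
  show "poly_act g u \<in> layer \<mu> j"
    using u polys_in_act[OF S_N_bij[OF gN] content_monos_act[OF gN]] ext_kernel_act[OF S_N_bij[OF gN]] by (simp add: layer_def)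
qed

text \<open>
  The quotient of two consecutive layers has the factors whose finite part has \<open>j\<close> boxes.
\<close>

lemma filt_layer:
  assumes G: "S_infty \<subseteq> G" "G \<subseteq> S_N" and \<mu>: "0 \<notin># \<mu>"
  shows "\<exists>ls. distinct ls \<and> set ls = {l \<in> inf_tableaux_content \<mu>. card (fin_part (fst l)) = j} \<and>
     filt G V_label (layer \<mu> (Suc j)) ls (layer \<mu> j)"
proof -
  let ?I = "{l \<in> inf_tableaux_content \<mu>. card (fin_part (fst l)) = j}"
  have Gb: "bij g" if "g \<in> G" for g using that G(2) S_N_bij by blast
  obtain ls where ls: "distinct ls" "set ls = ?I" "filt G V_label {0} ls (qvs.span (\<Union>l\<in>?I. V_label l))"
    using filt_labels[OF G, of ?I \<mu>] finite_labels[of \<mu>] by auto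
  let ?B = "qvs.span (\<Union>l\<in>?I. V_label l)"
  note h = ext_part_hom[of j]
  have sL: "qvs.subspace (layer \<mu> j)" using layer_inv[OF G(2)] by (simp add: inv_sub_def)
  have onto: "?B \<subseteq> ext_part j ` layer \<mu> j"
  proof (rule qvs.span_minimal)
    show "qvs.subspace (ext_part j ` layer \<mu> j)" by (rule module_hom.subspace_image[OF h sL])
    show "(\<Union>l\<in>?I. V_label l) \<subseteq> ext_part j ` layer \<mu> j"
    proof
      fix H assume "H \<in> (\<Union>l\<in>?I. V_label l)"
      then obtain l where l: "l \<in> ?I" "H \<in> V_label l" by blast
      obtain D M m where e: "l = (D, (M, m))" by (metis prod.collapse)
      define b where "b = image_mset M (mset_set (fin_part D))"
      have v: "valid_label D M" "0 \<notin># m" "m + b = \<mu>" "card (fin_part D) = j" using l(1) unfolding e b_def by (auto simp: label_iff)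
      have sb: "size b = j" using v(4) by (simp add: b_def)
      have "H \<in> polys_in (content_monos b)" "H \<in> ext_kernel (size b)"
        using V_infty_harmonic[OF v(1) b_def[symmetric]] l(2) by (auto simp: V_label_def e)
      from ext_part_surj[OF this v(2)] show "H \<in> ext_part j ` layer \<mu> j"
        using v(3) sb by (auto simp: layer_def add.commute)
    qed
  qed
  \<comment> \<open>Split \<open>ext_part j F\<close> into its components of content \<open>b\<close>; the multiplicities that belong
    to \<open>b\<close> are \<open>\<mu> - b\<close>.\<close>
  have into: "ext_part j F \<in> ?B" if F: "F \<in> layer \<mu> j" for F
  proof -
    define Bs where "Bs = {b. b \<subseteq># \<mu> \<and> size b = j}"
    have FA: "F \<in> polys_in (content_monos \<mu>)" "F \<in> ext_kernel j" using F by (auto simp: layer_def)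
    have fB: "finite Bs"
    proof (rule finite_subset)
      show "Bs \<subseteq> (\<lambda>f. Abs_multiset f) ` {f. \<forall>x. (x \<in> set_mset \<mu> \<longrightarrow> f x \<in> {..size \<mu>}) \<and> (x \<notin> set_mset \<mu> \<longrightarrow> f x = 0)}"
      proof
        fix b assume b: "b \<in> Bs"
        hence le: "count b x \<le> count \<mu> x" for x by (simp add: Bs_def subseteq_mset_def)
        have "count b x \<le> size \<mu>" for x using le[of x] count_le_size[of \<mu> x] by linarith
        moreover have "count b x = 0" if "x \<notin># \<mu>" for x using le[of x] that by (simp add: not_in_iff)
        moreover have "b = Abs_multiset (count b)" by (simp add: count_inverse)
        ultimately show "b \<in> (\<lambda>f. Abs_multiset f) ` {f. \<forall>x. (x \<in> set_mset \<mu> \<longrightarrow> f x \<in> {..size \<mu>}) \<and> (x \<notin> set_mset \<mu> \<longrightarrow> f x = 0)}"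
          by (intro image_eqI[of _ _ "count b"]) auto
      qed
      show "finite ((\<lambda>f. Abs_multiset f) ` {f. \<forall>x. (x \<in> set_mset \<mu> \<longrightarrow> f x \<in> {..size \<mu>}) \<and> (x \<notin> set_mset \<mu> \<longrightarrow> f x = 0)})"
        by (intro finite_imageI finite_set_of_finite_funs) auto
    qed
    have "mono_content q \<in> Bs" if "q \<in> keys (ext_part j F)" for q
    proof -
      have q: "card (keys q) = j" "ext_sum F q \<noteq> 0" using that by (auto simp: in_keys_iff lookup_ext_part split: if_splits)
      have "{p \<in> keys F. submono q p} \<noteq> {}" using q(2) unfolding ext_sum_def by force
      then obtain p where p: "p \<in> keys F" "submono q p" by blast
      have "mono_content p = \<mu>" using p(1) FA(1) by (auto simp: polys_in_def content_monos_def)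
      thus ?thesis using submono_content[OF p(2)] q(1) by (simp add: Bs_def size_mono_content)
    qed
    hence "ext_part j F = (\<Sum>b\<in>Bs. content_part b (ext_part j F))" by (rule content_split[OF fB])
    also have "\<dots> \<in> ?B"
    proof (rule qvs.span_sum)
      fix b assume b: "b \<in> Bs"
      have sb: "size b = j" using b by (simp add: Bs_def)
      have "content_part b (ext_part j F) \<in> polys_in (content_monos b)" "content_part b (ext_part j F) \<in> ext_kernel (size b)"
        using content_part_ext_part[OF FA sb] sb by auto
      from harmonic_spanned[OF this]
      have "content_part b (ext_part j F) \<in> qvs.span (\<Union>(D, M)\<in>{(D, M). valid_label D M \<and> image_mset M (mset_set (fin_part D)) = b}. V_infty D M)" .
      also have "\<dots> \<subseteq> ?B"
      proof (rule qvs.span_mono, rule subsetI)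
        fix x assume "x \<in> (\<Union>(D, M)\<in>{(D, M). valid_label D M \<and> image_mset M (mset_set (fin_part D)) = b}. V_infty D M)"
        then obtain D M where DM: "valid_label D M" "image_mset M (mset_set (fin_part D)) = b" "x \<in> V_infty D M" by blast
        have "0 \<notin># \<mu> - b" using \<mu> by (meson in_diffD)
        moreover have "\<mu> - b + b = \<mu>" using b by (simp add: Bs_def)
        ultimately have "(D, (M, \<mu> - b)) \<in> inf_tableaux_content \<mu>" using DM by (simp add: label_iff)
        moreover have "card (fin_part D) = j" using DM(2) sb by (metis size_image_mset size_mset_set)
        ultimately have "(D, (M, \<mu> - b)) \<in> ?I" by simp
        moreover have "x \<in> V_label (D, (M, \<mu> - b))" using DM(3) by (simp add: V_label_def)
        ultimately show "x \<in> (\<Union>l\<in>?I. V_label l)" by blast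
      qed
      finally show "content_part b (ext_part j F) \<in> ?B" .
    qed
    finally show ?thesis .
  qed
  have "filt G V_label (layer \<mu> j \<inter> ext_part j -` {0}) ls (layer \<mu> j \<inter> ext_part j -` ?B)"
    by (rule filt_pullback[OF ls(3) layer_inv[OF G(2)] h ext_part_act[OF Gb] onto])
  moreover have "layer \<mu> j \<inter> ext_part j -` ?B = layer \<mu> j" using into by blast
  moreover have "layer \<mu> j \<inter> ext_part j -` {0} = layer \<mu> (Suc j)"
  proof (rule set_eqI)
    fix F
    have "ext_part j F = 0 \<longleftrightarrow> (\<forall>q. card (keys q) = j \<longrightarrow> ext_sum F q = 0)"
      unfolding poly_mapping_eq_iff fun_eq_iff lookup_ext_part by auto
    thus "F \<in> layer \<mu> j \<inter> ext_part j -` {0} \<longleftrightarrow> F \<in> layer \<mu> (Suc j)"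
      by (auto simp: layer_def ext_kernel_def less_Suc_eq)
  qed
  ultimately show ?thesis using ls(1,2) by auto
qed

lemma filt_content:
  assumes G: "S_infty \<subseteq> G" "G \<subseteq> S_N" and \<mu>: "0 \<notin># \<mu>"
  shows "\<exists>ls. distinct ls \<and> set ls = inf_tableaux_content \<mu> \<and> filt G V_label {0} ls (content_polys \<mu>)"
proof -
  let ?k = "size \<mu>"
  have "\<exists>ls. distinct ls \<and> set ls = {l \<in> inf_tableaux_content \<mu>. j \<le> card (fin_part (fst l)) \<and> card (fin_part (fst l)) \<le> ?k} \<and>
     filt G V_label (layer \<mu> (Suc ?k)) ls (layer \<mu> j)" if "j \<le> Suc ?k" for j
    using that
  proof (induction j rule: inc_induct)
    case base
    have "filt G V_label (layer \<mu> (Suc ?k)) [] (layer \<mu> (Suc ?k))" by (rule filt_nil[OF layer_inv[OF G(2)]])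
    thus ?case by (intro exI[of _ "[]"]) auto
  next
    case (step j)
    obtain ls where ls: "distinct ls" "set ls = {l \<in> inf_tableaux_content \<mu>. Suc j \<le> card (fin_part (fst l)) \<and> card (fin_part (fst l)) \<le> ?k}"
      "filt G V_label (layer \<mu> (Suc ?k)) ls (layer \<mu> (Suc j))" using step by blast
    obtain ls' where ls': "distinct ls'" "set ls' = {l \<in> inf_tableaux_content \<mu>. card (fin_part (fst l)) = j}"
      "filt G V_label (layer \<mu> (Suc j)) ls' (layer \<mu> j)" using filt_layer[OF G \<mu>, of j] by blast
    have "filt G V_label (layer \<mu> (Suc ?k)) (ls @ ls') (layer \<mu> j)" by (rule filt_append[OF ls'(3) ls(3)])
    moreover have "distinct (ls @ ls')" using ls ls' by auto
    moreover have "set (ls @ ls') = {l \<in> inf_tableaux_content \<mu>. j \<le> card (fin_part (fst l)) \<and> card (fin_part (fst l)) \<le> ?k}"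
      unfolding set_append ls(2) ls'(2) using step.hyps by auto
    ultimately show ?case by blast
  qed
  from this[of 0] obtain ls where ls: "distinct ls" "set ls = {l \<in> inf_tableaux_content \<mu>. card (fin_part (fst l)) \<le> ?k}"
    "filt G V_label (layer \<mu> (Suc ?k)) ls (layer \<mu> 0)" by auto
  have "card (fin_part (fst l)) \<le> ?k" if "l \<in> inf_tableaux_content \<mu>" for l
  proof -
    obtain D M m where e: "l = (D, (M, m))" by (metis prod.collapse)
    have "m + image_mset M (mset_set (fin_part D)) = \<mu>" using that by (simp add: e label_iff)
    hence "size m + card (fin_part D) = ?k" by (metis size_image_mset size_mset_set size_union)
    thus ?thesis by (simp add: e)
  qed
  hence "set ls = inf_tableaux_content \<mu>" using ls(2) by auto
  moreover have "layer \<mu> 0 = content_polys \<mu>"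
    by (simp add: layer_def ext_kernel_def content_polys_eq content_monos_def)
  moreover have "layer \<mu> (Suc ?k) = {0}"
  proof
    show "layer \<mu> (Suc ?k) \<subseteq> {0}"
    proof
      fix F assume F: "F \<in> layer \<mu> (Suc ?k)"
      have FA: "F \<in> polys_in (content_monos \<mu>)" "F \<in> ext_kernel (Suc ?k)" using F by (auto simp: layer_def)
      have "lookup F q = 0" for q
      proof (cases "q \<in> keys F")
        case True
        hence "card (keys q) = ?k" using FA(1) content_monos_size by (auto simp: polys_in_def)
        thus ?thesis using ext_sum_top[OF FA(1), of q] FA(2) by (simp add: ext_kernel_def)
      qed (simp add: in_keys_iff)
      hence "F = 0" by (intro poly_mapping_eqI) simp
      thus "F \<in> {0}" by simp
    qed
    show "{0} \<subseteq> layer \<mu> (Suc ?k)" using layer_inv[OF G(2)] qvs.subspace_0 by (auto simp: inv_sub_def)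
  qed
  ultimately show ?thesis using ls by auto
qed

lemma finite_contents: "finite {\<mu>. is_content \<mu> d}"
proof (rule finite_subset)
  show "{\<mu>. is_content \<mu> d} \<subseteq> mono_content ` {m. keys m \<subseteq> {1..d} \<and> mono_deg m \<le> d}"
  proof
    fix \<mu> assume "\<mu> \<in> {\<mu>. is_content \<mu> d}"
    hence \<mu>: "0 \<notin># \<mu>" "sum_mset \<mu> = d" by (auto simp: is_content_def)
    obtain r where r: "keys r = {0 + 1..0 + size \<mu>}" "mono_content r = \<mu>" using ex_mono_of_content[OF \<mu>(1), of 0] by blast
    have "size \<mu> \<le> sum_mset \<mu>" using \<mu>(1)
    proof (induction \<mu>)
      case (add x \<mu>) thus ?case by (cases x) auto
    qed simp
    hence "keys r \<subseteq> {1..d}" using r(1) \<mu>(2) by auto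
    moreover have "mono_deg r \<le> d" using r(2) \<mu>(2) sum_mono_content[of r] by simp
    ultimately show "\<mu> \<in> mono_content ` {m. keys m \<subseteq> {1..d} \<and> mono_deg m \<le> d}" using r(2) by blast
  qed
  show "finite (mono_content ` {m. keys m \<subseteq> {1..d} \<and> mono_deg m \<le> d})" by (intro finite_imageI finite_monomials) simp
qed

lemma filt_degree:
  assumes G: "S_infty \<subseteq> G" "G \<subseteq> S_N"
  shows "\<exists>ls. distinct ls \<and> set ls = inf_tableaux_deg d \<and> filt G V_label {0} ls (hom_polys {1..} d)"
proof -
  have Gb: "bij g" if "g \<in> G" for g using that G(2) S_N_bij by blast
  have "\<exists>ls. distinct ls \<and> set ls = (\<Union>\<mu>\<in>C. inf_tableaux_content \<mu>) \<and> filt G V_label {0} ls (polys_in (\<Union>\<mu>\<in>C. content_monos \<mu>))"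
    if "finite C" "C \<subseteq> {\<mu>. is_content \<mu> d}" for C
    using that
  proof (induction C rule: finite_induct)
    case empty
    have "polys_in {} = {0}" by (auto simp: polys_in_def intro: poly_mapping_eqI simp: in_keys_iff)
    moreover have "inv_sub G {0}" by (rule inv_subI) (auto simp: qvs.subspace_single_0 poly_act_0 Gb)
    ultimately show ?case using filt_nil[of G "{0}" V_label] by (intro exI[of _ "[]"]) auto
  next
    case (insert \<mu> C)
    have \<mu>: "0 \<notin># \<mu>" using insert.prems by (auto simp: is_content_def)
    obtain ls where ls: "distinct ls" "set ls = (\<Union>\<mu>\<in>C. inf_tableaux_content \<mu>)"
      "filt G V_label {0} ls (polys_in (\<Union>\<mu>\<in>C. content_monos \<mu>))" using insert by blast
    obtain ls' where ls': "distinct ls'" "set ls' = inf_tableaux_content \<mu>" "filt G V_label {0} ls' (content_polys \<mu>)"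
      using filt_content[OF G \<mu>] by blast
    let ?W = "polys_in (\<Union>\<nu>\<in>insert \<mu> C. content_monos \<nu>)"
    have W: "inv_sub G ?W"
    proof (rule inv_subI[OF polys_in_subspace])
      fix g u assume g: "g \<in> G" and u: "u \<in> ?W"
      have gN: "g \<in> S_N" using g G(2) by blast
      show "poly_act g u \<in> ?W"
        by (rule polys_in_act[OF S_N_bij[OF gN] _ u]) (use content_monos_act[OF gN] in blast)
    qed
    have cp: "content_polys \<mu> = polys_in (content_monos \<mu>)" by (simp add: content_polys_eq content_monos_def)
    have part: "content_part \<mu> F \<in> content_polys \<mu>" if F: "F \<in> ?W" for F
      unfolding cp polys_in_def
    proof (intro CollectI subsetI)
      fix m assume "m \<in> keys (content_part \<mu> F)"
      hence m: "mono_content m = \<mu>" "m \<in> keys F" by (auto simp: in_keys_iff lookup_content_part split: if_splits)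
      then obtain \<nu> where "m \<in> content_monos \<nu>" using F unfolding polys_in_def by blast
      thus "m \<in> content_monos \<mu>" using m(1) by (simp add: content_monos_def)
    qed
    have onto: "content_polys \<mu> \<subseteq> content_part \<mu> ` ?W"
    proof
      fix F assume F: "F \<in> content_polys \<mu>"
      have "content_part \<mu> F = F"
      proof (rule poly_mapping_eqI)
        fix m
        have "m \<in> keys F \<Longrightarrow> mono_content m = \<mu>" using F unfolding cp by (auto simp: polys_in_def content_monos_def)
        thus "lookup (content_part \<mu> F) m = lookup F m" by (auto simp: lookup_content_part in_keys_iff)
      qed
      moreover have "F \<in> ?W" using F unfolding cp by (auto simp: polys_in_def)
      ultimately show "F \<in> content_part \<mu> ` ?W" by (metis imageI)
    qed
    have "filt G V_label (?W \<inter> content_part \<mu> -` {0}) ls' (?W \<inter> content_part \<mu> -` content_polys \<mu>)"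
      by (rule filt_pullback[OF ls'(3) W content_part_hom content_part_act[OF Gb] onto])
    moreover have "?W \<inter> content_part \<mu> -` content_polys \<mu> = ?W" using part by blast
    moreover have "?W \<inter> content_part \<mu> -` {0} = polys_in (\<Union>\<mu>\<in>C. content_monos \<mu>)"
    proof (intro equalityI subsetI)
      fix F assume F: "F \<in> ?W \<inter> content_part \<mu> -` {0}"
      show "F \<in> polys_in (\<Union>\<mu>\<in>C. content_monos \<mu>)" unfolding polys_in_def
      proof (intro CollectI subsetI)
        fix m assume m: "m \<in> keys F"
        have "lookup (content_part \<mu> F) m = 0" using F by simp
        hence "mono_content m \<noteq> \<mu>" using m by (auto simp: lookup_content_part in_keys_iff)
        moreover obtain \<nu> where "\<nu> \<in> insert \<mu> C" "m \<in> content_monos \<nu>" using F m by (auto simp: polys_in_def)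
        ultimately show "m \<in> (\<Union>\<mu>\<in>C. content_monos \<mu>)" by (auto simp: content_monos_def)
      qed
    next
      fix F assume F: "F \<in> polys_in (\<Union>\<mu>\<in>C. content_monos \<mu>)"
      have "content_part \<mu> F = 0"
      proof (rule poly_mapping_eqI)
        fix m
        have "mono_content m \<noteq> \<mu>" if "m \<in> keys F"
          using that F insert.hyps(2) by (auto simp: polys_in_def content_monos_def)
        thus "lookup (content_part \<mu> F) m = lookup 0 m" by (auto simp: lookup_content_part in_keys_iff)
      qed
      thus "F \<in> ?W \<inter> content_part \<mu> -` {0}" using F by (auto simp: polys_in_def)
    qed
    ultimately have "filt G V_label {0} (ls @ ls') ?W" using filt_append[OF _ ls(3)] by simp
    moreover have "set ls \<inter> set ls' = {}"
    proof (rule ccontr)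
      assume "set ls \<inter> set ls' \<noteq> {}"
      then obtain l \<nu> where l: "\<nu> \<in> C" "l \<in> inf_tableaux_content \<nu>" "l \<in> inf_tableaux_content \<mu>" unfolding ls(2) ls'(2) by blast
      hence "\<nu> = \<mu>" by (auto simp: inf_tableaux_content_def)
      thus False using l(1) insert.hyps(2) by simp
    qed
    ultimately show ?case using ls(1,2) ls'(1,2) by (intro exI[of _ "ls @ ls'"]) auto
  qed
  from this[OF finite_contents subset_refl] obtain ls where ls: "distinct ls" "set ls = (\<Union>\<mu>\<in>{\<mu>. is_content \<mu> d}. inf_tableaux_content \<mu>)"
    "filt G V_label {0} ls (polys_in (\<Union>\<mu>\<in>{\<mu>. is_content \<mu> d}. content_monos \<mu>))" by blast
  have "(\<Union>\<mu>\<in>{\<mu>. is_content \<mu> d}. content_monos \<mu>) = {m. keys m \<subseteq> {1..} \<and> mono_deg m = d}"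
    by (auto simp: content_monos_def is_content_def zero_notin_mono_content sum_mono_content)
  moreover have "(\<Union>\<mu>\<in>{\<mu>. is_content \<mu> d}. inf_tableaux_content \<mu>) = inf_tableaux_deg d"
  proof (rule set_eqI)
    fix l :: label
    obtain D M m where e: "l = (D, (M, m))" by (metis prod.collapse)
    have "0 \<notin># m + image_mset M (mset_set (fin_part D))" if "valid_label D M" "0 \<notin># m"
      using that valid_labelD(6)[OF that(1)] by (auto simp: valid_label_def partition_infty_def)
    thus "l \<in> (\<Union>\<mu>\<in>{\<mu>. is_content \<mu> d}. inf_tableaux_content \<mu>) \<longleftrightarrow> l \<in> inf_tableaux_deg d"
      by (auto simp: e inf_tableaux_content_def inf_tableaux_deg_def is_content_def SSYT_infty_def tab_content_def valid_label_def)
  qed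
  ultimately show ?thesis using ls by (auto simp: hom_polys_eq)
qed

section \<open>The Jordan--Hoelder theorem\<close>

lemma filt_chain:
  "filt G V U ls W \<Longrightarrow> \<exists>A. A 0 = U \<and> A (length ls) = W \<and> (\<forall>i\<le>length ls. inv_sub G (A i)) \<and>
     (\<forall>i<length ls. simple_step G (A i) (A (Suc i)) \<and> subq_iso G (A i) (A (Suc i)) {0} (V (ls ! i)))"
proof (induction rule: filt.induct)
  case (filt_nil U)
  thus ?case by (intro exI[of _ "\<lambda>_. U"]) simp
next
  case (filt_step U ls W W' l)
  then obtain A where A: "A 0 = U" "A (length ls) = W" "\<forall>i\<le>length ls. inv_sub G (A i)"
    "\<forall>i<length ls. simple_step G (A i) (A (Suc i)) \<and> subq_iso G (A i) (A (Suc i)) {0} (V (ls ! i))" by blast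
  define A' where "A' i = (if i \<le> length ls then A i else W')" for i
  have "inv_sub G W" using A(2,3) by auto
  hence s: "simple_step G W W'" using filt_step by (intro simple_step_of_irred[of G W W' "V l"]) auto
  have "simple_step G (A' i) (A' (Suc i)) \<and> subq_iso G (A' i) (A' (Suc i)) {0} (V ((ls @ [l]) ! i))"
    if "i < length (ls @ [l])" for i
  proof (cases "i = length ls")
    case True thus ?thesis using s filt_step A(2) by (simp add: A'_def)
  next
    case False thus ?thesis using A(4) that by (simp add: A'_def nth_append)
  qed
  moreover have "\<forall>i\<le>length (ls @ [l]). inv_sub G (A' i)" using A(3) filt_step by (simp add: A'_def)
  moreover have "A' 0 = U" "A' (length (ls @ [l])) = W'" using A(1) by (simp_all add: A'_def)
  ultimately show ?case by blast
qed

text \<open>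
  A composition series of \<open>P\<close> with \<open>n\<close> steps, as a function on \<open>{0..n}\<close>.
\<close>

definition chain_to :: "(nat \<Rightarrow> nat) set \<Rightarrow> (nat \<Rightarrow> qpoly set) \<Rightarrow> nat \<Rightarrow> qpoly set \<Rightarrow> bool" where
  "chain_to G A n P \<longleftrightarrow> A 0 = {0} \<and> A n = P \<and> (\<forall>i\<le>n. inv_sub G (A i)) \<and> (\<forall>i<n. simple_step G (A i) (A (Suc i)))"

text \<open>
  The subquotient \<open>(A' \<inter> B') / ((A \<inter> B') + (A' \<inter> B))\<close> of Zassenhaus' lemma does not vanish,
  where \<open>A' / A\<close> and \<open>B' / B\<close> are the factors with numbers \<open>i\<close> and \<open>j\<close> of the two series.
\<close>

definition linked :: "(nat \<Rightarrow> qpoly set) \<Rightarrow> (nat \<Rightarrow> qpoly set) \<Rightarrow> nat \<Rightarrow> nat \<Rightarrow> bool" where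
  "linked A B i j \<longleftrightarrow>
     \<not> A (Suc i) \<inter> B (Suc j) \<subseteq> {x + y |x y. x \<in> A i \<inter> B (Suc j) \<and> y \<in> A (Suc i) \<inter> B j}"

lemma linked_sym: "linked A B i j \<longleftrightarrow> linked B A j i"
proof -
  have "{x + y |x y. x \<in> A i \<inter> B (Suc j) \<and> y \<in> A (Suc i) \<inter> B j} = {x + y |x y. x \<in> B j \<inter> A (Suc i) \<and> y \<in> B (Suc j) \<inter> A i}"
    by (metis (no_types, opaque_lifting) Int_commute add.commute)
  thus ?thesis by (simp add: linked_def Int_commute)
qed

lemma inv_sub_sum:
  assumes "\<And>g. g \<in> G \<Longrightarrow> bij g" "inv_sub G A" "inv_sub G B"
  shows "inv_sub G {x + y |x y. x \<in> A \<and> y \<in> B}"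
proof (rule inv_subI)
  show "qvs.subspace {x + y |x y. x \<in> A \<and> y \<in> B}"
    using assms(2,3) by (intro qvs.subspace_sums) (auto simp: inv_sub_def)
  fix g u assume g: "g \<in> G" "u \<in> {x + y |x y. x \<in> A \<and> y \<in> B}"
  then obtain x y where u: "u = x + y" "x \<in> A" "y \<in> B" by blast
  hence "poly_act g u = poly_act g x + poly_act g y" "poly_act g x \<in> A" "poly_act g y \<in> B"
    using g(1) assms by (simp_all add: poly_act_add inv_sub_def)
  thus "poly_act g u \<in> {x + y |x y. x \<in> A \<and> y \<in> B}" by blast
qed

lemma inv_sub_Int: "inv_sub G A \<Longrightarrow> inv_sub G B \<Longrightarrow> inv_sub G (A \<inter> B)"
  by (simp add: inv_sub_def qvs.subspace_inter)

text \<open>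
  The refinement \<open>A + (A' \<inter> B)\<close> of step \<open>i\<close> of the first series by the terms of the second. As
  the step is simple, it equals \<open>A\<close> or \<open>A'\<close>.
\<close>

definition step_sum :: "(nat \<Rightarrow> qpoly set) \<Rightarrow> (nat \<Rightarrow> qpoly set) \<Rightarrow> nat \<Rightarrow> nat \<Rightarrow> qpoly set" where
  "step_sum A B i j = {x + y |x y. x \<in> A i \<and> y \<in> A (Suc i) \<inter> B j}"

context
  fixes G A B n m P
  assumes Gb: "\<And>g. g \<in> G \<Longrightarrow> bij g" and A: "chain_to G A n P" and B: "chain_to G B m P"
begin

lemma chain_facts:
  shows "i \<le> n \<Longrightarrow> inv_sub G (A i)" "j \<le> m \<Longrightarrow> inv_sub G (B j)"
    "i \<le> n \<Longrightarrow> qvs.subspace (A i)" "j \<le> m \<Longrightarrow> qvs.subspace (B j)"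
    "i < n \<Longrightarrow> A i \<subseteq> A (Suc i)" "j < m \<Longrightarrow> B j \<subseteq> B (Suc j)" "i < n \<Longrightarrow> A i \<noteq> A (Suc i)"
  using A B by (auto simp: chain_to_def inv_sub_def simple_step_def)

lemma chain_mono: "i \<le> i' \<Longrightarrow> i' \<le> n \<Longrightarrow> A i \<subseteq> A i'"
proof (induction i' rule: dec_induct)
  case (step i')
  thus ?case using chain_facts(5)[of i'] by auto
qed simp

lemma step_sum_cases:
  assumes i: "i < n" and j: "j \<le> m"
  shows "step_sum A B i j = A i \<or> step_sum A B i j = A (Suc i)"
proof -
  have s: "simple_step G (A i) (A (Suc i))" using A i by (simp add: chain_to_def)
  have "inv_sub G (step_sum A B i j)" unfolding step_sum_def
    using i j by (intro inv_sub_sum Gb inv_sub_Int chain_facts) auto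
  moreover have "A i \<subseteq> step_sum A B i j"
  proof
    fix x assume x: "x \<in> A i"
    have "0 \<in> A (Suc i) \<inter> B j" using chain_facts(3)[of "Suc i"] chain_facts(4)[OF j] i by (simp add: qvs.subspace_0)
    thus "x \<in> step_sum A B i j" unfolding step_sum_def using x by (intro CollectI exI[of _ x] exI[of _ 0]) simp
  qed
  moreover have "step_sum A B i j \<subseteq> A (Suc i)"
  proof
    fix z assume "z \<in> step_sum A B i j"
    then obtain x y where "z = x + y" "x \<in> A i" "y \<in> A (Suc i)" unfolding step_sum_def by blast
    thus "z \<in> A (Suc i)" using chain_facts(5)[OF i] chain_facts(3)[of "Suc i"] i by (auto intro: qvs.subspace_add)
  qed
  ultimately show ?thesis using s by (simp add: simple_step_def)
qed

lemma step_sum_mono: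
  assumes "i < n"
  shows "j \<le> j' \<Longrightarrow> j' \<le> m \<Longrightarrow> step_sum A B i j \<subseteq> step_sum A B i j'"
proof (induction j' rule: dec_induct)
  case (step j')
  have "B j' \<subseteq> B (Suc j')" using chain_facts(6)[of j'] step by simp
  hence "step_sum A B i j' \<subseteq> step_sum A B i (Suc j')" unfolding step_sum_def by blast
  thus ?case using step by auto
qed simp

text \<open>
  Steps are linked if and only if the refinement of the one step increases exactly at the
  other one. This gives the unique partner of each step.
\<close>

lemma linked_iff_jump:
  assumes i: "i < n" and j: "j < m"
  shows "linked A B i j \<longleftrightarrow> step_sum A B i j = A i \<and> step_sum A B i (Suc j) = A (Suc i)"
proof
  assume l: "linked A B i j"
  then obtain z where z: "z \<in> A (Suc i)" "z \<in> B (Suc j)" "z \<notin> {x + y |x y. x \<in> A i \<inter> B (Suc j) \<and> y \<in> A (Suc i) \<inter> B j}"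
    unfolding linked_def by blast
  have "z \<notin> step_sum A B i j"
  proof
    assume "z \<in> step_sum A B i j"
    then obtain x y where xy: "z = x + y" "x \<in> A i" "y \<in> A (Suc i)" "y \<in> B j" unfolding step_sum_def by blast
    have "y \<in> B (Suc j)" using xy(4) chain_facts(6)[OF j] by blast
    hence "z - y \<in> B (Suc j)" using z(2) chain_facts(4)[of "Suc j"] j by (intro qvs.subspace_diff) simp_all
    hence "x \<in> B (Suc j)" using xy(1) by simp
    thus False using z(3) xy by blast
  qed
  hence 1: "step_sum A B i j = A i" using step_sum_cases[OF i, of j] z(1) j by auto
  have "0 \<in> A i" using chain_facts(3)[of i] i by (simp add: qvs.subspace_0)
  hence "z \<in> step_sum A B i (Suc j)" unfolding step_sum_def using z(1,2) by (intro CollectI exI[of _ 0] exI[of _ z]) simp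
  moreover have "z \<notin> A i" using \<open>z \<notin> step_sum A B i j\<close> 1 by simp
  ultimately have "step_sum A B i (Suc j) = A (Suc i)" using step_sum_cases[OF i, of "Suc j"] j by auto
  thus "step_sum A B i j = A i \<and> step_sum A B i (Suc j) = A (Suc i)" using 1 by simp
next
  assume a: "step_sum A B i j = A i \<and> step_sum A B i (Suc j) = A (Suc i)"
  show "linked A B i j" unfolding linked_def
  proof
    assume sub: "A (Suc i) \<inter> B (Suc j) \<subseteq> {x + y |x y. x \<in> A i \<inter> B (Suc j) \<and> y \<in> A (Suc i) \<inter> B j}"
    have "step_sum A B i (Suc j) \<subseteq> step_sum A B i j"
    proof
      fix z assume "z \<in> step_sum A B i (Suc j)"
      then obtain x y where xy: "z = x + y" "x \<in> A i" "y \<in> A (Suc i) \<inter> B (Suc j)" unfolding step_sum_def by blast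
      then obtain x' y' where "y = x' + y'" "x' \<in> A i" "y' \<in> A (Suc i) \<inter> B j" using sub by blast
      moreover have "x + x' \<in> A i" using xy(2) calculation(2) chain_facts(3)[of i] i by (intro qvs.subspace_add) simp_all
      ultimately show "z \<in> step_sum A B i j" unfolding step_sum_def xy(1)
        by (intro CollectI exI[of _ "x + x'"] exI[of _ y']) (simp add: add.assoc)
    qed
    thus False using a chain_facts(5,7)[OF i] by blast
  qed
qed

lemma linked_unique:
  assumes i: "i < n"
  shows "\<exists>!j. j < m \<and> linked A B i j"
proof -
  have c0: "step_sum A B i 0 = A i"
  proof -
    have "B 0 = {0}" using B by (simp add: chain_to_def)
    moreover have "0 \<in> A (Suc i)" using chain_facts(3)[of "Suc i"] i by (simp add: qvs.subspace_0)
    ultimately have "A (Suc i) \<inter> B 0 = {0}" by auto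
    thus ?thesis unfolding step_sum_def by simp
  qed
  have cm: "step_sum A B i m = A (Suc i)"
  proof -
    have "A (Suc i) \<subseteq> B m" using chain_mono[of "Suc i" n] i A B by (simp add: chain_to_def)
    hence "A (Suc i) \<subseteq> step_sum A B i m"
      unfolding step_sum_def using chain_facts(3)[of i] i qvs.subspace_0[of "A i"] by force
    thus ?thesis using step_sum_cases[OF i, of m] chain_facts(5,7)[OF i] by blast
  qed
  \<comment> \<open>The place where the refinement jumps from \<open>A i\<close> to \<open>A (Suc i)\<close>\<close>
  define j1 where "j1 = (LEAST j. step_sum A B i j = A (Suc i))"
  have j1: "step_sum A B i j1 = A (Suc i)" unfolding j1_def by (rule LeastI[of "\<lambda>j. step_sum A B i j = A (Suc i)", OF cm])
  have j1m: "j1 \<le> m" unfolding j1_def by (rule Least_le[of "\<lambda>j. step_sum A B i j = A (Suc i)", OF cm])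
  have "j1 \<noteq> 0" using j1 c0 chain_facts(7)[OF i] by metis
  then obtain j where j: "j1 = Suc j" by (cases j1) auto
  have jm: "j < m" using j j1m by simp
  have "step_sum A B i j \<noteq> A (Suc i)" using not_less_Least[of j "\<lambda>j. step_sum A B i j = A (Suc i)"] j by (simp add: j1_def)
  hence l: "linked A B i j" using linked_iff_jump[OF i jm] step_sum_cases[OF i, of j] jm j1 j by auto
  show ?thesis
  proof (rule ex1I[of _ j])
    show "j < m \<and> linked A B i j" using jm l by simp
    fix j' assume j': "j' < m \<and> linked A B i j'"
    have a: "step_sum A B i j = A i" "step_sum A B i (Suc j) = A (Suc i)" "step_sum A B i j' = A i" "step_sum A B i (Suc j') = A (Suc i)"
      using linked_iff_jump[OF i, of j] linked_iff_jump[OF i, of j'] l j' jm by auto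
    have ne: "\<not> A (Suc i) \<subseteq> A i" using chain_facts(5,7)[OF i] by blast
    have "\<not> j' < j" using step_sum_mono[of i "Suc j'" j] i a jm ne by auto
    moreover have "\<not> j < j'" using step_sum_mono[of i "Suc j" j'] i a j' ne by auto
    ultimately show "j' = j" by simp
  qed
qed

end

text \<open>
  Factors of linked steps are isomorphic: classes correspond if they have a common
  representative in \<open>A' \<inter> B'\<close>.
\<close>

lemma linked_iso:
  assumes Gb: "\<And>g. g \<in> G \<Longrightarrow> bij g" and A: "chain_to G A n P" and B: "chain_to G B m P"
    and i: "i < n" and j: "j < m" and l: "linked A B i j"
  shows "subq_iso G (A i) (A (Suc i)) (B j) (B (Suc j))"
proof -
  note jump = linked_iff_jump[OF Gb A B i j] and jump' = linked_iff_jump[OF Gb B A j i]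
  note defs = step_sum_def
  have 1: "step_sum A B i j = A i" "step_sum A B i (Suc j) = A (Suc i)" using jump l by blast+
  have 2: "step_sum B A j i = B j" "step_sum B A j (Suc i) = B (Suc j)" using jump' l linked_sym[of A B i j] by blast+
  note fA = chain_facts[OF Gb A B]
  have sA: "qvs.subspace (A i)" "qvs.subspace (A (Suc i))" "qvs.subspace (B j)" "qvs.subspace (B (Suc j))" using fA(3,4) i j by simp_all
  have iA: "inv_sub G (A i)" "inv_sub G (A (Suc i))" "inv_sub G (B j)" "inv_sub G (B (Suc j))" using fA(1,2) i j by simp_all
  have AB: "x \<in> A i" if "x \<in> A (Suc i)" "x \<in> B j" for x
  proof -
    have "x \<in> step_sum A B i j" unfolding defs using that qvs.subspace_0[OF sA(1)]
      by (intro CollectI exI[of _ 0] exI[of _ x]) simp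
    thus ?thesis using 1 by simp
  qed
  have BA: "x \<in> B j" if "x \<in> B (Suc j)" "x \<in> A i" for x
  proof -
    have "x \<in> step_sum B A j i" unfolding defs using that qvs.subspace_0[OF sA(3)]
      by (intro CollectI exI[of _ 0] exI[of _ x]) simp
    thus ?thesis using 2 by simp
  qed
  \<comment> \<open>\<open>z\<close> represents both classes.\<close>
  let ?R = "\<lambda>x x'. x \<in> A (Suc i) \<and> x' \<in> B (Suc j) \<and> (\<exists>z. z \<in> A (Suc i) \<and> z \<in> B (Suc j) \<and> x - z \<in> A i \<and> x' - z \<in> B j)"
  have "subq_rel G ?R (A i) (A (Suc i)) (B j) (B (Suc j))"
  proof (rule subq_relI)
    fix x x' assume R: "?R x x'"
    then obtain z where z: "z \<in> A (Suc i)" "z \<in> B (Suc j)" "x - z \<in> A i" "x' - z \<in> B j" by blast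
    show "x \<in> A (Suc i)" "x' \<in> B (Suc j)" using R by blast+
    show "x \<in> A i \<longleftrightarrow> x' \<in> B j"
    proof
      assume "x \<in> A i"
      hence "x - (x - z) \<in> A i" using z(3) qvs.subspace_diff[OF sA(1)] by blast
      hence "z \<in> B j" using BA[OF z(2)] by simp
      hence "(x' - z) + z \<in> B j" using z(4) qvs.subspace_add[OF sA(3)] by blast
      thus "x' \<in> B j" by simp
    next
      assume "x' \<in> B j"
      hence "x' - (x' - z) \<in> B j" using z(4) qvs.subspace_diff[OF sA(3)] by blast
      hence "z \<in> A i" using AB[OF z(1)] by simp
      hence "(x - z) + z \<in> A i" using z(3) qvs.subspace_add[OF sA(1)] by blast
      thus "x \<in> A i" by simp
    qed
    show "?R (qscale c x) (qscale c x')" for c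
    proof (intro conjI exI[of _ "qscale c z"])
      show "qscale c x - qscale c z \<in> A i" using qvs.subspace_scale[OF sA(1) z(3), of c] by (simp add: qvs.scale_right_diff_distrib)
      show "qscale c x' - qscale c z \<in> B j" using qvs.subspace_scale[OF sA(3) z(4), of c] by (simp add: qvs.scale_right_diff_distrib)
    qed (use R z qvs.subspace_scale[OF sA(2)] qvs.subspace_scale[OF sA(4)] in simp_all)
    show "?R (poly_act g x) (poly_act g x')" if g: "g \<in> G" for g
    proof (intro conjI exI[of _ "poly_act g z"])
      have "poly_act g (x - z) \<in> A i" "poly_act g (x' - z) \<in> B j" using iA(1,3) z(3,4) g by (simp_all add: inv_sub_def)
      thus "poly_act g x - poly_act g z \<in> A i" "poly_act g x' - poly_act g z \<in> B j"
        by (simp_all add: module_hom.diff[OF poly_act_hom[OF Gb[OF g]]])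
    qed (use R z iA(2,4) g in \<open>simp_all add: inv_sub_def\<close>)
    fix y y' assume R': "?R y y'"
    then obtain w where w: "w \<in> A (Suc i)" "w \<in> B (Suc j)" "y - w \<in> A i" "y' - w \<in> B j" by blast
    show "?R (x + y) (x' + y')"
    proof (intro conjI exI[of _ "z + w"])
      have "(x - z) + (y - w) \<in> A i" using qvs.subspace_add[OF sA(1) z(3) w(3)] .
      thus "x + y - (z + w) \<in> A i" by (simp add: algebra_simps)
      have "(x' - z) + (y' - w) \<in> B j" using qvs.subspace_add[OF sA(3) z(4) w(4)] .
      thus "x' + y' - (z + w) \<in> B j" by (simp add: algebra_simps)
    qed (use R R' z w qvs.subspace_add[OF sA(2)] qvs.subspace_add[OF sA(4)] in simp_all)
  next
    fix x assume x: "x \<in> A (Suc i)"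
    hence "x \<in> step_sum A B i (Suc j)" using 1 by simp
    then obtain a z where az: "x = a + z" "a \<in> A i" "z \<in> A (Suc i)" "z \<in> B (Suc j)" unfolding defs by blast
    show "\<exists>x'. ?R x x'"
      using x az qvs.subspace_0[OF sA(3)] by (intro exI[of _ z] conjI exI[of _ z]) simp_all
  next
    fix x' assume x': "x' \<in> B (Suc j)"
    hence "x' \<in> step_sum B A j (Suc i)" using 2 by simp
    then obtain a z where az: "x' = a + z" "a \<in> B j" "z \<in> B (Suc j)" "z \<in> A (Suc i)" unfolding defs by blast
    show "\<exists>x. ?R x x'"
      using x' az qvs.subspace_0[OF sA(1)] by (intro exI[of _ z] conjI exI[of _ z]) simp_all
  qed
  thus ?thesis by (auto simp: subq_iso_def)
qed

text \<open>
  Being linked is symmetric and functional, so it is a bijection between the steps.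
\<close>

lemma jordan_hoelder:
  assumes Gb: "\<And>g. g \<in> G \<Longrightarrow> bij g" and A: "chain_to G A n P" and B: "chain_to G B m P"
  shows "\<exists>g. bij_betw g {..<n} {..<m} \<and> (\<forall>i<n. subq_iso G (A i) (A (Suc i)) (B (g i)) (B (Suc (g i))))"
proof -
  define g where "g i = (THE j. j < m \<and> linked A B i j)" for i
  have g: "g i < m \<and> linked A B i (g i)" if "i < n" for i
    unfolding g_def by (rule theI'[OF linked_unique[OF Gb A B that]])
  have "bij_betw g {..<n} {..<m}"
  proof (rule bij_betw_imageI)
    show "inj_on g {..<n}"
    proof (rule inj_onI)
      fix i i' assume a: "i \<in> {..<n}" "i' \<in> {..<n}" "g i = g i'"
      have "linked B A (g i) i" "linked B A (g i) i'" using g[of i] g[of i'] a linked_sym[of A B] by auto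
      thus "i = i'" using linked_unique[OF Gb B A, of "g i"] g[of i] a by auto
    qed
    show "g ` {..<n} = {..<m}"
    proof (intro equalityI subsetI)
      fix j assume "j \<in> {..<m}"
      hence j: "j < m" by simp
      then obtain i where i: "i < n" "linked B A j i" using linked_unique[OF Gb B A j] by blast
      hence "linked A B i j" using linked_sym[of A B] by blast
      hence "g i = j" using linked_unique[OF Gb A B i(1)] g[OF i(1)] j by blast
      thus "j \<in> g ` {..<n}" using i by auto
    qed (use g in auto)
  qed
  thus ?thesis using linked_iso[OF Gb A B] g by blast
qed

section \<open>Quotients and direct sums of representations\<close>

text \<open>
  The coset of \<open>v\<close> modulo \<open>A\<close>.
\<close>

definition coset :: "qpoly set \<Rightarrow> qpoly \<Rightarrow> qpoly set" where
  "coset A v = {v + w |w. w \<in> A}"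

text \<open>
  The representation \<open>B / A\<close> on cosets.
\<close>

definition subquotient :: "qpoly set \<Rightarrow> qpoly set \<Rightarrow> (nat \<Rightarrow> nat, qpoly set) rep" where
  "subquotient A B = quot_rep (poly_rep B) A"

lemma coset_mem: "x \<in> coset A v \<longleftrightarrow> x - v \<in> A"
proof
  assume "x - v \<in> A"
  thus "x \<in> coset A v" unfolding coset_def by (intro CollectI exI[of _ "x - v"]) simp
qed (auto simp: coset_def)

lemma coset_eq_iff:
  assumes "qvs.subspace A"
  shows "coset A v = coset A v' \<longleftrightarrow> v - v' \<in> A"
proof
  assume "coset A v = coset A v'"
  moreover have "v \<in> coset A v" using qvs.subspace_0[OF assms] by (simp add: coset_mem)
  ultimately show "v - v' \<in> A" by (simp add: coset_mem)
next
  assume a: "v - v' \<in> A"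
  show "coset A v = coset A v'"
  proof (rule set_eqI)
    fix x
    have "x - v \<in> A \<longleftrightarrow> x - v' \<in> A"
      using qvs.subspace_add[OF assms _ a, of "x - v"] qvs.subspace_diff[OF assms _ a, of "x - v'"] by auto
    thus "x \<in> coset A v \<longleftrightarrow> x \<in> coset A v'" by (simp add: coset_mem)
  qed
qed

lemma coset_zero: "qvs.subspace A \<Longrightarrow> coset A v = A \<longleftrightarrow> v \<in> A"
  using coset_eq_iff[of A v 0] by (simp add: coset_def)

context
  fixes G :: "(nat \<Rightarrow> nat) set"
  assumes Gb: "\<And>g. g \<in> G \<Longrightarrow> bij g" and Ginv: "\<And>g. g \<in> G \<Longrightarrow> inv g \<in> G"
begin

lemma subquotient_sel:
  assumes A: "inv_sub G A"
  shows "vecs (subquotient A B) = coset A ` B" "vzero (subquotient A B) = A"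
    "vadd (subquotient A B) (coset A u) (coset A v) = coset A (u + v)"
    "vscale (subquotient A B) c (coset A u) = coset A (qscale c u)"
    "g \<in> G \<Longrightarrow> vact (subquotient A B) g (coset A u) = coset A (poly_act g u)"
proof -
  have sA: "qvs.subspace A" using A by (simp add: inv_sub_def)
  show "vecs (subquotient A B) = coset A ` B" by (auto simp: subquotient_def quot_rep_def poly_rep_def coset_def)
  show "vzero (subquotient A B) = A" by (simp add: subquotient_def quot_rep_def)
  have "{a + b |a b. a \<in> coset A u \<and> b \<in> coset A v} = coset A (u + v)"
  proof (intro equalityI subsetI)
    fix x assume "x \<in> {a + b |a b. a \<in> coset A u \<and> b \<in> coset A v}"
    then obtain a b where "x = a + b" "a - u \<in> A" "b - v \<in> A" by (auto simp: coset_mem)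
    thus "x \<in> coset A (u + v)" using qvs.subspace_add[OF sA, of "a - u" "b - v"] by (simp add: coset_mem algebra_simps)
  next
    fix x assume "x \<in> coset A (u + v)"
    hence "x - v \<in> coset A u" by (simp add: coset_mem algebra_simps)
    moreover have "v \<in> coset A v" using qvs.subspace_0[OF sA] by (simp add: coset_mem)
    ultimately show "x \<in> {a + b |a b. a \<in> coset A u \<and> b \<in> coset A v}"
      by (intro CollectI exI[of _ "x - v"] exI[of _ v]) simp
  qed
  thus "vadd (subquotient A B) (coset A u) (coset A v) = coset A (u + v)" by (simp add: subquotient_def quot_rep_def poly_rep_def)
  have "{qscale c a + w |a w. a \<in> coset A u \<and> w \<in> A} = coset A (qscale c u)"
  proof (intro equalityI subsetI)
    fix x assume "x \<in> {qscale c a + w |a w. a \<in> coset A u \<and> w \<in> A}"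
    then obtain a w where aw: "x = qscale c a + w" "a - u \<in> A" "w \<in> A" by (auto simp: coset_mem)
    have "qscale c (a - u) + w \<in> A" using aw qvs.subspace_add[OF sA] qvs.subspace_scale[OF sA] by blast
    thus "x \<in> coset A (qscale c u)" using aw(1) by (simp add: coset_mem qvs.scale_right_diff_distrib algebra_simps)
  next
    fix x assume "x \<in> coset A (qscale c u)"
    moreover have "u \<in> coset A u" using qvs.subspace_0[OF sA] by (simp add: coset_mem)
    ultimately show "x \<in> {qscale c a + w |a w. a \<in> coset A u \<and> w \<in> A}"
      by (intro CollectI exI[of _ u] exI[of _ "x - qscale c u"]) (simp add: coset_mem)
  qed
  thus "vscale (subquotient A B) c (coset A u) = coset A (qscale c u)" by (simp add: subquotient_def quot_rep_def poly_rep_def)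
  show "vact (subquotient A B) g (coset A u) = coset A (poly_act g u)" if g: "g \<in> G"
  proof -
    note b = Gb[OF g]
    have d: "poly_act g (x - y) = poly_act g x - poly_act g y" for x y by (rule module_hom.diff[OF poly_act_hom[OF b]])
    have "poly_act g ` coset A u = coset A (poly_act g u)"
    proof (intro equalityI subsetI)
      fix x assume "x \<in> poly_act g ` coset A u"
      then obtain a where a: "x = poly_act g a" "a - u \<in> A" by (auto simp: coset_mem)
      have "poly_act g (a - u) \<in> A" using a(2) g A by (simp add: inv_sub_def)
      thus "x \<in> coset A (poly_act g u)" by (simp add: coset_mem a(1) d)
    next
      fix x assume "x \<in> coset A (poly_act g u)"
      hence "poly_act (inv g) (x - poly_act g u) \<in> A" using A Ginv[OF g] by (simp add: inv_sub_def coset_mem)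
      moreover have "poly_act (inv g) (x - poly_act g u) = poly_act (inv g) x - u"
        using module_hom.diff[OF poly_act_hom[OF bij_imp_bij_inv[OF b]], of x "poly_act g u"] b by simp
      ultimately have "poly_act (inv g) x \<in> coset A u" by (simp add: coset_mem)
      moreover have "x = poly_act g (poly_act (inv g) x)" using b by simp
      ultimately show "x \<in> poly_act g ` coset A u" by (rule rev_image_eqI)
    qed
    thus ?thesis by (simp add: subquotient_def quot_rep_def poly_rep_def)
  qed
qed

lemma irreducible_subquotient_iff:
  assumes A: "inv_sub G A" and B: "inv_sub G B" and AB: "A \<subseteq> B"
  shows "irreducible_rep G (subquotient A B) \<longleftrightarrow> simple_step G A B"
proof -
  note sel = subquotient_sel[OF A]
  have sA: "qvs.subspace A" and sB: "qvs.subspace B" using A B by (simp_all add: inv_sub_def)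
  have c0: "coset A 0 = A" using coset_zero[OF sA] qvs.subspace_0[OF sA] by blast
  have triv: "vecs (subquotient A B) = {vzero (subquotient A B)} \<longleftrightarrow> A = B"
  proof -
    have "coset A ` B = {A} \<longleftrightarrow> B \<subseteq> A"
    proof
      assume "coset A ` B = {A}"
      hence "\<And>v. v \<in> B \<Longrightarrow> coset A v = A" by blast
      thus "B \<subseteq> A" using coset_zero[OF sA] by blast
    next
      assume "B \<subseteq> A"
      hence "coset A ` B = (\<lambda>_. A) ` B" using coset_zero[OF sA] by (intro image_cong) auto
      thus "coset A ` B = {A}" using qvs.subspace_0[OF sB] by auto
    qed
    thus ?thesis using AB sel(1,2) by auto
  qed
  have sub1: "subrep G (subquotient A B) (coset A ` C)" if C: "inv_sub G C" "A \<subseteq> C" "C \<subseteq> B" for C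
  proof -
    have sC: "qvs.subspace C" using C by (simp add: inv_sub_def)
    show ?thesis unfolding subrep_def
    proof (intro conjI ballI allI)
      show "coset A ` C \<subseteq> vecs (subquotient A B)" using sel(1) C(3) by auto
      show "vzero (subquotient A B) \<in> coset A ` C" unfolding sel(2) using c0 qvs.subspace_0[OF sC] by (metis imageI)
    next
      fix u v assume "u \<in> coset A ` C" "v \<in> coset A ` C"
      thus "vadd (subquotient A B) u v \<in> coset A ` C" using qvs.subspace_add[OF sC] by (auto simp: sel(3))
    next
      fix c u assume "u \<in> coset A ` C"
      thus "vscale (subquotient A B) c u \<in> coset A ` C" using qvs.subspace_scale[OF sC] by (auto simp: sel(4))
    next
      fix g u assume "g \<in> G" "u \<in> coset A ` C"
      thus "vact (subquotient A B) g u \<in> coset A ` C" using C(1) by (auto simp: sel(5) inv_sub_def)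
    qed
  qed
  show ?thesis
  proof
    assume irr: "irreducible_rep G (subquotient A B)"
    have "C = A \<or> C = B" if C: "inv_sub G C" "A \<subseteq> C" "C \<subseteq> B" for C
    proof -
      have sC: "qvs.subspace C" using C by (simp add: inv_sub_def)
      have "coset A ` C = {A} \<or> coset A ` C = coset A ` B"
        using irr sub1[OF C] by (simp add: irreducible_rep_def sel(1,2))
      thus ?thesis
      proof
        assume "coset A ` C = {A}"
        hence "\<And>v. v \<in> C \<Longrightarrow> coset A v = A" by blast
        hence "C \<subseteq> A" using coset_zero[OF sA] by blast
        thus ?thesis using C by blast
      next
        assume e: "coset A ` C = coset A ` B"
        have "B \<subseteq> C"
        proof
          fix v assume "v \<in> B"
          hence "coset A v \<in> coset A ` C" using e by blast
          then obtain c where c: "c \<in> C" "coset A v = coset A c" by blast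
          have "v - c \<in> C" using c(2) coset_eq_iff[OF sA] C(2) by blast
          hence "v - c + c \<in> C" using c(1) qvs.subspace_add[OF sC] by blast
          thus "v \<in> C" by simp
        qed
        thus ?thesis using C by blast
      qed
    qed
    thus "simple_step G A B" using A B AB irr triv by (simp add: simple_step_def irreducible_rep_def)
  next
    assume s: "simple_step G A B"
    have "U = {A} \<or> U = coset A ` B" if U: "subrep G (subquotient A B) U" for U
    proof -
      have Uv: "U \<subseteq> coset A ` B" "A \<in> U" using U by (auto simp: subrep_def sel(1,2))
      define C where "C = {v \<in> B. coset A v \<in> U}"
      have UC: "U = coset A ` C" using Uv(1) by (auto simp: C_def)
      have "inv_sub G C"
      proof (rule inv_subI[OF qvs.subspaceI])
        show "0 \<in> C" using Uv(2) c0 qvs.subspace_0[OF sB] by (simp add: C_def)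
        show "x + y \<in> C" if "x \<in> C" "y \<in> C" for x y
        proof -
          have "vadd (subquotient A B) (coset A x) (coset A y) \<in> U" using U that by (simp add: subrep_def C_def)
          thus ?thesis using that qvs.subspace_add[OF sB] by (simp add: sel(3) C_def)
        qed
        show "qscale c x \<in> C" if "x \<in> C" for c x
        proof -
          have "vscale (subquotient A B) c (coset A x) \<in> U" using U that by (simp add: subrep_def C_def)
          thus ?thesis using that qvs.subspace_scale[OF sB] by (simp add: sel(4) C_def)
        qed
        show "poly_act g x \<in> C" if "g \<in> G" "x \<in> C" for g x
        proof -
          have "vact (subquotient A B) g (coset A x) \<in> U" using U that by (simp add: subrep_def C_def)
          thus ?thesis using that B by (simp add: sel(5) C_def inv_sub_def)
        qed
      qed
      moreover have "A \<subseteq> C"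
      proof
        fix v assume v: "v \<in> A"
        hence "coset A v = A" using coset_zero[OF sA] by blast
        thus "v \<in> C" using v AB Uv(2) by (auto simp: C_def)
      qed
      moreover have "C \<subseteq> B" by (auto simp: C_def)
      ultimately have "C = A \<or> C = B" using s by (simp add: simple_step_def)
      thus ?thesis
      proof
        assume "C = A"
        have "coset A ` A = (\<lambda>_. A) ` A" using coset_zero[OF sA] by (intro image_cong) auto
        thus ?thesis using UC \<open>C = A\<close> qvs.subspace_0[OF sA] by auto
      next
        assume "C = B" thus ?thesis using UC by simp
      qed
    qed
    thus "irreducible_rep G (subquotient A B)"
      using s triv by (simp add: irreducible_rep_def simple_step_def sel(1,2))
  qed
qed

lemma subquotient_rep_iso:
  assumes A: "inv_sub G A" and iso: "subq_iso G A B {0} V"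
  shows "rep_iso G (subquotient A B) (poly_rep V)"
proof -
  obtain R where "subq_rel G R A B {0} V" using iso by (auto simp: subq_iso_def)
  note R = subq_relD[OF this]
  note sel = subquotient_sel[OF A]
  have sA: "qvs.subspace A" using A by (simp add: inv_sub_def)
  have Rdiff: "R (x - x') (y - y')" if "R x y" "R x' y'" for x y x' y'
    using R(3)[OF that(1) R(4)[OF that(2), of "-1"]] by simp
  \<comment> \<open>This is well-defined: elements related to representatives of the same coset are equal.\<close>
  define \<phi> where "\<phi> X = (THE y. \<exists>x\<in>X. R x y)" for X
  have \<phi>: "\<phi> (coset A v) = y" if v: "R v y" for v y
    unfolding \<phi>_def
  proof (rule the_equality)
    show "\<exists>x\<in>coset A v. R x y" using v qvs.subspace_0[OF sA] by (intro bexI[of _ v]) (simp_all add: coset_mem)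
    fix y' assume "\<exists>x\<in>coset A v. R x y'"
    then obtain x where x: "x - v \<in> A" "R x y'" by (auto simp: coset_mem)
    have "y' - y \<in> {0}" using R(8)[OF Rdiff[OF x(2) v]] x(1) by blast
    thus "y' = y" by simp
  qed
  have "bij_betw \<phi> (coset A ` B) V"
  proof (rule bij_betw_imageI)
    show "inj_on \<phi> (coset A ` B)"
    proof (rule inj_onI)
      fix X X' assume "X \<in> coset A ` B" "X' \<in> coset A ` B" and e: "\<phi> X = \<phi> X'"
      then obtain v v' where v: "v \<in> B" "X = coset A v" "v' \<in> B" "X' = coset A v'" by blast
      obtain y where y: "R v y" using R(6)[OF v(1)] by blast
      obtain y' where y': "R v' y'" using R(6)[OF v(3)] by blast
      have "y = y'" using e \<phi>[OF y] \<phi>[OF y'] v by simp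
      hence "v - v' \<in> A" using R(8)[OF Rdiff[OF y y']] by simp
      thus "X = X'" using coset_eq_iff[OF sA] v by blast
    qed
    show "\<phi> ` coset A ` B = V"
    proof (intro equalityI subsetI)
      fix y assume "y \<in> \<phi> ` coset A ` B"
      then obtain v where v: "v \<in> B" "y = \<phi> (coset A v)" by blast
      obtain y' where y': "R v y'" using R(6)[OF v(1)] by blast
      thus "y \<in> V" using \<phi>[OF y'] R(2)[OF y'] v by simp
    next
      fix y assume "y \<in> V"
      then obtain v where v: "R v y" using R(7) by blast
      thus "y \<in> \<phi> ` coset A ` B" using \<phi>[OF v] R(1)[OF v] by (intro image_eqI[of _ _ "coset A v"]) auto
    qed
  qed
  moreover have "\<phi> (vadd (subquotient A B) u v) = \<phi> u + \<phi> v" if uv: "u \<in> coset A ` B" "v \<in> coset A ` B" for u v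
  proof -
    obtain x x' where x: "x \<in> B" "u = coset A x" "x' \<in> B" "v = coset A x'" using uv by blast
    obtain y where y: "R x y" using R(6)[OF x(1)] by blast
    obtain y' where y': "R x' y'" using R(6)[OF x(3)] by blast
    show ?thesis using \<phi>[OF y] \<phi>[OF y'] \<phi>[OF R(3)[OF y y']] x by (simp add: sel(3))
  qed
  moreover have "\<phi> (vscale (subquotient A B) c u) = qscale c (\<phi> u)" if u: "u \<in> coset A ` B" for c u
  proof -
    obtain x where x: "x \<in> B" "u = coset A x" using u by blast
    obtain y where y: "R x y" using R(6)[OF x(1)] by blast
    show ?thesis using \<phi>[OF y] \<phi>[OF R(4)[OF y]] x by (simp add: sel(4))
  qed
  moreover have "\<phi> (vact (subquotient A B) g u) = poly_act g (\<phi> u)" if g: "g \<in> G" and u: "u \<in> coset A ` B" for g u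
  proof -
    obtain x where x: "x \<in> B" "u = coset A x" using u by blast
    obtain y where y: "R x y" using R(6)[OF x(1)] by blast
    show ?thesis using \<phi>[OF y] \<phi>[OF R(5)[OF g y]] x g by (simp add: sel(5))
  qed
  ultimately show ?thesis unfolding rep_iso_def sel(1) by (intro exI[of _ \<phi>]) (simp add: poly_rep_def)
qed

end

text \<open>
  Direct sums over finite index sets with isomorphic summands are isomorphic, up to a
  bijection of the indices.
\<close>

lemma dsum_rep_iso:
  assumes fin: "finite I" and g: "bij_betw g I J" and iso: "\<And>i. i \<in> I \<Longrightarrow> rep_iso G (R i) (S (g i))"
  shows "rep_iso G (dsum_rep I R) (dsum_rep J S)"
proof -
  have finJ: "finite J" using bij_betw_finite[OF g] fin by simp
  define h where "h = inv_into I g"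
  have h: "h j \<in> I" "g (h j) = j" if "j \<in> J" for j
    using that g by (auto simp: h_def bij_betw_def inv_into_into f_inv_into_f)
  have hg: "h (g i) = i" if "i \<in> I" for i using that g by (simp add: h_def bij_betw_inv_into_left)
  have gJ: "g i \<in> J" if "i \<in> I" for i using bij_betw_apply[OF g that] .
  have "\<forall>i\<in>I. \<exists>\<phi>. bij_betw \<phi> (vecs (R i)) (vecs (S (g i))) \<and>
     (\<forall>u\<in>vecs (R i). \<forall>v\<in>vecs (R i). \<phi> (vadd (R i) u v) = vadd (S (g i)) (\<phi> u) (\<phi> v)) \<and>
     (\<forall>c. \<forall>u\<in>vecs (R i). \<phi> (vscale (R i) c u) = vscale (S (g i)) c (\<phi> u)) \<and>
     (\<forall>a\<in>G. \<forall>u\<in>vecs (R i). \<phi> (vact (R i) a u) = vact (S (g i)) a (\<phi> u))"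
    using iso unfolding rep_iso_def by blast
  from bchoice[OF this] obtain \<phi> where \<phi>': "\<forall>i\<in>I. bij_betw (\<phi> i) (vecs (R i)) (vecs (S (g i))) \<and>
     (\<forall>u\<in>vecs (R i). \<forall>v\<in>vecs (R i). \<phi> i (vadd (R i) u v) = vadd (S (g i)) (\<phi> i u) (\<phi> i v)) \<and>
     (\<forall>c. \<forall>u\<in>vecs (R i). \<phi> i (vscale (R i) c u) = vscale (S (g i)) c (\<phi> i u)) \<and>
     (\<forall>a\<in>G. \<forall>u\<in>vecs (R i). \<phi> i (vact (R i) a u) = vact (S (g i)) a (\<phi> i u))" ..
  have \<phi>: "\<And>i. i \<in> I \<Longrightarrow> bij_betw (\<phi> i) (vecs (R i)) (vecs (S (g i)))"
    "\<And>i u v. i \<in> I \<Longrightarrow> u \<in> vecs (R i) \<Longrightarrow> v \<in> vecs (R i) \<Longrightarrow> \<phi> i (vadd (R i) u v) = vadd (S (g i)) (\<phi> i u) (\<phi> i v)"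
    "\<And>i c u. i \<in> I \<Longrightarrow> u \<in> vecs (R i) \<Longrightarrow> \<phi> i (vscale (R i) c u) = vscale (S (g i)) c (\<phi> i u)"
    "\<And>i a u. i \<in> I \<Longrightarrow> a \<in> G \<Longrightarrow> u \<in> vecs (R i) \<Longrightarrow> \<phi> i (vact (R i) a u) = vact (S (g i)) a (\<phi> i u)"
    using \<phi>' by blast+
  have vI: "vecs (dsum_rep I R) = (\<Pi>\<^sub>E i\<in>I. vecs (R i))" and vJ: "vecs (dsum_rep J S) = (\<Pi>\<^sub>E j\<in>J. vecs (S j))"
    using fin finJ by (auto simp: dsum_rep_def)
  define \<Phi> where "\<Phi> f = (\<lambda>j\<in>J. \<phi> (h j) (f (h j)))" for f
  define \<Psi> where "\<Psi> f = (\<lambda>i\<in>I. inv_into (vecs (R i)) (\<phi> i) (f (g i)))" for f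
  have "bij_betw \<Phi> (\<Pi>\<^sub>E i\<in>I. vecs (R i)) (\<Pi>\<^sub>E j\<in>J. vecs (S j))"
  proof (rule bij_betw_byWitness[where f' = \<Psi>])
    show "\<forall>f\<in>\<Pi>\<^sub>E i\<in>I. vecs (R i). \<Psi> (\<Phi> f) = f"
    proof
      fix f assume f: "f \<in> (\<Pi>\<^sub>E i\<in>I. vecs (R i))"
      show "\<Psi> (\<Phi> f) = f"
      proof
        fix i show "\<Psi> (\<Phi> f) i = f i"
        proof (cases "i \<in> I")
          case True
          have "f i \<in> vecs (R i)" using f True by (rule PiE_mem)
          thus ?thesis using True \<phi>(1)[OF True] gJ hg by (simp add: \<Psi>_def \<Phi>_def bij_betw_inv_into_left)
        next
          case False thus ?thesis using PiE_arb[OF f] by (simp add: \<Psi>_def)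
        qed
      qed
    qed
    show "\<forall>f\<in>\<Pi>\<^sub>E j\<in>J. vecs (S j). \<Phi> (\<Psi> f) = f"
    proof
      fix f assume f: "f \<in> (\<Pi>\<^sub>E j\<in>J. vecs (S j))"
      show "\<Phi> (\<Psi> f) = f"
      proof
        fix j show "\<Phi> (\<Psi> f) j = f j"
        proof (cases "j \<in> J")
          case True
          have "f j \<in> vecs (S (g (h j)))" using PiE_mem[OF f True] h[OF True] by simp
          thus ?thesis using True \<phi>(1)[OF h(1)[OF True]] h[OF True] by (simp add: \<Psi>_def \<Phi>_def bij_betw_inv_into_right)
        next
          case False thus ?thesis using PiE_arb[OF f] by (simp add: \<Phi>_def)
        qed
      qed
    qed
    show "\<Phi> ` (\<Pi>\<^sub>E i\<in>I. vecs (R i)) \<subseteq> (\<Pi>\<^sub>E j\<in>J. vecs (S j))"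
    proof (rule image_subsetI)
      fix f assume f: "f \<in> (\<Pi>\<^sub>E i\<in>I. vecs (R i))"
      show "\<Phi> f \<in> (\<Pi>\<^sub>E j\<in>J. vecs (S j))"
      proof (rule PiE_I)
        fix j assume j: "j \<in> J"
        have "\<phi> (h j) (f (h j)) \<in> vecs (S (g (h j)))"
          by (rule bij_betw_apply[OF \<phi>(1)[OF h(1)[OF j]] PiE_mem[OF f h(1)[OF j]]])
        thus "\<Phi> f j \<in> vecs (S j)" using j h(2)[OF j] by (simp add: \<Phi>_def)
      qed (simp add: \<Phi>_def)
    qed
    show "\<Psi> ` (\<Pi>\<^sub>E j\<in>J. vecs (S j)) \<subseteq> (\<Pi>\<^sub>E i\<in>I. vecs (R i))"
    proof (rule image_subsetI)
      fix f assume f: "f \<in> (\<Pi>\<^sub>E j\<in>J. vecs (S j))"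
      show "\<Psi> f \<in> (\<Pi>\<^sub>E i\<in>I. vecs (R i))"
      proof (rule PiE_I)
        fix i assume i: "i \<in> I"
        have "f (g i) \<in> \<phi> i ` vecs (R i)" using PiE_mem[OF f gJ[OF i]] \<phi>(1)[OF i] by (simp add: bij_betw_def)
        thus "\<Psi> f i \<in> vecs (R i)" using i by (simp add: \<Psi>_def inv_into_into)
      qed (simp add: \<Psi>_def)
    qed
  qed
  moreover have "\<Phi> (vadd (dsum_rep I R) u v) = vadd (dsum_rep J S) (\<Phi> u) (\<Phi> v)"
    if uv: "u \<in> (\<Pi>\<^sub>E i\<in>I. vecs (R i))" "v \<in> (\<Pi>\<^sub>E i\<in>I. vecs (R i))" for u v
  proof
    fix j
    show "\<Phi> (vadd (dsum_rep I R) u v) j = vadd (dsum_rep J S) (\<Phi> u) (\<Phi> v) j"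
      using h[of j] \<phi>(2)[of "h j"] PiE_mem[OF uv(1)] PiE_mem[OF uv(2)] by (cases "j \<in> J") (simp_all add: \<Phi>_def dsum_rep_def)
  qed
  moreover have "\<Phi> (vscale (dsum_rep I R) c u) = vscale (dsum_rep J S) c (\<Phi> u)"
    if u: "u \<in> (\<Pi>\<^sub>E i\<in>I. vecs (R i))" for c u
  proof
    fix j
    show "\<Phi> (vscale (dsum_rep I R) c u) j = vscale (dsum_rep J S) c (\<Phi> u) j"
      using h[of j] \<phi>(3)[of "h j"] PiE_mem[OF u] by (cases "j \<in> J") (simp_all add: \<Phi>_def dsum_rep_def)
  qed
  moreover have "\<Phi> (vact (dsum_rep I R) a u) = vact (dsum_rep J S) a (\<Phi> u)"
    if a: "a \<in> G" and u: "u \<in> (\<Pi>\<^sub>E i\<in>I. vecs (R i))" for a u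
  proof
    fix j
    show "\<Phi> (vact (dsum_rep I R) a u) j = vact (dsum_rep J S) a (\<Phi> u) j"
      using h[of j] \<phi>(4)[of "h j" a] a PiE_mem[OF u] by (cases "j \<in> J") (simp_all add: \<Phi>_def dsum_rep_def)
  qed
  ultimately show ?thesis unfolding rep_iso_def vI vJ by (intro exI[of _ \<Phi>]) simp
qed

lemma subrep_poly_rep: "subrep G (poly_rep P) U \<longleftrightarrow> U \<subseteq> P \<and> inv_sub G U"
  by (auto simp: subrep_def poly_rep_def inv_sub_def qvs.subspace_def)

text \<open>
  A filtration by the right factors, each occurring once, determines the semi-simplification
  by the Jordan--Hoelder theorem.
\<close>

lemma filt_semisimplification:
  assumes Gb: "\<And>g. g \<in> G \<Longrightarrow> bij g" and Ginv: "\<And>g. g \<in> G \<Longrightarrow> inv g \<in> G"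
    and f: "filt G V_label {0} ls P" and ls: "distinct ls" "set ls = L"
  shows "has_semisimplification G (poly_rep P) (V_sum L)"
proof -
  let ?n = "length ls"
  obtain A where A: "A 0 = {0}" "A ?n = P" "\<forall>i\<le>?n. inv_sub G (A i)"
    "\<forall>i<?n. simple_step G (A i) (A (Suc i)) \<and> subq_iso G (A i) (A (Suc i)) {0} (V_label (ls ! i))"
    using filt_chain[OF f] by blast
  have cA: "chain_to G A ?n P" using A by (simp add: chain_to_def)
  have AP: "A i \<subseteq> P" if "i \<le> ?n" for i using chain_mono[OF Gb cA cA that] A(2) by simp
  have cf: "comp_factor (poly_rep P) Us i = subquotient (Us ! i) (Us ! Suc i)" for Us i
    by (simp add: comp_factor_def subquotient_def poly_rep_def)
  define Us where "Us = map A [0..<Suc ?n]"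
  have "composition_series G (poly_rep P) Us"
    unfolding composition_series_def
  proof (intro conjI ballI allI impI)
    have len: "length Us = Suc ?n" by (simp add: Us_def)
    have nth: "Us ! i = A i" if "i \<le> ?n" for i unfolding Us_def by (subst nth_map) (use that in \<open>simp_all del: upt_Suc\<close>)
    show ne: "Us \<noteq> []" using len by auto
    show "hd Us = {vzero (poly_rep P)}" using nth[of 0] A(1) ne by (simp add: hd_conv_nth poly_rep_def)
    show "last Us = vecs (poly_rep P)" using nth[of ?n] A(2) ne len by (simp add: last_conv_nth poly_rep_def)
    fix U assume "U \<in> set Us"
    then obtain i where "i \<le> ?n" "U = A i" by (auto simp: Us_def less_Suc_eq_le simp del: upt_Suc)
    thus "subrep G (poly_rep P) U" using A(3) AP by (simp add: subrep_poly_rep)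
  next
    have len: "length Us = Suc ?n" by (simp add: Us_def)
    have nth: "Us ! i = A i" if "i \<le> ?n" for i unfolding Us_def by (subst nth_map) (use that in \<open>simp_all del: upt_Suc\<close>)
    fix i assume "Suc i < length Us"
    hence i: "i < ?n" using len by simp
    have s: "simple_step G (A i) (A (Suc i))" using A(4) i by simp
    thus "Us ! i \<subseteq> Us ! Suc i" using i nth by (simp add: simple_step_def)
    have "irreducible_rep G (subquotient (A i) (A (Suc i)))"
      using irreducible_subquotient_iff[OF Gb Ginv, of "A i" "A (Suc i)"] s by (simp add: simple_step_def)
    thus "irreducible_rep G (comp_factor (poly_rep P) Us i)" using i nth by (simp add: cf)
  qed
  moreover have "rep_iso G (semisimplification (poly_rep P) Us) (V_sum L)" if Us: "composition_series G (poly_rep P) Us" for Us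
  proof -
    \<comment> \<open>Compare an arbitrary composition series with the given filtration.\<close>
    define B where "B i = Us ! i" for i
    define m where "m = length Us - 1"
    have ne: "Us \<noteq> []" using Us by (simp add: composition_series_def)
    have len: "length Us = Suc m" using ne by (simp add: m_def)
    have invB: "inv_sub G (B i)" if "i \<le> m" for i
    proof -
      have "Us ! i \<in> set Us" using that len by simp
      thus ?thesis using Us by (simp add: composition_series_def subrep_poly_rep B_def)
    qed
    have sB: "simple_step G (B i) (B (Suc i))" if "i < m" for i
    proof -
      have "B i \<subseteq> B (Suc i)" "irreducible_rep G (subquotient (B i) (B (Suc i)))"
        using Us that len by (auto simp: composition_series_def B_def cf)
      thus ?thesis using irreducible_subquotient_iff[OF Gb Ginv, of "B i" "B (Suc i)"] invB that by simp
    qed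
    have "B 0 = {0}" "B m = P"
      using Us ne len by (simp_all add: composition_series_def hd_conv_nth last_conv_nth B_def poly_rep_def)
    hence cB: "chain_to G B m P" using invB sB by (simp add: chain_to_def)
    obtain g where g: "bij_betw g {..<m} {..<?n}" "\<And>i. i < m \<Longrightarrow> subq_iso G (B i) (B (Suc i)) (A (g i)) (A (Suc (g i)))"
      using jordan_hoelder[OF Gb cB cA] by blast
    have I: "{i. Suc i < length Us} = {..<m}" using len by auto
    have bl: "bij_betw (\<lambda>i. ls ! g i) {..<m} L"
      using bij_betw_trans[OF g(1) bij_betw_nth[OF ls(1) refl ls(2)[symmetric]]] by (simp add: comp_def)
    have "rep_iso G (comp_factor (poly_rep P) Us i) ((\<lambda>(D, (M, m)). poly_rep (V_infty D M)) (ls ! g i))" if i: "i < m" for i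
    proof -
      have gi: "g i < ?n" using bij_betw_apply[OF g(1), of i] i by simp
      have "subq_iso G (B i) (B (Suc i)) {0} (V_label (ls ! g i))"
        using subq_iso_trans[OF g(2)[OF i]] A(4) gi by blast
      hence "rep_iso G (subquotient (B i) (B (Suc i))) (poly_rep (V_label (ls ! g i)))"
        using invB i by (intro subquotient_rep_iso[OF Gb Ginv]) simp_all
      thus ?thesis by (simp add: cf B_def V_label_def case_prod_unfold)
    qed
    thus ?thesis unfolding semisimplification_def V_sum_def I
      by (intro dsum_rep_iso[OF _ bl]) auto
  qed
  ultimately show ?thesis unfolding has_semisimplification_def by blast
qed

theorem corollary4p16:
  assumes conjecture:
    "\<And>d f n :: nat. d > 0 \<Longrightarrow> f > 0 \<Longrightarrow> n \<ge> 1 \<Longrightarrow>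
       (\<forall>D M F. partition_of D n \<longrightarrow> M \<in> SSYT d D \<longrightarrow> first_row_nonzeros D M = f \<longrightarrow>
          F \<in> V_fin n D M \<longrightarrow> F \<noteq> 0 \<longrightarrow>
          (\<forall>(D', N) \<in> specht_supp d (n + 1) F. first_row_nonzeros D' N \<in> {f, f - 1})) \<and>
       inj_on (p_map d n f) (W_space d n f) \<and>
       inj_on (\<lambda>(F, H). q_map d n f F + p_map d n (f - 1) H) (W_space d n f \<times> W_space d n (f - 1))"
  fixes d :: nat
  shows "\<forall>G \<in> {S_infty, S_N}.
      has_semisimplification G (poly_rep (hom_polys {1..} d)) (V_sum (inf_tableaux_deg d)) \<and>
      (\<forall>\<mu>. is_content \<mu> d \<longrightarrow>
         has_semisimplification G (poly_rep (content_polys \<mu>)) (V_sum (inf_tableaux_content \<mu>)))"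
proof
  fix G assume "G \<in> {S_infty, S_N}"
  hence G: "S_infty \<subseteq> G" "G \<subseteq> S_N" using S_infty_subset by auto
  have Gb: "bij g" if "g \<in> G" for g using that G(2) S_N_bij by blast
  have Ginv: "inv g \<in> G" if "g \<in> G" for g
    using that \<open>G \<in> {S_infty, S_N}\<close> by (auto simp: S_infty_def S_N_def intro: permutes_inv)
  show "has_semisimplification G (poly_rep (hom_polys {1..} d)) (V_sum (inf_tableaux_deg d)) \<and>
      (\<forall>\<mu>. is_content \<mu> d \<longrightarrow>
         has_semisimplification G (poly_rep (content_polys \<mu>)) (V_sum (inf_tableaux_content \<mu>)))"
  proof (intro conjI allI impI)
    show "has_semisimplification G (poly_rep (hom_polys {1..} d)) (V_sum (inf_tableaux_deg d))"
      using filt_degree[OF G, of d] filt_semisimplification[OF Gb Ginv] by blast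
    fix \<mu> assume "is_content \<mu> d"
    hence "0 \<notin># \<mu>" by (simp add: is_content_def)
    thus "has_semisimplification G (poly_rep (content_polys \<mu>)) (V_sum (inf_tableaux_content \<mu>))"
      using filt_content[OF G, of \<mu>] filt_semisimplification[OF Gb Ginv] by blast
  qed
qed

end
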